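(* Let $G$ be a connected Lie group with a smooth exponential function, $(S,\eta_S,W)$ a host semigroup of $G$ for which the map $$\mathrm{Exp} : W\to S,\quad x\mapsto \hat\eta_x(i)$$ is continuous, and $\alpha$ a $G$-invariant locally bounded absolute value on $S$. Let $\mathcal{A}:=C^*(S,\alpha)$ be the corresponding host algebra of $G$, let $\eta : G\to U(M(\mathcal{A}))$ be the strictly smooth multiplier action determined by $\eta(g)\eta_\alpha(s)=\eta_\alpha(\eta_S(g)s)$ for $g\in G$, $s\in S$, and let $I_\eta\subseteq\mathbf{L}(G)'$ be its momentum set. Then $$s : W\to\mathbb{R},\quad s(x) := -\inf\langle I_\eta,x\rangle$$ is a locally bounded function on $W$.
   Context: Lie groups and manifolds are modeled on locally convex spaces; smooth maps are in the sense of iterated continuous directional derivatives; holomorphic means smooth with complex linear differentials. An exponential function of $G$ is a smooth map $\exp_G:\mathbf{L}(G)\to G$ such that $t\mapsto\exp_G(tx)$ is a one-parameter group with derivative $x$ at $0$ for each $x$ in the Lie algebra $\mathbf{L}(G)$. A complex involutive semigroup is a complex manifold $S$ modeled on a locally convex space with holomorphic multiplication and an antiholomorphic involutive antiautomorphism $s\mapsto s^*$. An absolute value is $\alpha:S\to[0,\infty)$ with $\alpha(s^* )=\alpha(s)$, $\alpha(st)\le\alpha(s)\alpha(t)$. A multiplier of $S$ is a pair $(\lambda,\rho)$ of holomorphic maps $S\to S$ with $a\lambda(b)=\rho(a)b$, $\lambda(ab)=\lambda(a)b$, $\rho(ab)=a\rho(b)$. The set $M(S)$ of multipliers is an involutive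 semigroup with $(\lambda,\rho)(\lambda',\rho')=(\lambda\circ\lambda',\rho'\circ\rho)$, $(\lambda,\rho)^*=(\rho^*,\lambda^* )$, where $\lambda^*(a)=\lambda(a^* )^*$, $\rho^*(a)=\rho(a^* )^*$; $U(M(S))$ is its group of unitary elements. For $g=(\lambda,\rho)$ write $gs=\lambda(s)$. An approximate identity of $S$ is a net $(u_i)$ in $S$ with $u_is\to s$ and $su_i\to s$ for all $s\in S$; if one exists, $S\to M(S)$, $a\mapsto(\lambda_a,\rho_a)$ (left and right multiplication) is injective, and $S$ is regarded as a subsemigroup of $M(S)$. Host semigroup: let $\mathbb{C}_+=\mathbb{R}+i[0,\infty)$ (additive semigroup with involution $z^*=-\bar z$), $\mathbb{C}_+^0=\mathbb{R}+i(0,\infty)$. A host semigroup for $G$ is a triple $(S,\eta_S,W)$ with $S$ a complex involutive semigroup having an approximate identity, $\eta_S:G\to U(M(S))$ a group homomorphism, and $W\subseteq\mathbf{L}(G)$ an open convex $\mathrm{Ad}(G)$-invariant cone such that: (HS1) the left action of $G$ on $S$ defined by $\eta_S$ is smooth; (HS2) for each $x\in W$ the one-parameter group $t\mapsto\eta_S(\exp_G(tx))$ extends to a morphism $\hat\eta_x:\mathbb{C}_+\to M(S)$ of involutive semigroups defining a continuous left action of $\mathbb{C}_+$ on $S$, with $\hat\eta_x(\mathbb{C}_+^0)\subseteq S$ and $\hat\eta_x:\mathbb{C}_+^0\to S$ holomorphic; (HS3) if $f:S\to\mathbb{C}$ is holomorphic and $f\circ\hat\eta_x$ vanishes on $\mathbb{C}_+^0$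 for all $x\in W$, then $f=0$. $\alpha$ is $G$-invariant if $\alpha(\eta_S(g)s)=\alpha(s)$ for all $g\in G,s\in S$. $C^*(S,\alpha)$: let $\ell^1(S,\alpha)$ be the Banach $*$-algebra completion of the semigroup algebra $\mathbb{C}[S]$ with seminorm $\sum_s|f(s)|\alpha(s)$ and involution $f^*(s)=\overline{f(s^* )}$. Each morphism $\beta$ of involutive semigroups from $S$ into a $C^*$-algebra with $\|\beta(s)\|\le\alpha(s)$ induces $\hat\beta(f)=\sum_s f(s)\beta(s)$ on $\ell^1(S,\alpha)$; let $I$ be the intersection of $\ker\hat\beta$ over all such holomorphic $\beta$; $C^*(S,\alpha)$ is the completion of $\ell^1(S,\alpha)/I$ in the norm $\sup_{\beta\text{ holomorphic}}\|\hat\beta(f)\|$; $\eta_\alpha(s)$ is the image of $\delta_s$, and $\eta_\alpha:S\to C^*(S,\alpha)$ is holomorphic. A homomorphism $\eta:G\to U(M(\mathcal{A}))$ into the unitary group of the multiplier algebra of a $C^*$-algebra is strictly smooth if the set of $a\in\mathcal{A}$ for which $g\mapsto\eta(g)a$ and $g\mapsto a\eta(g)$ are smooth is dense. Each state $\phi$ of $\mathcal{A}$ extends canonically to a state $\tilde\phi$ of $M(\mathcal{A})$ (if $\phi(a)=\langle\pi(a)v,v\rangle$ with $\pi$ a non-degenerate representation and $v$ a unit vector, $\tilde\phi(m)=\langle\tilde\pi(m)v,v\rangle$, where $\tilde\pi$ is the unique extension of $\pi$ to $M(\mathcal{A})$). Let $S(\mathcal{A})^\infty$ be the set of states $\phi$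 with $\tilde\phi\circ\eta$ smooth on $G$, and $\Psi_\eta(\phi)=\frac1i d(\tilde\phi\circ\eta)(\mathbf 1)\in\mathbf{L}(G)'$. The momentum set $I_\eta$ is the weak-$*$-closure of $\Psi_\eta(S(\mathcal{A})^\infty)$ in the topological dual $\mathbf{L}(G)'$; $\langle I_\eta,x\rangle=\{f(x):f\in I_\eta\}$. *)

theory Defs
  imports "HOL-Analysis.Analysis" "HOL-Algebra.Module"
begin

section \<open>Locally convex spaces\<close>

class lcs = real_vector + t2_space + topological_ab_group_add +
  assumes tendsto_scaleR_Pair_lcs:
    "LIM p (nhds r \<times>\<^sub>F nhds x). fst p *\<^sub>R snd p :> nhds (r *\<^sub>R x)"
  and convex_base_0': "open U \<Longrightarrow> 0 \<in> U \<Longrightarrow> \<exists>V. open V \<and> 0 \<in> V \<and>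
    (\<forall>x\<in>V. \<forall>y\<in>V. \<forall>u\<ge>0. \<forall>v\<ge>0. u + v = 1 \<longrightarrow> u *\<^sub>R x + v *\<^sub>R y \<in> V) \<and> V \<subseteq> U"

lemma convex_base_0:
  fixes U :: "'a::lcs set"
  shows "open U \<Longrightarrow> 0 \<in> U \<Longrightarrow> \<exists>V. open V \<and> 0 \<in> V \<and> convex V \<and> V \<subseteq> U"
  unfolding convex_def by (rule convex_base_0')

class complex_lcs = lcs +
  fixes scaleC :: "complex \<Rightarrow> 'a \<Rightarrow> 'a"  (infixr \<open>*\<^sub>C\<close> 75)
  assumes scaleC_add_right: "c *\<^sub>C (x + y) = c *\<^sub>C x + c *\<^sub>C y"
  and scaleC_add_left: "(c + d) *\<^sub>C x = c *\<^sub>C x + d *\<^sub>C x"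
  and scaleC_scaleC: "c *\<^sub>C d *\<^sub>C x = (c * d) *\<^sub>C x"
  and scaleC_of_real: "complex_of_real r *\<^sub>C x = r *\<^sub>R x"
  and tendsto_scaleC_Pair:
    "LIM p (nhds c \<times>\<^sub>F nhds x). fst p *\<^sub>C snd p :> nhds (c *\<^sub>C x)"

lemma tendsto_fst_nhds: "(fst \<longlongrightarrow> a) (nhds (a, b))"
  and tendsto_snd_nhds: "(snd \<longlongrightarrow> b) (nhds (a, b))"
  using tendsto_fst[OF filterlim_ident, of "(a, b)"] tendsto_snd[OF filterlim_ident, of "(a, b)"]
  by simp_all

instance real_normed_vector \<subseteq> lcs
proof
  fix r :: real and x :: 'a
  show "LIM p (nhds r \<times>\<^sub>F nhds x). fst p *\<^sub>R snd p :> nhds (r *\<^sub>R x)"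
    unfolding nhds_prod[symmetric]
    by (intro tendsto_scaleR tendsto_fst_nhds tendsto_snd_nhds)
next
  fix U :: "'a set" assume "open U" "0 \<in> U"
  then obtain e where "e > 0" "ball 0 e \<subseteq> U" by (meson open_contains_ball)
  then show "\<exists>V. open V \<and> 0 \<in> V \<and>
      (\<forall>x\<in>V. \<forall>y\<in>V. \<forall>u\<ge>0. \<forall>v\<ge>0. u + v = 1 \<longrightarrow> u *\<^sub>R x + v *\<^sub>R y \<in> V) \<and> V \<subseteq> U"
    unfolding convex_def[symmetric] by (intro exI[of _ "ball 0 e"]) auto
qed

instantiation complex :: complex_lcs
begin
definition scaleC_complex :: "complex \<Rightarrow> complex \<Rightarrow> complex" where "scaleC_complex = (*)"
instance
proof
  fix c x :: complex
  show "LIM p (nhds c \<times>\<^sub>F nhds x). fst p *\<^sub>C snd p :> nhds (c *\<^sub>C x)"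
    unfolding nhds_prod[symmetric] scaleC_complex_def
    by (intro tendsto_mult tendsto_fst_nhds tendsto_snd_nhds)
qed (auto simp: scaleC_complex_def algebra_simps scaleR_conv_of_real)
end

instance prod :: (topological_monoid_add, topological_monoid_add) topological_monoid_add
proof
  fix a b :: "'a \<times> 'b"
  have 1: "((\<lambda>x. fst (fst x) + fst (snd x)) \<longlongrightarrow> fst a + fst b) (nhds (a, b))"
    by (intro tendsto_add tendsto_fst tendsto_fst_nhds tendsto_snd_nhds)
  have 2: "((\<lambda>x. snd (fst x) + snd (snd x)) \<longlongrightarrow> snd a + snd b) (nhds (a, b))"
    by (intro tendsto_add tendsto_snd tendsto_fst_nhds tendsto_snd_nhds)
  show "LIM x nhds a \<times>\<^sub>F nhds b. fst x + snd x :> nhds (a + b)"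
    unfolding nhds_prod[symmetric] plus_prod_def using tendsto_Pair[OF 1 2] by simp
qed

instance prod :: (topological_comm_monoid_add, topological_comm_monoid_add) topological_comm_monoid_add ..

instance prod :: (topological_group_add, topological_group_add) topological_group_add
proof
  fix a :: "'a \<times> 'b"
  have "((\<lambda>x. (- fst x, - snd x)) \<longlongrightarrow> (- fst a, - snd a)) (nhds a)"
    by (intro tendsto_Pair tendsto_minus tendsto_fst tendsto_snd filterlim_ident)
  then show "(uminus \<longlongrightarrow> - a) (nhds a)"
    by (simp add: uminus_prod_def[abs_def])
qed

instance prod :: (topological_ab_group_add, topological_ab_group_add) topological_ab_group_add ..

instance prod :: (lcs, lcs) lcs
proof
  fix r :: real and x :: "'a \<times> 'b"
  have s1: "((\<lambda>p. fst p *\<^sub>R fst (snd p)) \<longlongrightarrow> r *\<^sub>R fst x) (nhds (r, x))"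
    using filterlim_compose[OF tendsto_scaleR_Pair_lcs[of r "fst x"],
        of "\<lambda>p. (fst p, fst (snd p))" "nhds (r, x)"]
    by (simp add: nhds_prod[symmetric] tendsto_Pair tendsto_fst_nhds tendsto_fst[OF tendsto_snd_nhds]
        tendsto_snd[OF tendsto_snd_nhds])
  have s2: "((\<lambda>p. fst p *\<^sub>R snd (snd p)) \<longlongrightarrow> r *\<^sub>R snd x) (nhds (r, x))"
    using filterlim_compose[OF tendsto_scaleR_Pair_lcs[of r "snd x"],
        of "\<lambda>p. (fst p, snd (snd p))" "nhds (r, x)"]
    by (simp add: nhds_prod[symmetric] tendsto_Pair tendsto_fst_nhds tendsto_fst[OF tendsto_snd_nhds]
        tendsto_snd[OF tendsto_snd_nhds])
  show "LIM p (nhds r \<times>\<^sub>F nhds x). fst p *\<^sub>R snd p :> nhds (r *\<^sub>R x)"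
    unfolding nhds_prod[symmetric] scaleR_prod_def
    using tendsto_Pair[OF s1 s2] by simp
next
  fix U :: "('a \<times> 'b) set" assume "open U" "0 \<in> U"
  then obtain A B where AB: "open A" "open B" "0 \<in> A" "0 \<in> B" "A \<times> B \<subseteq> U"
    by (metis open_prod_elim zero_prod_def mem_Sigma_iff)
  obtain V where V: "open V" "0 \<in> V" "convex V" "V \<subseteq> A"
    using convex_base_0 AB by blast
  obtain V' where V': "open V'" "0 \<in> V'" "convex V'" "V' \<subseteq> B"
    using convex_base_0 AB by blast
  show "\<exists>V. open V \<and> 0 \<in> V \<and>
      (\<forall>x\<in>V. \<forall>y\<in>V. \<forall>u\<ge>0. \<forall>v\<ge>0. u + v = 1 \<longrightarrow> u *\<^sub>R x + v *\<^sub>R y \<in> V) \<and> V \<subseteq> U"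
    unfolding convex_def[symmetric] using V V' AB(5)
    by (intro exI[of _ "V \<times> V'"]) (auto simp: open_Times convex_Times zero_prod_def)
qed

instantiation prod :: (complex_lcs, complex_lcs) complex_lcs
begin
definition scaleC_prod :: "complex \<Rightarrow> 'a \<times> 'b \<Rightarrow> 'a \<times> 'b"
  where "scaleC_prod c p = (c *\<^sub>C fst p, c *\<^sub>C snd p)"
instance
proof
  fix c :: complex and x :: "'a \<times> 'b"
  have s1: "((\<lambda>p. fst p *\<^sub>C fst (snd p)) \<longlongrightarrow> c *\<^sub>C fst x) (nhds (c, x))"
    using filterlim_compose[OF tendsto_scaleC_Pair[of c "fst x"],
        of "\<lambda>p. (fst p, fst (snd p))" "nhds (c, x)"]
    by (simp add: nhds_prod[symmetric] tendsto_Pair tendsto_fst_nhds tendsto_fst[OF tendsto_snd_nhds]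
        tendsto_snd[OF tendsto_snd_nhds])
  have s2: "((\<lambda>p. fst p *\<^sub>C snd (snd p)) \<longlongrightarrow> c *\<^sub>C snd x) (nhds (c, x))"
    using filterlim_compose[OF tendsto_scaleC_Pair[of c "snd x"],
        of "\<lambda>p. (fst p, snd (snd p))" "nhds (c, x)"]
    by (simp add: nhds_prod[symmetric] tendsto_Pair tendsto_fst_nhds tendsto_fst[OF tendsto_snd_nhds]
        tendsto_snd[OF tendsto_snd_nhds])
  show "LIM p (nhds c \<times>\<^sub>F nhds x). fst p *\<^sub>C snd p :> nhds (c *\<^sub>C x)"
    unfolding nhds_prod[symmetric] scaleC_prod_def
    using tendsto_Pair[OF s1 s2] by simp
qed (auto simp: scaleC_prod_def scaleC_add_right scaleC_add_left scaleC_scaleC scaleC_of_real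
      scaleR_prod_def)
end


section \<open>Smooth and holomorphic maps\<close>

text \<open>
  Domains of differentiable maps are always open subsets of types of class \<^class>\<open>lcs\<close>.  Targets
  may also be \<open>C\<^sup>*\<close>-algebras living on a proper carrier set, so they are given by a record.
\<close>

record 'v rtvs =
  tv_top :: "'v topology"
  tv_add :: "'v \<Rightarrow> 'v \<Rightarrow> 'v"
  tv_scaleR :: "real \<Rightarrow> 'v \<Rightarrow> 'v"

record 'v ctvs = "'v rtvs" +
  tv_scaleC :: "complex \<Rightarrow> 'v \<Rightarrow> 'v"

definition tv_real :: "'e::lcs rtvs" where
  "tv_real = \<lparr>tv_top = euclidean, tv_add = (+), tv_scaleR = (*\<^sub>R)\<rparr>"

definition tv_cplx :: "'f::complex_lcs ctvs" where
  "tv_cplx = \<lparr>tv_top = euclidean, tv_add = (+), tv_scaleR = (*\<^sub>R), tv_scaleC = (*\<^sub>C)\<rparr>"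

definition has_ddir :: "('v, 'z) rtvs_scheme \<Rightarrow> ('e::lcs \<Rightarrow> 'v) \<Rightarrow> 'e \<Rightarrow> 'e \<Rightarrow> 'v \<Rightarrow> bool" where
  "has_ddir V f x h l \<longleftrightarrow>
     limitin (tv_top V)
       (\<lambda>t::real. tv_scaleR V (1 / t) (tv_add V (f (x + t *\<^sub>R h)) (tv_scaleR V (-1) (f x)))) l (at 0)"

definition ddir :: "('v, 'z) rtvs_scheme \<Rightarrow> ('e::lcs \<Rightarrow> 'v) \<Rightarrow> 'e \<Rightarrow> 'e \<Rightarrow> 'v" where
  "ddir V f x h = (THE l. has_ddir V f x h l)"

text \<open>
  \<open>iter_ddir V f h k x\<close> is the \<open>k\<close>-th iterated directional derivative of \<open>f\<close> at \<open>x\<close> in the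
  directions \<open>h 0, \<dots>, h (k - 1)\<close>.  It does not depend on the other entries of the sequence \<open>h\<close>, so
  joint continuity in \<open>(x, h)\<close> for the product topology on sequences is joint continuity in
  \<open>(x, h 0, \<dots>, h (k - 1))\<close>.
\<close>

primrec iter_ddir ::
  "('v, 'z) rtvs_scheme \<Rightarrow> ('e::lcs \<Rightarrow> 'v) \<Rightarrow> (nat \<Rightarrow> 'e) \<Rightarrow> nat \<Rightarrow> 'e \<Rightarrow> 'v" where
  "iter_ddir V f h 0 = f"
| "iter_ddir V f h (Suc k) = (\<lambda>x. ddir V (iter_ddir V f h k) x (h k))"

definition smooth_to :: "('v, 'z) rtvs_scheme \<Rightarrow> 'e::lcs set \<Rightarrow> ('e \<Rightarrow> 'v) \<Rightarrow> bool" where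
  "smooth_to V U f \<longleftrightarrow> open U \<and>
     (\<forall>k h. \<forall>x\<in>U. \<exists>l. has_ddir V (iter_ddir V f h k) x (h k) l) \<and>
     (\<forall>k. continuous_map (top_of_set (U \<times> UNIV)) (tv_top V) (\<lambda>(x, h). iter_ddir V f h k x))"

definition holo_to :: "('v, 'z) ctvs_scheme \<Rightarrow> 'e::complex_lcs set \<Rightarrow> ('e \<Rightarrow> 'v) \<Rightarrow> bool" where
  "holo_to V U f \<longleftrightarrow> smooth_to V U f \<and>
     (\<forall>x\<in>U. (\<forall>h k. ddir V f x (h + k) = tv_add V (ddir V f x h) (ddir V f x k)) \<and>
            (\<forall>c h. ddir V f x (c *\<^sub>C h) = tv_scaleC V c (ddir V f x h)))"

definition antiholo_to :: "('v, 'z) ctvs_scheme \<Rightarrow> 'e::complex_lcs set \<Rightarrow> ('e \<Rightarrow> 'v) \<Rightarrow> bool" where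
  "antiholo_to V U f \<longleftrightarrow> smooth_to V U f \<and>
     (\<forall>x\<in>U. (\<forall>h k. ddir V f x (h + k) = tv_add V (ddir V f x h) (ddir V f x k)) \<and>
            (\<forall>c h. ddir V f x (c *\<^sub>C h) = tv_scaleC V (cnj c) (ddir V f x h)))"


section \<open>Manifolds\<close>

text \<open>A chart is a domain together with a map; values of the map outside the domain are irrelevant.\<close>

type_synonym ('m, 'e) chart = "'m set \<times> ('m \<Rightarrow> 'e)"

definition is_chart :: "('m::t2_space, 'e::lcs) chart \<Rightarrow> bool" where
  "is_chart = (\<lambda>(U, \<phi>). open U \<and> open (\<phi> ` U) \<and> inj_on \<phi> U \<and>
     homeomorphism U (\<phi> ` U) \<phi> (inv_into U \<phi>))"

text \<open>
  The predicate \<open>P\<close> below is one of the local notions \<^term>\<open>smooth_to tv_real\<close>,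
  \<^term>\<open>holo_to tv_cplx\<close>, \<^term>\<open>antiholo_to tv_cplx\<close>.
\<close>

definition is_atlas ::
  "('e set \<Rightarrow> ('e \<Rightarrow> 'e) \<Rightarrow> bool) \<Rightarrow> ('m::t2_space, 'e::lcs) chart set \<Rightarrow> bool" where
  "is_atlas P \<A> \<longleftrightarrow> (\<forall>c\<in>\<A>. is_chart c) \<and> \<Union> (fst ` \<A>) = UNIV \<and>
     (\<forall>(U, \<phi>)\<in>\<A>. \<forall>(V, \<psi>)\<in>\<A>. P (\<phi> ` (U \<inter> V)) (\<psi> \<circ> inv_into U \<phi>))"

abbreviation smooth_atlas :: "('m::t2_space, 'e::lcs) chart set \<Rightarrow> bool" where
  "smooth_atlas \<equiv> is_atlas (smooth_to tv_real)"

abbreviation complex_atlas :: "('m::t2_space, 'e::complex_lcs) chart set \<Rightarrow> bool" where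
  "complex_atlas \<equiv> is_atlas (holo_to tv_cplx)"

definition mfd_map ::
  "('e set \<Rightarrow> ('e \<Rightarrow> 'f) \<Rightarrow> bool) \<Rightarrow> 'm::t2_space set \<Rightarrow> ('m, 'e::lcs) chart set \<Rightarrow>
   ('n::t2_space, 'f::lcs) chart set \<Rightarrow> ('m \<Rightarrow> 'n) \<Rightarrow> bool" where
  "mfd_map P D \<A> \<B> f \<longleftrightarrow> open D \<and> continuous_on D f \<and>
     (\<forall>(U, \<phi>)\<in>\<A>. \<forall>(V, \<psi>)\<in>\<B>. P (\<phi> ` (U \<inter> D \<inter> f -` V)) (\<psi> \<circ> f \<circ> inv_into U \<phi>))"

abbreviation "mfd_smooth \<equiv> mfd_map (smooth_to tv_real)"
abbreviation "mfd_holo \<equiv> mfd_map (holo_to tv_cplx)"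
abbreviation "mfd_antiholo \<equiv> mfd_map (antiholo_to tv_cplx)"

definition mfd_smooth_to ::
  "('v, 'z) rtvs_scheme \<Rightarrow> ('m::t2_space, 'e::lcs) chart set \<Rightarrow> ('m \<Rightarrow> 'v) \<Rightarrow> bool" where
  "mfd_smooth_to V \<A> f \<longleftrightarrow> (\<forall>(U, \<phi>)\<in>\<A>. smooth_to V (\<phi> ` U) (f \<circ> inv_into U \<phi>))"

definition mfd_holo_to ::
  "('v, 'z) ctvs_scheme \<Rightarrow> ('m::t2_space, 'e::complex_lcs) chart set \<Rightarrow> ('m \<Rightarrow> 'v) \<Rightarrow> bool" where
  "mfd_holo_to V \<A> f \<longleftrightarrow> (\<forall>(U, \<phi>)\<in>\<A>. holo_to V (\<phi> ` U) (f \<circ> inv_into U \<phi>))"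

definition id_charts :: "('e, 'e) chart set" where
  "id_charts = {(UNIV, id)}"

definition prod_charts ::
  "('m, 'e) chart set \<Rightarrow> ('n, 'f) chart set \<Rightarrow> ('m \<times> 'n, 'e \<times> 'f) chart set" where
  "prod_charts \<A> \<B> = {(U \<times> V, map_prod \<phi> \<psi>) |U \<phi> V \<psi>. (U, \<phi>) \<in> \<A> \<and> (V, \<psi>) \<in> \<B>}"

definition locally_bounded_on :: "'m::topological_space set \<Rightarrow> ('m \<Rightarrow> real) \<Rightarrow> bool" where
  "locally_bounded_on D f \<longleftrightarrow> (\<forall>x\<in>D. \<exists>U. open U \<and> x \<in> U \<and> bounded (f ` (U \<inter> D)))"


section \<open>Lie groups\<close>

text \<open>
  The Lie algebra \<open>\<^bold>L(G) = T\<^sub>1(G)\<close> is realized on the model space, by means of a distinguished chart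
  \<open>lie_chart1\<close> around the unit element: \<open>x\<close> stands for the tangent vector whose coordinate vector in
  this chart is \<open>x\<close>.  No condition other than being a chart of the atlas around the unit is imposed
  on it; another chart yields an isomorphic topological vector space.
\<close>

record ('g, 'e) lie_group = "'g monoid" +
  lie_charts :: "('g, 'e) chart set"
  lie_chart1 :: "('g, 'e) chart"

definition lie_group :: "('g::t2_space, 'e::lcs) lie_group \<Rightarrow> bool" where
  "lie_group G \<longleftrightarrow> group G \<and> carrier G = UNIV \<and> smooth_atlas (lie_charts G) \<and>
     lie_chart1 G \<in> lie_charts G \<and> \<one>\<^bsub>G\<^esub> \<in> fst (lie_chart1 G) \<and>
     mfd_smooth UNIV (prod_charts (lie_charts G) (lie_charts G)) (lie_charts G)
       (\<lambda>(g, h). g \<otimes>\<^bsub>G\<^esub> h) \<and>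
     mfd_smooth UNIV (lie_charts G) (lie_charts G) (\<lambda>g. inv\<^bsub>G\<^esub> g)"

text \<open>The differential at the unit element, evaluated on a Lie algebra element.\<close>

definition diff_one ::
  "('g, 'e::lcs) lie_group \<Rightarrow> ('v, 'z) rtvs_scheme \<Rightarrow> ('g \<Rightarrow> 'v) \<Rightarrow> 'e \<Rightarrow> 'v" where
  "diff_one G V F x =
     (case lie_chart1 G of (U, \<phi>) \<Rightarrow> ddir V (F \<circ> inv_into U \<phi>) (\<phi> \<one>\<^bsub>G\<^esub>) x)"

definition Ad :: "('g, 'e::lcs) lie_group \<Rightarrow> 'g \<Rightarrow> 'e \<Rightarrow> 'e" where
  "Ad G g x = diff_one G tv_real (\<lambda>h. snd (lie_chart1 G) (g \<otimes>\<^bsub>G\<^esub> h \<otimes>\<^bsub>G\<^esub> inv\<^bsub>G\<^esub> g)) x"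

definition exponential_function ::
  "('g::t2_space, 'e::lcs) lie_group \<Rightarrow> ('e \<Rightarrow> 'g) \<Rightarrow> bool" where
  "exponential_function G ex \<longleftrightarrow> mfd_smooth UNIV id_charts (lie_charts G) ex \<and>
     (\<forall>x. (\<forall>s t. ex ((s + t) *\<^sub>R x) = ex (s *\<^sub>R x) \<otimes>\<^bsub>G\<^esub> ex (t *\<^sub>R x)) \<and>
        has_ddir tv_real (\<lambda>t. snd (lie_chart1 G) (ex (t *\<^sub>R x))) (0::real) 1 x)"

text \<open>The topological dual of \<open>\<^bold>L(G)\<close> with the weak-\<open>*\<close>-topology (pointwise convergence).\<close>

definition weak_star_dual :: "('e::lcs \<Rightarrow> real) topology" where
  "weak_star_dual = top_of_set {f. linear f \<and> continuous_on UNIV f}"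


section \<open>Complex involutive semigroups and their multipliers\<close>

record ('s, 'f) inv_semigroup =
  sg_mult :: "'s \<Rightarrow> 's \<Rightarrow> 's"
  sg_star :: "'s \<Rightarrow> 's"
  sg_charts :: "('s, 'f) chart set"

definition complex_inv_semigroup :: "('s::t2_space, 'f::complex_lcs) inv_semigroup \<Rightarrow> bool" where
  "complex_inv_semigroup S \<longleftrightarrow> complex_atlas (sg_charts S) \<and>
     (\<forall>a b c. sg_mult S (sg_mult S a b) c = sg_mult S a (sg_mult S b c)) \<and>
     (\<forall>a. sg_star S (sg_star S a) = a) \<and>
     (\<forall>a b. sg_star S (sg_mult S a b) = sg_mult S (sg_star S b) (sg_star S a)) \<and>
     mfd_holo UNIV (prod_charts (sg_charts S) (sg_charts S)) (sg_charts S)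
       (\<lambda>(a, b). sg_mult S a b) \<and>
     mfd_antiholo UNIV (sg_charts S) (sg_charts S) (sg_star S)"

text \<open>Nets in \<open>S\<close> are replaced by proper filters on \<open>S\<close>.\<close>

definition has_approximate_identity :: "('s::t2_space, 'f) inv_semigroup \<Rightarrow> bool" where
  "has_approximate_identity S \<longleftrightarrow> (\<exists>F. F \<noteq> bot \<and>
     (\<forall>s. ((\<lambda>u. sg_mult S u s) \<longlongrightarrow> s) F \<and> ((\<lambda>u. sg_mult S s u) \<longlongrightarrow> s) F))"

definition absolute_value :: "('s, 'f) inv_semigroup \<Rightarrow> ('s \<Rightarrow> real) \<Rightarrow> bool" where
  "absolute_value S \<alpha> \<longleftrightarrow> (\<forall>s. 0 \<le> \<alpha> s) \<and> (\<forall>s. \<alpha> (sg_star S s) = \<alpha> s) \<and>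
     (\<forall>s t. \<alpha> (sg_mult S s t) \<le> \<alpha> s * \<alpha> t)"

type_synonym 's mpair = "('s \<Rightarrow> 's) \<times> ('s \<Rightarrow> 's)"

definition sg_multipliers :: "('s::t2_space, 'f::complex_lcs) inv_semigroup \<Rightarrow> 's mpair set" where
  "sg_multipliers S = {(l, r).
     mfd_holo UNIV (sg_charts S) (sg_charts S) l \<and> mfd_holo UNIV (sg_charts S) (sg_charts S) r \<and>
     (\<forall>a b. sg_mult S a (l b) = sg_mult S (r a) b) \<and>
     (\<forall>a b. l (sg_mult S a b) = sg_mult S (l a) b) \<and>
     (\<forall>a b. r (sg_mult S a b) = sg_mult S a (r b))}"

definition mpair_mult :: "'s mpair \<Rightarrow> 's mpair \<Rightarrow> 's mpair" where
  "mpair_mult m m' = (fst m \<circ> fst m', snd m' \<circ> snd m)"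

definition mpair_star :: "('s, 'f) inv_semigroup \<Rightarrow> 's mpair \<Rightarrow> 's mpair" where
  "mpair_star S m = ((\<lambda>a. sg_star S (snd m (sg_star S a))), (\<lambda>a. sg_star S (fst m (sg_star S a))))"

definition sg_unitary_group :: "('s::t2_space, 'f::complex_lcs) inv_semigroup \<Rightarrow> 's mpair monoid" where
  "sg_unitary_group S =
     \<lparr>carrier = {u \<in> sg_multipliers S. mpair_mult u (mpair_star S u) = (id, id) \<and>
                  mpair_mult (mpair_star S u) u = (id, id)},
      mult = mpair_mult, one = (id, id)\<rparr>"

definition sg_embed :: "('s, 'f) inv_semigroup \<Rightarrow> 's \<Rightarrow> 's mpair" where
  "sg_embed S a = ((\<lambda>b. sg_mult S a b), (\<lambda>b. sg_mult S b a))"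

definition sg_elem :: "('s, 'f) inv_semigroup \<Rightarrow> 's mpair \<Rightarrow> 's" where
  "sg_elem S m = (THE a. sg_embed S a = m)"


section \<open>Host semigroups\<close>

text \<open>
  \<open>hat x\<close> is the extension to \<open>\<complex>\<^sub>+\<close> of the one-parameter group \<open>t \<mapsto> \<eta>\<^sub>S(exp(tx))\<close>.  Only the values
  \<open>hat x z\<close> for \<open>x \<in> W\<close> and \<open>Im z \<ge> 0\<close> matter.
\<close>

definition upper_extension ::
  "('s::t2_space, 'f::complex_lcs) inv_semigroup \<Rightarrow> (real \<Rightarrow> 's mpair) \<Rightarrow> (complex \<Rightarrow> 's mpair) \<Rightarrow> bool"
  where
  "upper_extension S \<gamma> h \<longleftrightarrow>
     (\<forall>z. Im z \<ge> 0 \<longrightarrow> h z \<in> sg_multipliers S) \<and>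
     (\<forall>t. h (complex_of_real t) = \<gamma> t) \<and>
     (\<forall>z w. Im z \<ge> 0 \<longrightarrow> Im w \<ge> 0 \<longrightarrow> h (z + w) = mpair_mult (h z) (h w)) \<and>
     (\<forall>z. Im z \<ge> 0 \<longrightarrow> h (- cnj z) = mpair_star S (h z)) \<and>
     continuous_on ({z. Im z \<ge> 0} \<times> UNIV) (\<lambda>(z, s). fst (h z) s) \<and>
     (\<forall>z. Im z > 0 \<longrightarrow> h z \<in> range (sg_embed S)) \<and>
     mfd_holo {z. Im z > 0} id_charts (sg_charts S) (\<lambda>z. sg_elem S (h z))"

definition host_semigroup ::
  "('g::t2_space, 'e::lcs) lie_group \<Rightarrow> ('e \<Rightarrow> 'g) \<Rightarrow> ('s::t2_space, 'f::complex_lcs) inv_semigroup \<Rightarrow>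
   ('g \<Rightarrow> 's mpair) \<Rightarrow> 'e set \<Rightarrow> ('e \<Rightarrow> complex \<Rightarrow> 's mpair) \<Rightarrow> bool" where
  "host_semigroup G ex S \<eta>\<^sub>S W hat \<longleftrightarrow>
     complex_inv_semigroup S \<and> has_approximate_identity S \<and>
     \<eta>\<^sub>S \<in> hom G (sg_unitary_group S) \<and>
     open W \<and> convex W \<and> (\<forall>x\<in>W. \<forall>t>0. t *\<^sub>R x \<in> W) \<and> (\<forall>g. \<forall>x\<in>W. Ad G g x \<in> W) \<and>
     mfd_smooth UNIV (prod_charts (lie_charts G) (sg_charts S)) (sg_charts S)
       (\<lambda>(g, s). fst (\<eta>\<^sub>S g) s) \<and>
     (\<forall>x\<in>W. upper_extension S (\<lambda>t. \<eta>\<^sub>S (ex (t *\<^sub>R x))) (hat x)) \<and>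
     (\<forall>f::'s \<Rightarrow> complex. mfd_holo UNIV (sg_charts S) id_charts f \<longrightarrow>
        (\<forall>x\<in>W. \<forall>z. Im z > 0 \<longrightarrow> f (sg_elem S (hat x z)) = 0) \<longrightarrow> (\<forall>s. f s = 0))"

definition host_Exp ::
  "('s, 'f) inv_semigroup \<Rightarrow> ('e \<Rightarrow> complex \<Rightarrow> 's mpair) \<Rightarrow> 'e \<Rightarrow> 's" where
  "host_Exp S hat x = sg_elem S (hat x \<i>)"


section \<open>Complex star algebras, Hilbert spaces\<close>

text \<open>
  Complex vector spaces are modules over the field \<open>\<complex>\<close>.  The fields \<open>one\<close> (for the possibly
  non-unital algebras below) and \<open>mult\<close>, \<open>one\<close> (for Hilbert spaces), inherited from
  the record type of modules, are not used.
\<close>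

definition complex_ring :: "complex ring" where
  "complex_ring = \<lparr>carrier = UNIV, mult = (*), one = 1, zero = 0, add = (+)\<rparr>"

record 'a star_algebra = "(complex, 'a) module" +
  star :: "'a \<Rightarrow> 'a"

record 'a normed_star_algebra = "'a star_algebra" +
  nrm :: "'a \<Rightarrow> real"

record 'h hilbert = "(complex, 'h) module" +
  hinner :: "'h \<Rightarrow> 'h \<Rightarrow> complex"

definition alg_cauchy :: "('a, 'z) normed_star_algebra_scheme \<Rightarrow> (nat \<Rightarrow> 'a) \<Rightarrow> bool" where
  "alg_cauchy A X \<longleftrightarrow> range X \<subseteq> carrier A \<and>
     (\<forall>e>0. \<exists>N. \<forall>m\<ge>N. \<forall>n\<ge>N. nrm A (X m \<ominus>\<^bsub>A\<^esub> X n) < e)"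

definition alg_tendsto :: "('a, 'z) normed_star_algebra_scheme \<Rightarrow> (nat \<Rightarrow> 'a) \<Rightarrow> 'a \<Rightarrow> bool" where
  "alg_tendsto A X a \<longleftrightarrow> (\<lambda>n. nrm A (X n \<ominus>\<^bsub>A\<^esub> a)) \<longlonglongrightarrow> 0"

locale star_algebra = Module.module complex_ring A for A :: "('a, 'z) star_algebra_scheme" (structure) +
  assumes m_closed: "x \<in> carrier A \<Longrightarrow> y \<in> carrier A \<Longrightarrow> x \<otimes> y \<in> carrier A"
    and m_assoc: "x \<in> carrier A \<Longrightarrow> y \<in> carrier A \<Longrightarrow> z \<in> carrier A \<Longrightarrow>
      (x \<otimes> y) \<otimes> z = x \<otimes> (y \<otimes> z)"
    and l_distr: "x \<in> carrier A \<Longrightarrow> y \<in> carrier A \<Longrightarrow> z \<in> carrier A \<Longrightarrow>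
      (x \<oplus> y) \<otimes> z = x \<otimes> z \<oplus> y \<otimes> z"
    and r_distr: "x \<in> carrier A \<Longrightarrow> y \<in> carrier A \<Longrightarrow> z \<in> carrier A \<Longrightarrow>
      z \<otimes> (x \<oplus> y) = z \<otimes> x \<oplus> z \<otimes> y"
    and smult_l: "x \<in> carrier A \<Longrightarrow> y \<in> carrier A \<Longrightarrow> (c \<odot>\<^bsub>A\<^esub> x) \<otimes> y = c \<odot>\<^bsub>A\<^esub> (x \<otimes> y)"
    and smult_r: "x \<in> carrier A \<Longrightarrow> y \<in> carrier A \<Longrightarrow> x \<otimes> (c \<odot>\<^bsub>A\<^esub> y) = c \<odot>\<^bsub>A\<^esub> (x \<otimes> y)"
    and star_closed: "x \<in> carrier A \<Longrightarrow> star A x \<in> carrier A"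
    and star_star: "x \<in> carrier A \<Longrightarrow> star A (star A x) = x"
    and star_add: "x \<in> carrier A \<Longrightarrow> y \<in> carrier A \<Longrightarrow> star A (x \<oplus> y) = star A x \<oplus> star A y"
    and star_smult: "x \<in> carrier A \<Longrightarrow> star A (c \<odot>\<^bsub>A\<^esub> x) = cnj c \<odot>\<^bsub>A\<^esub> star A x"
    and star_mult: "x \<in> carrier A \<Longrightarrow> y \<in> carrier A \<Longrightarrow> star A (x \<otimes> y) = star A y \<otimes> star A x"

locale cstar_algebra = star_algebra A for A :: "('a, 'z) normed_star_algebra_scheme" (structure) +
  assumes nrm_eq_0: "x \<in> carrier A \<Longrightarrow> nrm A x = 0 \<longleftrightarrow> x = \<zero>"
    and nrm_nonneg: "x \<in> carrier A \<Longrightarrow> 0 \<le> nrm A x"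
    and nrm_smult: "x \<in> carrier A \<Longrightarrow> nrm A (c \<odot>\<^bsub>A\<^esub> x) = cmod c * nrm A x"
    and nrm_triangle: "x \<in> carrier A \<Longrightarrow> y \<in> carrier A \<Longrightarrow> nrm A (x \<oplus> y) \<le> nrm A x + nrm A y"
    and nrm_mult: "x \<in> carrier A \<Longrightarrow> y \<in> carrier A \<Longrightarrow> nrm A (x \<otimes> y) \<le> nrm A x * nrm A y"
    and nrm_star_mult: "x \<in> carrier A \<Longrightarrow> nrm A (star A x \<otimes> x) = (nrm A x)\<^sup>2"
    and complete: "alg_cauchy A X \<Longrightarrow> \<exists>a\<in>carrier A. alg_tendsto A X a"

text \<open>The distance is set to \<open>0\<close> off the carrier to meet the axioms of \<^locale>\<open>Metric_space\<close>.\<close>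

definition tv_alg :: "('a, 'z) normed_star_algebra_scheme \<Rightarrow> 'a ctvs" where
  "tv_alg A =
     \<lparr>tv_top = Metric_space.mtopology (carrier A)
        (\<lambda>a b. if a \<in> carrier A \<and> b \<in> carrier A then nrm A (a \<ominus>\<^bsub>A\<^esub> b) else 0),
      tv_add = add A,
      tv_scaleR = (\<lambda>r. smult A (complex_of_real r)),
      tv_scaleC = smult A\<rparr>"

definition hnorm :: "('h, 'z) hilbert_scheme \<Rightarrow> 'h \<Rightarrow> real" where
  "hnorm H v = sqrt (Re (hinner H v v))"

locale hilbert = Module.module complex_ring H for H :: "('h, 'z) hilbert_scheme" (structure) +
  assumes hinner_add: "u \<in> carrier H \<Longrightarrow> v \<in> carrier H \<Longrightarrow> w \<in> carrier H \<Longrightarrow>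
      hinner H (u \<oplus> v) w = hinner H u w + hinner H v w"
    and hinner_smult: "v \<in> carrier H \<Longrightarrow> w \<in> carrier H \<Longrightarrow>
      hinner H (c \<odot>\<^bsub>H\<^esub> v) w = c * hinner H v w"
    and hinner_cnj: "v \<in> carrier H \<Longrightarrow> w \<in> carrier H \<Longrightarrow> hinner H w v = cnj (hinner H v w)"
    and hinner_pos: "v \<in> carrier H \<Longrightarrow> v \<noteq> \<zero> \<Longrightarrow> 0 < Re (hinner H v v)"
    and hcomplete: "range X \<subseteq> carrier H \<Longrightarrow>
      \<forall>e>0. \<exists>N. \<forall>m\<ge>N. \<forall>n\<ge>N. hnorm H (X m \<ominus> X n) < e \<Longrightarrow>
      \<exists>v\<in>carrier H. (\<lambda>n. hnorm H (X n \<ominus> v)) \<longlonglongrightarrow> 0"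

definition bounded_operators :: "('h, 'z) hilbert_scheme \<Rightarrow> ('h \<Rightarrow> 'h) set" where
  "bounded_operators H = {T. T \<in> carrier H \<rightarrow> carrier H \<and>
     (\<forall>v\<in>carrier H. \<forall>w\<in>carrier H. T (v \<oplus>\<^bsub>H\<^esub> w) = T v \<oplus>\<^bsub>H\<^esub> T w) \<and>
     (\<forall>c. \<forall>v\<in>carrier H. T (c \<odot>\<^bsub>H\<^esub> v) = c \<odot>\<^bsub>H\<^esub> T v) \<and>
     (\<exists>C. \<forall>v\<in>carrier H. hnorm H (T v) \<le> C * hnorm H v)}"

definition star_rep ::
  "('a, 'y) star_algebra_scheme \<Rightarrow> ('h, 'z) hilbert_scheme \<Rightarrow> ('a \<Rightarrow> 'h \<Rightarrow> 'h) \<Rightarrow> bool" where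
  "star_rep A H \<pi> \<longleftrightarrow> hilbert H \<and> (\<forall>a\<in>carrier A. \<pi> a \<in> bounded_operators H) \<and>
     (\<forall>a\<in>carrier A. \<forall>b\<in>carrier A. \<forall>v\<in>carrier H. \<pi> (a \<oplus>\<^bsub>A\<^esub> b) v = \<pi> a v \<oplus>\<^bsub>H\<^esub> \<pi> b v) \<and>
     (\<forall>c. \<forall>a\<in>carrier A. \<forall>v\<in>carrier H. \<pi> (c \<odot>\<^bsub>A\<^esub> a) v = c \<odot>\<^bsub>H\<^esub> \<pi> a v) \<and>
     (\<forall>a\<in>carrier A. \<forall>b\<in>carrier A. \<forall>v\<in>carrier H. \<pi> (a \<otimes>\<^bsub>A\<^esub> b) v = \<pi> a (\<pi> b v)) \<and>
     (\<forall>a\<in>carrier A. \<forall>v\<in>carrier H. \<forall>w\<in>carrier H.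
        hinner H (\<pi> a v) w = hinner H v (\<pi> (star A a) w))"

definition nondegenerate_rep ::
  "('a, 'y) star_algebra_scheme \<Rightarrow> ('h, 'z) hilbert_scheme \<Rightarrow> ('a \<Rightarrow> 'h \<Rightarrow> 'h) \<Rightarrow> bool" where
  "nondegenerate_rep A H \<pi> \<longleftrightarrow> star_rep A H \<pi> \<and>
     (\<forall>v\<in>carrier H. \<forall>e>0. \<exists>(n::nat) a w. (\<forall>i<n. a i \<in> carrier A \<and> w i \<in> carrier H) \<and>
        hnorm H (v \<ominus>\<^bsub>H\<^esub> finsum H (\<lambda>i. \<pi> (a i) (w i)) {..<n}) < e)"


section \<open>Multiplier algebras and states\<close>

text \<open>Multipliers are pairs of extensional functions, so that equality in \<open>M(A)\<close> is equality in HOL.\<close>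

definition multiplier_algebra ::
  "('a, 'z) normed_star_algebra_scheme \<Rightarrow> (('a \<Rightarrow> 'a) \<times> ('a \<Rightarrow> 'a)) star_algebra" where
  "multiplier_algebra A =
   \<lparr>carrier = {(l, r).
      (\<forall>f\<in>{l, r}. f \<in> carrier A \<rightarrow>\<^sub>E carrier A \<and>
         (\<forall>a\<in>carrier A. \<forall>b\<in>carrier A. f (a \<oplus>\<^bsub>A\<^esub> b) = f a \<oplus>\<^bsub>A\<^esub> f b) \<and>
         (\<forall>c. \<forall>a\<in>carrier A. f (c \<odot>\<^bsub>A\<^esub> a) = c \<odot>\<^bsub>A\<^esub> f a) \<and>
         (\<exists>C. \<forall>a\<in>carrier A. nrm A (f a) \<le> C * nrm A a)) \<and>
      (\<forall>a\<in>carrier A. \<forall>b\<in>carrier A.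
         a \<otimes>\<^bsub>A\<^esub> l b = r a \<otimes>\<^bsub>A\<^esub> b \<and> l (a \<otimes>\<^bsub>A\<^esub> b) = l a \<otimes>\<^bsub>A\<^esub> b \<and> r (a \<otimes>\<^bsub>A\<^esub> b) = a \<otimes>\<^bsub>A\<^esub> r b)},
    mult = (\<lambda>(l, r) (l', r'). (compose (carrier A) l l', compose (carrier A) r' r)),
    one = ((\<lambda>a\<in>carrier A. a), (\<lambda>a\<in>carrier A. a)),
    zero = ((\<lambda>a\<in>carrier A. \<zero>\<^bsub>A\<^esub>), (\<lambda>a\<in>carrier A. \<zero>\<^bsub>A\<^esub>)),
    add = (\<lambda>(l, r) (l', r').
      ((\<lambda>a\<in>carrier A. l a \<oplus>\<^bsub>A\<^esub> l' a), (\<lambda>a\<in>carrier A. r a \<oplus>\<^bsub>A\<^esub> r' a))),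
    smult = (\<lambda>c (l, r). ((\<lambda>a\<in>carrier A. c \<odot>\<^bsub>A\<^esub> l a), (\<lambda>a\<in>carrier A. c \<odot>\<^bsub>A\<^esub> r a))),
    star = (\<lambda>(l, r).
      ((\<lambda>a\<in>carrier A. star A (r (star A a))), (\<lambda>a\<in>carrier A. star A (l (star A a)))))\<rparr>"

definition alg_embed ::
  "('a, 'z) normed_star_algebra_scheme \<Rightarrow> 'a \<Rightarrow> ('a \<Rightarrow> 'a) \<times> ('a \<Rightarrow> 'a)" where
  "alg_embed A a = ((\<lambda>b\<in>carrier A. a \<otimes>\<^bsub>A\<^esub> b), (\<lambda>b\<in>carrier A. b \<otimes>\<^bsub>A\<^esub> a))"

definition alg_unitary_group ::
  "('a, 'z) normed_star_algebra_scheme \<Rightarrow> (('a \<Rightarrow> 'a) \<times> ('a \<Rightarrow> 'a)) monoid" where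
  "alg_unitary_group A = (let M = multiplier_algebra A in
     \<lparr>carrier = {u \<in> carrier M. u \<otimes>\<^bsub>M\<^esub> star M u = \<one>\<^bsub>M\<^esub> \<and> star M u \<otimes>\<^bsub>M\<^esub> u = \<one>\<^bsub>M\<^esub>},
      mult = mult M, one = one M\<rparr>)"

definition strictly_smooth ::
  "('g::t2_space, 'e::lcs) lie_group \<Rightarrow> ('a, 'z) normed_star_algebra_scheme \<Rightarrow>
   ('g \<Rightarrow> ('a \<Rightarrow> 'a) \<times> ('a \<Rightarrow> 'a)) \<Rightarrow> bool" where
  "strictly_smooth G A \<eta> \<longleftrightarrow>
     (\<forall>a\<in>carrier A. \<forall>e>0. \<exists>b\<in>carrier A. nrm A (a \<ominus>\<^bsub>A\<^esub> b) < e \<and>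
        mfd_smooth_to (tv_alg A) (lie_charts G) (\<lambda>g. fst (\<eta> g) b) \<and>
        mfd_smooth_to (tv_alg A) (lie_charts G) (\<lambda>g. snd (\<eta> g) b))"

definition state :: "('a, 'z) normed_star_algebra_scheme \<Rightarrow> ('a \<Rightarrow> complex) \<Rightarrow> bool" where
  "state A \<phi> \<longleftrightarrow>
     (\<forall>a\<in>carrier A. \<forall>b\<in>carrier A. \<phi> (a \<oplus>\<^bsub>A\<^esub> b) = \<phi> a + \<phi> b) \<and>
     (\<forall>c. \<forall>a\<in>carrier A. \<phi> (c \<odot>\<^bsub>A\<^esub> a) = c * \<phi> a) \<and>
     (\<forall>a\<in>carrier A. \<phi> (star A a \<otimes>\<^bsub>A\<^esub> a) \<in> \<real>\<^sub>\<ge>\<^sub>0) \<and>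
     bdd_above {cmod (\<phi> a) |a. a \<in> carrier A \<and> nrm A a \<le> 1} \<and>
     Sup {cmod (\<phi> a) |a. a \<in> carrier A \<and> nrm A a \<le> 1} = 1"

text \<open>
  The canonical extension of a state to \<open>M(A)\<close>: the value is independent of the choice of the
  representing triple \<open>(H, \<pi>, v)\<close>.  Hilbert spaces with carrier in the type \<open>nat \<Rightarrow> 'a\<close> suffice: the
  GNS space is a quotient of the set of Cauchy sequences in \<open>A\<close>, and a system of representatives
  can be taken as its carrier.
\<close>

definition state_ext ::
  "('a, 'z) normed_star_algebra_scheme \<Rightarrow> ('a \<Rightarrow> complex) \<Rightarrow> ('a \<Rightarrow> 'a) \<times> ('a \<Rightarrow> 'a) \<Rightarrow> complex" where
  "state_ext A \<phi> m = (THE c. \<exists>(H :: (nat \<Rightarrow> 'a) hilbert) \<pi> v \<pi>'.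
     nondegenerate_rep A H \<pi> \<and> v \<in> carrier H \<and> hnorm H v = 1 \<and>
     (\<forall>a\<in>carrier A. \<phi> a = hinner H (\<pi> a v) v) \<and>
     star_rep (multiplier_algebra A) H \<pi>' \<and>
     (\<forall>a\<in>carrier A. \<forall>w\<in>carrier H. \<pi>' (alg_embed A a) w = \<pi> a w) \<and>
     c = hinner H (\<pi>' m v) v)"

definition smooth_states ::
  "('g::t2_space, 'e::lcs) lie_group \<Rightarrow> ('a, 'z) normed_star_algebra_scheme \<Rightarrow>
   ('g \<Rightarrow> ('a \<Rightarrow> 'a) \<times> ('a \<Rightarrow> 'a)) \<Rightarrow> ('a \<Rightarrow> complex) set" where
  "smooth_states G A \<eta> =
     {\<phi>. state A \<phi> \<and> mfd_smooth UNIV (lie_charts G) id_charts (state_ext A \<phi> \<circ> \<eta>)}"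

text \<open>
  Since \<open>\<eta>\<close> is unitary, the differential at the unit is purely imaginary, and taking the real part
  merely converts the type.
\<close>

definition momentum_map ::
  "('g::t2_space, 'e::lcs) lie_group \<Rightarrow> ('a, 'z) normed_star_algebra_scheme \<Rightarrow>
   ('g \<Rightarrow> ('a \<Rightarrow> 'a) \<times> ('a \<Rightarrow> 'a)) \<Rightarrow> ('a \<Rightarrow> complex) \<Rightarrow> 'e \<Rightarrow> real" where
  "momentum_map G A \<eta> \<phi> x = Re (1 / \<i> * diff_one G tv_real (state_ext A \<phi> \<circ> \<eta>) x)"

definition momentum_set ::
  "('g::t2_space, 'e::lcs) lie_group \<Rightarrow> ('a, 'z) normed_star_algebra_scheme \<Rightarrow>
   ('g \<Rightarrow> ('a \<Rightarrow> 'a) \<times> ('a \<Rightarrow> 'a)) \<Rightarrow> ('e \<Rightarrow> real) set" where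
  "momentum_set G A \<eta> = weak_star_dual closure_of (momentum_map G A \<eta> ` smooth_states G A \<eta>)"


section \<open>The \<open>C\<^sup>*\<close>-algebra of a complex involutive semigroup with absolute value\<close>

text \<open>
  Hausdorff completion of a seminormed star algebra: Cauchy sequences modulo null sequences.  In
  particular the kernel of the seminorm is divided out.
\<close>

definition cauchy_class :: "('a, 'z) normed_star_algebra_scheme \<Rightarrow> (nat \<Rightarrow> 'a) \<Rightarrow> (nat \<Rightarrow> 'a) set" where
  "cauchy_class A X = {Y. alg_cauchy A Y \<and> (\<lambda>n. nrm A (X n \<ominus>\<^bsub>A\<^esub> Y n)) \<longlonglongrightarrow> 0}"

definition cauchy_rep :: "(nat \<Rightarrow> 'a) set \<Rightarrow> nat \<Rightarrow> 'a" where
  "cauchy_rep C = (SOME X. X \<in> C)"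

definition completion :: "'a normed_star_algebra \<Rightarrow> (nat \<Rightarrow> 'a) set normed_star_algebra" where
  "completion A =
   \<lparr>carrier = cauchy_class A ` {X. alg_cauchy A X},
    mult = (\<lambda>C D. cauchy_class A (\<lambda>n. cauchy_rep C n \<otimes>\<^bsub>A\<^esub> cauchy_rep D n)),
    one = undefined,
    zero = cauchy_class A (\<lambda>n. \<zero>\<^bsub>A\<^esub>),
    add = (\<lambda>C D. cauchy_class A (\<lambda>n. cauchy_rep C n \<oplus>\<^bsub>A\<^esub> cauchy_rep D n)),
    smult = (\<lambda>c C. cauchy_class A (\<lambda>n. c \<odot>\<^bsub>A\<^esub> cauchy_rep C n)),
    star = (\<lambda>C. cauchy_class A (\<lambda>n. star A (cauchy_rep C n))),
    nrm = (\<lambda>C. lim (\<lambda>n. nrm A (cauchy_rep C n)))\<rparr>"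

definition completion_embed :: "'a normed_star_algebra \<Rightarrow> 'a \<Rightarrow> (nat \<Rightarrow> 'a) set" where
  "completion_embed A a = cauchy_class A (\<lambda>n. a)"

definition semigroup_algebra ::
  "('s, 'f) inv_semigroup \<Rightarrow> ('s \<Rightarrow> real) \<Rightarrow> ('s \<Rightarrow> complex) normed_star_algebra" where
  "semigroup_algebra S \<alpha> =
   \<lparr>carrier = {f. finite {s. f s \<noteq> 0}},
    mult = (\<lambda>f g u. \<Sum>(s, t) | f s \<noteq> 0 \<and> g t \<noteq> 0 \<and> sg_mult S s t = u. f s * g t),
    one = undefined,
    zero = (\<lambda>s. 0),
    add = (\<lambda>f g s. f s + g s),
    smult = (\<lambda>c f s. c * f s),
    star = (\<lambda>f s. cnj (f (sg_star S s))),
    nrm = (\<lambda>f. \<Sum>s | f s \<noteq> 0. cmod (f s) * \<alpha> s)\<rparr>"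

definition delta :: "'s \<Rightarrow> 's \<Rightarrow> complex" where
  "delta s = (\<lambda>t. if t = s then 1 else 0)"

definition ell1 ::
  "('s, 'f) inv_semigroup \<Rightarrow> ('s \<Rightarrow> real) \<Rightarrow> (nat \<Rightarrow> 's \<Rightarrow> complex) set normed_star_algebra" where
  "ell1 S \<alpha> = completion (semigroup_algebra S \<alpha>)"

text \<open>
  HOL cannot quantify over all \<open>C\<^sup>*\<close>-algebras, but every morphism \<open>\<beta>\<close> takes its values in the closed
  linear span of \<open>range \<beta>\<close>, a \<open>C\<^sup>*\<close>-subalgebra each of whose elements is the limit of a
  sequence \<open>\<Sum>\<^sub>s f\<^sub>n(s) \<beta>(s)\<close> with finitely supported \<open>f\<^sub>n\<close>.  Hence it is isomorphic to
  a \<open>C\<^sup>*\<close>-algebra with carrier in the type \<open>nat \<Rightarrow> 's \<Rightarrow> complex\<close>, and no morphism is lost below.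
\<close>

definition holo_morphisms ::
  "('s::t2_space, 'f::complex_lcs) inv_semigroup \<Rightarrow> ('s \<Rightarrow> real) \<Rightarrow>
   ((nat \<Rightarrow> 's \<Rightarrow> complex) normed_star_algebra \<times> ('s \<Rightarrow> nat \<Rightarrow> 's \<Rightarrow> complex)) set" where
  "holo_morphisms S \<alpha> = {(B, \<beta>). cstar_algebra B \<and> range \<beta> \<subseteq> carrier B \<and>
     (\<forall>s t. \<beta> (sg_mult S s t) = \<beta> s \<otimes>\<^bsub>B\<^esub> \<beta> t) \<and>
     (\<forall>s. \<beta> (sg_star S s) = star B (\<beta> s)) \<and>
     (\<forall>s. nrm B (\<beta> s) \<le> \<alpha> s) \<and>
     mfd_holo_to (tv_alg B) (sg_charts S) \<beta>}"

text \<open>The continuous extension to \<open>\<ell>\<^sup>1(S, \<alpha>)\<close> of \<open>f \<mapsto> \<Sum>\<^sub>s f(s) \<beta>(s)\<close>.\<close>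

definition ell1_ext ::
  "('b, 'z) normed_star_algebra_scheme \<Rightarrow> ('s \<Rightarrow> 'b) \<Rightarrow> (nat \<Rightarrow> 's \<Rightarrow> complex) set \<Rightarrow> 'b" where
  "ell1_ext B \<beta> C = (THE b. b \<in> carrier B \<and>
     (\<forall>X\<in>C. alg_tendsto B (\<lambda>n. finsum B (\<lambda>s. X n s \<odot>\<^bsub>B\<^esub> \<beta> s) {s. X n s \<noteq> 0}) b))"

text \<open>
  The algebra \<open>\<ell>\<^sup>1(S, \<alpha>)\<close> with the \<open>C\<^sup>*\<close>-seminorm \<open>sup\<^sub>\<beta> \<parallel>\<beta>^(f)\<parallel>\<close>.  The kernel of this seminorm is the
  ideal \<open>I\<close>, the intersection of the kernels of all \<open>\<beta>^\<close>; so its Hausdorff completion is the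
  completion of \<open>\<ell>\<^sup>1(S, \<alpha>)/I\<close>.
\<close>

definition ell1_cstar ::
  "('s::t2_space, 'f::complex_lcs) inv_semigroup \<Rightarrow> ('s \<Rightarrow> real) \<Rightarrow>
   (nat \<Rightarrow> 's \<Rightarrow> complex) set normed_star_algebra" where
  "ell1_cstar S \<alpha> = (ell1 S \<alpha>)\<lparr>nrm := \<lambda>f. SUP (B, \<beta>)\<in>holo_morphisms S \<alpha>. nrm B (ell1_ext B \<beta> f)\<rparr>"

definition host_cstar ::
  "('s::t2_space, 'f::complex_lcs) inv_semigroup \<Rightarrow> ('s \<Rightarrow> real) \<Rightarrow>
   (nat \<Rightarrow> (nat \<Rightarrow> 's \<Rightarrow> complex) set) set normed_star_algebra" where
  "host_cstar S \<alpha> = completion (ell1_cstar S \<alpha>)"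

definition host_eta ::
  "('s::t2_space, 'f::complex_lcs) inv_semigroup \<Rightarrow> ('s \<Rightarrow> real) \<Rightarrow> 's \<Rightarrow>
   (nat \<Rightarrow> (nat \<Rightarrow> 's \<Rightarrow> complex) set) set" where
  "host_eta S \<alpha> s =
     completion_embed (ell1_cstar S \<alpha>) (completion_embed (semigroup_algebra S \<alpha>) (delta s))"

end

theory Submission
  imports Defs "HOL-Complex_Analysis.Complex_Analysis" "HOL-Computational_Algebra.Polynomial"
begin

text \<open>
  Let \<open>\<phi>\<close> be a smooth state, \<open>x \<in> W\<close>, \<open>g(t) = \<phi>(\<eta>(exp tx))\<close> and \<open>F(z) = \<phi>(\<eta>\<^sub>\<alpha>(\<eta>^\<^sub>x(z)))\<close>
  on the upper half plane.  The Kadison inequality \<open>|\<phi>(a)|\<^sup>2 \<le> \<phi>(a\<^sup>*a)\<close> gives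
  \<open>|F(i2\<^sup>-\<^sup>n)| \<le> \<alpha>(Exp x) ^ (2\<^sup>-\<^sup>n)\<close>, while the Cauchy-Schwarz inequality applied to \<open>\<eta>(exp tx) - 1\<close> and
  \<open>\<eta>\<^sub>\<alpha>(\<eta>^\<^sub>x(is)) - 1\<close> shows that \<open>F'(is)\<close> tends to \<open>g'(0)\<close> as \<open>s \<rightarrow> 0\<close>.  Hence the momentum
  \<open>g'(0) / i\<close> of \<open>\<phi>\<close> at \<open>x\<close> is at least \<open>- ln (1 + \<alpha>(Exp x))\<close>, and this bound passes to the weak-\<open>*\<close>-closure.
  As \<open>\<alpha>\<close> is locally bounded and \<open>Exp\<close> continuous, \<open>s\<close> is locally bounded above; it is bounded below by
  \<open>-f\<close> for any single \<open>f\<close> in the momentum set.  Smooth states exist because a positive functional can be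
  compressed by a smooth element, and positive functionals exist because elements \<open>a\<^sup>*a\<close> are positive
  (Kaplansky) and the Hahn-Banach theorem applies; neither step needs completeness or a unit.
\<close>

text \<open>Two facts shape the proof: \<open>host_cstar S \<alpha>\<close> is a completion of a
  completion, handled without unit and spectrum, and \<open>state_ext\<close> is a definite
  description over representations. Self-adjoint h are therefore studied through the operators b ->
  p(h) b for real polynomials p, whose constants act as multiples of the identity, and u is positive
  if M(c - u) \<le> c for some c \<ge> 0. Roots and approximate units then exist up to an error,
  which is enough for estimates. For \<open>state_ext\<close>, the GNS space gives existence and a
  sequence a_n with \<phi>(a_n) -> 1 gives uniqueness: the extension at a multiplier m is the limit
  of \<phi>(m a_n), and a_n replaces 1 in all estimates with U - 1 and T - 1. The norm of the host
  algebra is a supremum over all holomorphic morphisms, so holomorphy of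
  \<open>\<eta>\<alpha>\<close> along curves rests on Cauchy and Schwarz estimates whose constants
  depend only on a local bound of \<alpha>. The 1 in ln (1 + \<alpha>(Exp x)) keeps the base of the
  powers at least 1, as \<alpha> may take the value 0. Dyadic points appear because the Kadison
  inequality doubles the parameter.\<close>

section \<open>Positivity for real polynomials under a C*-like seminorm\<close>

text \<open>The model is M p = norm of p(h) for a self-adjoint h, that is the maximum of |p| on the
  spectrum of h. The axiom \<open>sq_le\<close> is the trace of the C*-identity: p is the real part
  of p + iq, whose norm squared is the norm of p^2 + q^2.\<close>

locale real_calculus_seminorm =
  fixes M :: "real poly => real"
  assumes nonneg: "0 \<le> M p"
    and add: "M (p + q) \<le> M p + M q"
    and mult: "M (p * q) \<le> M p * M q"
    and smult_le: "M (Polynomial.smult c p) \<le> \<bar>c\<bar> * M p"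
    and one_le: "M 1 \<le> 1"
    and sq_le: "(M p)\<^sup>2 \<le> M (p\<^sup>2 + q\<^sup>2)"
begin

lemma zero: "M 0 = 0"
  using smult_le[of 0 0] nonneg[of 0] by simp

lemma minus: "M (- p) = M p"
  using smult_le[of "-1" p] smult_le[of "-1" "-p"] by simp

lemma diff: "M (p - q) \<le> M p + M q"
  using add[of p "-q"] by (simp add: minus)

lemma const: "M [:c:] \<le> \<bar>c\<bar>"
  using smult_le[of c 1] mult_left_mono[OF one_le, of "\<bar>c\<bar>"] by simp

lemma sq: "M (p\<^sup>2) = (M p)\<^sup>2"
  using sq_le[of p 0] mult[of p p] by (simp add: power2_eq_square)

lemma power_le: "M (p ^ n) \<le> M p ^ n"
proof (induction n)
  case (Suc n)
  have "M (p ^ Suc n) \<le> M p * M (p ^ n)" using mult[of p "p ^ n"] by simp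
  also have "\<dots> \<le> M p * M p ^ n" using Suc nonneg by (intro mult_left_mono) auto
  finally show ?case by simp
qed (simp add: one_le)

lemma power_two_power: "M (p ^ (2 ^ n)) = M p ^ (2 ^ n)"
proof (induction n)
  case (Suc n)
  have "p ^ (2 ^ Suc n) = (p ^ (2 ^ n))\<^sup>2" by (simp add: power_mult[symmetric] mult.commute)
  then have "M (p ^ (2 ^ Suc n)) = (M (p ^ (2 ^ n)))\<^sup>2" by (simp only: sq)
  also have "\<dots> = M p ^ (2 ^ Suc n)" using Suc by (simp add: power_mult[symmetric] mult.commute)
  finally show ?case .
qed simp

text \<open>Equality is known at the exponent 2^n. Splitting p^(2^n) into p^n and a cofactor, and
  bounding the cofactor by \<open>power_le\<close>, leaves the claim after division.\<close>

lemma power_ge: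
  assumes "M p > 0"
  shows "M p ^ n \<le> M (p ^ n)"
proof -
  have n: "n \<le> 2 ^ n" by (simp add: less_imp_le)
  have "M p ^ n * M p ^ (2 ^ n - n) = M (p ^ n * p ^ (2 ^ n - n))"
    using n by (simp add: power_add[symmetric] power_two_power)
  also have "\<dots> \<le> M (p ^ n) * M (p ^ (2 ^ n - n))" by (rule mult)
  also have "\<dots> \<le> M (p ^ n) * M p ^ (2 ^ n - n)"
    by (intro mult_left_mono power_le nonneg)
  finally show "M p ^ n \<le> M (p ^ n)" using assms by (simp add: mult_le_cancel_right)
qed

text \<open>A fixed point of s = (1 - u + s^2) / 2 satisfies (1 - s)^2 = u. The numerical iteration
  \<sigma>, with 1 in place of 1 - u, dominates the polynomials s and their increments; it increases
  and stays below 1, so its increments tend to 0. The defect of 1 - s as a root of u is twice an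
  increment, so that no limit of the polynomials themselves is taken.\<close>

lemma approx_root_unit:
  assumes u: "M (1 - u) \<le> 1" and e: "e > 0"
  obtains r where "M (r\<^sup>2 - u) < e"
proof -
  define s where "s = rec_nat (0 :: real poly) (\<lambda>_ s. Polynomial.smult (1/2) (1 - u + s\<^sup>2))"
  define \<sigma> where "\<sigma> = rec_nat (0 :: real) (\<lambda>_ s. (1 + s\<^sup>2) / 2)"
  have s: "s 0 = 0" "s (Suc n) = Polynomial.smult (1/2) (1 - u + (s n)\<^sup>2)" for n
    by (simp_all add: s_def)
  have \<sigma>: "\<sigma> 0 = 0" "\<sigma> (Suc n) = (1 + (\<sigma> n)\<^sup>2) / 2" for n
    by (simp_all add: \<sigma>_def)
  have M_half: "M (Polynomial.smult (1/2) p) \<le> M p / 2" for p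
    using smult_le[of "1/2" p] by simp
  have sb: "M (s n) \<le> \<sigma> n \<and> 0 \<le> \<sigma> n \<and> \<sigma> n \<le> 1" for n
  proof (induction n)
    case (Suc n)
    have "M (s (Suc n)) \<le> M (1 - u + (s n)\<^sup>2) / 2" unfolding s by (rule M_half)
    also have "M (1 - u + (s n)\<^sup>2) \<le> 1 + (M (s n))\<^sup>2"
      using add[of "1 - u" "(s n)\<^sup>2"] u by (simp add: sq)
    also have "(M (s n))\<^sup>2 \<le> (\<sigma> n)\<^sup>2" using Suc nonneg by (intro power_mono) auto
    finally show ?case using Suc unfolding \<sigma> by (auto simp: power_le_one)
  qed (simp add: s \<sigma> zero)
  have incr: "M (s (Suc n) - s n) \<le> \<sigma> (Suc n) - \<sigma> n" for n
  proof (induction n)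
    case 0
    show ?case using M_half[of "1 - u"] u by (simp add: s \<sigma>)
  next
    case (Suc n)
    have "s (Suc (Suc n)) - s (Suc n) =
        Polynomial.smult (1/2) ((1 - u + (s (Suc n))\<^sup>2) - (1 - u + (s n)\<^sup>2))"
      by (simp only: s(2)[of "Suc n"] s(2)[of n] smult_diff_right)
    also have "\<dots> = Polynomial.smult (1/2) ((s (Suc n) - s n) * (s (Suc n) + s n))"
      by (simp add: algebra_simps power2_eq_square)
    finally have "M (s (Suc (Suc n)) - s (Suc n)) \<le> M ((s (Suc n) - s n) * (s (Suc n) + s n)) / 2"
      using M_half by simp
    also have "\<dots> \<le> (M (s (Suc n) - s n) * M (s (Suc n) + s n)) / 2"
      using mult by (simp add: divide_right_mono)
    also have "\<dots> \<le> ((\<sigma> (Suc n) - \<sigma> n) * (\<sigma> (Suc n) + \<sigma> n)) / 2"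
      using Suc sb[of n] sb[of "Suc n"] add[of "s (Suc n)" "s n"] nonneg[of "s (Suc n) - s n"]
      by (intro divide_right_mono mult_mono) (auto intro: nonneg)
    also have "\<dots> = \<sigma> (Suc (Suc n)) - \<sigma> (Suc n)"
      unfolding \<sigma>(2)[of "Suc n"] by (simp add: \<sigma>(2)[of n] field_simps power2_eq_square)
    finally show ?case .
  qed
  \<comment> \<open>The increments of \<sigma> dominate values of a seminorm, hence are
    nonnegative.\<close>
  have "incseq \<sigma>"
    by (rule incseq_SucI) (use incr nonneg in \<open>metis diff_ge_0_iff_ge order_trans\<close>)
  then obtain L where "\<sigma> \<longlonglongrightarrow> L"
    using incseq_convergent[of \<sigma> 1] sb by blast
  then have "(\<lambda>n. \<sigma> (Suc n) - \<sigma> n) \<longlonglongrightarrow> L - L"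
    by (intro tendsto_diff) (simp_all add: LIMSEQ_Suc)
  then have "(\<lambda>n. 2 * (\<sigma> (Suc n) - \<sigma> n)) \<longlonglongrightarrow> 0"
    by (intro tendsto_mult_right_zero) simp
  then have "\<forall>\<^sub>F n in sequentially. 2 * (\<sigma> (Suc n) - \<sigma> n) < e"
    using e by (rule order_tendstoD)
  then obtain n where n: "2 * (\<sigma> (Suc n) - \<sigma> n) < e" by (auto simp: eventually_sequentially)
  have "(1 - s n)\<^sup>2 - u = Polynomial.smult 2 (s (Suc n) - s n)"
  proof -
    have two: "Polynomial.smult 2 q = q + q" for q :: "real poly"
      using smult_add_left[of 1 1 q] by simp
    have half: "Polynomial.smult 2 (Polynomial.smult (1/2) q) = q" for q :: "real poly" by simp
    show ?thesis unfolding s(2) smult_diff_right half by (simp add: two power2_eq_square algebra_simps)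
  qed
  then have "M ((1 - s n)\<^sup>2 - u) \<le> 2 * M (s (Suc n) - s n)"
    using smult_le[of 2 "s (Suc n) - s n"] by simp
  also have "\<dots> < e" using incr[of n] n by simp
  finally show thesis by (rule that)
qed

text \<open>Norm characterization of positive elements; it makes sense without spectra.\<close>

definition NP :: "real poly => bool" where
  "NP u \<longleftrightarrow> (\<exists>c\<ge>0. M ([:c:] - u) \<le> c)"

lemma approx_root:
  assumes "NP u" "e > 0"
  obtains r where "M (r\<^sup>2 - u) < e"
proof -
  obtain c where c: "c \<ge> 0" "M ([:c:] - u) \<le> c" using assms by (auto simp: NP_def)
  show thesis
  proof (cases "c = 0")
    case True
    then have "M (- u) = 0" using c nonneg[of "-u"] by simp
    then show thesis using assms by (intro that[of 0]) simp
  next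
    case False
    then have c0: "c > 0" using c by simp
    have "M (1 - Polynomial.smult (1/c) u) \<le> \<bar>1/c\<bar> * M ([:c:] - u)"
      using smult_le[of "1/c" "[:c:] - u"] c0 by (simp add: smult_diff_right one_pCons)
    also have "\<dots> \<le> 1" using c c0 by (simp add: field_simps)
    finally obtain r where r: "M (r\<^sup>2 - Polynomial.smult (1/c) u) < e / c"
      using approx_root_unit[of "Polynomial.smult (1/c) u" "e/c"] c0 assms by auto
    have "(Polynomial.smult (sqrt c) r)\<^sup>2 - u = Polynomial.smult c (r\<^sup>2 - Polynomial.smult (1/c) u)"
      using c0 by (simp add: smult_diff_right power2_eq_square)
    then have "M ((Polynomial.smult (sqrt c) r)\<^sup>2 - u) \<le> c * M (r\<^sup>2 - Polynomial.smult (1/c) u)"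
      using smult_le[of c "r\<^sup>2 - Polynomial.smult (1/c) u"] c0 by simp
    also have "\<dots> < e" using r c0 by (simp add: field_simps)
    finally show thesis by (rule that)
  qed
qed

lemma NP_add: "NP u ==> NP v ==> NP (u + v)"
proof -
  assume "NP u" "NP v"
  then obtain c d where "c \<ge> 0" "d \<ge> 0" "M ([:c:] - u) \<le> c" "M ([:d:] - v) \<le> d"
    by (auto simp: NP_def)
  moreover have "[:c + d:] - (u + v) = ([:c:] - u) + ([:d:] - v)" by simp
  then have "M ([:c + d:] - (u + v)) \<le> M ([:c:] - u) + M ([:d:] - v)"
    using add[of "[:c:] - u" "[:d:] - v"] by (simp only:)
  ultimately have "0 \<le> c + d" "M ([:c + d:] - (u + v)) \<le> c + d" by auto
  then show ?thesis unfolding NP_def by blast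
qed

lemma NP_const: "c \<ge> 0 ==> NP [:c:]"
  unfolding NP_def using zero by (intro exI[of _ c]) auto

lemma NP_scale: "NP u ==> c \<ge> 0 ==> NP (Polynomial.smult c u)"
proof -
  assume "NP u" and c: "c \<ge> 0"
  then obtain d where d: "d \<ge> 0" "M ([:d:] - u) \<le> d" by (auto simp: NP_def)
  have "M ([:c * d:] - Polynomial.smult c u) \<le> \<bar>c\<bar> * M ([:d:] - u)"
    using smult_le[of c "[:d:] - u"] by (simp add: smult_diff_right)
  also have "\<dots> \<le> c * d" using c d by (simp add: mult_left_mono)
  finally show ?thesis using c d unfolding NP_def by (metis mult_nonneg_nonneg)
qed

lemma NP_sum: "(\<And>i. i \<in> I ==> NP (f i)) ==> NP (sum f I)"
  using NP_const[of 0] by (induction I rule: infinite_finite_induct) (auto intro: NP_add)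

text \<open>Since 1 - (1 - h^2) = h^2 has seminorm at most 1, there is an approximate root k of 1 -
  h^2. Then k^2 + h^2 is close to 1, and \<open>sq_le\<close> bounds the square of M k by
  it.\<close>

lemma one_minus_sq:
  assumes "M h \<le> 1" shows "M (1 - h\<^sup>2) \<le> 1"
proof (rule field_le_epsilon)
  fix e :: real assume e: "e > 0"
  have "M (1 - (1 - h\<^sup>2)) \<le> 1" using assms nonneg[of h] by (simp add: sq power_le_one)
  then obtain k where k: "M (k\<^sup>2 - (1 - h\<^sup>2)) < e / 2"
    using approx_root_unit[of "1 - h\<^sup>2" "e/2"] e by auto
  have "(M k)\<^sup>2 \<le> M (k\<^sup>2 + h\<^sup>2)" by (rule sq_le)
  also have "k\<^sup>2 + h\<^sup>2 = 1 + (k\<^sup>2 - (1 - h\<^sup>2))" by simp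
  also have "M \<dots> \<le> 1 + e / 2" using add[of 1 "k\<^sup>2 - (1 - h\<^sup>2)"] one_le k by linarith
  finally have "M (k\<^sup>2) \<le> 1 + e / 2" by (simp add: sq)
  moreover have "M (1 - h\<^sup>2) \<le> M (k\<^sup>2) + M (k\<^sup>2 - (1 - h\<^sup>2))"
    using diff[of "k\<^sup>2" "k\<^sup>2 - (1 - h\<^sup>2)"] by simp
  ultimately show "M (1 - h\<^sup>2) \<le> 1 + e" using k by linarith
qed

lemma const_minus_sq:
  assumes "(M p)\<^sup>2 \<le> e" shows "M ([:e:] - p\<^sup>2) \<le> e"
proof (cases "e = 0")
  case True
  then have "M (p\<^sup>2) = 0" using assms by (simp add: sq)
  then show ?thesis using True minus[of "p\<^sup>2"] by simp
next
  case False
  then have e: "e > 0" using assms by (metis less_eq_real_def order_trans zero_le_power2)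
  have "M (Polynomial.smult (1 / sqrt e) p) \<le> \<bar>1 / sqrt e\<bar> * M p" by (rule smult_le)
  also have "\<dots> \<le> 1" using assms e nonneg[of p] by (simp add: real_le_rsqrt)
  finally have *: "M (1 - (Polynomial.smult (1 / sqrt e) p)\<^sup>2) \<le> 1" by (rule one_minus_sq)
  have "[:e:] - p\<^sup>2 = Polynomial.smult e (1 - (Polynomial.smult (1 / sqrt e) p)\<^sup>2)"
    using e by (simp add: smult_diff_right power2_eq_square one_pCons)
  then have "M ([:e:] - p\<^sup>2) \<le> \<bar>e\<bar> * M (1 - (Polynomial.smult (1 / sqrt e) p)\<^sup>2)"
    using smult_le by simp
  also have "\<dots> \<le> e" using e * by simp
  finally show ?thesis .
qed

text \<open>With an approximate root r of u, the product u p^2 is close to the square of r p, and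
  squares are covered by \<open>const_minus_sq\<close>.\<close>

lemma NP_mult_sq:
  assumes u: "NP u" shows "NP (u * p\<^sup>2)"
proof -
  \<comment> \<open>\<open>NP\<close> asks for one constant, so e is fixed before the error: M u + 1
    bounds M(r^2) for every approximate root r with error \<delta> \<le> 1.\<close>
  define e where "e = (M u + 1) * (M p)\<^sup>2"
  have e0: "e \<ge> 0" unfolding e_def using nonneg[of u] by simp
  have "M ([:e:] - u * p\<^sup>2) \<le> e"
  proof (rule field_le_epsilon)
    fix \<epsilon> :: real assume \<epsilon>: "\<epsilon> > 0"
    define \<delta> where "\<delta> = min 1 (\<epsilon> / (1 + (M p)\<^sup>2))"
    have \<delta>: "\<delta> > 0" "\<delta> \<le> 1" unfolding \<delta>_def using \<epsilon> by (auto intro!: divide_pos_pos add_pos_nonneg)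
    have "\<delta> * (M p)\<^sup>2 \<le> \<epsilon> / (1 + (M p)\<^sup>2) * (M p)\<^sup>2" unfolding \<delta>_def by (intro mult_right_mono) auto
    also have "\<dots> \<le> \<epsilon>" using \<epsilon> by (simp add: field_simps add_pos_nonneg)
    finally have \<delta>e: "\<delta> * (M p)\<^sup>2 \<le> \<epsilon>" .
    obtain r where r: "M (r\<^sup>2 - u) < \<delta>" using approx_root[OF u] \<delta> by metis
    have "M (r\<^sup>2) \<le> M u + 1" using add[of u "r\<^sup>2 - u"] r \<delta> by simp
    then have "(M r * M p)\<^sup>2 \<le> e" unfolding e_def power_mult_distrib sq by (rule mult_right_mono) simp
    moreover have "(M (r * p))\<^sup>2 \<le> (M r * M p)\<^sup>2" by (intro power_mono mult nonneg)
    ultimately have "M ([:e:] - (r * p)\<^sup>2) \<le> e" by (intro const_minus_sq) simp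
    moreover have "M ((r\<^sup>2 - u) * p\<^sup>2) \<le> \<epsilon>"
    proof -
      have "M ((r\<^sup>2 - u) * p\<^sup>2) \<le> M (r\<^sup>2 - u) * (M p)\<^sup>2" using mult[of "r\<^sup>2 - u" "p\<^sup>2"] by (simp add: sq)
      also have "\<dots> \<le> \<delta> * (M p)\<^sup>2" using r by (intro mult_right_mono) auto
      finally show ?thesis using \<delta>e by simp
    qed
    moreover have eq: "[:e:] - u * p\<^sup>2 = ([:e:] - (r * p)\<^sup>2) + (r\<^sup>2 - u) * p\<^sup>2"
      by (simp add: algebra_simps power_mult_distrib)
    ultimately show "M ([:e:] - u * p\<^sup>2) \<le> e + \<epsilon>"
      unfolding eq by (metis add add_mono order_trans)
  qed
  then show ?thesis unfolding NP_def using e0 by blast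
qed

lemma NP_sq: "NP (p\<^sup>2)"
  using NP_mult_sq[OF NP_const[of 1], of p] by (simp add: one_pCons[symmetric])

lemma NP_mult_power: assumes "NP g" shows "NP (p\<^sup>2 * g ^ n)"
proof (cases "even n")
  case True
  then obtain k where "n = 2 * k" by blast
  then have "p\<^sup>2 * g ^ n = (p * g ^ k)\<^sup>2" by (simp add: power_mult_distrib power_mult mult.commute)
  then show ?thesis by (simp only: NP_sq)
next
  case False
  then obtain k where "n = Suc (2 * k)" using oddE by fastforce
  then have "p\<^sup>2 * g ^ n = g * (p * g ^ k)\<^sup>2"
    by (simp add: power_mult_distrib power_mult mult.commute algebra_simps)
  then show ?thesis using NP_mult_sq[OF assms] by simp
qed

text \<open>If \<open>r\<^sup>2 = d + a\<close> and \<open>s\<^sup>2 = d - a\<close>, then \<open>r + is\<close> has norm \<open>\<surd>(2d)\<close> and \<open>a\<close> is half the real part of its square.\<close>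

lemma norm_le_of_NP:
  assumes u: "NP ([:d:] + a)" and v: "NP ([:d:] - a)" and d: "d \<ge> 0"
  shows "M a \<le> d"
proof (rule field_le_epsilon)
  fix e :: real assume e: "e > 0"
  obtain r where r: "M (r\<^sup>2 - ([:d:] + a)) < e / 2" using approx_root[OF u, of "e/2"] e by auto
  obtain s where s: "M (s\<^sup>2 - ([:d:] - a)) < e / 2" using approx_root[OF v, of "e/2"] e by auto
  \<comment> \<open>The identity (r^2 - s^2)^2 + (2rs)^2 = (r^2 + s^2)^2 is what
    \<open>sq_le\<close> needs; up to the errors, r^2 - s^2 is 2a and r^2 + s^2 is 2d.\<close>
  have "(M (r\<^sup>2 - s\<^sup>2))\<^sup>2 \<le> M ((r\<^sup>2 - s\<^sup>2)\<^sup>2 + (2 * r * s)\<^sup>2)" by (rule sq_le)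
  also have "(r\<^sup>2 - s\<^sup>2)\<^sup>2 + (2 * r * s)\<^sup>2 = (r\<^sup>2 + s\<^sup>2)\<^sup>2"
    by (simp add: algebra_simps power2_eq_square)
  finally have 1: "M (r\<^sup>2 - s\<^sup>2) \<le> M (r\<^sup>2 + s\<^sup>2)"
    using nonneg by (simp add: sq power2_le_iff_abs_le)
  have "r\<^sup>2 + s\<^sup>2 = [:2 * d:] + ((r\<^sup>2 - ([:d:] + a)) + (s\<^sup>2 - ([:d:] - a)))"
  proof -
    have "[:2 * d:] = [:d:] + [:d:]" by simp
    then show ?thesis by (simp only: diff_conv_add_uminus add_ac minus_add_distrib add_minus_cancel minus_add_cancel minus_minus)
  qed
  then have "M (r\<^sup>2 + s\<^sup>2) \<le> M [:2 * d:] + (M (r\<^sup>2 - ([:d:] + a)) + M (s\<^sup>2 - ([:d:] - a)))"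
    by (metis add add_left_mono order_trans)
  then have 2: "M (r\<^sup>2 + s\<^sup>2) \<le> 2 * d + e" using r s const[of "2 * d"] d by simp
  have "2 * a = (r\<^sup>2 - s\<^sup>2) - ((r\<^sup>2 - ([:d:] + a)) - (s\<^sup>2 - ([:d:] - a)))" by simp
  then have "M (2 * a) \<le> M (r\<^sup>2 - s\<^sup>2) + (M (r\<^sup>2 - ([:d:] + a)) + M (s\<^sup>2 - ([:d:] - a)))"
    by (metis diff add_left_mono order_trans)
  then have "M (2 * a) \<le> 2 * d + 2 * e" using 1 2 r s by linarith
  moreover have "M a \<le> M (2 * a) / 2"
    using smult_le[of "1/2" "2 * a"] by (simp add: numeral_poly)
  ultimately show "M a \<le> d + e" by simp
qed

text \<open>After adding g^n the right-hand side is 1 - n (1 - g) g^n. The identity thus certifies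
  (1 - g) g^n \<le> 1/n for g \<ge> 0 by a sum of products of squares with powers of g.\<close>

lemma certificate:
  fixes g :: "'a::comm_ring_1"
  shows "(1 - g)\<^sup>2 * (\<Sum>j<n. of_nat (j + 1) * g ^ j) = 1 - of_nat (n + 1) * g ^ n + of_nat n * g ^ (n + 1)"
  by (induction n) (simp_all add: algebra_simps power2_eq_square)

text \<open>The pointwise bound (1 - g) g^n \<le> 1/n at n = 2k, proved through
  \<open>certificate\<close>: each summand is a square times a power of the positive g, hence
  positive in the sense of \<open>NP\<close>.\<close>

lemma NP_weight_le:
  assumes g: "NP g" and k: "k \<ge> 1"
  shows "NP ([:1 / (2 * real k):] - (1 - g) * g ^ (2 * k))"
proof -
  have "NP ((1 - g)\<^sup>2 * (\<Sum>j<2*k. of_nat (j + 1) * g ^ j) + (g ^ k)\<^sup>2)"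
  proof (intro NP_add NP_sq)
    have "NP (Polynomial.smult (real (j + 1)) ((1 - g)\<^sup>2 * g ^ j))" for j
      by (intro NP_scale NP_mult_power g) simp
    moreover have "(1 - g)\<^sup>2 * (\<Sum>j<2*k. of_nat (j + 1) * g ^ j) =
       (\<Sum>j<2*k. Polynomial.smult (real (j + 1)) ((1 - g)\<^sup>2 * g ^ j))"
      unfolding sum_distrib_left by (intro sum.cong refl) (simp add: of_nat_poly algebra_simps)
    ultimately show "NP ((1 - g)\<^sup>2 * (\<Sum>j<2*k. of_nat (j + 1) * g ^ j))"
      by (simp only: NP_sum)
  qed
  then have "NP (1 - of_nat (2 * k) * ((1 - g) * g ^ (2 * k)))"
    unfolding certificate by (simp add: algebra_simps power_mult)
  then have "NP (Polynomial.smult (1 / (2 * real k)) (1 - of_nat (2 * k) * ((1 - g) * g ^ (2 * k))))"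
    by (rule NP_scale) simp
  moreover have "Polynomial.smult (1 / (2 * real k)) (1 - of_nat (2 * k) * q) = [:1 / (2 * real k):] - q" for q
    using k by (simp add: smult_diff_right of_nat_poly one_pCons)
  ultimately show ?thesis by simp
qed

text \<open>The polynomial is p = 1 - (1 - t^2)^N. It vanishes at 0, so it can be evaluated at an
  element without using a unit. Both p = t^2 (1 + g + ... + g^(N-1)) and 1 - p = g^N are positive
  for g = 1 - t^2, which gives M p \<le> 1; the square of t (1 - p)^2 is (1 - g) g^(4N), which is at
  most 1/(4N).\<close>

lemma approx_unit_poly:
  assumes t: "M [:0, 1:] \<le> 1" and e: "e > 0"
  obtains p where "poly p 0 = 0" "M p \<le> 1" "M ([:0, 1:] * (1 - p)\<^sup>2) < e"
proof -
  define t where "t = ([:0, 1:] :: real poly)"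
  define g where "g = 1 - t\<^sup>2"
  have g: "NP g"
    unfolding NP_def g_def using t nonneg[of t]
    by (intro exI[of _ 1]) (simp add: one_pCons[symmetric] sq power_le_one t_def)
  have "e\<^sup>2 > 0" using e by simp
  then obtain k where k0: "1 / real (Suc k) < e\<^sup>2" using nat_approx_posE by blast
  \<comment> \<open>N is even so that g^N is a square; moreover 1/(4N) \<le> 1/(k + 1), which lies
    below the square of e.\<close>
  define N where "N = 2 * Suc k"
  define p where "p = 1 - g ^ N"
  have gN: "NP (g ^ N)" using NP_sq[of "g ^ Suc k"] unfolding N_def by (simp only: power_even_eq)
  have "t\<^sup>2 * (\<Sum>j<N. g ^ j) = p"
    unfolding p_def using one_diff_power_eq[of g N] by (simp add: g_def)
  moreover have "NP (t\<^sup>2 * (\<Sum>j<N. g ^ j))"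
    unfolding sum_distrib_left by (intro NP_sum NP_mult_power g)
  ultimately have p: "NP p" by simp
  have "M p \<le> 1"
  proof (rule norm_le_of_NP)
    show "NP ([:1:] + p)" by (intro NP_add NP_const p) simp
    show "NP ([:1:] - p)" using gN by (simp add: p_def one_pCons)
  qed simp
  moreover have "poly p 0 = 0" by (simp add: p_def g_def t_def N_def power2_eq_square)
  moreover have "M (t * (1 - p)\<^sup>2) < e"
  proof -
    define A where "A = (1 - g) * g ^ (2 * (2 * N))"
    have N1: "2 * N \<ge> 1" by (simp add: N_def)
    have "M A \<le> 1 / (2 * real (2 * N))"
    proof (rule norm_le_of_NP)
      have "A = t\<^sup>2 * g ^ (2 * (2 * N))" by (simp add: A_def g_def)
      then have "NP A" using NP_mult_power[OF g] by simp
      then show "NP ([:1 / (2 * real (2 * N)):] + A)" by (intro NP_add NP_const) auto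
      show "NP ([:1 / (2 * real (2 * N)):] - A)" unfolding A_def by (rule NP_weight_le[OF g N1])
    qed simp
    also have "\<dots> \<le> 1 / real (Suc k)" by (simp add: N_def field_simps)
    finally have "M A < e\<^sup>2" using k0 by simp
    moreover have "(t * (1 - p)\<^sup>2)\<^sup>2 = A"
      by (simp add: p_def A_def g_def power_mult_distrib power_mult[symmetric] mult.commute)
    ultimately have "(M (t * (1 - p)\<^sup>2))\<^sup>2 < e\<^sup>2" by (metis sq)
    then show ?thesis using e by (simp add: power_less_imp_less_base)
  qed
  ultimately show thesis using that by (simp add: t_def)
qed

text \<open>On a spectrum this says that |c - t| \<le> d where t is nonzero, by taking n-th roots,
  while |c - t| = c < d at t = 0. Algebraically, m = M(c - t) > d would give m - c \<le> K (d/m)^n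
  for all n, and the right side tends to 0.\<close>

lemma const_minus_le:
  assumes b: "\<And>n. M ([:0, 1:] * ([:c:] - [:0, 1:]) ^ n) \<le> K * d ^ n" and c: "0 \<le> c" "c < d"
  shows "M ([:c:] - [:0, 1:]) \<le> d"
proof (rule ccontr)
  define g where "g = [:c:] - ([:0, 1:] :: real poly)"
  define m where "m = M g"
  assume "\<not> M ([:c:] - [:0, 1:]) \<le> d"
  then have m: "m > d" by (simp add: m_def g_def)
  have le: "m - c \<le> K * (d / m) ^ n" for n
  proof -
    have "m ^ Suc n \<le> M (g ^ Suc n)" unfolding m_def using m c by (intro power_ge) (simp add: m_def)
    also have "g ^ Suc n = Polynomial.smult c (g ^ n) - [:0, 1:] * g ^ n"
      by (simp add: g_def left_diff_distrib)
    also have "M \<dots> \<le> M (Polynomial.smult c (g ^ n)) + M ([:0, 1:] * g ^ n)" by (rule diff)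
    also have "M (Polynomial.smult c (g ^ n)) \<le> c * m ^ n"
      using smult_le[of c "g ^ n"] power_le[of g n] c unfolding m_def
      by (smt (verit) mult_left_mono)
    also have "M ([:0, 1:] * g ^ n) \<le> K * d ^ n" unfolding g_def by (rule b)
    finally have "m ^ n * (m - c) \<le> K * d ^ n" by (simp add: algebra_simps)
    also have "K * d ^ n = m ^ n * (K * (d / m) ^ n)" using m c by (simp add: power_divide)
    finally show ?thesis using m c by (simp add: mult_le_cancel_left)
  qed
  have "(\<lambda>n. (d / m) ^ n) \<longlonglongrightarrow> 0" using m c by (intro LIMSEQ_realpow_zero) auto
  then have "(\<lambda>n. K * (d / m) ^ n) \<longlonglongrightarrow> 0" by (rule tendsto_mult_right_zero)
  then have "m - c \<le> 0" by (rule LIMSEQ_le_const) (use le in auto)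
  then show False using m c by linarith
qed

text \<open>A negative spectral value t would make t (1 - t)^(2k) unbounded in k. Without spectra: m
  = M(1 - t) > 1 would give m^(2K) (m - 1) \<le> 1, and this fails for large K.\<close>

lemma one_minus_le_one:
  assumes b: "\<And>k. k \<ge> 1 ==> M ([:0, 1:] * (1 - [:0, 1:]) ^ (2 * k)) \<le> 1"
  shows "M (1 - [:0, 1:]) \<le> 1"
proof (rule ccontr)
  define g where "g = 1 - ([:0, 1:] :: real poly)"
  define m where "m = M g"
  assume "\<not> M (1 - [:0, 1:]) \<le> 1"
  then have m: "m > 1" by (simp add: m_def g_def)
  then obtain k where k: "1 / (m - 1) < m ^ k" using real_arch_pow by blast
  define K where "K = Suc k"
  have "m ^ (2 * K + 1) \<le> M (g ^ (2 * K + 1))" unfolding m_def using m by (intro power_ge) (simp add: m_def)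
  also have "g ^ (2 * K + 1) = g ^ (2 * K) - [:0, 1:] * g ^ (2 * K)" by (simp add: g_def algebra_simps)
  also have "M \<dots> \<le> M (g ^ (2 * K)) + M ([:0, 1:] * g ^ (2 * K))" by (rule diff)
  also have "M (g ^ (2 * K)) \<le> m ^ (2 * K)" unfolding m_def by (rule power_le)
  also have "M ([:0, 1:] * g ^ (2 * K)) \<le> 1" unfolding g_def by (rule b) (simp add: K_def)
  finally have "m ^ (2 * K) * (m - 1) \<le> 1" by (simp add: algebra_simps)
  moreover have "m ^ k \<le> m ^ (2 * K)" using m by (intro power_increasing) (auto simp: K_def)
  then have "m ^ k * (m - 1) \<le> m ^ (2 * K) * (m - 1)" using m by (intro mult_right_mono) auto
  moreover have "1 < m ^ k * (m - 1)" using k m by (simp add: field_simps)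
  ultimately show False by linarith
qed

end

section \<open>Arithmetic in star algebras\<close>

context star_algebra
begin

lemma carrier_complex_ring [simp]: "c \<in> carrier complex_ring"
  by (simp add: complex_ring_def)

lemma complex_ring_simps [simp]:
  "a \<oplus>\<^bsub>complex_ring\<^esub> b = a + b" "a \<otimes>\<^bsub>complex_ring\<^esub> b = a * b"
  "\<one>\<^bsub>complex_ring\<^esub> = 1" "\<zero>\<^bsub>complex_ring\<^esub> = 0"
  by (simp_all add: complex_ring_def)

lemma sm_closed [simp]: "x \<in> carrier A ==> c \<odot> x \<in> carrier A"
  by (rule smult_closed) simp_all

lemma sm_add_l: "x \<in> carrier A ==> (c + d) \<odot> x = c \<odot> x \<oplus> d \<odot> x"
  using smult_l_distr[of c d x] by simp

lemma sm_add_r: "x \<in> carrier A ==> y \<in> carrier A ==> c \<odot> (x \<oplus> y) = c \<odot> x \<oplus> c \<odot> y"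
  by (rule smult_r_distr) simp_all

lemma sm_assoc: "x \<in> carrier A ==> c \<odot> (d \<odot> x) = (c * d) \<odot> x"
  using smult_assoc1[of c d x] by simp

lemma sm_one [simp]: "x \<in> carrier A ==> 1 \<odot> x = x"
  using smult_one[of x] by simp

lemma sm_zero [simp]: "x \<in> carrier A ==> 0 \<odot> x = \<zero>"
  using smult_l_null[of x] by simp

lemma sm_zero_r [simp]: "c \<odot> \<zero> = \<zero>"
  by (rule smult_r_null) simp

lemma sm_minus: "x \<in> carrier A ==> \<ominus> x = (-1) \<odot> x"
proof -
  assume x: "x \<in> carrier A"
  have "(-1) \<odot> x \<oplus> x = \<zero>"
    using sm_add_l[OF x, of "-1" 1] x by simp
  then show ?thesis using x by (simp add: minus_equality)
qed

lemma minus_sm: "x \<in> carrier A ==> y \<in> carrier A ==> x \<ominus> y = x \<oplus> (-1) \<odot> y"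
  by (simp add: a_minus_def sm_minus)

lemma m_closed' [simp]: "x \<in> carrier A ==> y \<in> carrier A ==> x \<otimes> y \<in> carrier A"
  by (rule m_closed)

lemma star_closed' [simp]: "x \<in> carrier A ==> star A x \<in> carrier A"
  by (rule star_closed)

declare star_star [simp]

lemma zero_mult [simp]: "y \<in> carrier A ==> \<zero> \<otimes> y = \<zero>"
  using smult_l[of \<zero> y 0] by simp

lemma mult_zero [simp]: "y \<in> carrier A ==> y \<otimes> \<zero> = \<zero>"
  using smult_r[of y \<zero> 0] by simp

lemma star_zero [simp]: "star A \<zero> = \<zero>"
  using star_smult[of \<zero> 0] by simp

lemmas alg = l_distr r_distr smult_l smult_r star_add star_smult star_mult m_assoc
  sm_add_r sm_assoc minus_sm sm_minus

lemma sm_collect_pair: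
  assumes "x \<in> carrier A"
  shows "x \<oplus> x = 2 \<odot> x" "x \<oplus> c \<odot> x = (1 + c) \<odot> x" "c \<odot> x \<oplus> x = (c + 1) \<odot> x"
    "c \<odot> x \<oplus> d \<odot> x = (c + d) \<odot> x"
  using assms sm_add_l[of x 1 1] sm_add_l[of x 1 c] sm_add_l[of x c 1] sm_add_l[of x c d]
  by simp_all

lemma sm_collect_left:
  assumes "x \<in> carrier A" "y \<in> carrier A"
  shows "x \<oplus> (x \<oplus> y) = 2 \<odot> x \<oplus> y" "x \<oplus> (c \<odot> x \<oplus> y) = (1 + c) \<odot> x \<oplus> y"
    "c \<odot> x \<oplus> (x \<oplus> y) = (c + 1) \<odot> x \<oplus> y"
    "c \<odot> x \<oplus> (d \<odot> x \<oplus> y) = (c + d) \<odot> x \<oplus> y"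
  using assms sm_add_l[of x 1 1] sm_add_l[of x 1 c] sm_add_l[of x c 1] sm_add_l[of x c d]
  by (simp_all add: a_assoc[symmetric])

lemmas sm_collect = sm_collect_pair sm_collect_left

lemma cancel_middle:
  assumes [simp]: "a \<in> carrier A" "x \<in> carrier A" "b \<in> carrier A"
  shows "(a \<oplus> c \<odot> x) \<oplus> ((- c) \<odot> x \<oplus> b) = a \<oplus> b"
proof -
  have "c \<odot> x \<oplus> ((- c) \<odot> x \<oplus> b) = b"
    using sm_add_l[of x c "- c"] by (simp add: a_assoc[symmetric])
  then show ?thesis by (simp add: a_assoc)
qed

subsection \<open>Polynomials in one element, as left multiplication operators\<close>

text \<open>p(h) b by the scheme of Horner. The algebra has no unit, so p(h) exists only as an
  operator, in which the constant coefficient multiplies b.\<close>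

definition hop :: "'a => real poly => 'a => 'a" where
  "hop h p b = fold_coeffs (\<lambda>c r. complex_of_real c \<odot> b \<oplus> h \<otimes> r) p \<zero>"

lemma hop_0 [simp]: "hop h 0 b = \<zero>"
  by (simp add: hop_def)

lemma hop_pCons:
  assumes "h \<in> carrier A" "b \<in> carrier A"
  shows "hop h (pCons c p) b = complex_of_real c \<odot> b \<oplus> h \<otimes> hop h p b"
proof (cases "pCons c p = 0")
  case True
  then show ?thesis using assms by simp
next
  case False
  then show ?thesis unfolding hop_def by (cases "p = 0") (simp_all add: fold_coeffs_def cCons_def)
qed

lemma hop_closed [simp]: "h \<in> carrier A ==> b \<in> carrier A ==> hop h p b \<in> carrier A"
  by (induction p) (simp_all add: hop_pCons)

lemma hop_const: "h \<in> carrier A ==> b \<in> carrier A ==> hop h [:c:] b = complex_of_real c \<odot> b"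
  by (simp add: hop_pCons)

lemma hop_1: "h \<in> carrier A ==> b \<in> carrier A ==> hop h 1 b = b"
  using hop_const[of h b 1] by (simp add: one_pCons del: pCons_one)

lemma hop_X: "h \<in> carrier A ==> b \<in> carrier A ==> hop h [:0, 1:] b = h \<otimes> b"
  by (simp add: hop_pCons)

lemma hop_add:
  assumes [simp]: "h \<in> carrier A" "b \<in> carrier A"
  shows "hop h (p + q) b = hop h p b \<oplus> hop h q b"
proof (induction p q rule: poly_induct2)
  case (pCons c p d q)
  then show ?case by (simp add: hop_pCons sm_add_l r_distr a_ac)
qed simp

lemma hop_smult:
  assumes [simp]: "h \<in> carrier A" "b \<in> carrier A"
  shows "hop h (Polynomial.smult c p) b = complex_of_real c \<odot> hop h p b"
  by (induction p) (simp_all add: hop_pCons alg)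

lemma hop_minus:
  assumes [simp]: "h \<in> carrier A" "b \<in> carrier A"
  shows "hop h (p - q) b = hop h p b \<ominus> hop h q b"
  using hop_add[of h b p "Polynomial.smult (-1) q"] hop_smult[of h b "-1" q] by (simp add: minus_sm)

lemma hop_mult_X:
  assumes [simp]: "h \<in> carrier A" "b \<in> carrier A"
  shows "hop h p (h \<otimes> b) = h \<otimes> hop h p b"
  by (induction p) (simp_all add: hop_pCons alg)

lemma hop_sm_right:
  assumes [simp]: "h \<in> carrier A" "b \<in> carrier A"
  shows "hop h p (c \<odot> b) = c \<odot> hop h p b"
  by (induction p) (simp_all add: hop_pCons alg mult.commute)

lemma hop_mult_right:
  assumes [simp]: "h \<in> carrier A" "b \<in> carrier A" "c \<in> carrier A"
  shows "hop h p (b \<otimes> c) = hop h p b \<otimes> c"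
  by (induction p) (simp_all add: hop_pCons alg)

lemma hop_mult:
  assumes [simp]: "h \<in> carrier A" "b \<in> carrier A"
  shows "hop h (p * q) b = hop h p (hop h q b)"
proof (induction p)
  case (pCons c p)
  then show ?case by (simp add: hop_pCons hop_add hop_smult)
qed simp

text \<open>Self-adjointness of the operator p(h) is expressed between two elements, because p(h)
  need not be an element of A. Moving one factor h at a time across the product changes c into h c,
  so c varies in the induction.\<close>

lemma hop_adjoint:
  assumes [simp]: "h \<in> carrier A" "b \<in> carrier A" "c \<in> carrier A" and h: "star A h = h"
  shows "star A (hop h p b) \<otimes> c = star A b \<otimes> hop h p c"
  using \<open>c \<in> carrier A\<close>
proof (induction p arbitrary: c)
  case (pCons a p)
  then have [simp]: "c \<in> carrier A" by simp
  have "star A (hop h (pCons a p) b) \<otimes> c =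
      complex_of_real a \<odot> (star A b \<otimes> c) \<oplus> star A (hop h p b) \<otimes> (h \<otimes> c)"
    by (simp add: hop_pCons alg h)
  also have "star A (hop h p b) \<otimes> (h \<otimes> c) = star A b \<otimes> (h \<otimes> hop h p c)"
    using pCons.IH[of "h \<otimes> c"] by (simp add: hop_mult_X)
  finally show ?case by (simp add: hop_pCons alg)
qed simp

lemma hop_self_adjoint:
  assumes [simp]: "h \<in> carrier A" and h: "star A h = h"
  shows "star A (hop h p h) = hop h p h"
proof (induction p)
  case (pCons a p)
  have "hop h p h \<otimes> h = h \<otimes> hop h p h"
    using hop_mult_right[of h h h p] hop_mult_X[of h h p] by simp
  then show ?case using pCons by (simp add: hop_pCons alg h)
qed simp

end

subsection \<open>\<open>C\<^sup>*\<close>-norms without completeness\<close>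

locale pre_cstar = star_algebra A for A :: "('a, 'z) normed_star_algebra_scheme" (structure) +
  assumes nrm_eq_0: "x \<in> carrier A ==> nrm A x = 0 \<longleftrightarrow> x = \<zero>"
    and nrm_nonneg: "x \<in> carrier A ==> 0 \<le> nrm A x"
    and nrm_smult: "x \<in> carrier A ==> nrm A (c \<odot> x) = cmod c * nrm A x"
    and nrm_triangle: "x \<in> carrier A ==> y \<in> carrier A ==> nrm A (x \<oplus> y) \<le> nrm A x + nrm A y"
    and nrm_mult: "x \<in> carrier A ==> y \<in> carrier A ==> nrm A (x \<otimes> y) \<le> nrm A x * nrm A y"
    and nrm_star_mult: "x \<in> carrier A ==> nrm A (star A x \<otimes> x) = (nrm A x)\<^sup>2"

sublocale cstar_algebra \<subseteq> pre_cstar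
  by unfold_locales (fact nrm_eq_0 nrm_nonneg nrm_smult nrm_triangle nrm_mult nrm_star_mult)+

context pre_cstar
begin

lemma nrm_zero [simp]: "nrm A \<zero> = 0"
  by (simp add: nrm_eq_0)

lemma nrm_star [simp]: assumes [simp]: "x \<in> carrier A" shows "nrm A (star A x) = nrm A x"
proof -
  have le: "nrm A y \<le> nrm A (star A y)" if [simp]: "y \<in> carrier A" for y
  proof (cases "nrm A y = 0")
    case False
    have "nrm A y * nrm A y \<le> nrm A (star A y) * nrm A y"
      using nrm_mult[of "star A y" y] by (simp add: nrm_star_mult power2_eq_square)
    then show ?thesis using False nrm_nonneg[of y] by (simp add: mult_le_cancel_right)
  qed (simp add: nrm_nonneg)
  show ?thesis using le[of x] le[of "star A x"] by simp
qed

lemma nrm_minus_commute: "x \<in> carrier A ==> y \<in> carrier A ==> nrm A (x \<ominus> y) = nrm A (y \<ominus> x)"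
proof -
  assume [simp]: "x \<in> carrier A" "y \<in> carrier A"
  have "y \<ominus> x = (-1) \<odot> (x \<ominus> y)" by (simp add: alg a_ac)
  then show ?thesis by (simp add: nrm_smult)
qed

lemma nrm_minus_triangle:
  assumes [simp]: "x \<in> carrier A" "y \<in> carrier A" "z \<in> carrier A"
  shows "nrm A (x \<ominus> z) \<le> nrm A (x \<ominus> y) + nrm A (y \<ominus> z)"
proof -
  have "x \<ominus> z = (x \<ominus> y) \<oplus> (y \<ominus> z)" by (simp add: alg a_ac sm_collect)
  then show ?thesis using nrm_triangle[of "x \<ominus> y" "y \<ominus> z"] by simp
qed

lemma nrm_self_adjoint_sq: "x \<in> carrier A ==> star A x = x ==> nrm A (x \<otimes> x) = (nrm A x)\<^sup>2"
  using nrm_star_mult[of x] by simp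

lemma hop_bounded:
  assumes [simp]: "h \<in> carrier A"
  shows "\<exists>K\<ge>0. \<forall>b\<in>carrier A. nrm A (hop h p b) \<le> K * nrm A b"
proof (induction p)
  case 0
  then show ?case by (intro exI[of _ 0]) simp
next
  case (pCons c p)
  then obtain K where K: "K \<ge> 0" "\<And>b. b \<in> carrier A ==> nrm A (hop h p b) \<le> K * nrm A b" by blast
  have "nrm A (hop h (pCons c p) b) \<le> (\<bar>c\<bar> + nrm A h * K) * nrm A b" if [simp]: "b \<in> carrier A" for b
  proof -
    have "nrm A (hop h (pCons c p) b) \<le> \<bar>c\<bar> * nrm A b + nrm A (h \<otimes> hop h p b)"
      using nrm_triangle[of "complex_of_real c \<odot> b" "h \<otimes> hop h p b"] by (simp add: hop_pCons nrm_smult)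
    also have "nrm A (h \<otimes> hop h p b) \<le> nrm A h * nrm A (hop h p b)" by (simp add: nrm_mult)
    also have "\<dots> \<le> nrm A h * (K * nrm A b)" by (intro mult_left_mono K nrm_nonneg) simp_all
    finally show ?thesis by (simp add: algebra_simps)
  qed
  then show ?case using K nrm_nonneg[of h] by (intro exI[of _ "\<bar>c\<bar> + nrm A h * K"]) simp
qed

text \<open>Takes the place of the norm of p(h) in a unitization of A.\<close>

definition opn :: "'a => real poly => real" where
  "opn h p = Sup {nrm A (hop h p b) |b. b \<in> carrier A \<and> nrm A b \<le> 1}"

lemma opn_le:
  assumes [simp]: "h \<in> carrier A" and K: "\<And>b. b \<in> carrier A ==> nrm A (hop h p b) \<le> K * nrm A b" and "K \<ge> 0"
  shows "opn h p \<le> K"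
  unfolding opn_def
proof (rule cSup_least)
  show "{nrm A (hop h p b) |b. b \<in> carrier A \<and> nrm A b \<le> 1} \<noteq> {}"
    using nrm_zero zero_closed by (metis (mono_tags, lifting) Collect_empty_eq zero_le_one)
next
  fix x assume "x \<in> {nrm A (hop h p b) |b. b \<in> carrier A \<and> nrm A b \<le> 1}"
  then obtain b where b: "x = nrm A (hop h p b)" "b \<in> carrier A" "nrm A b \<le> 1" by blast
  have "x \<le> K * nrm A b" using K b by simp
  also have "\<dots> \<le> K" using b \<open>K \<ge> 0\<close> nrm_nonneg by (simp add: mult_left_le)
  finally show "x \<le> K" .
qed

lemma hop_le_opn:
  assumes [simp]: "h \<in> carrier A" "b \<in> carrier A"
  shows "nrm A (hop h p b) \<le> opn h p * nrm A b"
proof (cases "nrm A b = 0")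
  case True
  then have "b = \<zero>" by (simp add: nrm_eq_0)
  then show ?thesis using hop_bounded[of h p] True by force
next
  case False
  define s where "s = complex_of_real (1 / nrm A b)"
  have pos: "nrm A b > 0" using False nrm_nonneg[of b] by simp
  obtain K where K: "K \<ge> 0" "\<And>b. b \<in> carrier A ==> nrm A (hop h p b) \<le> K * nrm A b"
    using hop_bounded[of h p] by auto
  have "nrm A (hop h p (s \<odot> b)) \<le> opn h p"
    unfolding opn_def
  proof (rule cSup_upper)
    show "nrm A (hop h p (s \<odot> b)) \<in> {nrm A (hop h p b) |b. b \<in> carrier A \<and> nrm A b \<le> 1}"
      using pos by (intro CollectI exI[of _ "s \<odot> b"]) (simp add: nrm_smult s_def norm_divide)
    show "bdd_above {nrm A (hop h p b) |b. b \<in> carrier A \<and> nrm A b \<le> 1}"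
      using K by (intro bdd_aboveI[of _ K]) (force intro: order_trans[OF K(2)] simp: nrm_nonneg mult_left_le)
  qed
  then show ?thesis using pos by (simp add: hop_sm_right nrm_smult s_def norm_divide field_simps)
qed

lemma opn_X: "h \<in> carrier A ==> opn h [:0, 1:] \<le> nrm A h"
  by (rule opn_le) (simp_all add: hop_X nrm_mult nrm_nonneg)

lemma opn_nonneg: "h \<in> carrier A ==> 0 \<le> opn h p"
  unfolding opn_def
proof (rule cSup_upper2[of 0])
  assume [simp]: "h \<in> carrier A"
  have "hop h p \<zero> = \<zero>" by (induction p) (simp_all add: hop_pCons)
  then show "0 \<in> {nrm A (hop h p b) |b. b \<in> carrier A \<and> nrm A b \<le> 1}"
    by (intro CollectI exI[of _ \<zero>]) simp
  obtain K where K: "K \<ge> 0" "\<And>b. b \<in> carrier A ==> nrm A (hop h p b) \<le> K * nrm A b"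
    using hop_bounded[of h p] by auto
  then show "bdd_above {nrm A (hop h p b) |b. b \<in> carrier A \<and> nrm A b \<le> 1}"
    by (intro bdd_aboveI[of _ K]) (force intro: order_trans[OF K(2)] simp: nrm_nonneg mult_left_le)
qed simp

text \<open>For commuting self-adjoint \<open>p\<close> and \<open>q\<close>, the element \<open>p\<close> is the real part of \<open>p + iq\<close>,
  whose norm squared is that of \<open>p\<^sup>2 + q\<^sup>2\<close>.\<close>

lemma opn_sq_le:
  assumes [simp]: "h \<in> carrier A" and h: "star A h = h"
  shows "(opn h p)\<^sup>2 \<le> opn h (p\<^sup>2 + q\<^sup>2)"
proof -
  define L where "L = opn h (p\<^sup>2 + q\<^sup>2)"
  have L0: "L \<ge> 0" unfolding L_def by (rule opn_nonneg) simp
  have "opn h p \<le> sqrt L"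
  proof (rule opn_le)
    fix b assume [simp]: "b \<in> carrier A"
    define P Q where "P = hop h p b" and "Q = hop h q b"
    have [simp]: "P \<in> carrier A" "Q \<in> carrier A" by (simp_all add: P_def Q_def)
    \<comment> \<open>p(h) and q(h) commute and are self-adjoint; hence the mixed terms cancel when
      P + eQ is multiplied from the left by its adjoint, for e = i and for e = -i.\<close>
    have PQ: "star A P \<otimes> Q = star A Q \<otimes> P"
      by (simp add: P_def Q_def hop_adjoint h hop_mult[symmetric] mult.commute)
    have sum: "star A P \<otimes> P \<oplus> star A Q \<otimes> Q = star A b \<otimes> hop h (p\<^sup>2 + q\<^sup>2) b"
      by (simp add: P_def Q_def hop_adjoint h hop_mult[symmetric] hop_add r_distr power2_eq_square)
    have bound: "nrm A (P \<oplus> e \<odot> Q) \<le> sqrt L * nrm A b" if e: "e = \<i> \<or> e = - \<i>" for e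
    proof -
      have "star A (P \<oplus> e \<odot> Q) \<otimes> (P \<oplus> e \<odot> Q) = star A P \<otimes> P \<oplus> star A Q \<otimes> Q"
      proof -
        have "star A (P \<oplus> e \<odot> Q) \<otimes> (P \<oplus> e \<odot> Q) =
            (star A P \<otimes> P \<oplus> (- e) \<odot> (star A Q \<otimes> P)) \<oplus> (e \<odot> (star A Q \<otimes> P) \<oplus> star A Q \<otimes> Q)"
          using e by (auto simp: l_distr r_distr star_add star_smult smult_l smult_r sm_assoc sm_add_r PQ)
        then show ?thesis using cancel_middle[of "star A P \<otimes> P" "star A Q \<otimes> P" "star A Q \<otimes> Q" "- e"] by simp
      qed
      then have "(nrm A (P \<oplus> e \<odot> Q))\<^sup>2 = nrm A (star A b \<otimes> hop h (p\<^sup>2 + q\<^sup>2) b)"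
        using sum nrm_star_mult[of "P \<oplus> e \<odot> Q"] by simp
      also have "\<dots> \<le> nrm A b * (L * nrm A b)"
        using nrm_mult[of "star A b" "hop h (p\<^sup>2 + q\<^sup>2) b"] hop_le_opn[of h b "p\<^sup>2 + q\<^sup>2"] nrm_nonneg[of b]
        unfolding L_def by (simp add: mult_left_mono order_trans)
      also have "\<dots> = (sqrt L * nrm A b)\<^sup>2" using L0 by (simp add: power_mult_distrib power2_eq_square[of "nrm A b"])
      finally show ?thesis by (rule power2_le_imp_le) (use L0 nrm_nonneg[of b] in simp)
    qed
    have "P = (1/2) \<odot> ((P \<oplus> \<i> \<odot> Q) \<oplus> (P \<oplus> (- \<i>) \<odot> Q))"
      using cancel_middle[of P Q P \<i>]
      by (simp add: a_assoc a_comm[of P "(- \<i>) \<odot> Q"] sm_collect sm_assoc)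
    then have "nrm A P \<le> (nrm A (P \<oplus> \<i> \<odot> Q) + nrm A (P \<oplus> (- \<i>) \<odot> Q)) / 2"
      using nrm_triangle[of "P \<oplus> \<i> \<odot> Q" "P \<oplus> (- \<i>) \<odot> Q"]
        nrm_smult[of "(P \<oplus> \<i> \<odot> Q) \<oplus> (P \<oplus> (- \<i>) \<odot> Q)" "1/2"] by simp
    then show "nrm A (hop h p b) \<le> sqrt L * nrm A b"
      using bound[of \<i>] bound[of "- \<i>"] by (simp add: P_def)
  qed (use L0 in simp_all)
  then have "(opn h p)\<^sup>2 \<le> (sqrt L)\<^sup>2" by (intro power_mono opn_nonneg) simp_all
  then show ?thesis using L0 by (simp add: L_def)
qed

lemma opn_calculus:
  assumes [simp]: "h \<in> carrier A" and h: "star A h = h"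
  shows "real_calculus_seminorm (opn h)"
proof
  fix p q :: "real poly" and c :: real
  show "0 \<le> opn h p" by (rule opn_nonneg) simp
  show "opn h (p + q) \<le> opn h p + opn h q"
  proof (rule opn_le)
    fix b assume [simp]: "b \<in> carrier A"
    have "nrm A (hop h (p + q) b) \<le> nrm A (hop h p b) + nrm A (hop h q b)" by (simp add: hop_add nrm_triangle)
    also have "\<dots> \<le> opn h p * nrm A b + opn h q * nrm A b" by (intro add_mono hop_le_opn) simp_all
    finally show "nrm A (hop h (p + q) b) \<le> (opn h p + opn h q) * nrm A b" by (simp add: algebra_simps)
  qed (simp_all add: opn_nonneg)
  show "opn h (p * q) \<le> opn h p * opn h q"
  proof (rule opn_le)
    fix b assume [simp]: "b \<in> carrier A"
    have "nrm A (hop h (p * q) b) \<le> opn h p * nrm A (hop h q b)" by (simp add: hop_mult hop_le_opn)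
    also have "\<dots> \<le> opn h p * (opn h q * nrm A b)" by (intro mult_left_mono hop_le_opn opn_nonneg) simp_all
    finally show "nrm A (hop h (p * q) b) \<le> (opn h p * opn h q) * nrm A b" by (simp add: algebra_simps)
  qed (simp_all add: opn_nonneg)
  show "opn h (Polynomial.smult c p) \<le> \<bar>c\<bar> * opn h p"
  proof (rule opn_le)
    fix b assume [simp]: "b \<in> carrier A"
    have "nrm A (hop h (Polynomial.smult c p) b) = \<bar>c\<bar> * nrm A (hop h p b)" by (simp add: hop_smult nrm_smult)
    also have "\<dots> \<le> \<bar>c\<bar> * (opn h p * nrm A b)" by (intro mult_left_mono hop_le_opn) simp_all
    finally show "nrm A (hop h (Polynomial.smult c p) b) \<le> \<bar>c\<bar> * opn h p * nrm A b" by (simp add: algebra_simps)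
  qed (simp_all add: opn_nonneg)
  show "opn h 1 \<le> 1"
    by (rule opn_le) (simp_all add: one_pCons hop_const del: pCons_one)
  show "(opn h p)\<^sup>2 \<le> opn h (p\<^sup>2 + q\<^sup>2)" by (rule opn_sq_le) (simp_all add: h)
qed

end

subsection \<open>Kaplansky's theorem: elements of the form \<open>x\<^sup>*x\<close> are positive\<close>

context pre_cstar
begin

lemma const_minus_square:
  assumes [simp]: "a \<in> carrier A" "b \<in> carrier A" and a: "star A a = a"
  shows "nrm A (complex_of_real ((nrm A a)\<^sup>2) \<odot> b \<ominus> a \<otimes> (a \<otimes> b)) \<le> (nrm A a)\<^sup>2 * nrm A b"
proof -
  interpret N: real_calculus_seminorm "opn a" by (rule opn_calculus) (simp_all add: a)
  have "(opn a [:0, 1:])\<^sup>2 \<le> (nrm A a)\<^sup>2" by (intro power_mono opn_X opn_nonneg) simp_all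
  then have "opn a ([:(nrm A a)\<^sup>2:] - [:0, 1:]\<^sup>2) \<le> (nrm A a)\<^sup>2" by (rule N.const_minus_sq)
  moreover have "complex_of_real ((nrm A a)\<^sup>2) \<odot> b \<ominus> a \<otimes> (a \<otimes> b) =
      hop a ([:(nrm A a)\<^sup>2:] - [:0, 1:]\<^sup>2) b"
    by (simp only: power2_eq_square hop_minus hop_mult hop_X hop_const \<open>a \<in> carrier A\<close> \<open>b \<in> carrier A\<close> m_closed')
  ultimately show ?thesis
    using hop_le_opn[of a b "[:(nrm A a)\<^sup>2:] - [:0, 1:]\<^sup>2"] nrm_nonneg[of b]
    by (simp add: mult_right_mono order_trans)
qed

text \<open>Write y' for the adjoint of y. With the real and imaginary parts u = y + y' and v = i (y
  - y') one has u^2 + v^2 = 2 (y'y + yy'), so that yy' = (u^2 + v^2)/2 - y'y. The hypothesis encodes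
  y'y \<le> \<delta> and the conclusion yy' \<ge> -\<delta>; the constant c collects the norms that
  make the squares of u and v positive in the norm sense.\<close>

lemma positive_commutator:
  assumes [simp]: "y \<in> carrier A"
    and up: "\<And>b. b \<in> carrier A ==>
      nrm A (complex_of_real \<kappa> \<odot> b \<oplus> (star A y \<otimes> y) \<otimes> b) \<le> (\<kappa> + \<delta>) * nrm A b"
  shows "\<exists>c\<ge>\<kappa>. \<forall>b\<in>carrier A.
      nrm A (complex_of_real c \<odot> b \<ominus> (y \<otimes> star A y) \<otimes> b) \<le> (c + \<delta>) * nrm A b"
proof -
  define u v where "u = y \<oplus> star A y" and "v = \<i> \<odot> (y \<ominus> star A y)"
  have [simp]: "u \<in> carrier A" "v \<in> carrier A" by (simp_all add: u_def v_def minus_sm)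
  have uv: "star A u = u" "star A v = v"
    by (simp_all add: u_def v_def minus_sm star_add star_smult sm_add_r sm_assoc a_comm)
  define c where "c = ((nrm A u)\<^sup>2 + (nrm A v)\<^sup>2) / 2 + \<kappa>"
  have "nrm A (complex_of_real c \<odot> b \<ominus> (y \<otimes> star A y) \<otimes> b) \<le> (c + \<delta>) * nrm A b"
    if [simp]: "b \<in> carrier A" for b
  proof -
    define s t w r where "s = star A y \<otimes> (star A y \<otimes> b)" and "t = y \<otimes> (y \<otimes> b)"
      and "w = y \<otimes> (star A y \<otimes> b)" and "r = star A y \<otimes> (y \<otimes> b)"
    have [simp]: "s \<in> carrier A" "t \<in> carrier A" "w \<in> carrier A" "r \<in> carrier A"
      by (simp_all add: s_def t_def w_def r_def)
    have uub: "u \<otimes> (u \<otimes> b) = (s \<oplus> t) \<oplus> (w \<oplus> r)"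
      by (simp add: u_def l_distr r_distr m_assoc s_def t_def w_def r_def a_ac)
    have vvb: "v \<otimes> (v \<otimes> b) = (-1) \<odot> (s \<oplus> t) \<oplus> (w \<oplus> r)"
      by (simp add: v_def minus_sm l_distr r_distr m_assoc s_def t_def w_def r_def smult_l smult_r sm_add_r sm_assoc a_ac)
    define U V Y where "U = complex_of_real ((nrm A u)\<^sup>2) \<odot> b \<ominus> u \<otimes> (u \<otimes> b)"
      and "V = complex_of_real ((nrm A v)\<^sup>2) \<odot> b \<ominus> v \<otimes> (v \<otimes> b)"
      and "Y = complex_of_real \<kappa> \<odot> b \<oplus> (star A y \<otimes> y) \<otimes> b"
    have [simp]: "U \<in> carrier A" "V \<in> carrier A" "Y \<in> carrier A" by (simp_all add: U_def V_def Y_def minus_sm)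
    have "(1/2) \<odot> (U \<oplus> V) = complex_of_real (((nrm A u)\<^sup>2 + (nrm A v)\<^sup>2) / 2) \<odot> b \<ominus> (w \<oplus> r)"
    proof -
      define p q where "p = s \<oplus> t" and "q = w \<oplus> r"
      have [simp]: "p \<in> carrier A" "q \<in> carrier A" by (simp_all add: p_def q_def)
      have "U \<oplus> V = (complex_of_real ((nrm A u)\<^sup>2) \<odot> b \<oplus> complex_of_real ((nrm A v)\<^sup>2) \<odot> b)
          \<oplus> (((-1) \<odot> p \<oplus> p) \<oplus> ((-1) \<odot> q \<oplus> (-1) \<odot> q))"
        unfolding U_def V_def uub vvb p_def[symmetric] q_def[symmetric]
        by (simp add: minus_sm sm_add_r sm_assoc a_ac)
      then show ?thesis unfolding p_def[symmetric] q_def[symmetric]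
        by (simp add: sm_add_l[symmetric] sm_add_r sm_assoc minus_sm sm_collect add_divide_distrib)
    qed
    then have "complex_of_real c \<odot> b \<ominus> (y \<otimes> star A y) \<otimes> b = (1/2) \<odot> (U \<oplus> V) \<oplus> Y"
    proof -
      have "(-1) \<odot> r \<oplus> r = \<zero>" by (simp add: sm_collect)
      then have "X \<oplus> ((-1) \<odot> w \<oplus> (-1) \<odot> r) \<oplus> (Z \<oplus> r) = (X \<oplus> Z) \<oplus> (-1) \<odot> w"
        if [simp]: "X \<in> carrier A" "Z \<in> carrier A" for X Z
        using cancel_middle[of "X \<oplus> (-1) \<odot> w" r Z "-1"] by (simp add: a_ac)
      moreover assume "(1/2) \<odot> (U \<oplus> V) = complex_of_real (((nrm A u)\<^sup>2 + (nrm A v)\<^sup>2) / 2) \<odot> b \<ominus> (w \<oplus> r)"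
      ultimately show ?thesis
        by (simp add: Y_def c_def m_assoc r_def[symmetric] w_def[symmetric] minus_sm sm_add_r sm_add_l)
    qed
    then have "nrm A (complex_of_real c \<odot> b \<ominus> (y \<otimes> star A y) \<otimes> b) \<le> (nrm A U + nrm A V) / 2 + nrm A Y"
    proof -
      have "nrm A ((1/2) \<odot> (U \<oplus> V)) = nrm A (U \<oplus> V) / 2" by (simp add: nrm_smult)
      moreover have "nrm A (U \<oplus> V) \<le> nrm A U + nrm A V" by (rule nrm_triangle) simp_all
      moreover have "nrm A ((1/2) \<odot> (U \<oplus> V) \<oplus> Y) \<le> nrm A ((1/2) \<odot> (U \<oplus> V)) + nrm A Y"
        by (rule nrm_triangle) simp_all
      moreover assume "complex_of_real c \<odot> b \<ominus> (y \<otimes> star A y) \<otimes> b = (1/2) \<odot> (U \<oplus> V) \<oplus> Y"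
      ultimately show ?thesis by (simp only: add_divide_distrib)
    qed
    also have "\<dots> \<le> ((nrm A u)\<^sup>2 * nrm A b + (nrm A v)\<^sup>2 * nrm A b) / 2 + (\<kappa> + \<delta>) * nrm A b"
      unfolding U_def V_def Y_def by (intro add_mono divide_right_mono const_minus_square up uv) simp_all
    also have "\<dots> = (c + \<delta>) * nrm A b" by (simp add: c_def field_simps)
    finally show ?thesis .
  qed
  moreover have "\<kappa> \<le> c" by (simp add: c_def)
  ultimately show ?thesis by blast
qed

text \<open>\<open>y\<^sup>*y\<close> and \<open>yy\<^sup>*\<close> have the same nonzero spectrum, expressed by \<open>A(c - A)\<^sup>n = y\<^sup>*(c - B)\<^sup>ny\<close>.\<close>

lemma commutator_bound:
  assumes [simp]: "y \<in> carrier A" and c: "0 \<le> c" "0 < \<delta>"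
    and B: "\<And>b. b \<in> carrier A ==>
      nrm A (complex_of_real c \<odot> b \<ominus> (y \<otimes> star A y) \<otimes> b) \<le> (c + \<delta>) * nrm A b"
  shows "opn (star A y \<otimes> y) ([:c:] - [:0, 1:]) \<le> c + \<delta>"
proof -
  define X Y where "X = star A y \<otimes> y" and "Y = y \<otimes> star A y"
  have [simp]: "X \<in> carrier A" "Y \<in> carrier A" "star A X = X" "star A Y = Y"
    by (simp_all add: X_def Y_def star_mult)
  interpret N: real_calculus_seminorm "opn X" by (rule opn_calculus) simp_all
  interpret K: real_calculus_seminorm "opn Y" by (rule opn_calculus) simp_all
  have intertwine: "y \<otimes> hop X p b = hop Y p (y \<otimes> b)" if [simp]: "b \<in> carrier A" for p b
  proof (induction p)
    case (pCons a p)
    have "y \<otimes> (X \<otimes> hop X p b) = Y \<otimes> (y \<otimes> hop X p b)" by (simp add: X_def Y_def m_assoc)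
    then show ?case using pCons by (simp add: hop_pCons r_distr smult_r)
  qed simp
  have cB: "opn Y ([:c:] - [:0, 1:]) \<le> c + \<delta>"
  proof (rule opn_le)
    fix b assume b [simp]: "b \<in> carrier A"
    have "hop Y ([:c:] - [:0, 1:]) b = complex_of_real c \<odot> b \<ominus> Y \<otimes> b"
      by (simp only: hop_minus hop_const hop_X \<open>Y \<in> carrier A\<close> b)
    then show "nrm A (hop Y ([:c:] - [:0, 1:]) b) \<le> (c + \<delta>) * nrm A b" using B[OF b] by (simp only: Y_def)
  qed (use c in simp_all)
  have "opn X ([:0, 1:] * ([:c:] - [:0, 1:]) ^ n) \<le> (nrm A y)\<^sup>2 * (c + \<delta>) ^ n" for n
  proof (rule opn_le)
    fix b assume b [simp]: "b \<in> carrier A"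
    define P where "P = ([:c:] - [:0, 1:] :: real poly) ^ n"
    have "hop X ([:0, 1:] * P) b = star A y \<otimes> hop Y P (y \<otimes> b)"
      using intertwine[OF b, of P, symmetric] by (simp only: hop_mult hop_X \<open>X \<in> carrier A\<close> b hop_closed)
        (simp add: X_def m_assoc)
    then have "nrm A (hop X ([:0, 1:] * P) b) \<le> nrm A y * nrm A (hop Y P (y \<otimes> b))"
      using nrm_mult[of "star A y" "hop Y P (y \<otimes> b)"] by simp
    also have "\<dots> \<le> nrm A y * (opn Y P * (nrm A y * nrm A b))"
      by (intro mult_left_mono order_trans[OF hop_le_opn] nrm_mult nrm_nonneg K.nonneg) simp_all
    also have "\<dots> \<le> nrm A y * ((c + \<delta>) ^ n * (nrm A y * nrm A b))"
    proof (intro mult_left_mono mult_right_mono)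
      have "opn Y P \<le> opn Y ([:c:] - [:0, 1:]) ^ n" unfolding P_def by (rule K.power_le)
      also have "\<dots> \<le> (c + \<delta>) ^ n" by (intro power_mono cB K.nonneg)
      finally show "opn Y P \<le> (c + \<delta>) ^ n" .
    qed (simp_all add: nrm_nonneg)
    finally show "nrm A (hop X ([:0, 1:] * ([:c:] - [:0, 1:]) ^ n) b) \<le> (nrm A y)\<^sup>2 * (c + \<delta>) ^ n * nrm A b"
      by (simp add: P_def power2_eq_square algebra_simps)
  qed (use c in simp_all)
  then show ?thesis unfolding X_def[symmetric] using c by (intro N.const_minus_le) auto
qed

text \<open>Let h = x'x with x' the adjoint of x. A negative part of h is detected by q(h) with q =
  t (1 - t)^(2k), and q(h) = y'y for y = x (1 - h)^k. \<open>NP_weight_le\<close> at g = 1 - t gives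
  y'y \<le> \<delta> = 1/(2k); then yy' \<ge> -\<delta> by \<open>positive_commutator\<close> and
  y'y \<ge> -\<delta> by \<open>commutator_bound\<close>. So q(h) is bounded by \<delta> \<le> 1 for
  every k, and \<open>one_minus_le_one\<close> applies.\<close>

lemma star_square_positive_unit:
  assumes [simp]: "x \<in> carrier A" "b \<in> carrier A" and x: "nrm A x \<le> 1"
  shows "nrm A (b \<ominus> (star A x \<otimes> x) \<otimes> b) \<le> nrm A b"
proof -
  define h where "h = star A x \<otimes> x"
  have [simp]: "h \<in> carrier A" "star A h = h" by (simp_all add: h_def star_mult)
  interpret N: real_calculus_seminorm "opn h" by (rule opn_calculus) simp_all
  have "nrm A h \<le> 1" using x nrm_nonneg[of x] by (simp add: h_def nrm_star_mult power_le_one)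
  then have hX: "opn h [:0, 1:] \<le> 1" using opn_X[of h] by simp
  have NPg: "N.NP (1 - [:0, 1:])" unfolding N.NP_def using hX by (intro exI[of _ 1]) (simp add: one_pCons)
  have "opn h (1 - [:0, 1:]) \<le> 1"
  proof (rule N.one_minus_le_one)
    fix k :: nat assume k: "k \<ge> 1"
    define q where "q = [:0, 1:] * (1 - [:0, 1:] :: real poly) ^ (2 * k)"
    define \<delta> where "\<delta> = 1 / (2 * real k)"
    have \<delta>: "\<delta> > 0" "\<delta> \<le> 1" using k by (simp_all add: \<delta>_def)
    have NP1: "N.NP ([:\<delta>:] - q)" using N.NP_weight_le[OF NPg k] by (simp add: q_def \<delta>_def)
    then obtain c1 where c1: "c1 \<ge> 0" "opn h ([:c1:] - ([:\<delta>:] - q)) \<le> c1" unfolding N.NP_def by blast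
    define \<kappa> where "\<kappa> = c1"
    have \<kappa>b: "opn h ([:\<kappa>:] + q) \<le> \<kappa> + \<delta>"
    proof -
      have "[:\<kappa>:] + q = ([:c1:] - ([:\<delta>:] - q)) + [:\<delta>:]" by (simp add: \<kappa>_def)
      then have "opn h ([:\<kappa>:] + q) \<le> opn h ([:c1:] - ([:\<delta>:] - q)) + opn h [:\<delta>:]" using N.add by metis
      also have "\<dots> \<le> c1 + \<delta>" using c1 N.const[of \<delta>] \<delta> by (intro add_mono) auto
      finally show ?thesis by (simp add: \<kappa>_def)
    qed
    define n where "n = (1 - [:0, 1:] :: real poly) ^ k"
    \<comment> \<open>This is x n(h): the operator n(h) acts from the left only, so it is applied to
      the adjoint of x.\<close>
    define y where "y = star A (hop h n (star A x))"
    have y [simp]: "y \<in> carrier A" by (simp add: y_def)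
    have yb: "y \<otimes> b = x \<otimes> hop h n b" if "b \<in> carrier A" for b
      using hop_adjoint[of h "star A x" b n] that by (simp add: y_def)
    have ysb: "star A y \<otimes> b = hop h n (star A x \<otimes> b)" if "b \<in> carrier A" for b
      using hop_mult_right[of h "star A x" b n] that by (simp add: y_def)
    have Ab: "(star A y \<otimes> y) \<otimes> b = hop h q b" if b [simp]: "b \<in> carrier A" for b
    proof -
      have "(star A y \<otimes> y) \<otimes> b = star A y \<otimes> (y \<otimes> b)" by (rule m_assoc) simp_all
      also have "\<dots> = hop h n (h \<otimes> hop h n b)"
        by (simp add: yb ysb) (simp add: h_def m_assoc)
      also have "\<dots> = hop h (n * ([:0, 1:] * n)) b"
        by (simp only: hop_mult hop_X \<open>h \<in> carrier A\<close> b hop_closed)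
      also have "n * ([:0, 1:] * n) = q" by (simp add: q_def n_def power_mult power2_eq_square mult_2 power_add algebra_simps)
      finally show ?thesis .
    qed
    have "nrm A (complex_of_real \<kappa> \<odot> b \<oplus> (star A y \<otimes> y) \<otimes> b) \<le> (\<kappa> + \<delta>) * nrm A b"
      if b: "b \<in> carrier A" for b
    proof -
      have "complex_of_real \<kappa> \<odot> b \<oplus> (star A y \<otimes> y) \<otimes> b = hop h ([:\<kappa>:] + q) b"
        using b by (simp only: Ab hop_add hop_const \<open>h \<in> carrier A\<close>)
      also have "nrm A \<dots> \<le> opn h ([:\<kappa>:] + q) * nrm A b" using b by (intro hop_le_opn) simp_all
      also have "\<dots> \<le> (\<kappa> + \<delta>) * nrm A b" using \<kappa>b nrm_nonneg[OF b] by (rule mult_right_mono)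
      finally show ?thesis .
    qed
    from positive_commutator[OF y this] obtain c where c: "c \<ge> \<kappa>"
      "\<And>b. b \<in> carrier A ==>
        nrm A (complex_of_real c \<odot> b \<ominus> (y \<otimes> star A y) \<otimes> b) \<le> (c + \<delta>) * nrm A b" by blast
    have c0: "c \<ge> 0" using c c1 by (simp add: \<kappa>_def)
    have cA: "opn (star A y \<otimes> y) ([:c:] - [:0, 1:]) \<le> c + \<delta>"
      by (rule commutator_bound[OF y c0 \<delta>(1) c(2)])
    have "opn h ([:c:] - q) \<le> c + \<delta>"
    proof (rule opn_le)
      fix b assume b: "b \<in> carrier A"
      have "hop h ([:c:] - q) b = hop (star A y \<otimes> y) ([:c:] - [:0, 1:]) b"
        using b by (simp only: hop_minus hop_const hop_X Ab \<open>h \<in> carrier A\<close> y m_closed' star_closed')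
      also have "nrm A \<dots> \<le> opn (star A y \<otimes> y) ([:c:] - [:0, 1:]) * nrm A b"
        using b by (intro hop_le_opn) simp_all
      also have "\<dots> \<le> (c + \<delta>) * nrm A b" using cA nrm_nonneg[OF b] by (rule mult_right_mono)
      finally show "nrm A (hop h ([:c:] - q) b) \<le> (c + \<delta>) * nrm A b" .
    qed (use c0 \<delta> in simp_all)
    then have "N.NP ([:\<delta>:] + q)"
    proof -
      have "[:c + \<delta>:] - ([:\<delta>:] + q) = [:c:] - q"
      proof -
        have "[:c + \<delta>:] = [:c:] + [:\<delta>:]" by simp
        then show ?thesis by (simp only: add_diff_cancel_left add_diff_add)
      qed
      moreover assume "opn h ([:c:] - q) \<le> c + \<delta>"
      ultimately show ?thesis unfolding N.NP_def using c0 \<delta> by (intro exI[of _ "c + \<delta>"]) (simp only:, simp)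
    qed
    then have "opn h q \<le> \<delta>" using NP1 \<delta> by (intro N.norm_le_of_NP) simp_all
    then show "opn h ([:0, 1:] * (1 - [:0, 1:]) ^ (2 * k)) \<le> 1" using \<delta> by (simp add: q_def)
  qed
  then have "nrm A (hop h (1 - [:0, 1:]) b) \<le> 1 * nrm A b"
    using hop_le_opn[of h b "1 - [:0, 1:]"] nrm_nonneg[of b] by (meson \<open>b \<in> carrier A\<close> \<open>h \<in> carrier A\<close> mult_right_mono order_trans)
  moreover have "hop h ([:1:] - [:0, 1:]) b = b \<ominus> h \<otimes> b"
    by (simp only: hop_minus hop_const hop_X \<open>h \<in> carrier A\<close> \<open>b \<in> carrier A\<close>) simp
  ultimately show ?thesis by (simp add: h_def one_pCons del: pCons_one)
qed

end

subsection \<open>Sums of positive elements and approximate units\<close>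

context pre_cstar
begin

lemma star_square_positive:
  assumes [simp]: "x \<in> carrier A" "b \<in> carrier A"
  shows "nrm A (complex_of_real ((nrm A x)\<^sup>2) \<odot> b \<ominus> (star A x \<otimes> x) \<otimes> b) \<le> (nrm A x)\<^sup>2 * nrm A b"
proof (cases "nrm A x = 0")
  case True
  then have "x = \<zero>" by (simp add: nrm_eq_0)
  then show ?thesis by (simp add: minus_sm)
next
  case False
  define s where "s = 1 / nrm A x"
  define y where "y = complex_of_real s \<odot> x"
  have y [simp]: "y \<in> carrier A" by (simp add: y_def)
  have pos: "nrm A x > 0" using False nrm_nonneg[of x] by simp
  have x: "x = complex_of_real (nrm A x) \<odot> y" using pos by (simp add: y_def s_def sm_assoc)
  have "nrm A y \<le> 1" using pos by (simp add: y_def s_def nrm_smult norm_divide)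
  then have *: "nrm A (b \<ominus> (star A y \<otimes> y) \<otimes> b) \<le> nrm A b" by (intro star_square_positive_unit) simp_all
  have "star A x \<otimes> x = complex_of_real ((nrm A x)\<^sup>2) \<odot> (star A y \<otimes> y)"
    by (subst x, subst (2) x) (simp add: star_smult smult_l smult_r sm_assoc power2_eq_square)
  then have "complex_of_real ((nrm A x)\<^sup>2) \<odot> b \<ominus> (star A x \<otimes> x) \<otimes> b =
      complex_of_real ((nrm A x)\<^sup>2) \<odot> (b \<ominus> (star A y \<otimes> y) \<otimes> b)"
    by (simp add: minus_sm smult_l sm_assoc sm_add_r)
  then show ?thesis using * by (simp add: nrm_smult minus_sm mult_left_mono del: of_real_power)
qed

text \<open>The convex cone generated by the elements x'x, with x' the adjoint of x. Only
  approximate square roots are available, so a sum of such elements is not rewritten as a single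
  one.\<close>

inductive_set psums :: "'a set" where
  square: "x \<in> carrier A ==> star A x \<otimes> x \<in> psums"
| add: "p \<in> psums ==> q \<in> psums ==> p \<oplus> q \<in> psums"

lemma psums_positive:
  assumes "q \<in> psums"
  shows "q \<in> carrier A \<and> star A q = q \<and>
    (\<exists>c\<ge>0. \<forall>b\<in>carrier A. nrm A (complex_of_real c \<odot> b \<ominus> q \<otimes> b) \<le> c * nrm A b)"
  using assms
proof (induction rule: psums.induct)
  case (square x)
  then show ?case
    by (auto simp: star_mult intro!: exI[of _ "(nrm A x)\<^sup>2"] star_square_positive simp del: of_real_power)
next
  case (add p q)
  then obtain c d where c: "c \<ge> 0" "\<And>b. b \<in> carrier A ==> nrm A (complex_of_real c \<odot> b \<ominus> p \<otimes> b) \<le> c * nrm A b"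
    and d: "d \<ge> 0" "\<And>b. b \<in> carrier A ==> nrm A (complex_of_real d \<odot> b \<ominus> q \<otimes> b) \<le> d * nrm A b"
    by blast
  have [simp]: "p \<in> carrier A" "q \<in> carrier A" using add by auto
  have "nrm A (complex_of_real (c + d) \<odot> b \<ominus> (p \<oplus> q) \<otimes> b) \<le> (c + d) * nrm A b" if [simp]: "b \<in> carrier A" for b
  proof -
    have "complex_of_real (c + d) \<odot> b \<ominus> (p \<oplus> q) \<otimes> b =
        (complex_of_real c \<odot> b \<ominus> p \<otimes> b) \<oplus> (complex_of_real d \<odot> b \<ominus> q \<otimes> b)"
      by (simp add: sm_add_l l_distr minus_sm sm_add_r a_ac)
    also have "nrm A \<dots> \<le> c * nrm A b + d * nrm A b"
      by (intro order_trans[OF nrm_triangle] add_mono c d) (simp_all add: minus_sm)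
    finally show ?thesis by (simp add: algebra_simps)
  qed
  then show ?case using add c(1) d(1) by (auto simp: star_add intro!: exI[of _ "c + d"])
qed

text \<open>The norm is monotone on positive elements: with \<rho> the norm of h + q, the
  decomposition c + h = (c - q) + (h + q) has norm at most c + \<rho>, which encodes h \<le> \<rho>.
  Together with h \<ge> 0 this confines h to within \<rho>/2 of \<rho>/2.\<close>

lemma nrm_star_square_le_add_psums:
  assumes [simp]: "a \<in> carrier A" and q: "q \<in> psums"
  shows "(nrm A a)\<^sup>2 \<le> nrm A (star A a \<otimes> a \<oplus> q)"
proof -
  define h where "h = star A a \<otimes> a"
  have [simp]: "h \<in> carrier A" "star A h = h" by (simp_all add: h_def star_mult)
  interpret N: real_calculus_seminorm "opn h" by (rule opn_calculus) simp_all
  have [simp]: "q \<in> carrier A" using psums_positive[OF q] by simp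
  obtain c where c: "c \<ge> 0" "\<And>b. b \<in> carrier A ==> nrm A (complex_of_real c \<odot> b \<ominus> q \<otimes> b) \<le> c * nrm A b"
    using psums_positive[OF q] by blast
  define \<rho> where "\<rho> = nrm A (h \<oplus> q)"
  have \<rho>: "\<rho> \<ge> 0" by (simp add: \<rho>_def nrm_nonneg)
  have "opn h ([:(nrm A a)\<^sup>2:] - [:0, 1:]) \<le> (nrm A a)\<^sup>2"
  proof (rule opn_le)
    fix b assume [simp]: "b \<in> carrier A"
    have "hop h ([:(nrm A a)\<^sup>2:] - [:0, 1:]) b = complex_of_real ((nrm A a)\<^sup>2) \<odot> b \<ominus> h \<otimes> b"
      by (simp only: hop_minus hop_const hop_X \<open>h \<in> carrier A\<close> \<open>b \<in> carrier A\<close>)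
    then show "nrm A (hop h ([:(nrm A a)\<^sup>2:] - [:0, 1:]) b) \<le> (nrm A a)\<^sup>2 * nrm A b"
      using star_square_positive[of a b] by (simp only: h_def \<open>a \<in> carrier A\<close> \<open>b \<in> carrier A\<close>)
  qed simp_all
  then have P1: "N.NP [:0, 1:]" unfolding N.NP_def by (intro exI[of _ "(nrm A a)\<^sup>2"]) simp
  have "opn h ([:c + \<rho>:] - ([:\<rho>:] - [:0, 1:])) \<le> c + \<rho>"
  proof (rule opn_le)
    fix b assume [simp]: "b \<in> carrier A"
    have "[:c + \<rho>:] - ([:\<rho>:] - [:0, 1:]) = [:c:] + [:0, 1:]" by simp
    then have "hop h ([:c + \<rho>:] - ([:\<rho>:] - [:0, 1:])) b = complex_of_real c \<odot> b \<oplus> h \<otimes> b"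
      by (simp only: hop_add hop_const hop_X \<open>h \<in> carrier A\<close> \<open>b \<in> carrier A\<close>)
    also have "\<dots> = (complex_of_real c \<odot> b \<ominus> q \<otimes> b) \<oplus> (h \<oplus> q) \<otimes> b"
      using cancel_middle[of "complex_of_real c \<odot> b" "q \<otimes> b" "h \<otimes> b" "-1"]
      by (simp add: minus_sm l_distr a_comm[of "h \<otimes> b"])
    also have "nrm A \<dots> \<le> c * nrm A b + \<rho> * nrm A b"
      unfolding \<rho>_def by (intro order_trans[OF nrm_triangle] add_mono c nrm_mult) (simp_all add: minus_sm)
    finally show "nrm A (hop h ([:c + \<rho>:] - ([:\<rho>:] - [:0, 1:])) b) \<le> (c + \<rho>) * nrm A b"
      by (simp add: algebra_simps)
  qed (use c \<rho> in simp_all)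
  then have P2: "N.NP ([:\<rho>:] - [:0, 1:])" unfolding N.NP_def using c \<rho> by (intro exI[of _ "c + \<rho>"]) simp
  have "opn h ([:0, 1:] - [:\<rho> / 2:]) \<le> \<rho> / 2"
  proof (rule N.norm_le_of_NP)
    show "N.NP ([:\<rho> / 2:] + ([:0, 1:] - [:\<rho> / 2:]))" using P1 by simp
    show "N.NP ([:\<rho> / 2:] - ([:0, 1:] - [:\<rho> / 2:]))" using P2 by simp
  qed (use \<rho> in simp)
  then have "opn h [:0, 1:] \<le> \<rho>"
    using N.add[of "[:0, 1:] - [:\<rho> / 2:]" "[:\<rho> / 2:]"] N.const[of "\<rho> / 2"] \<rho> by simp
  then have "nrm A (h \<otimes> h) \<le> \<rho> * nrm A h"
    using hop_le_opn[of h h "[:0, 1:]"] nrm_nonneg[of h]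
    by (simp add: hop_X mult_right_mono order_trans)
  then have "nrm A h * nrm A h \<le> \<rho> * nrm A h" by (simp add: nrm_self_adjoint_sq power2_eq_square)
  then have "nrm A h \<le> \<rho>" using nrm_nonneg[of h] \<rho> by (cases "nrm A h = 0") (auto simp: mult_le_cancel_right)
  then show ?thesis by (simp add: h_def \<rho>_def nrm_star_mult)
qed

text \<open>Take h = a a' with a' the adjoint of a, and u = p(h) with the polynomial of
  \<open>approx_unit_poly\<close>. For w = a - ua the product of w with its adjoint is r^2(h) h,
  where r = 1 - p, and this is small by the choice of p.\<close>

lemma approximate_unit_le_one:
  assumes [simp]: "a \<in> carrier A" and a: "nrm A a \<le> 1" and e: "e > 0"
  shows "\<exists>u\<in>carrier A. star A u = u \<and> nrm A u \<le> 1 \<and> nrm A (a \<ominus> u \<otimes> a) < e"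
proof -
  define h where "h = a \<otimes> star A a"
  have h [simp]: "h \<in> carrier A" "star A h = h" by (simp_all add: h_def star_mult)
  interpret N: real_calculus_seminorm "opn h" by (rule opn_calculus) simp_all
  \<comment> \<open>For self-adjoint v the C*-identity converts a bound for left multiplication,
    tested on v itself, into a bound for the norm of v.\<close>
  have sq_le: "nrm A v \<le> K" if v: "v \<in> carrier A" "star A v = v" "nrm A (v \<otimes> v) \<le> K * nrm A v" "K \<ge> 0" for v K
    using that nrm_nonneg[of v]
    by (cases "nrm A v = 0") (auto simp: nrm_self_adjoint_sq power2_eq_square mult_le_cancel_right)
  have "nrm A h \<le> 1" using a nrm_nonneg[of a] nrm_star_mult[of "star A a"] by (simp add: h_def power_le_one)
  then have "opn h [:0, 1:] \<le> 1" using opn_X[of h] by simp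
  moreover have "e\<^sup>2 > 0" using e by simp
  ultimately obtain p where p: "poly p 0 = 0" "opn h p \<le> 1" "opn h ([:0, 1:] * (1 - p)\<^sup>2) < e\<^sup>2"
    using N.approx_unit_poly by blast
  \<comment> \<open>As p has no constant term, p(h) = p'(h) h is a genuine element of A and not just
    an operator.\<close>
  obtain p' where p': "p = pCons 0 p'" using p(1) by (cases p) simp
  then have pX: "p = p' * [:0, 1:]" by simp
  define u where "u = hop h p' h"
  have u [simp]: "u \<in> carrier A" "star A u = u" by (simp_all add: u_def hop_self_adjoint)
  have ub: "u \<otimes> b = hop h p b" if b: "b \<in> carrier A" for b
    unfolding pX by (simp only: u_def hop_mult hop_X hop_mult_right[symmetric] h b)
  have "nrm A u \<le> 1"
  proof (rule sq_le)
    show "nrm A (u \<otimes> u) \<le> 1 * nrm A u"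
      using hop_le_opn[of h u p] mult_right_mono[OF p(2), of "nrm A u"] nrm_nonneg[of u] by (simp add: ub)
  qed simp_all
  moreover have "nrm A (a \<ominus> u \<otimes> a) < e"
  proof -
    define r where "r = 1 - p"
    define w where "w = hop h r a"
    have w [simp]: "w \<in> carrier A" by (simp add: w_def)
    have "a \<ominus> u \<otimes> a = w"
      by (simp add: w_def r_def ub hop_minus hop_1)
    have "a \<otimes> star A w = star A (w \<otimes> star A a)" by (simp add: star_mult)
    also have "w \<otimes> star A a = hop h r h" by (simp add: w_def hop_mult_right[symmetric] h_def)
    finally have aw: "a \<otimes> star A w = hop h r h" by (simp add: hop_self_adjoint)
    have "w \<otimes> star A w = hop h r (hop h r h)" by (simp add: w_def hop_mult_right[symmetric] aw[unfolded w_def])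
    also have "\<dots> = hop h (r\<^sup>2) h" by (simp add: hop_mult power2_eq_square)
    finally have ww: "w \<otimes> star A w = hop h (r\<^sup>2) h" .
    have "(nrm A w)\<^sup>2 = nrm A (hop h (r\<^sup>2) h)"
      using nrm_star_mult[of "star A w"] by (simp add: ww)
    also have "\<dots> \<le> opn h ([:0, 1:] * r\<^sup>2)"
    proof (rule sq_le)
      have "hop h (r\<^sup>2) h \<otimes> hop h (r\<^sup>2) h = hop h (r\<^sup>2 * [:0, 1:]) (hop h (r\<^sup>2) h)"
        by (simp only: hop_mult_right[symmetric] h hop_closed hop_mult hop_X)
      then show "nrm A (hop h (r\<^sup>2) h \<otimes> hop h (r\<^sup>2) h) \<le> opn h ([:0, 1:] * r\<^sup>2) * nrm A (hop h (r\<^sup>2) h)"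
        using hop_le_opn[of h "hop h (r\<^sup>2) h" "r\<^sup>2 * [:0, 1:]"] by (simp add: mult.commute del: mult_pCons_left mult_pCons_right)
    qed (simp_all add: hop_self_adjoint N.nonneg)
    also have "\<dots> < e\<^sup>2" using p(3) by (simp only: r_def)
    finally have "nrm A w < e" by (rule power_less_imp_less_base) (use e in simp)
    then show ?thesis using \<open>a \<ominus> u \<otimes> a = w\<close> by simp
  qed
  ultimately show ?thesis using u by blast
qed

lemma approximate_unit:
  assumes [simp]: "a \<in> carrier A" and e: "e > 0"
  obtains u where "u \<in> carrier A" "star A u = u" "nrm A u \<le> 1" "nrm A (a \<ominus> u \<otimes> a) < e"
proof -
  define s where "s = 1 / (1 + nrm A a)"
  have s: "s > 0" using nrm_nonneg[of a] by (simp add: s_def)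
  have "nrm A (complex_of_real s \<odot> a) \<le> 1"
    using nrm_nonneg[of a] s by (simp add: nrm_smult) (simp add: s_def)
  then obtain u where u: "u \<in> carrier A" "star A u = u" "nrm A u \<le> 1"
    "nrm A (complex_of_real s \<odot> a \<ominus> u \<otimes> (complex_of_real s \<odot> a)) < s * e"
    using approximate_unit_le_one[of "complex_of_real s \<odot> a" "s * e"] s e by auto
  moreover have "complex_of_real s \<odot> a \<ominus> u \<otimes> (complex_of_real s \<odot> a) =
      complex_of_real s \<odot> (a \<ominus> u \<otimes> a)"
    using u by (simp add: minus_sm smult_r sm_add_r sm_assoc mult.commute)
  ultimately show thesis using s that by (simp add: nrm_smult minus_sm)
qed

end

section \<open>Linear functionals\<close>

context star_algebra
begin

definition sublin :: "('a => real) => bool" where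
  "sublin p \<longleftrightarrow> (\<forall>x\<in>carrier A. \<forall>y\<in>carrier A. p (x \<oplus> y) \<le> p x + p y) \<and>
     (\<forall>t\<ge>0. \<forall>x\<in>carrier A. p (complex_of_real t \<odot> x) = t * p x)"

lemma sublinI:
  assumes add: "\<And>x y. x \<in> carrier A ==> y \<in> carrier A ==> p (x \<oplus> y) \<le> p x + p y"
    and zero: "p \<zero> \<le> 0"
    and scale: "\<And>t x. t > 0 ==> x \<in> carrier A ==> p (complex_of_real t \<odot> x) \<le> t * p x"
  shows "sublin p"
  unfolding sublin_def
proof (intro conjI ballI allI impI add)
  fix t :: real and x assume t: "t \<ge> 0" and [simp]: "x \<in> carrier A"
  show "p (complex_of_real t \<odot> x) = t * p x"
  proof (cases "t = 0")
    case True
    then show ?thesis using zero add[of \<zero> \<zero>] by simp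
  next
    case False
    then have t: "t > 0" using t by simp
    have "p x \<le> (1 / t) * p (complex_of_real t \<odot> x)"
      using scale[of "1 / t" "complex_of_real t \<odot> x"] t by (simp add: sm_assoc)
    then have "t * p x \<le> p (complex_of_real t \<odot> x)" using t by (simp add: field_simps)
    then show ?thesis using scale[OF t, of x] by simp
  qed
qed

lemma sublin_zero: "sublin p ==> p \<zero> = 0"
  unfolding sublin_def by (metis mult_zero_left of_real_0 order_refl sm_zero zero_closed)

lemma sublin_lower:
  assumes "sublin p" "x \<in> carrier A"
  shows "- p (\<ominus> x) \<le> p x"
proof -
  have "p (x \<oplus> \<ominus> x) \<le> p x + p (\<ominus> x)" using assms unfolding sublin_def by simp
  then show ?thesis using assms sublin_zero[of p] by (simp add: r_neg)
qed

text \<open>A sublinear functional below p (t = 0) that takes a value at most - p y at -y (t = 1).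
  It pushes p down as far as linearity in the direction y demands.\<close>

definition shift :: "('a => real) => 'a => 'a => real" where
  "shift p y x = (INF t\<in>{0..}. p (x \<oplus> complex_of_real t \<odot> y) - t * p y)"

lemma shift_le:
  assumes p: "sublin p" and [simp]: "x \<in> carrier A" "y \<in> carrier A" and t: "t \<ge> 0"
  shows "shift p y x \<le> p (x \<oplus> complex_of_real t \<odot> y) - t * p y"
  unfolding shift_def
proof (rule cINF_lower)
  have "- p (\<ominus> x) \<le> p (x \<oplus> complex_of_real t \<odot> y) - t * p y" if "t \<ge> 0" for t
  proof -
    have eq: "complex_of_real t \<odot> y = (x \<oplus> complex_of_real t \<odot> y) \<oplus> \<ominus> x"
      by (metis \<open>x \<in> carrier A\<close> \<open>y \<in> carrier A\<close> a_closed a_comm a_inv_closed r_neg1 sm_closed)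
    have "t * p y = p (complex_of_real t \<odot> y)" using p that unfolding sublin_def by simp
    also have "\<dots> \<le> p (x \<oplus> complex_of_real t \<odot> y) + p (\<ominus> x)"
      using p eq unfolding sublin_def
      by (metis \<open>x \<in> carrier A\<close> \<open>y \<in> carrier A\<close> a_closed a_inv_closed sm_closed)
    finally show ?thesis by simp
  qed
  then show "bdd_below ((\<lambda>t. p (x \<oplus> complex_of_real t \<odot> y) - t * p y) ` {0..})"
    by (intro bdd_belowI2[of _ "- p (\<ominus> x)"]) simp
qed (use t in simp)

lemma shift_greatest:
  "(\<And>t. t \<ge> 0 ==> c \<le> p (x \<oplus> complex_of_real t \<odot> y) - t * p y) ==> c \<le> shift p y x"
  unfolding shift_def by (rule cINF_greatest) auto

lemma shift_sublin:
  assumes p: "sublin p" and y [simp]: "y \<in> carrier A"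
  shows "sublin (shift p y)"
proof (rule sublinI)
  fix x x' assume [simp]: "x \<in> carrier A" "x' \<in> carrier A"
  have *: "shift p y (x \<oplus> x') \<le> (p (x \<oplus> complex_of_real s \<odot> y) - s * p y) +
      (p (x' \<oplus> complex_of_real t \<odot> y) - t * p y)" if "s \<ge> 0" "t \<ge> 0" for s t
  proof -
    have "shift p y (x \<oplus> x') \<le> p ((x \<oplus> x') \<oplus> complex_of_real (s + t) \<odot> y) - (s + t) * p y"
      using that by (intro shift_le p) simp_all
    also have "(x \<oplus> x') \<oplus> complex_of_real (s + t) \<odot> y =
        (x \<oplus> complex_of_real s \<odot> y) \<oplus> (x' \<oplus> complex_of_real t \<odot> y)"
      by (simp add: sm_add_l a_ac)
    also have "p \<dots> \<le> p (x \<oplus> complex_of_real s \<odot> y) + p (x' \<oplus> complex_of_real t \<odot> y)"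
      using p unfolding sublin_def by simp
    finally show ?thesis by (simp add: algebra_simps)
  qed
  have "shift p y (x \<oplus> x') - (p (x \<oplus> complex_of_real s \<odot> y) - s * p y) \<le> shift p y x'" if "s \<ge> 0" for s
    using *[OF that] by (intro shift_greatest) (simp add: algebra_simps)
  then have "shift p y (x \<oplus> x') - shift p y x' \<le> shift p y x"
    by (intro shift_greatest) (simp add: algebra_simps)
  then show "shift p y (x \<oplus> x') \<le> shift p y x + shift p y x'" by simp
next
  show "shift p y \<zero> \<le> 0" using shift_le[OF p zero_closed y, of 0] sublin_zero[OF p] by simp
next
  fix t :: real and x assume t: "t > 0" and [simp]: "x \<in> carrier A"
  have "shift p y (complex_of_real t \<odot> x) / t \<le> shift p y x"
  proof (rule shift_greatest)
    fix s :: real assume s: "s \<ge> 0"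
    have "shift p y (complex_of_real t \<odot> x) \<le>
        p (complex_of_real t \<odot> x \<oplus> complex_of_real (t * s) \<odot> y) - (t * s) * p y"
      using s t by (intro shift_le p) simp_all
    also have "complex_of_real t \<odot> x \<oplus> complex_of_real (t * s) \<odot> y =
        complex_of_real t \<odot> (x \<oplus> complex_of_real s \<odot> y)"
      by (simp add: sm_add_r sm_assoc)
    also have "p \<dots> = t * p (x \<oplus> complex_of_real s \<odot> y)" using p t unfolding sublin_def by simp
    finally show "shift p y (complex_of_real t \<odot> x) / t \<le> p (x \<oplus> complex_of_real s \<odot> y) - s * p y"
      using t by (simp add: field_simps)
  qed
  then show "shift p y (complex_of_real t \<odot> x) \<le> t * shift p y x" using t by (simp add: field_simps)
qed

text \<open>The lemma of Zorn for the reversed pointwise order. The infimum over a chain is finite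
  because every member a satisfies a x \<ge> - p0 (- x), and it is subadditive because two members
  of a chain have a common lower member.\<close>

lemma minimal_sublin:
  assumes p0: "sublin p0"
  obtains p where "sublin p" "\<And>x. x \<in> carrier A ==> p x \<le> p0 x"
    "\<And>q x. sublin q ==> (\<And>x. x \<in> carrier A ==> q x \<le> p x) ==> x \<in> carrier A ==> q x = p x"
proof -
  \<comment> \<open>The functionals are set to 0 off the carrier so that the pointwise order is
    antisymmetric on functions.\<close>
  define \<S> where "\<S> = {p. sublin p \<and> (\<forall>x\<in>carrier A. p x \<le> p0 x) \<and> (\<forall>x. x \<notin> carrier A \<longrightarrow> p x = 0)}"
  define R where "R = (\<lambda>a b :: 'a => real. \<forall>x. b x \<le> a x)"
  have restrict: "sublin (\<lambda>x. if x \<in> carrier A then q x else 0)" if "sublin q" for q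
    using that unfolding sublin_def by simp
  have "\<exists>m\<in>\<S>. \<forall>a\<in>\<S>. R m a \<longrightarrow> a = m"
  proof (rule predicate_Zorn)
    show "partial_order_on \<S> (relation_of R \<S>)"
      by (rule partial_order_on_relation_ofI) (auto simp: R_def intro!: ext intro: order_antisym order_trans)
  next
    fix C assume C: "C \<in> Chains (relation_of R \<S>)"
    show "\<exists>u\<in>\<S>. \<forall>a\<in>C. R a u"
    proof (cases "C = {}")
      case True
      then show ?thesis using restrict[OF p0] p0
        by (intro bexI[of _ "\<lambda>x. if x \<in> carrier A then p0 x else 0"]) (auto simp: \<S>_def)
    next
      case False
      have CS: "a \<in> \<S>" if "a \<in> C" for a using C that by (auto simp: Chains_def relation_of_def)
      have tot: "R a b \<or> R b a" if "a \<in> C" "b \<in> C" for a b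
        using C that by (auto simp: Chains_def relation_of_def)
      define u where "u = (\<lambda>x. if x \<in> carrier A then INF a\<in>C. a x else 0)"
      have u_le: "u x \<le> a x" if "a \<in> C" "x \<in> carrier A" for a x
      proof -
        have "bdd_below ((\<lambda>a. a x) ` C)"
        proof (rule bdd_belowI2[of _ "- p0 (\<ominus> x)"])
          fix a assume "a \<in> C"
          then have "sublin a" "a (\<ominus> x) \<le> p0 (\<ominus> x)" using CS that(2) by (auto simp: \<S>_def)
          then show "- p0 (\<ominus> x) \<le> a x" using sublin_lower[of a x] that(2) by linarith
        qed
        then show ?thesis using that cINF_lower[of "\<lambda>a. a x" C a] by (simp add: u_def)
      qed
      have u_ge: "c \<le> u x" if "\<And>a. a \<in> C ==> c \<le> a x" "x \<in> carrier A" for c x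
        using that False by (simp add: u_def cINF_greatest)
      obtain a0 where a0: "a0 \<in> C" using False by blast
      have "sublin u"
      proof (rule sublinI)
        fix x y assume [simp]: "x \<in> carrier A" "y \<in> carrier A"
        have *: "u (x \<oplus> y) \<le> a x + b y" if ab: "a \<in> C" "b \<in> C" for a b
        proof -
          obtain r where r: "r \<in> C" "r x \<le> a x" "r y \<le> b y"
            using tot[OF ab] ab by (auto simp: R_def)
          have "u (x \<oplus> y) \<le> r (x \<oplus> y)" using r by (intro u_le) simp_all
          also have "\<dots> \<le> r x + r y" using CS[OF r(1)] by (auto simp: \<S>_def sublin_def)
          finally show ?thesis using r by linarith
        qed
        have "u (x \<oplus> y) - a x \<le> u y" if "a \<in> C" for a
          using *[OF that] by (intro u_ge) (simp_all add: algebra_simps)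
        then have "u (x \<oplus> y) - u y \<le> u x" by (intro u_ge) (simp_all add: algebra_simps)
        then show "u (x \<oplus> y) \<le> u x + u y" by simp
      next
        show "u \<zero> \<le> 0" using u_le[OF a0 zero_closed] CS[OF a0] sublin_zero[of a0] by (simp add: \<S>_def)
      next
        fix t :: real and x assume t: "t > 0" and [simp]: "x \<in> carrier A"
        have "u (complex_of_real t \<odot> x) / t \<le> u x"
        proof (rule u_ge)
          fix a assume a: "a \<in> C"
          have "u (complex_of_real t \<odot> x) \<le> a (complex_of_real t \<odot> x)" using a by (intro u_le) simp_all
          also have "\<dots> = t * a x" using CS[OF a] t by (simp add: \<S>_def sublin_def)
          finally show "u (complex_of_real t \<odot> x) / t \<le> a x" using t by (simp add: field_simps)
        qed simp
        then show "u (complex_of_real t \<odot> x) \<le> t * u x" using t by (simp add: field_simps)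
      qed
      moreover have "u x \<le> p0 x" if "x \<in> carrier A" for x
        using u_le[OF a0 that] CS[OF a0] that by (force simp: \<S>_def)
      ultimately have "u \<in> \<S>" by (simp add: \<S>_def u_def)
      moreover have "R a u" if "a \<in> C" for a
        using u_le[OF that] CS[OF that] by (auto simp: R_def \<S>_def u_def)
      ultimately show ?thesis by blast
    qed
  qed
  then obtain m where m: "m \<in> \<S>" "\<And>a. a \<in> \<S> ==> R m a ==> a = m" by blast
  show thesis
  proof (rule that[of m])
    fix q x assume q: "sublin q" "\<And>x. x \<in> carrier A ==> q x \<le> m x" and x: "x \<in> carrier A"
    define q' where "q' = (\<lambda>x. if x \<in> carrier A then q x else 0)"
    have "q' \<in> \<S>" unfolding \<S>_def q'_def using restrict[OF q(1)] q(2) m(1) by (fastforce simp: \<S>_def)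
    moreover have "R m q'" using q(2) m(1) by (auto simp: R_def q'_def \<S>_def)
    ultimately have "q' = m" by (rule m(2))
    then show "q x = m x" using x by (auto simp: q'_def dest: fun_cong[of _ _ x])
  qed (use m(1) in \<open>auto simp: \<S>_def\<close>)
qed

text \<open>A minimal sublinear functional is linear, since it agrees with all its shifts.\<close>

lemma dominated_functional:
  assumes p: "sublin p" and a [simp]: "a \<in> carrier A"
  obtains f where "\<And>x y. x \<in> carrier A ==> y \<in> carrier A ==> f (x \<oplus> y) = f x + f y"
    "\<And>t x. x \<in> carrier A ==> f (complex_of_real t \<odot> x) = t * f x"
    "\<And>x. x \<in> carrier A ==> f x \<le> p x" "f a = p a"
proof -
  \<comment> \<open>Minimality is taken below \<open>shift p a\<close> rather than below p: this
    forces f(-a) \<le> - p a and thereby f a = p a.\<close>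
  obtain f where f: "sublin f" "\<And>x. x \<in> carrier A ==> f x \<le> shift p a x"
    "\<And>q x. sublin q ==> (\<And>x. x \<in> carrier A ==> q x \<le> f x) ==> x \<in> carrier A ==> q x = f x"
    using minimal_sublin[OF shift_sublin[OF p a]] by blast
  have add: "f (x \<oplus> y) = f x + f y" if [simp]: "x \<in> carrier A" "y \<in> carrier A" for x y
  proof -
    have "shift f y x = f x"
    proof (rule f(3))
      show "shift f y z \<le> f z" if "z \<in> carrier A" for z
        using shift_le[OF f(1) that, of y 0] that by simp
    qed (simp_all add: shift_sublin f(1))
    then have "f x \<le> f (x \<oplus> y) - f y" using shift_le[OF f(1), of x y 1] by simp
    moreover have "f (x \<oplus> y) \<le> f x + f y" using f(1) by (simp add: sublin_def)
    ultimately show ?thesis by simp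
  qed
  have neg: "f (\<ominus> x) = - f x" if "x \<in> carrier A" for x
    using add[of x "\<ominus> x"] that sublin_zero[OF f(1)] by (simp add: r_neg)
  have le: "f x \<le> p x" if "x \<in> carrier A" for x
    using f(2)[OF that] shift_le[OF p that a, of 0] that by simp
  have "f (\<ominus> a) \<le> - p a"
    using f(2)[of "\<ominus> a"] shift_le[OF p _ a, of "\<ominus> a" 1] sublin_zero[OF p] by (simp add: l_neg)
  then have "f a = p a" using le[of a] neg[of a] by simp
  moreover have "f (complex_of_real t \<odot> x) = t * f x" if [simp]: "x \<in> carrier A" for t x
  proof (cases "t \<ge> 0")
    case True
    then show ?thesis using f(1) by (simp add: sublin_def)
  next
    case False
    then have "- t \<ge> 0" by simp
    then have "f (complex_of_real (- t) \<odot> x) = - t * f x"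
      using f(1) \<open>x \<in> carrier A\<close> unfolding sublin_def by blast
    moreover have "complex_of_real t \<odot> x = \<ominus> (complex_of_real (- t) \<odot> x)"
      by (simp add: sm_minus sm_assoc)
    ultimately show ?thesis using neg[of "complex_of_real (- t) \<odot> x"] by simp
  qed
  ultimately show thesis using that add le by blast
qed

definition clin :: "('a => complex) => bool" where
  "clin l \<longleftrightarrow> (\<forall>x\<in>carrier A. \<forall>y\<in>carrier A. l (x \<oplus> y) = l x + l y) \<and>
     (\<forall>c. \<forall>x\<in>carrier A. l (c \<odot> x) = c * l x)"

lemma clin_add: "clin l ==> x \<in> carrier A ==> y \<in> carrier A ==> l (x \<oplus> y) = l x + l y"
  and clin_smult: "clin l ==> x \<in> carrier A ==> l (c \<odot> x) = c * l x"
  by (simp_all add: clin_def)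

lemma clin_zero: "clin l ==> l \<zero> = 0"
  using clin_smult[of l \<zero> 0] by simp

lemma clin_minus: "clin l ==> x \<in> carrier A ==> y \<in> carrier A ==> l (x \<ominus> y) = l x - l y"
  by (simp add: minus_sm clin_add clin_smult)

text \<open>The passage l x = f x - i f(ix) from a real-linear functional to the complex-linear one
  with real part f.\<close>

lemma complexify:
  assumes add: "\<And>x y. x \<in> carrier A ==> y \<in> carrier A ==> f (x \<oplus> y) = f x + f y"
    and scale: "\<And>t x. x \<in> carrier A ==> f (complex_of_real t \<odot> x) = t * f x"
  shows "clin (\<lambda>x. Complex (f x) (- f (\<i> \<odot> x)))"
  unfolding clin_def
proof (intro conjI ballI allI)
  fix c x assume [simp]: "x \<in> carrier A"
  have c: "c \<odot> x = complex_of_real (Re c) \<odot> x \<oplus> complex_of_real (Im c) \<odot> (\<i> \<odot> x)"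
    by (simp add: sm_assoc sm_add_l[symmetric] mult.commute[of "complex_of_real (Im c)"] complex_eq[symmetric])
  have ic: "\<i> \<odot> (c \<odot> x) = complex_of_real (Re c) \<odot> (\<i> \<odot> x) \<oplus> complex_of_real (- Im c) \<odot> x"
  proof -
    have "\<i> * c = complex_of_real (Re c) * \<i> + complex_of_real (- Im c)"
      by (simp add: complex_eq_iff)
    then show ?thesis by (simp add: sm_assoc sm_add_l[symmetric])
  qed
  show "Complex (f (c \<odot> x)) (- f (\<i> \<odot> (c \<odot> x))) = c * Complex (f x) (- f (\<i> \<odot> x))"
    unfolding ic unfolding c by (simp add: add scale complex_eq_iff del: of_real_minus)
qed (simp add: add sm_add_r complex_eq_iff)

end

context pre_cstar
begin

lemma clin_bound:
  assumes l: "clin l" and Re: "\<And>x. x \<in> carrier A ==> Re (l x) \<le> nrm A x" and [simp]: "x \<in> carrier A"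
  shows "cmod (l x) \<le> nrm A x"
proof (cases "l x = 0")
  case False
  define u where "u = cnj (l x) / complex_of_real (cmod (l x))"
  have "cmod u = 1" using False by (simp add: u_def norm_divide)
  have "u * l x = complex_of_real (cmod (l x))"
    using False complex_norm_square[of "l x"] by (simp add: u_def power2_eq_square field_simps)
  then have "cmod (l x) = Re (l (u \<odot> x))" by (simp add: clin_smult[OF l])
  also have "\<dots> \<le> nrm A (u \<odot> x)" by (rule Re) simp
  finally show ?thesis by (simp add: nrm_smult \<open>cmod u = 1\<close>)
qed (simp add: nrm_nonneg)

lemma norming_functional:
  assumes b [simp]: "b \<in> carrier A"
  obtains l where "clin l" "\<And>x. x \<in> carrier A ==> cmod (l x) \<le> nrm A x" "cmod (l b) = nrm A b"
proof -
  have "sublin (nrm A)" by (intro sublinI) (simp_all add: nrm_triangle nrm_smult)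
  then obtain f where f: "\<And>x y. x \<in> carrier A ==> y \<in> carrier A ==> f (x \<oplus> y) = f x + f y"
    "\<And>t x. x \<in> carrier A ==> f (complex_of_real t \<odot> x) = t * f x"
    "\<And>x. x \<in> carrier A ==> f x \<le> nrm A x" "f b = nrm A b"
    using dominated_functional[OF _ b] by metis
  define l where "l x = Complex (f x) (- f (\<i> \<odot> x))" for x
  have l: "clin l" unfolding l_def by (rule complexify) (simp_all add: f)
  have bd: "cmod (l x) \<le> nrm A x" if "x \<in> carrier A" for x
    by (rule clin_bound[OF l _ that]) (simp add: l_def f)
  have "nrm A b \<le> cmod (l b)" using complex_Re_le_cmod[of "l b"] by (simp add: l_def f)
  then show thesis using that[OF l bd] bd[of b] by simp
qed

lemma nrm_le_functionals:
  assumes "x \<in> carrier A" "\<And>l. clin l ==> (\<And>y. y \<in> carrier A ==> cmod (l y) \<le> nrm A y) ==> cmod (l x) \<le> K"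
  shows "nrm A x \<le> K"
  using norming_functional[OF assms(1)] assms(2) by metis

text \<open>Reduces identities between finite sums in an algebra to identities between sums of
  complex numbers; used for the extension of a morphism to the semigroup algebra.\<close>

lemma eq_by_functionals:
  assumes "x \<in> carrier A" "y \<in> carrier A"
    "\<And>l. clin l ==> (\<And>y. y \<in> carrier A ==> cmod (l y) \<le> nrm A y) ==> l x = l y"
  shows "x = y"
proof -
  have "nrm A (x \<ominus> y) \<le> 0"
    by (rule nrm_le_functionals) (use assms in \<open>auto simp: minus_sm clin_add clin_smult\<close>)
  then have "x \<ominus> y = \<zero>" using nrm_nonneg[of "x \<ominus> y"] nrm_eq_0[of "x \<ominus> y"] assms by simp
  moreover have "x = (x \<ominus> y) \<oplus> y" using assms(1,2) by (simp add: minus_sm a_assoc sm_collect)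
  ultimately show ?thesis using assms(2) by simp
qed

lemma psums_zero: "\<zero> \<in> psums"
  using psums.square[of \<zero>] by simp

lemma psums_scale: "q \<in> psums ==> t \<ge> 0 ==> complex_of_real t \<odot> q \<in> psums"
proof (induction rule: psums.induct)
  case (square x)
  have "star A (complex_of_real (sqrt t) \<odot> x) \<otimes> (complex_of_real (sqrt t) \<odot> x) =
      complex_of_real t \<odot> (star A x \<otimes> x)"
    using square by (simp add: star_smult smult_l smult_r sm_assoc of_real_mult[symmetric])
  then show ?case using psums.square[of "complex_of_real (sqrt t) \<odot> x"] square by simp
next
  case (add p q)
  then show ?case using psums_positive by (simp add: sm_add_r psums.add)
qed

text \<open>The functional is dominated by the distance of the real part to the negative of the cone of
  sums of squares; that this is not zero on \<open>a\<^sup>*a\<close> is the content of Kaplansky's theorem.\<close>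

lemma positive_functional:
  assumes a [simp]: "a \<in> carrier A" and a0: "a \<noteq> \<zero>"
  obtains \<phi> where "clin \<phi>" "\<And>x. x \<in> carrier A ==> cmod (\<phi> x) \<le> nrm A x"
    "\<And>x. x \<in> carrier A ==> \<phi> (star A x \<otimes> x) \<in> \<real>\<^sub>\<ge>\<^sub>0" "\<phi> (star A a \<otimes> a) \<noteq> 0"
proof -
  define re where "re x = (1/2) \<odot> (x \<oplus> star A x)" for x
  have re [simp]: "re x \<in> carrier A" if "x \<in> carrier A" for x using that by (simp add: re_def)
  have re_add: "re (x \<oplus> y) = re x \<oplus> re y" if "x \<in> carrier A" "y \<in> carrier A" for x y
    using that by (simp add: re_def star_add sm_add_r a_ac)
  have re_scale: "re (complex_of_real t \<odot> x) = complex_of_real t \<odot> re x" if "x \<in> carrier A" for t x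
    using that by (simp add: re_def star_smult sm_add_r sm_assoc mult.commute)
  have ps [simp]: "q \<in> carrier A" if "q \<in> psums" for q using psums_positive[OF that] by simp
  define p where "p x = (INF q\<in>psums. nrm A (re x \<oplus> q))" for x
  have p_le: "p x \<le> nrm A (re x \<oplus> q)" if "q \<in> psums" "x \<in> carrier A" for x q
    unfolding p_def using that by (intro cINF_lower bdd_belowI2[of _ 0] nrm_nonneg) simp_all
  have p_ge: "c \<le> p x" if "\<And>q. q \<in> psums ==> c \<le> nrm A (re x \<oplus> q)" for c x
    unfolding p_def using that psums_zero by (intro cINF_greatest) auto
  have "sublin p"
  proof (rule sublinI)
    fix x y assume [simp]: "x \<in> carrier A" "y \<in> carrier A"
    have *: "p (x \<oplus> y) \<le> nrm A (re x \<oplus> q) + nrm A (re y \<oplus> r)" if [simp]: "q \<in> psums" "r \<in> psums" for q r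
    proof -
      have "p (x \<oplus> y) \<le> nrm A (re (x \<oplus> y) \<oplus> (q \<oplus> r))" by (rule p_le) (simp_all add: psums.add)
      also have "re (x \<oplus> y) \<oplus> (q \<oplus> r) = (re x \<oplus> q) \<oplus> (re y \<oplus> r)" by (simp add: re_add a_ac)
      finally show ?thesis using nrm_triangle[of "re x \<oplus> q" "re y \<oplus> r"] by simp
    qed
    have "p (x \<oplus> y) - nrm A (re x \<oplus> q) \<le> p y" if "q \<in> psums" for q
      using *[OF that] by (intro p_ge) (simp add: algebra_simps)
    then have "p (x \<oplus> y) - p y \<le> p x" by (intro p_ge) (simp add: algebra_simps)
    then show "p (x \<oplus> y) \<le> p x + p y" by simp
  next
    show "p \<zero> \<le> 0" using p_le[OF psums_zero zero_closed] by (simp add: re_def)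
  next
    fix t :: real and x assume t: "t > 0" and [simp]: "x \<in> carrier A"
    have "p (complex_of_real t \<odot> x) / t \<le> p x"
    proof (rule p_ge)
      fix q assume [simp]: "q \<in> psums"
      have "p (complex_of_real t \<odot> x) \<le> nrm A (re (complex_of_real t \<odot> x) \<oplus> complex_of_real t \<odot> q)"
        using t by (intro p_le psums_scale) simp_all
      also have "re (complex_of_real t \<odot> x) \<oplus> complex_of_real t \<odot> q = complex_of_real t \<odot> (re x \<oplus> q)"
        by (simp add: re_scale sm_add_r)
      finally show "p (complex_of_real t \<odot> x) / t \<le> nrm A (re x \<oplus> q)" using t by (simp add: nrm_smult field_simps)
    qed
    then show "p (complex_of_real t \<odot> x) \<le> t * p x" using t by (simp add: field_simps)
  qed
  then obtain f where f: "\<And>x y. x \<in> carrier A ==> y \<in> carrier A ==> f (x \<oplus> y) = f x + f y"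
    "\<And>t x. x \<in> carrier A ==> f (complex_of_real t \<odot> x) = t * f x"
    "\<And>x. x \<in> carrier A ==> f x \<le> p x" "f (star A a \<otimes> a) = p (star A a \<otimes> a)"
    using dominated_functional[of p "star A a \<otimes> a"] by (metis a m_closed star_closed)
  have re_sa: "re x = x" if [simp]: "x \<in> carrier A" and "star A x = x" for x
    using that(2) by (simp add: re_def sm_collect sm_assoc)
  have f_neg: "f ((-1) \<odot> x) = - f x" if "x \<in> carrier A" for x
    using f(2)[OF that, of "-1"] by simp
  define \<phi> where "\<phi> x = Complex (f x) (- f (\<i> \<odot> x))" for x
  have lin: "clin \<phi>" unfolding \<phi>_def by (rule complexify) (simp_all add: f)
  have "Re (\<phi> x) \<le> nrm A x" if [simp]: "x \<in> carrier A" for x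
  proof -
    have "f x \<le> nrm A (re x \<oplus> \<zero>)" using f(3)[of x] p_le[OF psums_zero, of x] by simp
    also have "\<dots> \<le> (nrm A x + nrm A (star A x)) / 2"
      using nrm_triangle[of x "star A x"] by (simp add: re_def nrm_smult)
    finally show ?thesis by (simp add: \<phi>_def)
  qed
  then have bd: "cmod (\<phi> x) \<le> nrm A x" if "x \<in> carrier A" for x using clin_bound[OF lin _ that] by blast
  \<comment> \<open>For y in the cone the choice q = y gives p(-y) \<le> 0, hence f y \<ge> 0. As y
    is self-adjoint, the real parts of iy and -iy vanish, which forces f(iy) = 0, so \<phi> is real
    there.\<close>
  have pos: "f y \<ge> 0 \<and> f (\<i> \<odot> y) = 0" if y: "y \<in> psums" for y
  proof -
    have [simp]: "y \<in> carrier A" "star A y = y" using psums_positive[OF y] by auto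
    have "f ((-1) \<odot> y) \<le> nrm A (re ((-1) \<odot> y) \<oplus> y)"
      using f(3)[of "(-1) \<odot> y"] p_le[OF y, of "(-1) \<odot> y"] by simp
    also have "re ((-1) \<odot> y) = (-1) \<odot> y" by (intro re_sa) (simp_all add: star_smult)
    finally have 1: "f y \<ge> 0" by (simp add: f_neg sm_collect)
    have re0: "re (\<i> \<odot> y) = \<zero>" "re ((- \<i>) \<odot> y) = \<zero>"
      by (simp_all add: re_def star_smult sm_collect)
    have 2: "f (\<i> \<odot> y) \<le> 0"
      using f(3)[of "\<i> \<odot> y"] p_le[OF psums_zero, of "\<i> \<odot> y"] by (simp add: re0)
    have "f ((- \<i>) \<odot> y) \<le> 0"
      using f(3)[of "(- \<i>) \<odot> y"] p_le[OF psums_zero, of "(- \<i>) \<odot> y"] by (simp add: re0)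
    moreover have "f ((- \<i>) \<odot> y) = - f (\<i> \<odot> y)"
      using f_neg[of "\<i> \<odot> y"] by (simp add: sm_assoc)
    ultimately show ?thesis using 1 2 by simp
  qed
  show thesis
  proof (rule that[OF lin bd])
    fix x assume "x \<in> carrier A"
    then have "star A x \<otimes> x \<in> psums" by (rule psums.square)
    then show "\<phi> (star A x \<otimes> x) \<in> \<real>\<^sub>\<ge>\<^sub>0" using pos by (simp add: \<phi>_def complex_nonneg_Reals_iff)
  next
    have "(nrm A a)\<^sup>2 \<le> p (star A a \<otimes> a)"
    proof (rule p_ge)
      fix q assume "q \<in> psums"
      moreover have "re (star A a \<otimes> a) = star A a \<otimes> a" by (intro re_sa) (simp_all add: star_mult)
      ultimately show "(nrm A a)\<^sup>2 \<le> nrm A (re (star A a \<otimes> a) \<oplus> q)"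
        using nrm_star_square_le_add_psums[of a q] by simp
    qed
    moreover have "nrm A a \<noteq> 0" using a0 nrm_eq_0[of a] by simp
    ultimately have "f (star A a \<otimes> a) > 0" using f(4) by (smt (verit) zero_less_power2)
    then show "\<phi> (star A a \<otimes> a) \<noteq> 0" by (simp add: \<phi>_def complex_eq_iff)
  qed
qed

end

section \<open>Completions\<close>

locale seminormed = star_algebra A for A :: "('a, 'z) normed_star_algebra_scheme" (structure) +
  assumes nonneg: "x \<in> carrier A ==> 0 \<le> nrm A x"
    and smult_eq: "x \<in> carrier A ==> nrm A (c \<odot> x) = cmod c * nrm A x"
    and triangle: "x \<in> carrier A ==> y \<in> carrier A ==> nrm A (x \<oplus> y) \<le> nrm A x + nrm A y"
begin

abbreviation cau :: "(nat => 'a) => bool" where "cau \<equiv> alg_cauchy A"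

definition sim :: "(nat => 'a) => (nat => 'a) => bool" where
  "sim X Y \<longleftrightarrow> (\<lambda>n. nrm A (X n \<ominus> Y n)) \<longlonglongrightarrow> 0"

lemma minus_commute: "x \<in> carrier A ==> y \<in> carrier A ==> nrm A (x \<ominus> y) = nrm A (y \<ominus> x)"
proof -
  assume [simp]: "x \<in> carrier A" "y \<in> carrier A"
  have "y \<ominus> x = (-1) \<odot> (x \<ominus> y)" by (simp add: alg a_ac)
  then show ?thesis by (simp add: smult_eq)
qed

lemma minus_triangle:
  assumes [simp]: "x \<in> carrier A" "y \<in> carrier A" "z \<in> carrier A"
  shows "nrm A (x \<ominus> z) \<le> nrm A (x \<ominus> y) + nrm A (y \<ominus> z)"
proof -
  have "x \<ominus> z = (x \<ominus> y) \<oplus> (y \<ominus> z)" by (simp add: alg a_ac sm_collect)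
  then show ?thesis using triangle[of "x \<ominus> y" "y \<ominus> z"] by simp
qed

lemma abs_diff_le: "x \<in> carrier A ==> y \<in> carrier A ==> \<bar>nrm A x - nrm A y\<bar> \<le> nrm A (x \<ominus> y)"
proof -
  have *: "nrm A x \<le> nrm A (x \<ominus> y) + nrm A y" if [simp]: "x \<in> carrier A" "y \<in> carrier A" for x y
  proof -
    have "x = (x \<ominus> y) \<oplus> y" by (simp add: minus_sm a_assoc sm_collect)
    then show ?thesis using triangle[of "x \<ominus> y" y] by simp
  qed
  assume "x \<in> carrier A" "y \<in> carrier A"
  then show ?thesis using *[of x y] *[of y x] minus_commute[of x y] by linarith
qed

lemma cau_in [simp]: "cau X ==> X n \<in> carrier A"
  unfolding alg_cauchy_def by blast

lemma cau_dominated: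
  assumes X: "cau X" and Y: "cau Y" and Z: "\<And>n. Z n \<in> carrier A" and K: "K \<ge> 0"
    and le: "\<And>m n. nrm A (Z m \<ominus> Z n) \<le> K * (nrm A (X m \<ominus> X n) + nrm A (Y m \<ominus> Y n))"
  shows "cau Z"
  unfolding alg_cauchy_def
proof (intro conjI allI impI)
  fix e :: real assume e: "e > 0"
  define d where "d = e / (2 * (K + 1))"
  have d: "d > 0" using e K by (simp add: d_def)
  obtain M N where MN: "\<And>m n. m \<ge> M ==> n \<ge> M ==> nrm A (X m \<ominus> X n) < d"
    "\<And>m n. m \<ge> N ==> n \<ge> N ==> nrm A (Y m \<ominus> Y n) < d"
    using X Y d unfolding alg_cauchy_def by metis
  have "nrm A (Z m \<ominus> Z n) < e" if "m \<ge> max M N" "n \<ge> max M N" for m n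
  proof -
    have "nrm A (Z m \<ominus> Z n) \<le> K * (d + d)"
      using MN[of m n] that by (intro order_trans[OF le] mult_left_mono K) auto
    also have "\<dots> < (K + 1) * (d + d)" using d by simp
    also have "\<dots> = e"
    proof -
      have "K + 1 \<noteq> 0" using K by simp
      then show ?thesis unfolding d_def by (simp add: divide_eq_eq)
    qed
    finally show ?thesis .
  qed
  then show "\<exists>N. \<forall>m\<ge>N. \<forall>n\<ge>N. nrm A (Z m \<ominus> Z n) < e" by blast
qed (use Z in auto)

lemma sim_dominated:
  assumes "sim X X'" "sim Y Y'" and Z: "\<And>n. Z n \<in> carrier A" "\<And>n. Z' n \<in> carrier A"
    and le: "\<And>n. nrm A (Z n \<ominus> Z' n) \<le> K * (nrm A (X n \<ominus> X' n) + nrm A (Y n \<ominus> Y' n))"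
  shows "sim Z Z'"
proof -
  have "(\<lambda>n. K * (nrm A (X n \<ominus> X' n) + nrm A (Y n \<ominus> Y' n))) \<longlonglongrightarrow> K * (0 + 0)"
    using assms(1,2) unfolding sim_def by (intro tendsto_intros)
  then have *: "(\<lambda>n. K * (nrm A (X n \<ominus> X' n) + nrm A (Y n \<ominus> Y' n))) \<longlonglongrightarrow> 0" by simp
  show ?thesis unfolding sim_def
    by (rule tendsto_sandwich[OF _ _ tendsto_const *]) (use Z le nonneg in \<open>auto simp: minus_sm\<close>)
qed

lemma minus_self: "x \<in> carrier A ==> nrm A (x \<ominus> x) = 0"
  using smult_eq[of x 0] by (simp add: minus_sm sm_collect)

lemma cau_const: "a \<in> carrier A ==> cau (\<lambda>n. a)"
  unfolding alg_cauchy_def by (simp add: minus_self)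

lemma sim_refl: "cau X ==> sim X X"
  by (simp add: sim_def minus_self)

lemma sim_sym: "cau X ==> cau Y ==> sim X Y ==> sim Y X"
  by (simp add: sim_def minus_commute)

lemma sim_trans:
  assumes c: "cau X" "cau Y" "cau Z" and s: "sim X Y" "sim Y Z" shows "sim X Z"
  by (rule sim_dominated[where K = 1, OF s]) (use c in \<open>auto intro: minus_triangle\<close>)

lemma add_diff_le:
  assumes [simp]: "x \<in> carrier A" "y \<in> carrier A" "x' \<in> carrier A" "y' \<in> carrier A"
  shows "nrm A ((x \<oplus> y) \<ominus> (x' \<oplus> y')) \<le> nrm A (x \<ominus> x') + nrm A (y \<ominus> y')"
proof -
  have "(x \<oplus> y) \<ominus> (x' \<oplus> y') = (x \<ominus> x') \<oplus> (y \<ominus> y')" by (simp add: minus_sm sm_add_r a_ac)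
  then show ?thesis using triangle[of "x \<ominus> x'" "y \<ominus> y'"] by simp
qed

lemma smult_diff_eq:
  assumes [simp]: "x \<in> carrier A" "x' \<in> carrier A"
  shows "nrm A ((c \<odot> x) \<ominus> (c \<odot> x')) = cmod c * nrm A (x \<ominus> x')"
proof -
  have "(c \<odot> x) \<ominus> (c \<odot> x') = c \<odot> (x \<ominus> x')"
    by (simp add: minus_sm sm_add_r sm_assoc mult.commute)
  then show ?thesis using smult_eq[of "x \<ominus> x'" c] by simp
qed

lemma cau_add: "cau X ==> cau Y ==> cau (\<lambda>n. X n \<oplus> Y n)"
  by (rule cau_dominated[of X Y _ 1]) (auto intro: add_diff_le)

lemma cau_smult: "cau X ==> cau (\<lambda>n. c \<odot> X n)"
  by (rule cau_dominated[of X X _ "cmod c"]) (auto simp: smult_diff_eq nonneg mult_left_mono)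

lemma sim_add: "cau X ==> cau Y ==> cau X' ==> cau Y' ==> sim X X' ==> sim Y Y' ==>
    sim (\<lambda>n. X n \<oplus> Y n) (\<lambda>n. X' n \<oplus> Y' n)"
  by (rule sim_dominated[of X X' Y Y' _ _ 1]) (auto intro: add_diff_le)

lemma sim_smult: "cau X ==> cau X' ==> sim X X' ==> sim (\<lambda>n. c \<odot> X n) (\<lambda>n. c \<odot> X' n)"
  by (rule sim_dominated[of X X' X X' _ _ "cmod c"]) (auto simp: smult_diff_eq nonneg mult_left_mono)

lemma real_Cauchy:
  assumes X: "cau X" and le: "\<And>x y. x \<in> carrier A ==> y \<in> carrier A ==> dist (f x) (f y :: 'b::complete_space) \<le> K * nrm A (x \<ominus> y)"
  shows "convergent (\<lambda>n. f (X n))"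
proof (rule Cauchy_convergent, rule metric_CauchyI)
  fix e :: real assume e: "e > 0"
  define K' where "K' = max K 1"
  have K': "K' > 0" by (simp add: K'_def)
  then obtain N where N: "\<And>m n. m \<ge> N ==> n \<ge> N ==> nrm A (X m \<ominus> X n) < e / K'"
    using X e unfolding alg_cauchy_def by (meson divide_pos_pos)
  have "dist (f (X m)) (f (X n)) < e" if "m \<ge> N" "n \<ge> N" for m n
  proof -
    have "dist (f (X m)) (f (X n)) \<le> K * nrm A (X m \<ominus> X n)" using X by (intro le) simp_all
    also have "\<dots> \<le> K' * nrm A (X m \<ominus> X n)"
      unfolding K'_def using X by (intro mult_right_mono nonneg) (simp_all add: minus_sm)
    also have "\<dots> < e" using N[OF that] K' by (simp add: field_simps)
    finally show ?thesis .
  qed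
  then show "\<exists>M. \<forall>m\<ge>M. \<forall>n\<ge>M. dist (f (X m)) (f (X n)) < e" by blast
qed

lemma nrm_convergent: "cau X ==> convergent (\<lambda>n. nrm A (X n))"
  by (rule real_Cauchy[of X "nrm A" 1]) (simp_all add: dist_real_def abs_diff_le)

lemma lim_nrm: "cau X ==> (\<lambda>n. nrm A (X n)) \<longlonglongrightarrow> lim (\<lambda>n. nrm A (X n))"
  using nrm_convergent by (simp add: convergent_LIMSEQ_iff)

lemma cau_bounded:
  assumes "cau X" obtains K where "K > 0" "\<And>n. nrm A (X n) \<le> K"
proof -
  obtain K where "K > 0" "\<And>n. norm (nrm A (X n)) \<le> K"
    using convergent_imp_Bseq[OF nrm_convergent[OF assms]] by (auto simp: Bseq_def)
  then show thesis using that[of K] by (simp add: abs_le_iff)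
qed

lemma lim_eq_of_sim:
  assumes X: "cau X" "cau Y" and s: "sim X Y"
    and le: "\<And>x y. x \<in> carrier A ==> y \<in> carrier A ==> \<bar>f x - f y\<bar> \<le> nrm A (x \<ominus> y)"
    and l: "(\<lambda>n. f (X n)) \<longlonglongrightarrow> (l::real)"
  shows "(\<lambda>n. f (Y n)) \<longlonglongrightarrow> l"
proof -
  have "(\<lambda>n. f (X n) - f (Y n)) \<longlonglongrightarrow> 0"
    by (rule Lim_null_comparison[OF _ s[unfolded sim_def]]) (use X in \<open>simp add: le\<close>)
  from tendsto_diff[OF l this] show ?thesis by simp
qed

lemma class_eq: "cau X ==> cau Y ==> cauchy_class A X = cauchy_class A Y \<longleftrightarrow> sim X Y"
proof
  assume c: "cau X" "cau Y" and "cauchy_class A X = cauchy_class A Y"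
  moreover have "Y \<in> cauchy_class A Y" using c sim_refl by (simp add: cauchy_class_def sim_def)
  ultimately show "sim X Y" by (auto simp: cauchy_class_def sim_def)
next
  assume c: "cau X" "cau Y" and s: "sim X Y"
  have "sim X Z \<longleftrightarrow> sim Y Z" if "cau Z" for Z using c s that by (meson sim_sym sim_trans)
  then show "cauchy_class A X = cauchy_class A Y" by (auto simp: cauchy_class_def sim_def)
qed

lemma class_rep: assumes "cau X"
  shows "cau (cauchy_rep (cauchy_class A X)) \<and> sim (cauchy_rep (cauchy_class A X)) X"
proof -
  have "X \<in> cauchy_class A X" using assms sim_refl by (simp add: cauchy_class_def sim_def)
  then have "cauchy_rep (cauchy_class A X) \<in> cauchy_class A X" unfolding cauchy_rep_def by (rule someI[of "\<lambda>Y. Y \<in> cauchy_class A X"])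
  then have "cau (cauchy_rep (cauchy_class A X))" "sim X (cauchy_rep (cauchy_class A X))"
    by (simp_all add: cauchy_class_def sim_def)
  then show ?thesis using assms sim_sym by blast
qed

end

text \<open>\<open>Q\<close> identifies equivalent Cauchy sequences and \<open>rep\<close> chooses representatives; this covers
  both the completion of an algebra (classes) and Hilbert spaces (canonical sequences).\<close>

locale quotient_space = seminormed A for A :: "('a, 'z) normed_star_algebra_scheme" (structure) +
  fixes Q :: "(nat => 'a) => 'q" and rep :: "'q => nat => 'a"
  assumes Q_eq: "alg_cauchy A X ==> alg_cauchy A Y ==> Q X = Q Y \<longleftrightarrow> sim X Y"
    and rep_Q: "alg_cauchy A X ==> alg_cauchy A (rep (Q X)) \<and> sim (rep (Q X)) X"
begin

lemma Q_add: "cau X ==> cau Y ==> Q (\<lambda>n. rep (Q X) n \<oplus> rep (Q Y) n) = Q (\<lambda>n. X n \<oplus> Y n)"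
  using rep_Q by (simp add: Q_eq cau_add sim_add)

lemma Q_smult: "cau X ==> Q (\<lambda>n. c \<odot> rep (Q X) n) = Q (\<lambda>n. c \<odot> X n)"
  using rep_Q by (simp add: Q_eq cau_smult sim_smult)

lemma quotient_module:
  fixes M :: "(complex, 'q, 'w) module_scheme"
  assumes car: "carrier M = Q ` {X. cau X}" and zero: "zero M = Q (\<lambda>n. \<zero>)"
    and add: "\<And>C D. add M C D = Q (\<lambda>n. rep C n \<oplus> rep D n)"
    and smult: "\<And>c C. smult M c C = Q (\<lambda>n. c \<odot> rep C n)"
  shows "Module.module complex_ring M"
proof -
  have cr: "cring complex_ring" by (rule R.is_cring)
  have cz: "cau (\<lambda>n. \<zero>)" by (simp add: cau_const)
  have addQ: "add M (Q X) (Q Y) = Q (\<lambda>n. X n \<oplus> Y n)" if "cau X" "cau Y" for X Y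
    by (simp add: add Q_add that)
  have smQ: "smult M c (Q X) = Q (\<lambda>n. c \<odot> X n)" if "cau X" for X c
    by (simp add: smult Q_smult that)
  note simps = addQ smQ zero cau_add cau_smult cz
  have neg: "Q (\<lambda>n. (-1) \<odot> X n \<oplus> X n) = zero M" if "cau X" for X
    using that by (simp add: zero sm_collect)
  have "abelian_group M"
  proof (rule abelian_groupI)
    fix x assume "x \<in> carrier M"
    then obtain X where X: "cau X" "x = Q X" by (auto simp: car)
    have "smult M (-1) x \<in> carrier M \<and> add M (smult M (-1) x) x = zero M"
      using X neg[OF X(1)] by (auto simp: simps car)
    then show "\<exists>y\<in>carrier M. add M y x = zero M" by blast
  qed (auto simp: car simps a_ac)
  moreover have "Module.module_axioms complex_ring M"
    by unfold_locales (auto simp: car simps sm_add_l sm_add_r sm_assoc)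
  ultimately show ?thesis using cr by (simp add: Module.module_def)
qed

end

section \<open>Products and adjoints on Cauchy sequences\<close>

locale seminormed_algebra = seminormed +
  assumes mult_le: "x \<in> carrier A ==> y \<in> carrier A ==> nrm A (x \<otimes> y) \<le> nrm A x * nrm A y"
    and star_eq: "x \<in> carrier A ==> nrm A (star A x) = nrm A x"
begin

lemma mult_diff_le:
  assumes [simp]: "x \<in> carrier A" "y \<in> carrier A" "x' \<in> carrier A" "y' \<in> carrier A"
  shows "nrm A ((x \<otimes> y) \<ominus> (x' \<otimes> y')) \<le> nrm A x * nrm A (y \<ominus> y') + nrm A (x \<ominus> x') * nrm A y'"
proof -
  have "(x \<otimes> y) \<ominus> (x' \<otimes> y') = x \<otimes> (y \<ominus> y') \<oplus> (x \<ominus> x') \<otimes> y'"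
    using cancel_middle[of "x \<otimes> y" "x \<otimes> y'" "(-1) \<odot> (x' \<otimes> y')" "-1"]
    by (simp add: minus_sm l_distr r_distr smult_l smult_r)
  then show ?thesis
    using triangle[of "x \<otimes> (y \<ominus> y')" "(x \<ominus> x') \<otimes> y'"] mult_le[of x "y \<ominus> y'"] mult_le[of "x \<ominus> x'" y']
    by (simp add: minus_sm)
qed

lemma mult_diff_bounded:
  assumes c: "x \<in> carrier A" "y \<in> carrier A" "x' \<in> carrier A" "y' \<in> carrier A"
    and b: "nrm A x \<le> K" "nrm A y' \<le> L"
  shows "nrm A ((x \<otimes> y) \<ominus> (x' \<otimes> y')) \<le> (K + L) * (nrm A (x \<ominus> x') + nrm A (y \<ominus> y'))"
proof -
  have nn: "nrm A (x \<ominus> x') \<ge> 0" "nrm A (y \<ominus> y') \<ge> 0" "K \<ge> 0" "L \<ge> 0"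
    using c b nonneg[of x] nonneg[of y'] by (simp_all add: nonneg, linarith+)
  have "nrm A ((x \<otimes> y) \<ominus> (x' \<otimes> y')) \<le> K * nrm A (y \<ominus> y') + nrm A (x \<ominus> x') * L"
    using mult_diff_le[OF c] mult_right_mono[OF b(1) nn(2)] mult_left_mono[OF b(2) nn(1)] by linarith
  also have "\<dots> \<le> (K + L) * (nrm A (x \<ominus> x') + nrm A (y \<ominus> y'))"
    using nn by (simp add: algebra_simps)
  finally show ?thesis .
qed

lemma cau_mult: assumes X: "cau X" and Y: "cau Y" shows "cau (\<lambda>n. X n \<otimes> Y n)"
proof -
  obtain K where K: "K > 0" "\<forall>n. nrm A (X n) \<le> K" using cau_bounded[OF X] by metis
  obtain L where L: "L > 0" "\<forall>n. nrm A (Y n) \<le> L" using cau_bounded[OF Y] by metis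
  show ?thesis
  proof (rule cau_dominated[OF X Y])
    show "nrm A ((X m \<otimes> Y m) \<ominus> (X n \<otimes> Y n)) \<le> (K + L) * (nrm A (X m \<ominus> X n) + nrm A (Y m \<ominus> Y n))" for m n
      using K L X Y by (intro mult_diff_bounded) simp_all
  qed (use K L X Y in simp_all)
qed

lemma sim_mult:
  assumes c: "cau X" "cau Y" "cau X'" "cau Y'" and s: "sim X X'" "sim Y Y'"
  shows "sim (\<lambda>n. X n \<otimes> Y n) (\<lambda>n. X' n \<otimes> Y' n)"
proof -
  obtain K where K: "\<forall>n. nrm A (X n) \<le> K" using cau_bounded[OF c(1)] by metis
  obtain L where L: "\<forall>n. nrm A (Y' n) \<le> L" using cau_bounded[OF c(4)] by metis
  show ?thesis
  proof (rule sim_dominated[OF s])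
    show "nrm A ((X n \<otimes> Y n) \<ominus> (X' n \<otimes> Y' n)) \<le> (K + L) * (nrm A (X n \<ominus> X' n) + nrm A (Y n \<ominus> Y' n))" for n
      using K L c by (intro mult_diff_bounded) simp_all
  qed (use c in simp_all)
qed

lemma star_diff_eq: "x \<in> carrier A ==> y \<in> carrier A ==> nrm A (star A x \<ominus> star A y) = nrm A (x \<ominus> y)"
  using star_eq[of "x \<ominus> y"] by (simp add: minus_sm star_add star_smult)

lemma cau_star: "cau X ==> cau (\<lambda>n. star A (X n))"
  by (rule cau_dominated[of X X _ 1]) (auto simp: star_diff_eq nonneg)

lemma sim_star: "cau X ==> cau X' ==> sim X X' ==> sim (\<lambda>n. star A (X n)) (\<lambda>n. star A (X' n))"
  by (rule sim_dominated[of X X' X X' _ _ 1]) (auto simp: star_diff_eq nonneg)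

end

locale completable = seminormed_algebra A for A :: "'a normed_star_algebra" (structure)

sublocale completable \<subseteq> quotient_space A "cauchy_class A" cauchy_rep
  by unfold_locales (simp_all add: class_eq class_rep)

context completable
begin

abbreviation "cls \<equiv> cauchy_class A"

lemma completion_carrier: "carrier (completion A) = cls ` {X. cau X}"
  by (simp add: completion_def)

lemma completion_ops:
  assumes "cau X" "cau Y"
  shows "cls X \<oplus>\<^bsub>completion A\<^esub> cls Y = cls (\<lambda>n. X n \<oplus> Y n)"
    "cls X \<otimes>\<^bsub>completion A\<^esub> cls Y = cls (\<lambda>n. X n \<otimes> Y n)"
  using assms rep_Q by (simp_all add: completion_def Q_add class_eq cau_mult sim_mult)

lemma completion_ops1:
  assumes "cau X"
  shows "c \<odot>\<^bsub>completion A\<^esub> cls X = cls (\<lambda>n. c \<odot> X n)"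
    "star (completion A) (cls X) = cls (\<lambda>n. star A (X n))"
  using assms rep_Q by (simp_all add: completion_def Q_smult class_eq cau_star sim_star)

lemma completion_zero: "\<zero>\<^bsub>completion A\<^esub> = cls (\<lambda>n. \<zero>)"
  by (simp add: completion_def)

lemma completion_nrm:
  assumes "cau X" shows "(\<lambda>n. nrm A (X n)) \<longlonglongrightarrow> nrm (completion A) (cls X)"
proof -
  have "(\<lambda>n. nrm A (cauchy_rep (cls X) n)) \<longlonglongrightarrow> lim (\<lambda>n. nrm A (cauchy_rep (cls X) n))"
    using rep_Q[OF assms] by (intro lim_nrm) simp
  then have "(\<lambda>n. nrm A (X n)) \<longlonglongrightarrow> lim (\<lambda>n. nrm A (cauchy_rep (cls X) n))"
    using rep_Q[OF assms] assms by (intro lim_eq_of_sim[of "cauchy_rep (cls X)" X "nrm A"] abs_diff_le) auto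
  then show ?thesis by (simp add: completion_def)
qed

sublocale C: star_algebra "completion A"
proof -
  have "Module.module complex_ring (completion A)"
    by (rule quotient_module) (simp_all add: completion_def)
  then interpret CM: Module.module complex_ring "completion A" .
  show "star_algebra (completion A)"
    by unfold_locales
      (auto simp: completion_carrier completion_ops completion_ops1 cau_mult cau_add cau_star cau_smult
        m_assoc l_distr r_distr smult_l smult_r star_add star_smult star_mult)
qed

lemma completion_minus:
  "cau X ==> cau Y ==> cls X \<ominus>\<^bsub>completion A\<^esub> cls Y = cls (\<lambda>n. X n \<ominus> Y n)"
  by (simp add: C.minus_sm minus_sm completion_carrier completion_ops completion_ops1 cau_smult)

lemma cls_in [simp]: "cau X ==> cls X \<in> carrier (completion A)"
  by (simp add: completion_carrier)

lemma completion_cases: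
  assumes "C \<in> carrier (completion A)" obtains X where "cau X" "C = cls X"
  using assms by (auto simp: completion_carrier)

lemma completion_nrm_eq_0: "C \<in> carrier (completion A) ==> nrm (completion A) C = 0 \<longleftrightarrow> C = \<zero>\<^bsub>completion A\<^esub>"
proof (elim completion_cases)
  fix X assume X: "cau X" "C = cls X"
  have z: "(\<lambda>n. nrm A (X n \<ominus> \<zero>)) = (\<lambda>n. nrm A (X n))" using X by (simp add: minus_sm)
  have "C = \<zero>\<^bsub>completion A\<^esub> \<longleftrightarrow> (\<lambda>n. nrm A (X n)) \<longlonglongrightarrow> 0"
    using X by (simp add: completion_zero class_eq cau_const sim_def z)
  then show ?thesis using completion_nrm[OF X(1)] X(2) LIMSEQ_unique by metis
qed

lemma dense_embed:
  assumes "C \<in> carrier (completion A)" "e > 0"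
  obtains a where "a \<in> carrier A" "nrm (completion A) (C \<ominus>\<^bsub>completion A\<^esub> completion_embed A a) < e"
proof -
  obtain X where X: "cau X" "C = cls X" using assms by (elim completion_cases)
  obtain N where N: "\<And>m n. m \<ge> N ==> n \<ge> N ==> nrm A (X m \<ominus> X n) < e / 2"
    using X(1) assms(2) unfolding alg_cauchy_def by (meson half_gt_zero)
  have c: "cau (\<lambda>n. X n \<ominus> X N)" using X by (simp add: minus_sm cau_add cau_smult cau_const)
  have "(\<lambda>n. nrm A (X n \<ominus> X N)) \<longlonglongrightarrow> nrm (completion A) (C \<ominus>\<^bsub>completion A\<^esub> completion_embed A (X N))"
    using completion_nrm[OF c] X by (simp add: completion_embed_def completion_minus cau_const)
  then have "nrm (completion A) (C \<ominus>\<^bsub>completion A\<^esub> completion_embed A (X N)) \<le> e / 2"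
    by (rule LIMSEQ_le_const2) (use N less_imp_le in blast)
  then show thesis using that[of "X N"] X assms(2) by simp
qed

lemma embed_hom:
  assumes "a \<in> carrier A" "b \<in> carrier A"
  shows "completion_embed A a \<in> carrier (completion A)"
    "completion_embed A (a \<oplus> b) = completion_embed A a \<oplus>\<^bsub>completion A\<^esub> completion_embed A b"
    "completion_embed A (a \<otimes> b) = completion_embed A a \<otimes>\<^bsub>completion A\<^esub> completion_embed A b"
    "completion_embed A (c \<odot> a) = c \<odot>\<^bsub>completion A\<^esub> completion_embed A a"
    "completion_embed A (star A a) = star (completion A) (completion_embed A a)"
    "nrm (completion A) (completion_embed A a) = nrm A a"
  using assms completion_nrm[of "\<lambda>n. a"]
  by (simp_all add: completion_embed_def completion_ops completion_ops1 cau_const LIMSEQ_const_iff)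

end

text \<open>A \<open>C\<^sup>*\<close>-seminorm on a star algebra that is independent of the norm in the record.\<close>

locale cstar_seminorm = star_algebra A for A :: "('a, 'z) star_algebra_scheme" (structure) +
  fixes \<nu> :: "'a => real"
  assumes c_nonneg: "x \<in> carrier A ==> 0 \<le> \<nu> x"
    and c_smult: "x \<in> carrier A ==> \<nu> (c \<odot> x) = cmod c * \<nu> x"
    and c_triangle: "x \<in> carrier A ==> y \<in> carrier A ==> \<nu> (x \<oplus> y) \<le> \<nu> x + \<nu> y"
    and c_mult: "x \<in> carrier A ==> y \<in> carrier A ==> \<nu> (x \<otimes> y) \<le> \<nu> x * \<nu> y"
    and c_star: "x \<in> carrier A ==> \<nu> (star A x) = \<nu> x"
    and c_star_mult: "x \<in> carrier A ==> \<nu> (star A x \<otimes> x) = (\<nu> x)\<^sup>2"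

lemma (in star_algebra) star_algebra: "star_algebra A" by unfold_locales

text \<open>The C*-identity survives a supremum since squaring is monotone on nonnegative numbers.
  Homogeneity follows from the inequality for c and the one for 1/c.\<close>

lemma cstar_seminorm_SUP:
  fixes A :: "('a, 'z) star_algebra_scheme" (structure)
  assumes I: "I \<noteq> {}" and \<nu>: "\<And>i. i \<in> I ==> cstar_seminorm A (\<nu> i)"
    and bdd: "\<And>x. x \<in> carrier A ==> bdd_above ((\<lambda>i. \<nu> i x) ` I)"
  shows "cstar_seminorm A (\<lambda>x. SUP i\<in>I. \<nu> i x)"
proof -
  obtain i0 where i0: "i0 \<in> I" using I by blast
  interpret cstar_seminorm A "\<nu> i0" using \<nu> i0 by blast
  define N where "N x = (SUP i\<in>I. \<nu> i x)" for x
  have le: "\<nu> i x \<le> N x" if "i \<in> I" "x \<in> carrier A" for i x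
    unfolding N_def by (rule cSUP_upper[OF that(1) bdd[OF that(2)]])
  have least: "N x \<le> K" if "\<And>i. i \<in> I ==> \<nu> i x \<le> K" for x K
    unfolding N_def using I that by (rule cSUP_least)
  have nn: "0 \<le> \<nu> i x" if "i \<in> I" "x \<in> carrier A" for i x
    using \<nu>[OF that(1)] that(2) by (rule cstar_seminorm.c_nonneg)
  have N0: "0 \<le> N x" if "x \<in> carrier A" for x using le[OF i0 that] nn[OF i0 that] by linarith
  have sm: "N (c \<odot> x) \<le> cmod c * N x" if x: "x \<in> carrier A" for c x
    by (rule least) (use cstar_seminorm.c_smult[OF \<nu>] x le in \<open>simp add: mult_left_mono\<close>)
  have "cstar_seminorm A N"
  proof (unfold_locales, goal_cases)
    case (2 x c)
    show ?case
    proof (cases "c = 0")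
      case True
      then show ?thesis using sm[OF 2, of c] N0[of "c \<odot> x"] 2 by simp
    next
      case False
      have "N x \<le> cmod (1 / c) * N (c \<odot> x)"
        using sm[of "c \<odot> x" "1 / c"] 2 False by (simp add: sm_assoc)
      then have "cmod c * N x \<le> N (c \<odot> x)" using False by (simp add: norm_divide field_simps)
      then show ?thesis using sm[OF 2, of c] by simp
    qed
  next
    case (3 x y)
    show ?case
      by (rule least) (use cstar_seminorm.c_triangle[OF \<nu> 3] le 3 in \<open>smt (verit)\<close>)
  next
    case (4 x y)
    show ?case
    proof (rule least)
      fix i assume i: "i \<in> I"
      have "\<nu> i (x \<otimes> y) \<le> \<nu> i x * \<nu> i y" using \<nu>[OF i] 4 by (rule cstar_seminorm.c_mult)
      also have "\<dots> \<le> N x * N y" using i 4 by (intro mult_mono le N0 nn)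
      finally show "\<nu> i (x \<otimes> y) \<le> N x * N y" .
    qed
  next
    case (5 x)
    then show ?case unfolding N_def using cstar_seminorm.c_star[OF \<nu>] by simp
  next
    case (6 x)
    have sq: "\<nu> i (star A x \<otimes> x) = (\<nu> i x)\<^sup>2" if "i \<in> I" for i
      using \<nu>[OF that] 6 by (rule cstar_seminorm.c_star_mult)
    have "N (star A x \<otimes> x) \<le> (N x)\<^sup>2"
      by (rule least) (use sq le nn 6 in \<open>simp add: power_mono\<close>)
    moreover have "N x \<le> sqrt (N (star A x \<otimes> x))"
      by (rule least) (use sq le[of _ "star A x \<otimes> x"] 6 in \<open>simp add: real_le_rsqrt\<close>)
    then have "(N x)\<^sup>2 \<le> N (star A x \<otimes> x)"
      using N0[OF 6] N0[of "star A x \<otimes> x"] 6 by (metis abs_of_nonneg m_closed power2_abs real_sqrt_le_iff real_sqrt_pow2_iff real_sqrt_power star_closed)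
    ultimately show ?case by simp
  qed (use N0 in auto)
  then show ?thesis by (simp add: N_def[abs_def])
qed

context completable
begin

lemma completion_pre_cstar:
  assumes "\<And>x. x \<in> carrier A ==> nrm A (star A x \<otimes> x) = (nrm A x)\<^sup>2"
  shows "pre_cstar (completion A)"
proof (unfold_locales, goal_cases)
  case (1 x)
  then show ?case by (rule completion_nrm_eq_0)
next
  case (2 x)
  then obtain X where X: "cau X" "x = cls X" by (elim completion_cases)
  show ?case using completion_nrm[OF X(1)] X by (auto intro!: LIMSEQ_le_const nonneg)
next
  case (3 x c)
  then obtain X where X: "cau X" "x = cls X" by (elim completion_cases)
  have "(\<lambda>n. nrm A (c \<odot> X n)) \<longlonglongrightarrow> nrm (completion A) (c \<odot>\<^bsub>completion A\<^esub> x)"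
    using completion_nrm[OF cau_smult[OF X(1), of c]] X by (simp add: completion_ops1)
  moreover have "(\<lambda>n. nrm A (c \<odot> X n)) \<longlonglongrightarrow> cmod c * nrm (completion A) x"
    using tendsto_mult_left[OF completion_nrm[OF X(1)], of "cmod c"] X by (simp add: smult_eq)
  ultimately show ?case by (rule LIMSEQ_unique)
next
  case (4 x y)
  then obtain X Y where X: "cau X" "x = cls X" and Y: "cau Y" "y = cls Y" by (metis completion_cases)
  have 1: "(\<lambda>n. nrm A (X n \<oplus> Y n)) \<longlonglongrightarrow> nrm (completion A) (x \<oplus>\<^bsub>completion A\<^esub> y)"
    using completion_nrm[OF cau_add[OF X(1) Y(1)]] X Y by (simp add: completion_ops)
  have 2: "(\<lambda>n. nrm A (X n) + nrm A (Y n)) \<longlonglongrightarrow> nrm (completion A) x + nrm (completion A) y"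
    unfolding X Y by (intro tendsto_add completion_nrm X Y)
  show ?case by (rule LIMSEQ_le[OF 1 2]) (use X Y triangle in auto)
next
  case (5 x y)
  then obtain X Y where X: "cau X" "x = cls X" and Y: "cau Y" "y = cls Y" by (metis completion_cases)
  have 1: "(\<lambda>n. nrm A (X n \<otimes> Y n)) \<longlonglongrightarrow> nrm (completion A) (x \<otimes>\<^bsub>completion A\<^esub> y)"
    using completion_nrm[OF cau_mult[OF X(1) Y(1)]] X Y by (simp add: completion_ops)
  have 2: "(\<lambda>n. nrm A (X n) * nrm A (Y n)) \<longlonglongrightarrow> nrm (completion A) x * nrm (completion A) y"
    unfolding X Y by (intro tendsto_mult completion_nrm X Y)
  show ?case by (rule LIMSEQ_le[OF 1 2]) (use X Y mult_le in auto)
next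
  case (6 x)
  then obtain X where X: "cau X" "x = cls X" by (elim completion_cases)
  have "(\<lambda>n. nrm A (star A (X n) \<otimes> X n)) \<longlonglongrightarrow> nrm (completion A) (star (completion A) x \<otimes>\<^bsub>completion A\<^esub> x)"
    using completion_nrm[OF cau_mult[OF cau_star[OF X(1)] X(1)]] X by (simp add: completion_ops completion_ops1 cau_star)
  moreover have "(\<lambda>n. nrm A (star A (X n) \<otimes> X n)) \<longlonglongrightarrow> (nrm (completion A) x)\<^sup>2"
    using tendsto_power[OF completion_nrm[OF X(1)], of 2] X by (simp add: assms)
  ultimately show ?case by (rule LIMSEQ_unique)
qed

text \<open>Carries a C*-seminorm that differs from the norm of the record to the completion. It is
  applied to the seminorm of the image under one morphism, while the completion is taken in the
  weighted sum norm.\<close>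

lemma completion_cstar_seminorm:
  assumes \<nu>: "cstar_seminorm A \<nu>" and le: "\<And>x. x \<in> carrier A ==> \<nu> x \<le> nrm A x"
    and \<nu>': "\<And>X. cau X ==> (\<lambda>n. \<nu> (X n)) \<longlonglongrightarrow> \<nu>' (cls X)"
  shows "cstar_seminorm (completion A) \<nu>'"
proof -
  interpret V: cstar_seminorm A \<nu> by (rule \<nu>)
  show ?thesis
  proof (unfold_locales, goal_cases)
    case (1 x)
    then obtain X where X: "cau X" "x = cls X" by (elim completion_cases)
    show ?case using \<nu>'[OF X(1)] X by (auto intro!: LIMSEQ_le_const V.c_nonneg)
  next
    case (2 x c)
    then obtain X where X: "cau X" "x = cls X" by (elim completion_cases)
    have "(\<lambda>n. \<nu> (c \<odot> X n)) \<longlonglongrightarrow> \<nu>' (c \<odot>\<^bsub>completion A\<^esub> x)"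
      using \<nu>'[OF cau_smult[OF X(1), of c]] X by (simp add: completion_ops1)
    moreover have "(\<lambda>n. \<nu> (c \<odot> X n)) \<longlonglongrightarrow> cmod c * \<nu>' x"
      using tendsto_mult_left[OF \<nu>'[OF X(1)], of "cmod c"] X by (simp add: V.c_smult)
    ultimately show ?case by (rule LIMSEQ_unique)
  next
    case (3 x y)
    then obtain X Y where X: "cau X" "x = cls X" and Y: "cau Y" "y = cls Y" by (metis completion_cases)
    have 1: "(\<lambda>n. \<nu> (X n \<oplus> Y n)) \<longlonglongrightarrow> \<nu>' (x \<oplus>\<^bsub>completion A\<^esub> y)"
      using \<nu>'[OF cau_add[OF X(1) Y(1)]] X Y by (simp add: completion_ops)
    have 2: "(\<lambda>n. \<nu> (X n) + \<nu> (Y n)) \<longlonglongrightarrow> \<nu>' x + \<nu>' y"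
      unfolding X Y by (intro tendsto_add \<nu>' X Y)
    show ?case by (rule LIMSEQ_le[OF 1 2]) (use X Y V.c_triangle in auto)
  next
    case (4 x y)
    then obtain X Y where X: "cau X" "x = cls X" and Y: "cau Y" "y = cls Y" by (metis completion_cases)
    have 1: "(\<lambda>n. \<nu> (X n \<otimes> Y n)) \<longlonglongrightarrow> \<nu>' (x \<otimes>\<^bsub>completion A\<^esub> y)"
      using \<nu>'[OF cau_mult[OF X(1) Y(1)]] X Y by (simp add: completion_ops)
    have 2: "(\<lambda>n. \<nu> (X n) * \<nu> (Y n)) \<longlonglongrightarrow> \<nu>' x * \<nu>' y"
      unfolding X Y by (intro tendsto_mult \<nu>' X Y)
    show ?case by (rule LIMSEQ_le[OF 1 2]) (use X Y V.c_mult in auto)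
  next
    case (5 x)
    then obtain X where X: "cau X" "x = cls X" by (elim completion_cases)
    have "(\<lambda>n. \<nu> (star A (X n))) \<longlonglongrightarrow> \<nu>' (star (completion A) x)"
      using \<nu>'[OF cau_star[OF X(1)]] X by (simp add: completion_ops1)
    moreover have "(\<lambda>n. \<nu> (star A (X n))) \<longlonglongrightarrow> \<nu>' x" using \<nu>'[OF X(1)] X by (simp add: V.c_star)
    ultimately show ?case by (rule LIMSEQ_unique)
  next
    case (6 x)
    then obtain X where X: "cau X" "x = cls X" by (elim completion_cases)
    have "(\<lambda>n. \<nu> (star A (X n) \<otimes> X n)) \<longlonglongrightarrow> \<nu>' (star (completion A) x \<otimes>\<^bsub>completion A\<^esub> x)"
      using \<nu>'[OF cau_mult[OF cau_star[OF X(1)] X(1)]] X by (simp add: completion_ops completion_ops1 cau_star)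
    moreover have "(\<lambda>n. \<nu> (star A (X n) \<otimes> X n)) \<longlonglongrightarrow> (\<nu>' x)\<^sup>2"
      using tendsto_power[OF \<nu>'[OF X(1)], of 2] X by (simp add: V.c_star_mult)
    ultimately show ?case by (rule LIMSEQ_unique)
  qed
qed

end

section \<open>The host algebra\<close>

text \<open>Finitely supported functions are known by their pairings with all scalar functions.
  Convolution becomes an iterated pairing, so that associativity of the algebra is associativity
  inside the argument of \<xi>.\<close>

definition pairing :: "('s => complex) => ('s => complex) => complex" where
  "pairing f \<xi> = (\<Sum>s | f s \<noteq> 0. f s * \<xi> s)"

lemma pairing_superset:
  "finite T ==> {s. f s \<noteq> 0} \<subseteq> T ==> pairing f \<xi> = (\<Sum>s\<in>T. f s * \<xi> s)"
  unfolding pairing_def by (rule sum.mono_neutral_left) auto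

lemma pairing_ext:
  fixes f g :: "'s => complex"
  assumes "finite {s. f s \<noteq> 0}" "finite {s. g s \<noteq> 0}" "\<And>\<xi>. pairing f \<xi> = pairing g \<xi>"
  shows "f = g"
proof
  fix u
  have *: "pairing f (\<lambda>s. if s = u then 1 else 0) = f u" if "finite {s. f s \<noteq> 0}" for f :: "'s => complex"
    using that by (simp add: pairing_def if_distrib[of "\<lambda>x. _ * x"] sum.delta cong: if_cong)
  show "f u = g u" using *[OF assms(1)] *[OF assms(2)] assms(3) by metis
qed

lemma pairing_add: "finite {s. f s \<noteq> 0} ==> finite {s. g s \<noteq> 0} ==>
    pairing (\<lambda>s. f s + g s) \<xi> = pairing f \<xi> + pairing g \<xi>"
proof -
  assume fin: "finite {s. f s \<noteq> 0}" "finite {s. g s \<noteq> 0}"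
  define T where "T = {s. f s \<noteq> 0} \<union> {s. g s \<noteq> 0}"
  have T: "finite T" using fin by (simp add: T_def)
  show ?thesis
    using pairing_superset[OF T, of f \<xi>] pairing_superset[OF T, of g \<xi>] pairing_superset[OF T, of "\<lambda>s. f s + g s" \<xi>]
    by (force simp: T_def sum.distrib distrib_right)
qed

lemma pairing_smult: "finite {s. f s \<noteq> 0} ==> pairing (\<lambda>s. c * f s) \<xi> = c * pairing f \<xi>"
  using pairing_superset[of "{s. f s \<noteq> 0}" "\<lambda>s. c * f s" \<xi>] pairing_superset[of "{s. f s \<noteq> 0}" f \<xi>]
  by (force simp: sum_distrib_left mult.assoc)

lemma pairing_zero [simp]: "pairing (\<lambda>s. 0) \<xi> = 0"
  by (simp add: pairing_def)

lemma pairing_add_right: "pairing f (\<lambda>s. \<xi> s + \<psi> s) = pairing f \<xi> + pairing f \<psi>"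
  by (simp add: pairing_def sum.distrib distrib_left)

lemma pairing_smult_right: "pairing f (\<lambda>s. c * \<xi> s) = c * pairing f \<xi>"
  by (simp add: pairing_def sum_distrib_left mult_ac)

lemma pairing_bound: "(\<And>s. cmod (\<xi> s) \<le> b s) ==> cmod (pairing f \<xi>) \<le> (\<Sum>s | f s \<noteq> 0. cmod (f s) * b s)"
  unfolding pairing_def by (rule sum_norm_le) (simp add: norm_mult mult_left_mono)

lemma pairing_delta [simp]: "pairing (delta s) \<xi> = \<xi> s"
proof -
  have "{t. delta s t \<noteq> 0} = {s}" by (auto simp: delta_def)
  then show ?thesis by (simp add: pairing_def delta_def)
qed

lemma finite_delta [simp]: "finite {t. delta s t \<noteq> 0}"
proof -
  have "{t. delta s t \<noteq> 0} = {s}" by (auto simp: delta_def)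
  then show ?thesis by simp
qed

locale valued_semigroup =
  fixes S :: "('s::t2_space, 'f::complex_lcs) inv_semigroup" and \<alpha> :: "'s => real"
  assumes S: "complex_inv_semigroup S" and \<alpha>: "absolute_value S \<alpha>"
begin

abbreviation "L \<equiv> semigroup_algebra S \<alpha>"

lemma L_simps [simp]:
  "carrier L = {f. finite {s. f s \<noteq> 0}}" "\<zero>\<^bsub>L\<^esub> = (\<lambda>s. 0)"
  "f \<oplus>\<^bsub>L\<^esub> g = (\<lambda>s. f s + g s)" "c \<odot>\<^bsub>L\<^esub> f = (\<lambda>s. c * f s)"
  "star L f = (\<lambda>s. cnj (f (sg_star S s)))"
  by (simp_all add: semigroup_algebra_def)

lemma nrm_L: "nrm L f = (\<Sum>s | f s \<noteq> 0. cmod (f s) * \<alpha> s)"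
  by (simp add: semigroup_algebra_def)

lemma assoc: "sg_mult S (sg_mult S a b) c = sg_mult S a (sg_mult S b c)"
  and star_invol [simp]: "sg_star S (sg_star S a) = a"
  and star_antihom: "sg_star S (sg_mult S a b) = sg_mult S (sg_star S b) (sg_star S a)"
  using S by (auto simp: complex_inv_semigroup_def)

lemma \<alpha>_nonneg [simp]: "0 \<le> \<alpha> s" and \<alpha>_star [simp]: "\<alpha> (sg_star S s) = \<alpha> s"
  and \<alpha>_mult: "\<alpha> (sg_mult S s t) \<le> \<alpha> s * \<alpha> t"
  using \<alpha> by (auto simp: absolute_value_def)

text \<open>The convolution is a sum over pairs from the two supports, grouped by their product in
  S; pairing with \<xi> undoes the grouping.\<close>

lemma L_mult:
  assumes f: "finite {s. f s \<noteq> 0}" and g: "finite {s. g s \<noteq> 0}"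
  shows "finite {u. (f \<otimes>\<^bsub>L\<^esub> g) u \<noteq> 0}"
    "pairing (f \<otimes>\<^bsub>L\<^esub> g) \<xi> = pairing f (\<lambda>s. pairing g (\<lambda>t. \<xi> (sg_mult S s t)))"
proof -
  define P where "P = {s. f s \<noteq> 0} \<times> {t. g t \<noteq> 0}"
  define m where "m p = sg_mult S (fst p) (snd p)" for p
  have P: "finite P" using f g by (simp add: P_def)
  have eq: "(f \<otimes>\<^bsub>L\<^esub> g) u = (\<Sum>p\<in>{p\<in>P. m p = u}. f (fst p) * g (snd p))" for u
    unfolding semigroup_algebra_def by (simp add: case_prod_unfold P_def m_def mem_Times_iff conj_assoc)
  have sub: "{u. (f \<otimes>\<^bsub>L\<^esub> g) u \<noteq> 0} \<subseteq> m ` P"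
  proof
    fix u assume "u \<in> {u. (f \<otimes>\<^bsub>L\<^esub> g) u \<noteq> 0}"
    then have "{p\<in>P. m p = u} \<noteq> {}" unfolding eq by force
    then show "u \<in> m ` P" by auto
  qed
  then show "finite {u. (f \<otimes>\<^bsub>L\<^esub> g) u \<noteq> 0}" using P finite_subset by blast
  have "pairing (f \<otimes>\<^bsub>L\<^esub> g) \<xi> = (\<Sum>u\<in>m ` P. (\<Sum>p\<in>{p\<in>P. m p = u}. f (fst p) * g (snd p)) * \<xi> u)"
    using pairing_superset[OF finite_imageI[OF P, of m] sub, of \<xi>] by (simp only: eq[symmetric])
  also have "\<dots> = (\<Sum>u\<in>m ` P. \<Sum>p\<in>{p\<in>P. m p = u}. f (fst p) * g (snd p) * \<xi> (m p))"
    by (intro sum.cong refl) (simp add: sum_distrib_right)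
  also have "\<dots> = (\<Sum>p\<in>P. f (fst p) * g (snd p) * \<xi> (m p))"
    by (rule sum.image_gen[OF P, symmetric])
  also have "\<dots> = pairing f (\<lambda>s. pairing g (\<lambda>t. \<xi> (sg_mult S s t)))"
    unfolding pairing_def P_def by (simp add: sum.cartesian_product' m_def sum_distrib_left mult.assoc)
  finally show "pairing (f \<otimes>\<^bsub>L\<^esub> g) \<xi> = \<dots>" .
qed

lemma L_star:
  assumes f: "finite {s. f s \<noteq> 0}"
  shows "finite {s. cnj (f (sg_star S s)) \<noteq> 0}"
    "pairing (\<lambda>s. cnj (f (sg_star S s))) \<xi> = cnj (pairing f (\<lambda>s. cnj (\<xi> (sg_star S s))))"
    "(\<Sum>s | cnj (f (sg_star S s)) \<noteq> 0. cmod (cnj (f (sg_star S s))) * \<alpha> s) = nrm L f"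
proof -
  have b: "bij_betw (sg_star S) {s. f s \<noteq> 0} {s. cnj (f (sg_star S s)) \<noteq> 0}"
    by (rule bij_betwI[where g = "sg_star S"]) auto
  show "finite {s. cnj (f (sg_star S s)) \<noteq> 0}" using bij_betw_finite[OF b] f by simp
  show "pairing (\<lambda>s. cnj (f (sg_star S s))) \<xi> = cnj (pairing f (\<lambda>s. cnj (\<xi> (sg_star S s))))"
    unfolding pairing_def cnj_sum by (rule sum.reindex_bij_betw[OF b, symmetric, THEN trans]) simp
  show "(\<Sum>s | cnj (f (sg_star S s)) \<noteq> 0. cmod (cnj (f (sg_star S s))) * \<alpha> s) = nrm L f"
    unfolding nrm_L by (rule sum.reindex_bij_betw[OF b, symmetric, THEN trans]) simp
qed

lemma finite_add: "finite {s. f s \<noteq> (0::complex)} ==> finite {s. g s \<noteq> 0} ==> finite {s. f s + g s \<noteq> 0}"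
  by (rule finite_subset[of _ "{s. f s \<noteq> 0} \<union> {s. g s \<noteq> 0}"]) auto

lemma finite_smult: "finite {s. f s \<noteq> (0::complex)} ==> finite {s. c * f s \<noteq> 0}"
  by (rule finite_subset[of _ "{s. f s \<noteq> 0}"]) auto

lemma cring_complex_ring: "cring complex_ring"
proof (rule cringI)
  show "abelian_group complex_ring"
    by (rule abelian_groupI) (auto simp: complex_ring_def add_ac intro: exI[of _ "- _"] add.left_inverse)
  show "comm_monoid complex_ring"
    by (rule comm_monoidI) (auto simp: complex_ring_def)
qed (auto simp: complex_ring_def algebra_simps)

lemma L_module: "Module.module complex_ring L"
proof -
  have "abelian_group L"
  proof (rule abelian_groupI)
    fix f assume f: "f \<in> carrier L"
    have "(\<lambda>s. - f s) \<in> carrier L \<and> (\<lambda>s. - f s) \<oplus>\<^bsub>L\<^esub> f = \<zero>\<^bsub>L\<^esub>" using f by simp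
    then show "\<exists>g\<in>carrier L. g \<oplus>\<^bsub>L\<^esub> f = \<zero>\<^bsub>L\<^esub>" by blast
  qed (auto simp: add_ac finite_add)
  moreover have "Module.module_axioms complex_ring L"
    by unfold_locales (auto simp: complex_ring_def finite_smult algebra_simps)
  ultimately show ?thesis using cring_complex_ring by (simp add: Module.module_def)
qed

lemma L_star_algebra: "star_algebra L"
proof -
  interpret M: Module.module complex_ring L by (rule L_module)
  note fin = L_mult(1) finite_add finite_smult L_star(1)[simplified]
  note pr = L_mult(2) pairing_add pairing_smult L_star(2)
  show ?thesis
  proof (unfold_locales, goal_cases)
    case (1 f g) then show ?case by (simp add: fin)
  next
    case (2 f g h)
    then show ?case by (intro pairing_ext) (simp_all add: fin pr assoc)
  next
    case (3 f g h)
    then show ?case by (intro pairing_ext) (simp_all add: fin pr)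
  next
    case (4 f g h)
    then show ?case by (intro pairing_ext) (simp_all add: fin pr pairing_add_right)
  next
    case (5 f g c)
    then show ?case by (intro pairing_ext) (simp_all add: fin pr)
  next
    case (6 f g c)
    then show ?case by (intro pairing_ext) (simp_all add: fin pr pairing_smult_right)
  next
    case (7 f) then show ?case using L_star(1)[of f] by simp
  next
    case (8 f) then show ?case by simp
  next
    case (9 f g) then show ?case by simp
  next
    case (10 f c) then show ?case by simp
  next
    case (11 f g)
    have sw: "pairing f (\<lambda>s. pairing g (\<lambda>t. \<xi> s t)) = pairing g (\<lambda>t. pairing f (\<lambda>s. \<xi> s t))" for \<xi>
      unfolding pairing_def sum_distrib_left by (subst sum.swap) (simp add: mult_ac)
    show ?case
    proof (rule pairing_ext)
      show "finite {s. star L (f \<otimes>\<^bsub>L\<^esub> g) s \<noteq> 0}" using L_star(1)[OF L_mult(1)] 11 by simp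
      show "finite {s. (star L g \<otimes>\<^bsub>L\<^esub> star L f) s \<noteq> 0}" using L_mult(1)[OF L_star(1) L_star(1)] 11 by simp
      show "pairing (star L (f \<otimes>\<^bsub>L\<^esub> g)) \<xi> = pairing (star L g \<otimes>\<^bsub>L\<^esub> star L f) \<xi>" for \<xi>
        using 11 L_star(2)[OF L_mult(1), of f g \<xi>] L_mult(2)[OF L_star(1) L_star(1), of g f \<xi>]
        by (simp add: L_mult(2) L_star(2) star_antihom sw[of "\<lambda>s t. cnj (\<xi> (sg_mult S (sg_star S t) (sg_star S s)))"])
    qed
  qed
qed

lemma L_completable: "completable L"
proof -
  interpret star_algebra L by (rule L_star_algebra)
  have eq_superset: "nrm L f = (\<Sum>s\<in>T. cmod (f s) * \<alpha> s)" if "finite T" "{s. f s \<noteq> 0} \<subseteq> T" for f T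
    unfolding nrm_L by (rule sum.mono_neutral_left) (use that in auto)
  show ?thesis
  proof (unfold_locales, goal_cases)
    case (1 f) then show ?case unfolding nrm_L by (intro sum_nonneg) simp
  next
    case (2 f c)
    then have f: "finite {s. f s \<noteq> 0}" by simp
    have "nrm L (\<lambda>s. c * f s) = (\<Sum>s\<in>{s. f s \<noteq> 0}. cmod (c * f s) * \<alpha> s)"
      by (rule eq_superset[OF f]) auto
    then show ?case by (simp add: nrm_L norm_mult sum_distrib_left mult.assoc)
  next
    case (3 f g)
    define T where "T = {s. f s \<noteq> 0} \<union> {s. g s \<noteq> 0}"
    have T: "finite T" using 3 by (simp add: T_def)
    have "nrm L (\<lambda>s. f s + g s) = (\<Sum>s\<in>T. cmod (f s + g s) * \<alpha> s)" by (rule eq_superset[OF T]) (auto simp: T_def)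
    then have "nrm L (f \<oplus>\<^bsub>L\<^esub> g) = (\<Sum>s\<in>T. cmod (f s + g s) * \<alpha> s)" by simp
    also have "\<dots> \<le> (\<Sum>s\<in>T. cmod (f s) * \<alpha> s + cmod (g s) * \<alpha> s)"
      by (intro sum_mono) (metis \<alpha>_nonneg distrib_right mult_right_mono norm_triangle_ineq)
    also have "\<dots> = nrm L f + nrm L g"
    proof -
      have "nrm L f = (\<Sum>s\<in>T. cmod (f s) * \<alpha> s)" by (rule eq_superset[OF T]) (auto simp: T_def)
      moreover have "nrm L g = (\<Sum>s\<in>T. cmod (g s) * \<alpha> s)" by (rule eq_superset[OF T]) (auto simp: T_def)
      ultimately show ?thesis by (simp add: sum.distrib)
    qed
    finally show ?case .
  next
    case (4 f g)
    \<comment> \<open>A dual function that attains the norm: pairing the product with \<xi> gives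
      its weighted sum norm, and |\<xi>| \<le> \<alpha> allows the submultiplicativity of \<alpha>
      to be used in the iterated pairing.\<close>
    define \<xi> where "\<xi> u = cnj (sgn ((f \<otimes>\<^bsub>L\<^esub> g) u)) * complex_of_real (\<alpha> u)" for u
    have \<xi>: "cmod (\<xi> u) \<le> \<alpha> u" for u by (simp add: \<xi>_def norm_mult norm_sgn)
    have za: "z * (cnj (sgn z) * complex_of_real a) = complex_of_real (cmod z * a)" for z a
    proof (cases "z = 0")
      case False
      have "z * cnj (sgn z) = complex_of_real (cmod z)"
        using complex_norm_square[of z] False by (simp add: sgn_div_norm scaleR_conv_of_real field_simps power2_eq_square)
      then show ?thesis by (simp add: mult.assoc[symmetric])
    qed simp
    have "complex_of_real (nrm L (f \<otimes>\<^bsub>L\<^esub> g)) = pairing (f \<otimes>\<^bsub>L\<^esub> g) \<xi>"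
      unfolding nrm_L pairing_def \<xi>_def za of_real_sum ..
    also have "\<dots> = pairing f (\<lambda>s. pairing g (\<lambda>t. \<xi> (sg_mult S s t)))" using 4 by (simp add: L_mult)
    finally have "nrm L (f \<otimes>\<^bsub>L\<^esub> g) \<le> cmod (pairing f (\<lambda>s. pairing g (\<lambda>t. \<xi> (sg_mult S s t))))"
      by (metis abs_ge_self norm_of_real)
    also have "\<dots> \<le> (\<Sum>s | f s \<noteq> 0. cmod (f s) * (\<alpha> s * nrm L g))"
    proof (rule pairing_bound)
      fix s
      have "cmod (pairing g (\<lambda>t. \<xi> (sg_mult S s t))) \<le> (\<Sum>t | g t \<noteq> 0. cmod (g t) * (\<alpha> s * \<alpha> t))"
        by (rule pairing_bound) (rule order_trans[OF \<xi> \<alpha>_mult])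
      then show "cmod (pairing g (\<lambda>t. \<xi> (sg_mult S s t))) \<le> \<alpha> s * nrm L g"
        by (simp add: nrm_L sum_distrib_left mult_ac)
    qed
    also have "\<dots> = nrm L f * nrm L g" by (simp add: nrm_L sum_distrib_right mult.assoc)
    finally show ?case .
  next
    case (5 f) then show ?case using L_star(3)[of f] by (simp add: nrm_L)
  qed
qed

end

subsection \<open>Pulling back along a holomorphic morphism\<close>

context star_algebra
begin

lemma clin_finsum:
  assumes l: "clin l" and fin: "finite F" and f: "\<And>s. s \<in> F ==> f s \<in> carrier A"
  shows "l (finsum A f F) = (\<Sum>s\<in>F. l (f s))"
  using fin f by (induction F) (simp_all add: clin_zero[OF l] finsum_insert clin_add[OF l] Pi_def)

end

locale semigroup_morphism = valued_semigroup S \<alpha> + B: cstar_algebra B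
  for S :: "('s::t2_space, 'f::complex_lcs) inv_semigroup" and \<alpha>
    and B :: "(nat => 's => complex) normed_star_algebra" +
  fixes \<beta>
  assumes mor: "(B, \<beta>) \<in> holo_morphisms S \<alpha>"
begin

lemma \<beta>_in [simp]: "\<beta> s \<in> carrier B"
  and \<beta>_mult: "\<beta> (sg_mult S s t) = \<beta> s \<otimes>\<^bsub>B\<^esub> \<beta> t"
  and \<beta>_star: "\<beta> (sg_star S s) = star B (\<beta> s)"
  and \<beta>_le: "nrm B (\<beta> s) \<le> \<alpha> s"
  using mor by (auto simp: holo_morphisms_def)

text \<open>The linear extension of \<beta> to the semigroup algebra, on which
  \<open>ell1_ext\<close> is built by continuity.\<close>

definition bh :: "('s => complex) => nat => 's => complex" where
  "bh f = finsum B (\<lambda>s. f s \<odot>\<^bsub>B\<^esub> \<beta> s) {s. f s \<noteq> 0}"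

lemma bh_in [simp]: "bh f \<in> carrier B"
  unfolding bh_def by (rule B.finsum_closed) auto

lemma clin_bh: "B.clin l ==> finite {s. f s \<noteq> 0} ==> l (bh f) = pairing f (\<lambda>s. l (\<beta> s))"
  by (simp add: bh_def pairing_def B.clin_finsum B.clin_smult)

lemma bh_add: "finite {s. f s \<noteq> 0} ==> finite {s. g s \<noteq> 0} ==> bh (\<lambda>s. f s + g s) = bh f \<oplus>\<^bsub>B\<^esub> bh g"
  by (rule B.eq_by_functionals) (simp_all add: clin_bh B.clin_add pairing_add finite_add)

lemma bh_smult: "finite {s. f s \<noteq> 0} ==> bh (\<lambda>s. c * f s) = c \<odot>\<^bsub>B\<^esub> bh f"
  by (rule B.eq_by_functionals) (simp_all add: clin_bh B.clin_smult pairing_smult finite_smult del: mult_eq_0_iff)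

lemma bh_mult:
  assumes f: "finite {s. f s \<noteq> 0}" and g: "finite {s. g s \<noteq> 0}"
  shows "bh (f \<otimes>\<^bsub>L\<^esub> g) = bh f \<otimes>\<^bsub>B\<^esub> bh g"
proof (rule B.eq_by_functionals)
  fix l assume l: "B.clin l"
  \<comment> \<open>The product is split into two linear dependences, on the left factor with the
    right one fixed and conversely, so that \<open>clin_bh\<close> can be used twice.\<close>
  have 1: "B.clin (\<lambda>b. l (b \<otimes>\<^bsub>B\<^esub> bh g))"
    using l by (simp add: B.clin_def B.l_distr B.smult_l)
  have 2: "B.clin (\<lambda>b. l (\<beta> s \<otimes>\<^bsub>B\<^esub> b))" for s
    using l by (simp add: B.clin_def B.r_distr B.smult_r)
  show "l (bh (f \<otimes>\<^bsub>L\<^esub> g)) = l (bh f \<otimes>\<^bsub>B\<^esub> bh g)"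
    using clin_bh[OF 1 f] clin_bh[OF 2 g] f g by (simp add: clin_bh[OF l] L_mult \<beta>_mult)
qed simp_all

lemma bh_star:
  assumes f: "finite {s. f s \<noteq> 0}"
  shows "bh (\<lambda>s. cnj (f (sg_star S s))) = star B (bh f)"
proof (rule B.eq_by_functionals)
  fix l assume l: "B.clin l"
  have 1: "B.clin (\<lambda>b. cnj (l (star B b)))"
    using l by (simp add: B.clin_def B.star_add B.star_smult)
  show "l (bh (\<lambda>s. cnj (f (sg_star S s)))) = l (star B (bh f))"
    using arg_cong[OF clin_bh[OF 1 f], of cnj] clin_bh[OF l L_star(1)[OF f]] by (simp add: L_star(2)[OF f] \<beta>_star)
qed simp_all

lemma bh_le:
  assumes f: "finite {s. f s \<noteq> 0}"
  shows "nrm B (bh f) \<le> nrm L f"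
proof (rule B.nrm_le_functionals)
  fix l assume l: "B.clin l" "\<And>y. y \<in> carrier B ==> cmod (l y) \<le> nrm B y"
  show "cmod (l (bh f)) \<le> nrm L f"
    unfolding clin_bh[OF l(1) f] nrm_L by (rule pairing_bound) (use l(2) \<beta>_le order_trans in \<open>blast intro: \<beta>_in\<close>)
qed simp

lemma bh_diff:
  assumes "finite {s. f s \<noteq> 0}" "finite {s. g s \<noteq> 0}"
  shows "bh (\<lambda>s. f s + (-1) * g s) = bh f \<ominus>\<^bsub>B\<^esub> bh g"
  using bh_add[OF assms(1) finite_smult[OF assms(2)], of "-1"] bh_smult[OF assms(2), of "-1"] by (simp add: B.minus_sm)

lemma bh_cstar_seminorm: "cstar_seminorm L (\<lambda>f. nrm B (bh f))"
proof -
  interpret star_algebra L by (rule L_star_algebra)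
  show ?thesis
  proof (unfold_locales, goal_cases)
    case (5 f)
    then show ?case by (simp add: bh_star)
  next
    case (6 f)
    have "bh (star L f \<otimes>\<^bsub>L\<^esub> f) = bh (star L f) \<otimes>\<^bsub>B\<^esub> bh f"
      using 6 L_star(1)[of f] by (intro bh_mult) simp_all
    moreover have "bh (star L f) = star B (bh f)" using 6 bh_star[of f] by simp
    ultimately show ?case by (simp add: B.nrm_star_mult)
  qed (simp_all add: B.nrm_nonneg bh_smult B.nrm_smult bh_add B.nrm_triangle bh_mult B.nrm_mult)
qed

text \<open>Resolves the definite description in \<open>ell1_ext\<close>: the images of X form a
  Cauchy sequence because \<open>bh\<close> is a contraction, they converge because B is complete,
  and equivalent sequences have the same limit.\<close>

lemma ell1_ext_tendsto:
  assumes X: "alg_cauchy L X"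
  shows "(\<lambda>n. nrm B (bh (X n))) \<longlonglongrightarrow> nrm B (ell1_ext B \<beta> (cauchy_class L X))"
proof -
  interpret L: completable L by (rule L_completable)
  have fin: "finite {s. Y n s \<noteq> 0}" if "alg_cauchy L Y" for Y n using L.cau_in[OF that, of n] by simp
  have diff: "nrm B (bh f \<ominus>\<^bsub>B\<^esub> bh g) \<le> nrm L (f \<ominus>\<^bsub>L\<^esub> g)" if "f \<in> carrier L" "g \<in> carrier L" for f g
  proof -
    have fg: "finite {s. f s \<noteq> 0}" "finite {s. g s \<noteq> 0}" using that by simp_all
    have e: "f \<ominus>\<^bsub>L\<^esub> g = (\<lambda>s. f s + (-1) * g s)" unfolding L.minus_sm[OF that] by simp
    show ?thesis unfolding e bh_diff[OF fg, symmetric] by (intro bh_le finite_add finite_smult fg)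
  qed
  have "alg_cauchy B (\<lambda>n. bh (X n))"
    unfolding alg_cauchy_def
  proof (intro conjI allI impI)
    fix e :: real assume e: "e > 0"
    have "\<forall>e>0. \<exists>N. \<forall>m\<ge>N. \<forall>n\<ge>N. nrm L (X m \<ominus>\<^bsub>L\<^esub> X n) < e"
      using X unfolding alg_cauchy_def by (rule conjunct2)
    then obtain N where N: "\<forall>m\<ge>N. \<forall>n\<ge>N. nrm L (X m \<ominus>\<^bsub>L\<^esub> X n) < e"
      using e by meson
    have "nrm B (bh (X m) \<ominus>\<^bsub>B\<^esub> bh (X n)) < e" if "m \<ge> N" "n \<ge> N" for m n
      by (rule le_less_trans[OF diff[OF L.cau_in[OF X] L.cau_in[OF X]]]) (use N that in blast)
    then show "\<exists>N. \<forall>m\<ge>N. \<forall>n\<ge>N. nrm B (bh (X m) \<ominus>\<^bsub>B\<^esub> bh (X n)) < e" by meson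
  qed (rule image_subsetI, rule bh_in)
  then obtain b where b: "b \<in> carrier B" "alg_tendsto B (\<lambda>n. bh (X n)) b" using B.complete by blast
  have lim: "alg_tendsto B (\<lambda>n. bh (Y n)) b" if "Y \<in> cauchy_class L X" for Y
  proof -
    have Y: "alg_cauchy L Y" "(\<lambda>n. nrm L (X n \<ominus>\<^bsub>L\<^esub> Y n)) \<longlonglongrightarrow> 0"
      using that by (auto simp: cauchy_class_def)
    have "(\<lambda>n. nrm L (X n \<ominus>\<^bsub>L\<^esub> Y n) + nrm B (bh (X n) \<ominus>\<^bsub>B\<^esub> b)) \<longlonglongrightarrow> 0 + 0"
      using Y(2) b(2) unfolding alg_tendsto_def by (intro tendsto_add)
    then have *: "(\<lambda>n. nrm L (X n \<ominus>\<^bsub>L\<^esub> Y n) + nrm B (bh (X n) \<ominus>\<^bsub>B\<^esub> b)) \<longlonglongrightarrow> 0" by simp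
    show ?thesis unfolding alg_tendsto_def
    proof (rule tendsto_sandwich[OF _ _ tendsto_const *])
      have "nrm B (bh (Y n) \<ominus>\<^bsub>B\<^esub> b) \<le> nrm L (X n \<ominus>\<^bsub>L\<^esub> Y n) + nrm B (bh (X n) \<ominus>\<^bsub>B\<^esub> b)" for n
        using B.nrm_minus_triangle[of "bh (Y n)" "bh (X n)" b] b(1) diff[OF L.cau_in[OF X] L.cau_in[OF Y(1)], of n n]
          B.nrm_minus_commute[of "bh (Y n)" "bh (X n)"] by simp
      then show "\<forall>\<^sub>F n in sequentially. nrm B (bh (Y n) \<ominus>\<^bsub>B\<^esub> b) \<le> nrm L (X n \<ominus>\<^bsub>L\<^esub> Y n) + nrm B (bh (X n) \<ominus>\<^bsub>B\<^esub> b)"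
        by simp
    qed (use b(1) in \<open>simp add: B.nrm_nonneg\<close>)
  qed
  have XX: "X \<in> cauchy_class L X"
    using X by (simp add: cauchy_class_def L.minus_self[OF L.cau_in[OF X]] del: L_simps)
  have "ell1_ext B \<beta> (cauchy_class L X) = b"
    unfolding ell1_ext_def bh_def[symmetric]
  proof (rule the_equality)
    fix c assume c: "c \<in> carrier B \<and> (\<forall>X\<in>cauchy_class L X. alg_tendsto B (\<lambda>n. bh (X n)) c)"
    then have "alg_tendsto B (\<lambda>n. bh (X n)) c" using XX by blast
    then have "(\<lambda>n. nrm B (bh (X n) \<ominus>\<^bsub>B\<^esub> c) + nrm B (bh (X n) \<ominus>\<^bsub>B\<^esub> b)) \<longlonglongrightarrow> 0 + 0"
      using b(2) unfolding alg_tendsto_def by (intro tendsto_add)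
    then have "nrm B (c \<ominus>\<^bsub>B\<^esub> b) \<le> 0 + 0"
    proof (rule LIMSEQ_le_const)
      have "nrm B (c \<ominus>\<^bsub>B\<^esub> b) \<le> nrm B (bh (X n) \<ominus>\<^bsub>B\<^esub> c) + nrm B (bh (X n) \<ominus>\<^bsub>B\<^esub> b)" for n
        using B.nrm_minus_triangle[of c "bh (X n)" b] b c B.nrm_minus_commute[of c "bh (X n)"] by simp
      then show "\<exists>N. \<forall>n\<ge>N. nrm B (c \<ominus>\<^bsub>B\<^esub> b) \<le> nrm B (bh (X n) \<ominus>\<^bsub>B\<^esub> c) + nrm B (bh (X n) \<ominus>\<^bsub>B\<^esub> b)" by blast
    qed
    moreover have "c = (c \<ominus>\<^bsub>B\<^esub> b) \<oplus>\<^bsub>B\<^esub> b" using b c by (simp add: B.minus_sm B.a_assoc B.sm_collect)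
    ultimately show "c = b"
      using b c B.nrm_eq_0[of "c \<ominus>\<^bsub>B\<^esub> b"] B.nrm_nonneg[of "c \<ominus>\<^bsub>B\<^esub> b"] by simp
  qed (use b lim in blast)
  moreover have "(\<lambda>n. nrm B (bh (X n))) \<longlonglongrightarrow> nrm B b"
  proof (rule LIM_zero_cancel, rule Lim_null_comparison)
    show "(\<lambda>n. nrm B (bh (X n) \<ominus>\<^bsub>B\<^esub> b)) \<longlonglongrightarrow> 0" using b(2) by (simp add: alg_tendsto_def)
    have *: "nrm B x \<le> nrm B (x \<ominus>\<^bsub>B\<^esub> y) + nrm B y" if "x \<in> carrier B" "y \<in> carrier B" for x y
      using B.nrm_minus_triangle[of x y "\<zero>\<^bsub>B\<^esub>"] that by (simp add: B.minus_sm)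
    have "\<bar>nrm B (bh (X n)) - nrm B b\<bar> \<le> nrm B (bh (X n) \<ominus>\<^bsub>B\<^esub> b)" for n
      using *[of "bh (X n)" b] *[of b "bh (X n)"] b(1) B.nrm_minus_commute[of b "bh (X n)"] by auto
    then show "\<forall>\<^sub>F n in sequentially. norm (nrm B (bh (X n)) - nrm B b) \<le> nrm B (bh (X n) \<ominus>\<^bsub>B\<^esub> b)" by simp
  qed
  ultimately show ?thesis by simp
qed

end

lemma star_algebra_nrm_update: "star_algebra A ==> star_algebra (A\<lparr>nrm := n\<rparr>)"
  unfolding star_algebra_def star_algebra_axioms_def Module.module_def Module.module_axioms_def
    abelian_group_def abelian_monoid_def abelian_group_axioms_def
  by simp

lemma minus_nrm_update: "x \<ominus>\<^bsub>A\<lparr>nrm := n\<rparr>\<^esub> y = x \<ominus>\<^bsub>A\<^esub> y"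
  by (simp add: a_minus_def a_inv_def)

lemma cstar_seminorm_completable:
  assumes "cstar_seminorm A \<nu>"
  shows "completable (A\<lparr>nrm := \<nu>\<rparr>)"
proof -
  interpret V: cstar_seminorm A \<nu> by (rule assms)
  interpret U: star_algebra "A\<lparr>nrm := \<nu>\<rparr>" by (rule star_algebra_nrm_update[OF V.star_algebra])
  show ?thesis
    by unfold_locales (simp_all add: V.c_nonneg V.c_smult V.c_triangle V.c_mult V.c_star)
qed

text \<open>Morphisms into the zero algebra make the supremum defining the norm well-behaved.\<close>

lemma holo_morphisms_nonempty: "holo_morphisms (S :: ('s::t2_space, 'f::complex_lcs) inv_semigroup) \<alpha> \<noteq> {}"
  if "absolute_value S \<alpha>" "complex_inv_semigroup S"
proof -
  define u :: "nat => 's => complex" where "u = (\<lambda>_ _. 0)"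
  define B where "B = \<lparr>carrier = {u}, mult = (\<lambda>_ _. u), one = u, zero = u, add = (\<lambda>_ _. u),
    smult = (\<lambda>(_::complex) _. u), star = (\<lambda>_. u), nrm = (\<lambda>_ :: nat => 's => complex. 0 :: real)\<rparr>"
  define \<beta> where "\<beta> = (\<lambda>_::'s. u)"
  interpret V: valued_semigroup S \<alpha> by unfold_locales (use that in auto)
  have "abelian_group B" by (rule abelian_groupI) (auto simp: B_def)
  moreover have "Module.module_axioms complex_ring B" by unfold_locales (auto simp: B_def)
  ultimately have "Module.module complex_ring B" using V.cring_complex_ring by (simp add: Module.module_def)
  then interpret M: Module.module complex_ring B .
  have minus: "u \<ominus>\<^bsub>B\<^esub> u = u"
    using M.minus_closed[of u u] by (auto simp: B_def)
  have B: "cstar_algebra B"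
    by unfold_locales (auto simp: B_def alg_tendsto_def)
  \<comment> \<open>The topology lives on the single point u, so every difference quotient converges
    to u and all iterated derivatives equal u.\<close>
  define T where "T = tv_top (tv_alg B)"
  interpret Met: Metric_space "{u}" "\<lambda>a b. if a \<in> carrier B \<and> b \<in> carrier B then nrm B (a \<ominus>\<^bsub>B\<^esub> b) else 0"
    by unfold_locales (auto simp: B_def)
  have "carrier B = {u}" by (simp add: B_def)
  then have T: "T = Met.mtopology" by (simp add: T_def tv_alg_def)
  have topT: "topspace T = {u}" by (simp add: T)
  have lim: "limitin T f l F \<longleftrightarrow> l = u" if "\<And>x. f x = u" for f :: "real => _" and l F
  proof
    assume "limitin T f l F"
    then have "l \<in> topspace T" by (rule limitin_topspace)
    then show "l = u" by (simp only: topT singleton_iff)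
  next
    assume "l = u"
    then show "limitin T f l F" unfolding limitin_def topT by (simp only: that singletonI) simp
  qed
  have ops: "tv_add (tv_alg B) a b = u" "tv_scaleR (tv_alg B) r a = u" "tv_scaleC (tv_alg B) c a = u" for a b r c
    by (simp_all add: tv_alg_def B_def)
  have hd: "has_ddir (tv_alg B) f x h l \<longleftrightarrow> l = u" for f :: "'f => _" and x h l
    unfolding has_ddir_def T_def[symmetric] by (rule lim) (simp add: ops)
  have dd: "ddir (tv_alg B) f x h = u" for f :: "'f => _" and x h
    unfolding ddir_def hd by simp
  have it: "iter_ddir (tv_alg B) f h k x = u" if "\<And>x. f x = u" for f :: "'f => _" and h k x
    using that by (cases k) (simp_all add: dd)
  have "mfd_holo_to (tv_alg B) (sg_charts S) \<beta>"
    unfolding mfd_holo_to_def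
  proof (intro ballI, clarify)
    fix U and \<phi> :: "'s => 'f" assume "(U, \<phi>) \<in> sg_charts S"
    then have "is_chart (U, \<phi>)" using V.S by (auto simp: complex_inv_semigroup_def is_atlas_def)
    then have op: "open (\<phi> ` U)" by (simp add: is_chart_def)
    have u: "(\<beta> \<circ> inv_into U \<phi>) x = u" for x by (simp add: \<beta>_def)
    show "holo_to (tv_alg B) (\<phi> ` U) (\<beta> \<circ> inv_into U \<phi>)"
      unfolding holo_to_def smooth_to_def hd dd ops T_def[symmetric] it[OF u]
      by (simp add: op case_prod_unfold topT)
  qed
  then have "(B, \<beta>) \<in> holo_morphisms S \<alpha>"
    using B V.\<alpha>_nonneg by (auto simp: holo_morphisms_def \<beta>_def B_def)
  then show ?thesis by blast
qed

section \<open>The C*-seminorm and the canonical map into the host algebra\<close>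

context valued_semigroup
begin

lemma morphism: "(B, \<beta>) \<in> holo_morphisms S \<alpha> ==> semigroup_morphism S \<alpha> B \<beta>"
  by (simp add: semigroup_morphism_def semigroup_morphism_axioms_def valued_semigroup_axioms
      holo_morphisms_def)

definition \<nu> :: "(nat => 's => complex) set => real" where
  "\<nu> f = (SUP (B, \<beta>)\<in>holo_morphisms S \<alpha>. nrm B (ell1_ext B \<beta> f))"

text \<open>Bounds all morphisms by the norm of the completed semigroup algebra; this makes the
  supremum in \<nu> finite.\<close>

lemma ell1_ext_le:
  assumes i: "(B, \<beta>) \<in> holo_morphisms S \<alpha>" and f: "f \<in> carrier (ell1 S \<alpha>)"
  shows "nrm B (ell1_ext B \<beta> f) \<le> nrm (ell1 S \<alpha>) f"
proof -
  interpret L: completable L by (rule L_completable)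
  interpret semigroup_morphism S \<alpha> B \<beta> using i by (rule morphism)
  obtain X where X: "alg_cauchy L X" "f = cauchy_class L X" using f unfolding ell1_def by (elim L.completion_cases)
  have le: "nrm B (bh (X n)) \<le> nrm L (X n)" for n
    using bh_le[of "X n"] L.cau_in[OF X(1), of n] by simp
  show ?thesis unfolding X(2) ell1_def
    by (rule LIMSEQ_le[OF ell1_ext_tendsto[OF X(1)] L.completion_nrm[OF X(1)]]) (use le in blast)
qed

lemma \<nu>_cstar: "cstar_seminorm (ell1 S \<alpha>) \<nu>"
proof -
  interpret L: completable L by (rule L_completable)
  have "cstar_seminorm (ell1 S \<alpha>) (\<lambda>f. SUP i\<in>holo_morphisms S \<alpha>. (case i of (B, \<beta>) => \<lambda>f. nrm B (ell1_ext B \<beta> f)) f)"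
  proof (rule cstar_seminorm_SUP)
    show "holo_morphisms S \<alpha> \<noteq> {}" by (rule holo_morphisms_nonempty[OF \<alpha> S])
  next
    fix i assume i: "i \<in> holo_morphisms S \<alpha>"
    obtain B \<beta> where B: "i = (B, \<beta>)" by (cases i)
    interpret semigroup_morphism S \<alpha> B \<beta> using i B morphism by blast
    show "cstar_seminorm (ell1 S \<alpha>) (case i of (B, \<beta>) => \<lambda>f. nrm B (ell1_ext B \<beta> f))"
      unfolding B ell1_def prod.case
    proof (rule L.completion_cstar_seminorm[OF bh_cstar_seminorm])
      show "nrm B (bh f) \<le> nrm L f" if "f \<in> carrier L" for f using bh_le[of f] that by simp
    qed (rule ell1_ext_tendsto)
  next
    fix f assume f: "f \<in> carrier (ell1 S \<alpha>)"
    show "bdd_above ((\<lambda>i. (case i of (B, \<beta>) => \<lambda>f. nrm B (ell1_ext B \<beta> f)) f) ` holo_morphisms S \<alpha>)"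
      by (rule bdd_aboveI2[of _ _ "nrm (ell1 S \<alpha>) f"]) (use ell1_ext_le f in auto)
  qed
  then show ?thesis by (simp add: \<nu>_def[abs_def] case_prod_unfold)
qed

lemma ell1_cstar_eq: "ell1_cstar S \<alpha> = (ell1 S \<alpha>)\<lparr>nrm := \<nu>\<rparr>"
  by (simp add: ell1_cstar_def \<nu>_def[abs_def])

lemma ell1_cstar_completable: "completable (ell1_cstar S \<alpha>)"
  unfolding ell1_cstar_eq by (rule cstar_seminorm_completable[OF \<nu>_cstar])

lemma host_pre_cstar: "pre_cstar (host_cstar S \<alpha>)"
  unfolding host_cstar_def
proof (rule completable.completion_pre_cstar[OF ell1_cstar_completable])
  fix x assume "x \<in> carrier (ell1_cstar S \<alpha>)"
  then show "nrm (ell1_cstar S \<alpha>) (star (ell1_cstar S \<alpha>) x \<otimes>\<^bsub>ell1_cstar S \<alpha>\<^esub> x) = (nrm (ell1_cstar S \<alpha>) x)\<^sup>2"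
    using cstar_seminorm.c_star_mult[OF \<nu>_cstar, of x] by (simp add: ell1_cstar_eq)
qed

text \<open>The semigroup algebra mapped through both completions; \<open>\<eta>\<alpha>\<close> is
  its restriction to point masses.\<close>

definition \<iota> :: "('s => complex) => (nat => (nat => 's => complex) set) set" where
  "\<iota> f = completion_embed (ell1_cstar S \<alpha>) (completion_embed L f)"

lemma \<iota>_hom:
  assumes "finite {s. f s \<noteq> 0}" "finite {s. g s \<noteq> 0}"
  shows "\<iota> f \<in> carrier (host_cstar S \<alpha>)"
    "\<iota> (\<lambda>s. f s + g s) = \<iota> f \<oplus>\<^bsub>host_cstar S \<alpha>\<^esub> \<iota> g"
    "\<iota> (f \<otimes>\<^bsub>L\<^esub> g) = \<iota> f \<otimes>\<^bsub>host_cstar S \<alpha>\<^esub> \<iota> g"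
    "\<iota> (\<lambda>s. c * f s) = c \<odot>\<^bsub>host_cstar S \<alpha>\<^esub> \<iota> f"
    "\<iota> (\<lambda>s. cnj (f (sg_star S s))) = star (host_cstar S \<alpha>) (\<iota> f)"
    "nrm (host_cstar S \<alpha>) (\<iota> f) = \<nu> (completion_embed L f)"
proof -
  interpret L: completable L by (rule L_completable)
  interpret N: completable "ell1_cstar S \<alpha>" by (rule ell1_cstar_completable)
  have eq: "carrier (ell1_cstar S \<alpha>) = carrier (completion L)" "mult (ell1_cstar S \<alpha>) = mult (completion L)"
    "add (ell1_cstar S \<alpha>) = add (completion L)" "smult (ell1_cstar S \<alpha>) = smult (completion L)"
    "star (ell1_cstar S \<alpha>) = star (completion L)" "nrm (ell1_cstar S \<alpha>) = \<nu>"
    by (simp_all add: ell1_cstar_eq ell1_def)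
  have fg: "f \<in> carrier L" "g \<in> carrier L" using assms by simp_all
  note h = L.embed_hom[OF fg] L.embed_hom(1)[OF fg(2) fg(1)]
  note n = N.embed_hom[unfolded eq, OF h(1) h(7)]
  show "\<iota> f \<in> carrier (host_cstar S \<alpha>)"
    "\<iota> (\<lambda>s. f s + g s) = \<iota> f \<oplus>\<^bsub>host_cstar S \<alpha>\<^esub> \<iota> g"
    "\<iota> (f \<otimes>\<^bsub>L\<^esub> g) = \<iota> f \<otimes>\<^bsub>host_cstar S \<alpha>\<^esub> \<iota> g"
    "\<iota> (\<lambda>s. c * f s) = c \<odot>\<^bsub>host_cstar S \<alpha>\<^esub> \<iota> f"
    "\<iota> (\<lambda>s. cnj (f (sg_star S s))) = star (host_cstar S \<alpha>) (\<iota> f)"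
    "nrm (host_cstar S \<alpha>) (\<iota> f) = \<nu> (completion_embed L f)"
    using h n by (simp_all add: \<iota>_def host_cstar_def)
qed

text \<open>The norm in the host algebra is a supremum over morphisms, and each target norm is a
  supremum over contractive functionals. Thus scalar functions on S that are uniformly estimated
  give norm estimates.\<close>

lemma \<iota>_le:
  assumes f: "finite {s. f s \<noteq> 0}"
    and K: "\<And>B \<beta> l. (B, \<beta>) \<in> holo_morphisms S \<alpha> ==> star_algebra.clin B l ==>
      (\<And>y. y \<in> carrier B ==> cmod (l y) \<le> nrm B y) ==> cmod (pairing f (\<lambda>s. l (\<beta> s))) \<le> K"
  shows "nrm (host_cstar S \<alpha>) (\<iota> f) \<le> K"
  unfolding \<iota>_hom(6)[OF f f] \<nu>_def
proof (rule cSUP_least)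
  show "holo_morphisms S \<alpha> \<noteq> {}" by (rule holo_morphisms_nonempty[OF \<alpha> S])
next
  fix i assume i: "i \<in> holo_morphisms S \<alpha>"
  obtain B \<beta> where B: "i = (B, \<beta>)" by (cases i)
  interpret L: completable L by (rule L_completable)
  interpret semigroup_morphism S \<alpha> B \<beta> using i B morphism by blast
  have "(\<lambda>n. nrm B (bh f)) \<longlonglongrightarrow> nrm B (ell1_ext B \<beta> (completion_embed L f))"
    unfolding completion_embed_def by (rule ell1_ext_tendsto) (use f in \<open>simp add: L.cau_const\<close>)
  then have "nrm B (ell1_ext B \<beta> (completion_embed L f)) = nrm B (bh f)" by (simp add: LIMSEQ_const_iff)
  also have "\<dots> \<le> K"
  proof (rule B.nrm_le_functionals)
    fix l assume "B.clin l" "\<And>y. y \<in> carrier B ==> cmod (l y) \<le> nrm B y"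
    then show "cmod (l (bh f)) \<le> K" using K[of B \<beta> l] i B by (simp add: clin_bh f)
  qed simp
  finally show "(case i of (B, \<beta>) => nrm B (ell1_ext B \<beta> (completion_embed L f))) \<le> K" by (simp add: B)
qed

text \<open>One error e/2 for each of the two completions; the inner error is measured by \<nu>,
  which is dominated by the norm of the inner completion.\<close>

lemma \<iota>_dense:
  assumes a: "a \<in> carrier (host_cstar S \<alpha>)" and e: "e > 0"
  obtains f where "finite {s. f s \<noteq> 0}" "nrm (host_cstar S \<alpha>) (a \<ominus>\<^bsub>host_cstar S \<alpha>\<^esub> \<iota> f) < e"
proof -
  interpret L: completable L by (rule L_completable)
  interpret N: completable "ell1_cstar S \<alpha>" by (rule ell1_cstar_completable)
  interpret A: pre_cstar "host_cstar S \<alpha>" by (rule host_pre_cstar)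
  obtain x where x: "x \<in> carrier (ell1_cstar S \<alpha>)"
    "nrm (host_cstar S \<alpha>) (a \<ominus>\<^bsub>host_cstar S \<alpha>\<^esub> completion_embed (ell1_cstar S \<alpha>) x) < e / 2"
    using N.dense_embed[of a "e/2"] a e unfolding host_cstar_def by auto
  have x': "x \<in> carrier (completion L)" using x(1) by (simp add: ell1_cstar_eq ell1_def)
  obtain f where f: "f \<in> carrier L" "nrm (completion L) (x \<ominus>\<^bsub>completion L\<^esub> completion_embed L f) < e / 2"
    using L.dense_embed[OF x', of "e/2"] e by auto
  have fin: "finite {s. f s \<noteq> 0}" using f by simp
  have d: "x \<ominus>\<^bsub>completion L\<^esub> completion_embed L f \<in> carrier (completion L)"
    using x' L.embed_hom(1)[OF f(1) f(1)] by (rule L.C.minus_closed)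
  define y where "y = completion_embed L f"
  have y: "y \<in> carrier (ell1_cstar S \<alpha>)"
    using L.embed_hom(1)[OF f(1) f(1)] by (simp add: y_def ell1_cstar_eq ell1_def)
  have "nrm (ell1_cstar S \<alpha>) (x \<ominus>\<^bsub>ell1_cstar S \<alpha>\<^esub> y) = \<nu> (x \<ominus>\<^bsub>completion L\<^esub> y)"
    by (simp add: ell1_cstar_eq ell1_def minus_nrm_update)
  also have "\<dots> \<le> nrm (completion L) (x \<ominus>\<^bsub>completion L\<^esub> y)"
    unfolding \<nu>_def using d holo_morphisms_nonempty[OF \<alpha> S]
    by (intro cSUP_least) (auto intro!: ell1_ext_le[unfolded ell1_def] simp: y_def)
  also have "\<dots> < e / 2" using f(2) by (simp add: y_def)
  finally have 1: "nrm (ell1_cstar S \<alpha>) (x \<ominus>\<^bsub>ell1_cstar S \<alpha>\<^esub> y) < e / 2" .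
  define E where "E = completion_embed (ell1_cstar S \<alpha>)"
  have in_host: "E z \<in> carrier (host_cstar S \<alpha>)" if "z \<in> carrier (ell1_cstar S \<alpha>)" for z
    using N.embed_hom(1)[OF that that] by (simp add: E_def host_cstar_def)
  have "E x \<ominus>\<^bsub>host_cstar S \<alpha>\<^esub> E y = E (x \<ominus>\<^bsub>ell1_cstar S \<alpha>\<^esub> y)"
    using x(1) y N.embed_hom(2)[OF x(1) N.sm_closed[OF y, of "-1"]] N.embed_hom(4)[OF y y, of "-1"] in_host
    by (simp add: N.C.minus_sm N.minus_sm E_def host_cstar_def)
  then have 2: "nrm (host_cstar S \<alpha>) (E x \<ominus>\<^bsub>host_cstar S \<alpha>\<^esub> E y) < e / 2"
    using 1 N.embed_hom(6)[OF N.minus_closed[OF x(1) y] N.minus_closed[OF x(1) y]] by (simp add: E_def host_cstar_def)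
  have "nrm (host_cstar S \<alpha>) (a \<ominus>\<^bsub>host_cstar S \<alpha>\<^esub> E y) < e"
    using A.nrm_minus_triangle[OF a in_host[OF x(1)] in_host[OF y]] x(2) 2 by (simp add: E_def)
  then show thesis using that[OF fin] by (simp add: \<iota>_def E_def y_def)
qed

lemma L_mult_delta: "delta s \<otimes>\<^bsub>L\<^esub> delta t = delta (sg_mult S s t)"
  by (rule pairing_ext) (simp_all add: L_mult)

abbreviation "\<eta>\<alpha> \<equiv> host_eta S \<alpha>"

lemma eta_eq: "\<eta>\<alpha> s = \<iota> (delta s)"
  by (simp add: host_eta_def \<iota>_def)

lemma eta_in [simp]: "\<eta>\<alpha> s \<in> carrier (host_cstar S \<alpha>)"
  using \<iota>_hom(1)[OF finite_delta finite_delta] by (simp add: eta_eq)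

lemma eta_mult: "\<eta>\<alpha> (sg_mult S s t) = \<eta>\<alpha> s \<otimes>\<^bsub>host_cstar S \<alpha>\<^esub> \<eta>\<alpha> t"
  using \<iota>_hom(3)[of "delta s" "delta t"] by (simp add: eta_eq L_mult_delta)

lemma eta_star: "\<eta>\<alpha> (sg_star S s) = star (host_cstar S \<alpha>) (\<eta>\<alpha> s)"
proof -
  have "(\<lambda>t. cnj (delta s (sg_star S t))) = delta (sg_star S s)"
    by (auto simp: delta_def fun_eq_iff)
  then show ?thesis using \<iota>_hom(5)[of "delta s" "delta s"] by (simp add: eta_eq)
qed

lemma eta_le: "nrm (host_cstar S \<alpha>) (\<eta>\<alpha> s) \<le> \<alpha> s"
  unfolding eta_eq
proof (rule \<iota>_le)
  fix B \<beta> l assume i: "(B, \<beta>) \<in> holo_morphisms S \<alpha>" and l: "\<And>y. y \<in> carrier B ==> cmod (l y) \<le> nrm B y"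
  interpret semigroup_morphism S \<alpha> B \<beta> using i by (rule morphism)
  show "cmod (pairing (delta s) (\<lambda>s. l (\<beta> s))) \<le> \<alpha> s" using l[of "\<beta> s"] \<beta>_le[of s] by simp
qed simp

end

section \<open>Calculus in locally convex spaces\<close>

lemma tendsto_scaleR_lcs:
  fixes g :: "'a => 'e::lcs"
  assumes "(f \<longlongrightarrow> r) F" "(g \<longlongrightarrow> x) F"
  shows "((\<lambda>i. f i *\<^sub>R g i) \<longlongrightarrow> r *\<^sub>R x) F"
  using filterlim_compose[OF tendsto_scaleR_Pair_lcs filterlim_Pair[OF assms]] by simp

lemma tendsto_scaleC_lcs:
  fixes g :: "'a => 'e::complex_lcs"
  assumes "(f \<longlongrightarrow> r) F" "(g \<longlongrightarrow> x) F"
  shows "((\<lambda>i. f i *\<^sub>C g i) \<longlongrightarrow> r *\<^sub>C x) F"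
  using filterlim_compose[OF tendsto_scaleC_Pair filterlim_Pair[OF assms]] by simp

lemma has_ddir_real:
  fixes f :: "'e::lcs => 'f::lcs"
  shows "has_ddir tv_real f x h l \<longleftrightarrow> ((\<lambda>t. (1 / t) *\<^sub>R (f (x + t *\<^sub>R h) - f x)) \<longlongrightarrow> l) (at 0)"
  by (simp add: has_ddir_def tv_real_def)

lemma has_ddir_cplx:
  fixes f :: "'e::lcs => 'f::complex_lcs"
  shows "has_ddir tv_cplx f x h l \<longleftrightarrow> ((\<lambda>t. (1 / t) *\<^sub>R (f (x + t *\<^sub>R h) - f x)) \<longlongrightarrow> l) (at 0)"
  by (simp add: has_ddir_def tv_cplx_def)

lemma ddir_real:
  fixes f :: "'e::lcs => 'f::lcs"
  shows "has_ddir tv_real f x h l ==> ddir tv_real f x h = l"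
  unfolding ddir_def has_ddir_real by (rule the_equality) (auto intro: LIM_unique)

lemma ddir_cplx:
  fixes f :: "'e::lcs => 'f::complex_lcs"
  shows "has_ddir tv_cplx f x h l ==> ddir tv_cplx f x h = l"
  unfolding ddir_def has_ddir_cplx by (rule the_equality) (auto intro: LIM_unique)

text \<open>C^1 maps in the sense of jointly continuous directional derivatives, with the derivative
  D as a parameter. Linearity of D in the direction is derived in \<open>c1_on_add\<close> and
  \<open>c1_on_scale\<close>.\<close>

definition c1_on :: "'e::lcs set => ('e => complex) => ('e => 'e => complex) => bool" where
  "c1_on U F D \<longleftrightarrow> open U \<and>
     (\<forall>x\<in>U. \<forall>h. ((\<lambda>t. (1 / t) *\<^sub>R (F (x + t *\<^sub>R h) - F x)) \<longlongrightarrow> D x h) (at 0)) \<and>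
     continuous_on (U \<times> UNIV) (\<lambda>(x, h). D x h)"

lemma c1_on_tendsto:
  assumes "c1_on U F D" "y \<in> U" "(Y \<longlongrightarrow> y) G" "(K \<longlongrightarrow> k) G"
  shows "((\<lambda>i. D (Y i) (K i)) \<longlongrightarrow> D y k) G"
proof -
  have op: "open (U \<times> (UNIV :: 'a set))" using assms(1) by (simp add: c1_on_def open_Times)
  have "isCont (\<lambda>(x, h). D x h) (y, k)"
    using assms(1,2) op continuous_on_eq_continuous_at[OF op] by (auto simp: c1_on_def)
  from isCont_tendsto_compose[OF this tendsto_Pair[OF assms(3,4)]] show ?thesis by simp
qed

lemma c1_on_line:
  assumes c: "c1_on U F D" and x: "x + r *\<^sub>R k \<in> U"
  shows "((\<lambda>r. F (x + r *\<^sub>R k)) has_vector_derivative D (x + r *\<^sub>R k) k) (at r)"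
proof -
  have "((\<lambda>t. (1 / t) *\<^sub>R (F ((x + r *\<^sub>R k) + t *\<^sub>R k) - F (x + r *\<^sub>R k))) \<longlongrightarrow> D (x + r *\<^sub>R k) k) (at 0)"
    using c x by (simp add: c1_on_def)
  then have "((\<lambda>t. norm ((1 / t) *\<^sub>R (F (x + (r + t) *\<^sub>R k) - F (x + r *\<^sub>R k)) - D (x + r *\<^sub>R k) k)) \<longlongrightarrow> 0) (at 0)"
    by (intro tendsto_norm_zero LIM_zero) (simp add: scaleR_add_left add.assoc)
  then have "((\<lambda>t. norm (F (x + (r + t) *\<^sub>R k) - F (x + r *\<^sub>R k) - t *\<^sub>R D (x + r *\<^sub>R k) k) / norm t) \<longlongrightarrow> 0) (at 0)"
  proof (rule Lim_transform_eventually)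
    have "norm ((1 / t) *\<^sub>R a - b) = norm (a - t *\<^sub>R b) / norm t" if "t \<noteq> 0" for t :: real and a b :: complex
    proof -
      have "(1 / t) *\<^sub>R a - b = (1 / t) *\<^sub>R (a - t *\<^sub>R b)" using that by (simp add: scaleR_diff_right)
      then show ?thesis by simp
    qed
    then show "\<forall>\<^sub>F t in at 0. norm ((1 / t) *\<^sub>R (F (x + (r + t) *\<^sub>R k) - F (x + r *\<^sub>R k)) - D (x + r *\<^sub>R k) k) =
        norm (F (x + (r + t) *\<^sub>R k) - F (x + r *\<^sub>R k) - t *\<^sub>R D (x + r *\<^sub>R k) k) / norm t"
      by (auto simp: eventually_at_filter)
  qed
  then show ?thesis
    unfolding has_vector_derivative_def has_derivative_at by (simp add: bounded_linear_scaleR_left)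
qed

lemma c1_on_zero: "c1_on U F D ==> x \<in> U ==> D x 0 = 0"
proof -
  assume "c1_on U F D" "x \<in> U"
  then have "((\<lambda>t. (1 / t) *\<^sub>R (F (x + t *\<^sub>R 0) - F x)) \<longlongrightarrow> D x 0) (at 0)" unfolding c1_on_def by blast
  then show ?thesis by (intro LIM_unique[where f = "\<lambda>t::real. 0" and a = 0]) simp_all
qed

text \<open>The increment along \<open>t k'\<close> at base points \<open>y'\<close> near \<open>y\<close> is compared with \<open>t D y k\<close>
  by the mean value inequality.\<close>

lemma c1_on_difference_quotient:
  fixes T :: "'i => real"
  assumes c: "c1_on U F D" and y: "y \<in> U" and Y: "(Y \<longlongrightarrow> y) G" and K: "(K \<longlongrightarrow> k) G"
    and T: "(T \<longlongrightarrow> 0) G" "\<forall>\<^sub>F i in G. T i \<noteq> 0"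
  shows "((\<lambda>i. (1 / T i) *\<^sub>R (F (Y i + T i *\<^sub>R K i) - F (Y i))) \<longlongrightarrow> D y k) G"
proof (rule tendstoI)
  fix e :: real assume e: "e > 0"
  define P where "P = (nhds y \<times>\<^sub>F nhds k) \<times>\<^sub>F nhds (0::real)"
  have t0: "(fst \<longlongrightarrow> (y, k)) P" "(snd \<longlongrightarrow> (0::real)) P"
    unfolding P_def nhds_prod[symmetric] by (rule tendsto_fst_nhds tendsto_snd_nhds)+
  have t1: "((\<lambda>p. fst (fst p)) \<longlongrightarrow> y) P" "((\<lambda>p. snd (fst p)) \<longlongrightarrow> k) P" "(snd \<longlongrightarrow> (0::real)) P"
    using tendsto_fst[OF t0(1)] tendsto_snd[OF t0(1)] t0(2) by simp_all
  have t2: "((\<lambda>p. fst (fst p) + snd p *\<^sub>R snd (fst p)) \<longlongrightarrow> y) P"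
    using tendsto_add[OF t1(1) tendsto_scaleR_lcs[OF t1(3,2)]] by simp
  have "\<forall>\<^sub>F p in P. fst (fst p) + snd p *\<^sub>R snd (fst p) \<in> U"
    using topological_tendstoD[OF t2, of U] c y by (simp add: c1_on_def)
  moreover have "\<forall>\<^sub>F p in P. dist (D (fst (fst p) + snd p *\<^sub>R snd (fst p)) (snd (fst p))) (D y k) < e / 4"
    using tendstoD[OF c1_on_tendsto[OF c y t2 t1(2)], of "e / 4"] e by simp
  ultimately have ev: "\<forall>\<^sub>F p in P. fst (fst p) + snd p *\<^sub>R snd (fst p) \<in> U \<and>
      dist (D (fst (fst p) + snd p *\<^sub>R snd (fst p)) (snd (fst p))) (D y k) < e / 4"
    by (rule eventually_conj)
  \<comment> \<open>The product neighbourhood separates the pair of base point and direction from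
    the parameter t, so that the estimate holds simultaneously along the whole segment from 0 to T
    i.\<close>
  then obtain A B where A: "eventually A (nhds y \<times>\<^sub>F nhds k)" and B: "eventually B (nhds (0::real))"
    and AB: "\<And>p t. A p ==> B t ==> fst p + t *\<^sub>R snd p \<in> U \<and>
      dist (D (fst p + t *\<^sub>R snd p) (snd p)) (D y k) < e / 4"
  proof -
    obtain A B where "eventually A (nhds y \<times>\<^sub>F nhds k)" "eventually B (nhds (0::real))"
      and *: "\<forall>p t. A p \<longrightarrow> B t \<longrightarrow> (case (p, t) of (p, t) => fst p + t *\<^sub>R snd p \<in> U \<and>
        dist (D (fst p + t *\<^sub>R snd p) (snd p)) (D y k) < e / 4)"
      using ev unfolding P_def eventually_prod_filter by (simp only: fst_conv snd_conv prod.case) metis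
    then show thesis by (intro that[of A B]) auto
  qed
  obtain d where d: "d > 0" "\<And>t. \<bar>t\<bar> < d ==> B t"
    using B unfolding eventually_nhds_metric by (auto simp: dist_real_def)
  have "\<forall>\<^sub>F i in G. A (Y i, K i)"
    using filterlim_Pair[OF Y K] A unfolding filterlim_iff by blast
  moreover have "\<forall>\<^sub>F i in G. \<bar>T i\<bar> < d"
    using tendstoD[OF T(1) d(1)] by (simp add: dist_real_def)
  ultimately show "\<forall>\<^sub>F i in G. dist ((1 / T i) *\<^sub>R (F (Y i + T i *\<^sub>R K i) - F (Y i))) (D y k) < e"
    using T(2)
  proof eventually_elim
    case (elim i)
    define f where "f r = F (Y i + r *\<^sub>R K i)" for r
    define f' where "f' r = D (Y i + r *\<^sub>R K i) (K i)" for r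
    have seg: "\<bar>r\<bar> < d" if "r \<in> closed_segment 0 (T i)" for r
    proof -
      have "\<bar>r\<bar> \<le> \<bar>T i\<bar>" using that by (auto simp: closed_segment_eq_real_ivl split: if_splits)
      then show ?thesis using elim by simp
    qed
    have near: "norm (f' r - D y k) < e / 4" if "\<bar>r\<bar> < d" for r
      using AB[OF elim(1) d(2)[OF that]] by (simp add: f'_def dist_norm)
    have 0: "0 \<in> closed_segment 0 (T i)" by simp
    have "norm (f (T i) - f 0 - (T i - 0) *\<^sub>R f' 0) \<le> norm (T i - 0) * (e / 2)"
    proof (rule vector_differentiable_bound_linearization[OF _ subset_refl])
      fix r assume r: "r \<in> closed_segment 0 (T i)"
      show "(f has_vector_derivative f' r) (at r within closed_segment 0 (T i))"
        unfolding f_def f'_def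
        by (rule has_vector_derivative_at_within, rule c1_on_line[OF c])
          (use AB[OF elim(1) d(2)[OF seg[OF r]]] in simp)
      show "norm (f' r - f' 0) \<le> e / 2"
        using norm_triangle_ineq4[of "f' r - D y k" "f' 0 - D y k"] near[OF seg[OF r]] near[OF seg[OF 0]] by simp
    qed (rule 0)
    then have "norm ((1 / T i) *\<^sub>R (f (T i) - f 0) - f' 0) \<le> e / 2"
    proof -
      assume *: "norm (f (T i) - f 0 - (T i - 0) *\<^sub>R f' 0) \<le> norm (T i - 0) * (e / 2)"
      have "(1 / T i) *\<^sub>R (f (T i) - f 0) - f' 0 = (1 / T i) *\<^sub>R (f (T i) - f 0 - T i *\<^sub>R f' 0)"
        using elim by (simp add: scaleR_diff_right)
      then have "norm ((1 / T i) *\<^sub>R (f (T i) - f 0) - f' 0) = norm (f (T i) - f 0 - T i *\<^sub>R f' 0) / \<bar>T i\<bar>"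
        by simp
      then show ?thesis using * elim by (simp add: divide_le_eq mult.commute)
    qed
    then have "norm ((1 / T i) *\<^sub>R (f (T i) - f 0) - D y k) < e"
      using norm_triangle_ineq[of "(1 / T i) *\<^sub>R (f (T i) - f 0) - f' 0" "f' 0 - D y k"] near[of 0] d e by simp
    then show ?case by (simp add: f_def dist_norm)
  qed
qed

lemma at_0_scale: "((\<lambda>t::real. t) \<longlongrightarrow> 0) (at 0)" "\<forall>\<^sub>F t in at (0::real). t \<noteq> 0"
  by (auto simp: eventually_at_filter)

text \<open>The increment along h + k is the increment along h followed by the increment along k
  from the moving base point y + th; \<open>c1_on_difference_quotient\<close> allows the base point
  to move.\<close>

lemma c1_on_add:
  assumes c: "c1_on U F D" and y: "y \<in> U"
  shows "D y (h + k) = D y h + D y k"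
proof (rule tendsto_unique)
  have Y: "((\<lambda>t. y + t *\<^sub>R h) \<longlongrightarrow> y) (at (0::real))"
    using tendsto_add[OF tendsto_const tendsto_scaleR_lcs[OF at_0_scale(1) tendsto_const]] by force
  have "((\<lambda>t. (1 / t) *\<^sub>R (F (y + t *\<^sub>R h) - F y) + (1 / t) *\<^sub>R (F ((y + t *\<^sub>R h) + t *\<^sub>R k) - F (y + t *\<^sub>R h)))
      \<longlongrightarrow> D y h + D y k) (at 0)"
    using c y by (intro tendsto_add c1_on_difference_quotient[OF c y Y tendsto_const at_0_scale]) (simp add: c1_on_def)
  then show "((\<lambda>t. (1 / t) *\<^sub>R (F (y + t *\<^sub>R (h + k)) - F y)) \<longlongrightarrow> D y h + D y k) (at 0)"
    by (simp add: scaleR_add_right scaleR_diff_right add.assoc)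
  show "((\<lambda>t. (1 / t) *\<^sub>R (F (y + t *\<^sub>R (h + k)) - F y)) \<longlongrightarrow> D y (h + k)) (at 0)"
    using c y unfolding c1_on_def by blast
qed simp

lemma c1_on_scale:
  assumes c: "c1_on U F D" and y: "y \<in> U"
  shows "D y (r *\<^sub>R h) = r *\<^sub>R D y h"
proof (cases "r = 0")
  case True
  then show ?thesis using c1_on_zero[OF c y] by simp
next
  case False
  have "((\<lambda>t. r *\<^sub>R ((1 / (t * r)) *\<^sub>R (F (y + (t * r) *\<^sub>R h) - F y))) \<longlongrightarrow> r *\<^sub>R D y h) (at 0)"
  proof (intro tendsto_scaleR tendsto_const)
    have T: "((\<lambda>t. t * r) \<longlongrightarrow> 0) (at 0)" "\<forall>\<^sub>F t in at 0. t * r \<noteq> 0"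
      using False by (auto intro!: tendsto_eq_intros simp: eventually_at_filter)
    show "((\<lambda>t. (1 / (t * r)) *\<^sub>R (F (y + (t * r) *\<^sub>R h) - F y)) \<longlongrightarrow> D y h) (at 0)"
      using c1_on_difference_quotient[OF c y tendsto_const tendsto_const T] by simp
  qed
  then have "((\<lambda>t. (1 / t) *\<^sub>R (F (y + t *\<^sub>R (r *\<^sub>R h)) - F y)) \<longlongrightarrow> r *\<^sub>R D y h) (at 0)"
    using False by simp
  moreover have "((\<lambda>t. (1 / t) *\<^sub>R (F (y + t *\<^sub>R (r *\<^sub>R h)) - F y)) \<longlongrightarrow> D y (r *\<^sub>R h)) (at 0)"
    using c y unfolding c1_on_def by blast
  ultimately show ?thesis by (rule LIM_unique[symmetric])
qed

text \<open>The secant slope of \<gamma> serves as a moving direction in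
  \<open>c1_on_difference_quotient\<close>; it converges to v.\<close>

lemma c1_on_chain:
  fixes \<gamma> :: "real => 'e::lcs"
  assumes c: "c1_on U F D" and y: "\<gamma> s \<in> U"
    and \<gamma>: "((\<lambda>t. (1 / t) *\<^sub>R (\<gamma> (s + t) - \<gamma> s)) \<longlongrightarrow> v) (at 0)"
  shows "((\<lambda>t. (1 / t) *\<^sub>R (F (\<gamma> (s + t)) - F (\<gamma> s))) \<longlongrightarrow> D (\<gamma> s) v) (at 0)"
proof -
  have "((\<lambda>t. (1 / t) *\<^sub>R (F (\<gamma> s + t *\<^sub>R ((1 / t) *\<^sub>R (\<gamma> (s + t) - \<gamma> s))) - F (\<gamma> s))) \<longlongrightarrow> D (\<gamma> s) v) (at 0)"
    by (rule c1_on_difference_quotient[OF c y tendsto_const \<gamma> at_0_scale])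
  then show ?thesis
    by (rule Lim_transform_eventually) (auto simp: eventually_at_filter)
qed

lemma continuous_seq_const: "continuous_on X (\<lambda>(x, h). (x, \<lambda>_::nat. h))"
  unfolding case_prod_unfold
  by (intro continuous_on_Pair continuous_on_coordinatewise_then_product continuous_intros)

lemma smooth_to_continuous_on:
  fixes F :: "'e::lcs => 'f::lcs"
  assumes "smooth_to tv_real U F"
  shows "continuous_on (U \<times> UNIV) (\<lambda>(x, h). iter_ddir tv_real F h k x)"
proof -
  have "tv_top (tv_real :: 'f rtvs) = euclidean" by (simp add: tv_real_def)
  then have "continuous_map (top_of_set (U \<times> UNIV)) euclidean (\<lambda>(x, h). iter_ddir tv_real F h k x)"
    using assms unfolding smooth_to_def by metis
  then show ?thesis by (simp only: continuous_map_iff_continuous)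
qed

lemma smooth_to_c1_on:
  fixes F :: "'e::lcs => complex"
  assumes s: "smooth_to tv_real U F"
  shows "c1_on U F (ddir tv_real F)"
  unfolding c1_on_def
proof (intro conjI ballI allI)
  show "open U" using s by (simp add: smooth_to_def)
next
  fix x h assume x: "x \<in> U"
  have "\<exists>l. has_ddir tv_real (iter_ddir tv_real F (\<lambda>_. h) 0) x h l" using s x unfolding smooth_to_def by blast
  then show "((\<lambda>t. (1 / t) *\<^sub>R (F (x + t *\<^sub>R h) - F x)) \<longlongrightarrow> ddir tv_real F x h) (at 0)"
    using ddir_real has_ddir_real by fastforce
next
  have "continuous_on (U \<times> UNIV) (\<lambda>(x, h). iter_ddir tv_real F h 1 x)"
    by (rule smooth_to_continuous_on[OF s])
  then have "continuous_on (U \<times> UNIV) ((\<lambda>(x, h). iter_ddir tv_real F h 1 x) \<circ> (\<lambda>(x, h). (x, \<lambda>_. h)))"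
    by (intro continuous_on_compose continuous_seq_const) (auto elim: continuous_on_subset)
  then show "continuous_on (U \<times> UNIV) (\<lambda>(x, h). ddir tv_real F x h)"
    by (simp add: comp_def case_prod_unfold)
qed

subsection \<open>Second derivatives along curves\<close>

text \<open>The map of a point and a direction to the derivative is again C^1: differentiating in
  (k, l) gives the second derivative in h and k plus the first derivative in l, because D is linear
  in the direction.\<close>

lemma smooth_to_c1_on_deriv:
  fixes F :: "'e::lcs => complex"
  assumes s: "smooth_to tv_real U F"
  shows "\<exists>D2. c1_on (U \<times> UNIV) (\<lambda>(x, h). ddir tv_real F x h) D2"
proof -
  define D where "D = ddir tv_real F"
  define D2 where "D2 x h k = ddir tv_real (\<lambda>x. D x h) x k" for x h k
  have c: "c1_on U F D" unfolding D_def by (rule smooth_to_c1_on[OF s])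
  have iter2: "iter_ddir tv_real F h 2 x = D2 x (h 0) (h 1)" for h x
    by (simp add: numeral_2_eq_2 D2_def D_def)
  have lim2: "((\<lambda>t. (1 / t) *\<^sub>R (D (x + t *\<^sub>R k) h - D x h)) \<longlongrightarrow> D2 x h k) (at 0)" if "x \<in> U" for x h k
  proof -
    define H where "H n = (if n = 0 then h else k)" for n :: nat
    have "\<exists>l. has_ddir tv_real (iter_ddir tv_real F H 1) x (H 1) l" using s that unfolding smooth_to_def by blast
    then obtain l where l: "has_ddir tv_real (\<lambda>x. D x h) x k l" by (auto simp: H_def D_def)
    have "D2 x h k = l" unfolding D2_def by (rule ddir_real[OF l])
    then show ?thesis using l by (simp add: has_ddir_real)
  qed
  have cont2: "continuous_on (U \<times> UNIV) (\<lambda>(x, H). D2 x (H 0) (H (1::nat)))"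
  proof -
    have "continuous_on (U \<times> UNIV) (\<lambda>(x, H). iter_ddir tv_real F H 2 x)"
      by (rule smooth_to_continuous_on[OF s])
    then show ?thesis by (simp only: iter2)
  qed
  define E where "E = (\<lambda>(x, h) (k, l). D2 x h k + D x l)"
  have "c1_on (U \<times> UNIV) (\<lambda>(x, h). D x h) E"
    unfolding c1_on_def
  proof (intro conjI ballI allI)
    show "open (U \<times> (UNIV :: 'e set))" using c by (simp add: c1_on_def open_Times)
  next
    fix p q :: "'e \<times> 'e" assume p: "p \<in> U \<times> UNIV"
    obtain x h k l where pq: "p = (x, h)" "q = (k, l)" by (cases p, cases q) auto
    have x: "x \<in> U" using p pq by simp
    have Y: "((\<lambda>t. x + t *\<^sub>R k) \<longlongrightarrow> x) (at (0::real))"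
      using tendsto_add[OF tendsto_const tendsto_scaleR_lcs[OF at_0_scale(1) tendsto_const]] by force
    have "\<forall>\<^sub>F t in at 0. x + t *\<^sub>R k \<in> U"
      using topological_tendstoD[OF Y, of U] c x by (simp add: c1_on_def)
    moreover have "\<forall>\<^sub>F t in at (0::real). t \<noteq> 0" by (rule at_0_scale)
    ultimately have ev: "\<forall>\<^sub>F t in at 0. (1 / t) *\<^sub>R (D (x + t *\<^sub>R k) h - D x h) + D (x + t *\<^sub>R k) l =
        (1 / t) *\<^sub>R ((case p + t *\<^sub>R q of (x, h) => D x h) - (case p of (x, h) => D x h))"
    proof eventually_elim
      case (elim t)
      have "D (x + t *\<^sub>R k) (h + t *\<^sub>R l) = D (x + t *\<^sub>R k) h + t *\<^sub>R D (x + t *\<^sub>R k) l"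
        using c1_on_add[OF c elim(1)] c1_on_scale[OF c elim(1)] by simp
      then show ?case using elim by (simp add: pq scaleR_add_right scaleR_diff_right)
    qed
    have "((\<lambda>t. (1 / t) *\<^sub>R (D (x + t *\<^sub>R k) h - D x h) + D (x + t *\<^sub>R k) l) \<longlongrightarrow> D2 x h k + D x l) (at 0)"
      by (intro tendsto_add lim2 x c1_on_tendsto[OF c x Y tendsto_const])
    from Lim_transform_eventually[OF this ev]
    show "((\<lambda>t. (1 / t) *\<^sub>R ((case p + t *\<^sub>R q of (x, h) => D x h) - (case p of (x, h) => D x h))) \<longlongrightarrow> E p q) (at 0)"
      by (simp add: E_def pq)
  next
    have A: "continuous_on ((U \<times> UNIV) \<times> UNIV) (\<lambda>((x, h), (k, l)). (x, \<lambda>n::nat. if n = 0 then h else k))"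
      unfolding case_prod_unfold
    proof (intro continuous_on_Pair continuous_on_coordinatewise_then_product continuous_intros)
      fix i :: nat
      show "continuous_on ((U \<times> UNIV) \<times> UNIV) (\<lambda>p. if i = 0 then snd (fst p) else fst (snd p))"
        by (cases "i = 0") (simp_all add: continuous_intros)
    qed
    have "continuous_on ((U \<times> UNIV) \<times> UNIV)
        ((\<lambda>(x, H). D2 x (H 0) (H (1::nat))) \<circ> (\<lambda>((x, h), (k, l)). (x, \<lambda>n::nat. if n = 0 then h else k)))"
      by (intro continuous_on_compose A continuous_on_subset[OF cont2]) auto
    moreover have "continuous_on ((U \<times> UNIV) \<times> UNIV) ((\<lambda>(x, h). D x h) \<circ> (\<lambda>((x, h), (k, l)). (x, l)))"
      using c unfolding case_prod_unfold c1_on_def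
      by (intro continuous_on_compose continuous_intros) (auto elim: continuous_on_subset)
    ultimately show "continuous_on ((U \<times> UNIV) \<times> UNIV) (\<lambda>(p, q). E p q)"
      unfolding E_def comp_def case_prod_unfold by (intro continuous_on_add) simp_all
  qed
  then show ?thesis unfolding D_def by blast
qed

text \<open>The chain rule is applied to F along \<gamma>, and then to the derivative of F along the
  curve (\<gamma>, \<gamma>'). The second derivative at 0 is what later yields a quadratic bound for
  1 - Re g.\<close>

lemma smooth_to_curve:
  fixes F :: "'e::lcs => complex" and \<gamma> \<gamma>' :: "real => 'e"
  assumes s: "smooth_to tv_real U F" and \<gamma>0: "\<gamma> 0 \<in> U"
    and \<gamma>: "\<forall>\<^sub>F r in nhds 0. ((\<lambda>t. (1 / t) *\<^sub>R (\<gamma> (r + t) - \<gamma> r)) \<longlongrightarrow> \<gamma>' r) (at 0)"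
    and U: "\<forall>\<^sub>F r in nhds 0. \<gamma> r \<in> U"
    and \<gamma>'': "((\<lambda>t. (1 / t) *\<^sub>R (\<gamma>' t - \<gamma>' 0)) \<longlongrightarrow> w) (at 0)"
  shows "\<exists>g' g''. (\<forall>\<^sub>F r in nhds 0. ((\<lambda>r. F (\<gamma> r)) has_vector_derivative g' r) (at r)) \<and>
    (g' has_vector_derivative g'') (at 0) \<and> g' 0 = ddir tv_real F (\<gamma> 0) (\<gamma>' 0)"
proof -
  define D where "D = ddir tv_real F"
  define g' where "g' r = D (\<gamma> r) (\<gamma>' r)" for r
  have c: "c1_on U F D" unfolding D_def by (rule smooth_to_c1_on[OF s])
  obtain D2 where D2: "c1_on (U \<times> UNIV) (\<lambda>(x, h). D x h) D2"
    using smooth_to_c1_on_deriv[OF s] unfolding D_def by blast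
  have hvd: "(f has_vector_derivative l) (at r)"
    if "((\<lambda>t. (1 / t) *\<^sub>R (f (r + t) - f r)) \<longlongrightarrow> l) (at 0)" for f :: "real => complex" and l r
  proof -
    have "((\<lambda>t. norm ((1 / t) *\<^sub>R (f (r + t) - f r) - l)) \<longlongrightarrow> 0) (at 0)"
      by (intro tendsto_norm_zero LIM_zero that)
    then have "((\<lambda>t. norm (f (r + t) - f r - t *\<^sub>R l) / norm t) \<longlongrightarrow> 0) (at 0)"
    proof (rule Lim_transform_eventually)
      have "norm ((1 / t) *\<^sub>R a - b) = norm (a - t *\<^sub>R b) / norm t" if "t \<noteq> 0" for t :: real and a b :: complex
      proof -
        have "(1 / t) *\<^sub>R a - b = (1 / t) *\<^sub>R (a - t *\<^sub>R b)" using that by (simp add: scaleR_diff_right)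
        then show ?thesis by simp
      qed
      then show "\<forall>\<^sub>F t in at 0. norm ((1 / t) *\<^sub>R (f (r + t) - f r) - l) = norm (f (r + t) - f r - t *\<^sub>R l) / norm t"
        by (auto simp: eventually_at_filter)
    qed
    then show ?thesis unfolding has_vector_derivative_def has_derivative_at by (simp add: bounded_linear_scaleR_left)
  qed
  have "\<forall>\<^sub>F r in nhds 0. ((\<lambda>r. F (\<gamma> r)) has_vector_derivative g' r) (at r)"
    using \<gamma> U by eventually_elim (unfold g'_def, rule hvd, rule c1_on_chain[OF c])
  moreover have "(g' has_vector_derivative D2 (\<gamma> 0, \<gamma>' 0) (\<gamma>' 0, w)) (at 0)"
  proof (rule hvd)
    have "((\<lambda>t. (1 / t) *\<^sub>R (\<gamma> (0 + t) - \<gamma> 0)) \<longlongrightarrow> \<gamma>' 0) (at 0)"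
      using eventually_nhds_x_imp_x[OF \<gamma>] .
    then have "((\<lambda>t. (1 / t) *\<^sub>R ((\<gamma> (0 + t), \<gamma>' (0 + t)) - (\<gamma> 0, \<gamma>' 0))) \<longlongrightarrow> (\<gamma>' 0, w)) (at 0)"
      using \<gamma>'' by (simp add: tendsto_Pair scaleR_prod_def)
    from c1_on_chain[OF D2, of "\<lambda>r. (\<gamma> r, \<gamma>' r)" 0, OF _ this]
    show "((\<lambda>t. (1 / t) *\<^sub>R (g' (0 + t) - g' 0)) \<longlongrightarrow> D2 (\<gamma> 0, \<gamma>' 0) (\<gamma>' 0, w)) (at 0)"
      using \<gamma>0 by (simp add: g'_def)
  qed
  moreover have "g' 0 = ddir tv_real F (\<gamma> 0) (\<gamma>' 0)" by (simp add: g'_def D_def)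
  ultimately show ?thesis by blast
qed

subsection \<open>Holomorphic scalar functions\<close>

definition cholo_on :: "'e::complex_lcs set => ('e => complex) => ('e => 'e => complex) => bool" where
  "cholo_on U F D \<longleftrightarrow> c1_on U F D \<and> (\<forall>x\<in>U. \<forall>c h. D x (c *\<^sub>C h) = c * D x h)"

text \<open>The composite has directional derivative d * g z with a continuous g. The mean value
  inequality on the segment from z to z + h makes this a complex derivative in the usual
  sense.\<close>

lemma cholo_on_curve:
  fixes \<gamma> :: "complex => 'e::complex_lcs"
  assumes F: "cholo_on U F D" and \<Omega>: "open \<Omega>" and U: "\<gamma> ` \<Omega> \<subseteq> U"
    and cont: "continuous_on \<Omega> \<gamma>" "continuous_on \<Omega> \<gamma>1"
    and \<gamma>: "\<And>z d. z \<in> \<Omega> ==> ((\<lambda>t. (1 / t) *\<^sub>R (\<gamma> (z + t *\<^sub>R d) - \<gamma> z)) \<longlongrightarrow> d *\<^sub>C \<gamma>1 z) (at 0)"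
  shows "(\<lambda>z. F (\<gamma> z)) holomorphic_on \<Omega>"
proof -
  have c: "c1_on U F D" and lin: "\<And>x c h. x \<in> U ==> D x (c *\<^sub>C h) = c * D x h"
    using F by (auto simp: cholo_on_def)
  define G where "G z = F (\<gamma> z)" for z
  define g where "g z = D (\<gamma> z) (\<gamma>1 z)" for z
  have tend: "(f \<longlongrightarrow> f z) (at z)" if "continuous_on \<Omega> f" "z \<in> \<Omega>" for f :: "complex => 'b::topological_space" and z
    using that \<Omega> by (simp add: continuous_on_eq_continuous_at isCont_def)
  have gcont: "continuous_on \<Omega> g"
    unfolding continuous_on_eq_continuous_at[OF \<Omega>] isCont_def g_def
    using U by (intro ballI c1_on_tendsto[OF c] tend cont) auto
  have cG: "c1_on \<Omega> G (\<lambda>z d. d * g z)"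
    unfolding c1_on_def
  proof (intro conjI ballI allI \<Omega>)
    fix z d assume z: "z \<in> \<Omega>"
    have "((\<lambda>t. (1 / t) *\<^sub>R (F (\<gamma> (z + (0 + t) *\<^sub>R d)) - F (\<gamma> (z + 0 *\<^sub>R d)))) \<longlongrightarrow> D (\<gamma> (z + 0 *\<^sub>R d)) (d *\<^sub>C \<gamma>1 z)) (at 0)"
      using U z \<gamma>[OF z, of d] by (intro c1_on_chain[OF c, of "\<lambda>r. \<gamma> (z + r *\<^sub>R d)" 0]) auto
    then show "((\<lambda>t. (1 / t) *\<^sub>R (G (z + t *\<^sub>R d) - G z)) \<longlongrightarrow> d * g z) (at 0)"
      using lin[of "\<gamma> z"] U z by (auto simp: G_def g_def)
  next
    show "continuous_on (\<Omega> \<times> UNIV) (\<lambda>(z, d). d * g z)"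
      unfolding case_prod_unfold
      by (intro continuous_intros continuous_on_compose2[OF gcont]) auto
  qed
  have "(G has_field_derivative g z) (at z)" if z: "z \<in> \<Omega>" for z
    unfolding has_field_derivative_def has_derivative_at
  proof (intro conjI bounded_linear_mult_right tendstoI)
    fix e :: real assume e: "e > 0"
    obtain d1 where d1: "d1 > 0" "ball z d1 \<subseteq> \<Omega>" using \<Omega> z open_contains_ball by blast
    obtain d2 where d2: "d2 > 0" "\<And>w. dist w z < d2 ==> w \<in> \<Omega> ==> dist (g w) (g z) < e / 2"
      using gcont z e unfolding continuous_on_iff by (metis half_gt_zero)
    define d where "d = min d1 d2"
    have "norm (G (z + h) - G z - g z * h) / norm h < e" if h: "h \<noteq> 0" "norm h < d" for h
    proof -
      have seg: "z + r *\<^sub>R h \<in> \<Omega> \<and> norm (g (z + r *\<^sub>R h) - g z) \<le> e / 2" if r: "r \<in> {0..1}" for r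
      proof -
        have "norm (r *\<^sub>R h) \<le> norm h" using r by (simp add: mult_left_le_one_le)
        moreover have "dist (z + r *\<^sub>R h) z = norm (r *\<^sub>R h)" by (simp add: dist_norm)
        ultimately have "dist (z + r *\<^sub>R h) z < d" using h by linarith
        then have "z + r *\<^sub>R h \<in> \<Omega>" "dist (z + r *\<^sub>R h) z < d2" using d1(2) by (auto simp: d_def dist_commute)
        then show ?thesis using d2(2) by (force simp: dist_norm)
      qed
      have "norm (G (z + 1 *\<^sub>R h) - G (z + 0 *\<^sub>R h) - (1 - 0) *\<^sub>R (h * g (z + 0 *\<^sub>R h))) \<le> norm (1 - 0 :: real) * (norm h * (e / 2))"
      proof (rule vector_differentiable_bound_linearization[where S = "{0..1}"])
        fix r :: real assume r: "r \<in> {0..1}"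
        show "((\<lambda>r. G (z + r *\<^sub>R h)) has_vector_derivative h * g (z + r *\<^sub>R h)) (at r within {0..1})"
          by (rule has_vector_derivative_at_within, rule c1_on_line[OF cG]) (use seg[OF r] in simp)
        have "norm (h * g (z + r *\<^sub>R h) - h * g (z + 0 *\<^sub>R h)) = norm h * norm (g (z + r *\<^sub>R h) - g z)"
          by (simp add: norm_mult[symmetric] right_diff_distrib)
        also have "\<dots> \<le> norm h * (e / 2)" using seg[OF r] by (intro mult_left_mono) simp_all
        finally show "norm (h * g (z + r *\<^sub>R h) - h * g (z + 0 *\<^sub>R h)) \<le> norm h * (e / 2)" .
      qed (auto simp: closed_segment_eq_real_ivl)
      then have "norm (G (z + h) - G z - g z * h) \<le> norm h * (e / 2)" by (simp add: mult.commute)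
      then have "norm (G (z + h) - G z - g z * h) / norm h \<le> e / 2" using h by (simp add: divide_le_eq mult.commute)
      then show ?thesis using e by linarith
    qed
    then show "\<forall>\<^sub>F h in at 0. dist (norm (G (z + h) - G z - g z * h) / norm h) 0 < e"
      using d1 d2 unfolding eventually_at by (intro exI[of _ d]) (auto simp: d_def)
  qed
  then show ?thesis unfolding G_def[symmetric] holomorphic_on_def
    by (auto simp: field_differentiable_def intro: has_field_derivative_at_within)
qed

subsection \<open>Functions with values in a normed algebra\<close>

context pre_cstar
begin

abbreviation nd :: "'a => 'a => real" where
  "nd \<equiv> \<lambda>a b. if a \<in> carrier A \<and> b \<in> carrier A then nrm A (a \<ominus> b) else 0"

lemma metric: "Metric_space (carrier A) nd"
proof
  show "nd x y = nd y x" for x y by (simp add: nrm_minus_commute)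
  show "0 \<le> nd x y" for x y by (simp add: nrm_nonneg)
  fix x y z assume xy: "x \<in> carrier A" "y \<in> carrier A"
  have "x = (x \<ominus> y) \<oplus> y" using xy by (simp add: minus_sm a_assoc sm_collect)
  then show "nd x y = 0 \<longleftrightarrow> x = y"
    using xy nrm_eq_0[of "x \<ominus> y"] by (auto simp: minus_sm sm_collect)
  show "nd x z \<le> nd x y + nd y z" if "z \<in> carrier A" using xy that by (simp add: nrm_minus_triangle)
qed

lemma clin_limitin:
  assumes l: "clin l" "\<And>x. x \<in> carrier A ==> cmod (l x) \<le> K * nrm A x"
    and f: "limitin (tv_top (tv_alg A)) f b F"
  shows "((\<lambda>x. l (f x)) \<longlongrightarrow> l b) F"
proof (rule tendstoI)
  interpret Metric_space "carrier A" nd by (rule metric)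
  fix e :: real assume e: "e > 0"
  have "limitin mtopology f b F" using f by (simp add: tv_alg_def)
  then have "b \<in> carrier A \<and> (\<forall>e>0. \<forall>\<^sub>F x in F. f x \<in> carrier A \<and> nd (f x) b < e)"
    unfolding limitin_metric .
  then have b: "b \<in> carrier A" and lim: "\<And>e. e > 0 ==> \<forall>\<^sub>F x in F. f x \<in> carrier A \<and> nd (f x) b < e"
    by blast+
  define K' where "K' = max K 1"
  have K': "K' > 0" by (simp add: K'_def)
  have "\<forall>\<^sub>F x in F. f x \<in> carrier A \<and> nd (f x) b < e / K'" by (intro lim divide_pos_pos e K')
  then show "\<forall>\<^sub>F x in F. dist (l (f x)) (l b) < e"
    unfolding dist_norm
  proof (rule eventually_mono)
    fix x assume x: "f x \<in> carrier A \<and> nd (f x) b < e / K'"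
    have "cmod (l (f x) - l b) = cmod (l (f x \<ominus> b))" using x b by (simp add: clin_minus l)
    also have "\<dots> \<le> K * nrm A (f x \<ominus> b)" using x b by (intro l) simp
    also have "\<dots> \<le> K' * nrm A (f x \<ominus> b)" using x b by (intro mult_right_mono nrm_nonneg) (auto simp: K'_def)
    also have "\<dots> < e"
    proof -
      have "f x \<in> carrier A" and "nd (f x) b < e / K'" using x by blast+
      then have "nrm A (f x \<ominus> b) < e / K'" using b by simp
      then show ?thesis using K' by (simp add: field_simps)
    qed
    finally show "cmod (l (f x) - l b) < e" .
  qed
qed

lemma clin_continuous_map:
  assumes l: "clin l" "\<And>x. x \<in> carrier A ==> cmod (l x) \<le> K * nrm A x"
  shows "continuous_map (tv_top (tv_alg A)) euclidean l"
  unfolding continuous_map_atin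
proof
  fix x assume x: "x \<in> topspace (tv_top (tv_alg A))"
  have "limitin (tv_top (tv_alg A)) (\<lambda>y. y) x (atin (tv_top (tv_alg A)) x)"
    using continuous_map_id[of "tv_top (tv_alg A)"] x unfolding continuous_map_atin id_def by blast
  from clin_limitin[OF l this] show "limitin euclidean l (l x) (atin (tv_top (tv_alg A)) x)" by simp
qed

lemma topspace_tv_alg [simp]: "topspace (tv_top (tv_alg A)) = carrier A"
  using Metric_space.topspace_mtopology[OF metric] by (simp add: tv_alg_def)

lemma has_ddir_unique:
  assumes "has_ddir (tv_alg A) f x h l" "has_ddir (tv_alg A) f x h l'"
  shows "l = l'"
proof -
  interpret Metric_space "carrier A" nd by (rule metric)
  show ?thesis using assms unfolding has_ddir_def
    by (intro limitin_metric_unique[of _ l "at (0::real)" l']) (simp_all add: tv_alg_def)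
qed

lemma ddir_alg: "has_ddir (tv_alg A) f x h l ==> ddir (tv_alg A) f x h = l"
  unfolding ddir_def by (rule the_equality) (auto intro: has_ddir_unique)

lemma has_ddir_clin:
  fixes f :: "'e::lcs => 'a"
  assumes l: "clin l" "\<And>x. x \<in> carrier A ==> cmod (l x) \<le> K * nrm A x"
    and U: "open U" "x \<in> U" and f: "\<And>y. y \<in> U ==> f y \<in> carrier A" and F: "\<And>y. y \<in> U ==> F y = l (f y)"
    and d: "has_ddir (tv_alg A) f x h b"
  shows "has_ddir tv_real F x h (l b)"
proof -
  define q where "q t = complex_of_real (1 / t) \<odot>\<^bsub>A\<^esub> (f (x + t *\<^sub>R h) \<oplus> complex_of_real (- 1) \<odot>\<^bsub>A\<^esub> f x)" for t
  have "limitin (tv_top (tv_alg A)) q b (at 0)"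
    using d unfolding has_ddir_def q_def by (simp add: tv_alg_def)
  from clin_limitin[OF l this] have "((\<lambda>t. l (q t)) \<longlongrightarrow> l b) (at 0)" .
  moreover have "((\<lambda>t. x + t *\<^sub>R h) \<longlongrightarrow> x) (at (0::real))"
    using tendsto_add[OF tendsto_const tendsto_scaleR_lcs[OF at_0_scale(1) tendsto_const]] by force
  then have "\<forall>\<^sub>F t in at 0. x + t *\<^sub>R h \<in> U" using topological_tendstoD U by blast
  then have "\<forall>\<^sub>F t in at 0. l (q t) = (1 / t) *\<^sub>R (F (x + t *\<^sub>R h) - F x)"
  proof eventually_elim
    case (elim t)
    have [simp]: "f (x + t *\<^sub>R h) \<in> carrier A" "f x \<in> carrier A" using f elim U by auto
    show ?case using F[OF elim] F[OF U(2)]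
      by (simp add: q_def clin_smult[OF l(1)] clin_add[OF l(1)] scaleR_conv_of_real)
  qed
  ultimately show ?thesis unfolding has_ddir_real by (rule Lim_transform_eventually)
qed

lemma smooth_to_clin:
  fixes f :: "'e::lcs => 'a"
  assumes l: "clin l" "\<And>x. x \<in> carrier A ==> cmod (l x) \<le> K * nrm A x"
    and s: "smooth_to (tv_alg A) U f"
  shows "smooth_to tv_real U (\<lambda>x. l (f x))"
    and "x \<in> U ==> ddir tv_real (\<lambda>x. l (f x)) x h = l (ddir (tv_alg A) f x h)"
proof -
  have U: "open U" and ex: "\<And>k h x. x \<in> U ==> \<exists>b. has_ddir (tv_alg A) (iter_ddir (tv_alg A) f h k) x (h k) b"
    and cont: "\<And>k. continuous_map (top_of_set (U \<times> UNIV)) (tv_top (tv_alg A)) (\<lambda>(x, h). iter_ddir (tv_alg A) f h k x)"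
    using s by (auto simp: smooth_to_def)
  have inA: "iter_ddir (tv_alg A) f h k x \<in> carrier A" if "x \<in> U" for x h k
    using continuous_map_funspace[OF cont[of k]] that by (auto simp: Pi_iff)
  have iter: "iter_ddir tv_real (\<lambda>x. l (f x)) h k x = l (iter_ddir (tv_alg A) f h k x)" if "x \<in> U" for x h k
    using that
  proof (induction k arbitrary: x)
    case (Suc k)
    obtain b where b: "has_ddir (tv_alg A) (iter_ddir (tv_alg A) f h k) x (h k) b" using ex[OF Suc.prems] by blast
    have "has_ddir tv_real (iter_ddir tv_real (\<lambda>x. l (f x)) h k) x (h k) (l b)"
      using Suc.IH inA by (intro has_ddir_clin[OF l U Suc.prems _ _ b]) auto
    then show ?case using b ddir_alg ddir_real by fastforce
  qed simp
  have dd: "has_ddir tv_real (iter_ddir tv_real (\<lambda>x. l (f x)) h k) x (h k) (l (ddir (tv_alg A) (iter_ddir (tv_alg A) f h k) x (h k)))"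
    if x: "x \<in> U" for x h k
  proof -
    obtain b where b: "has_ddir (tv_alg A) (iter_ddir (tv_alg A) f h k) x (h k) b" using ex[OF x] by blast
    have "has_ddir tv_real (iter_ddir tv_real (\<lambda>x. l (f x)) h k) x (h k) (l b)"
      using iter inA by (intro has_ddir_clin[OF l U x _ _ b]) auto
    then show ?thesis using ddir_alg[OF b] by simp
  qed
  show "smooth_to tv_real U (\<lambda>x. l (f x))"
    unfolding smooth_to_def
  proof (intro conjI allI ballI U)
    show "\<exists>b. has_ddir tv_real (iter_ddir tv_real (\<lambda>x. l (f x)) h k) x (h k) b" if "x \<in> U" for x h k
      using dd[OF that] by blast
    fix k
    have "continuous_map (top_of_set (U \<times> UNIV)) euclidean (l \<circ> (\<lambda>(x, h). iter_ddir (tv_alg A) f h k x))"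
      by (rule continuous_map_compose[OF cont clin_continuous_map[OF l]])
    then have "continuous_map (top_of_set (U \<times> UNIV)) euclidean (\<lambda>(x, h). iter_ddir tv_real (\<lambda>x. l (f x)) h k x)"
      by (rule continuous_map_eq) (auto simp: iter)
    then show "continuous_map (top_of_set (U \<times> UNIV)) (tv_top tv_real) (\<lambda>(x, h). iter_ddir tv_real (\<lambda>x. l (f x)) h k x)"
      by (simp add: tv_real_def)
  qed
  show "ddir tv_real (\<lambda>x. l (f x)) x h = l (ddir (tv_alg A) f x h)" if "x \<in> U"
    using ddir_real[OF dd[OF that, of "\<lambda>_. h" 0]] by simp
qed

lemma holo_to_clin:
  fixes f :: "'e::complex_lcs => 'a"
  assumes l: "clin l" "\<And>x. x \<in> carrier A ==> cmod (l x) \<le> K * nrm A x"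
    and f: "holo_to (tv_alg A) U f"
  shows "cholo_on U (\<lambda>x. l (f x)) (ddir tv_real (\<lambda>x. l (f x)))"
proof -
  have s: "smooth_to (tv_alg A) U f" using f by (simp add: holo_to_def)
  have inA: "ddir (tv_alg A) f x h \<in> carrier A" if x: "x \<in> U" for x h
  proof -
    have "\<exists>b. has_ddir (tv_alg A) (iter_ddir (tv_alg A) f (\<lambda>_. h) 0) x h b"
      using s x unfolding smooth_to_def by blast
    then obtain b where b: "has_ddir (tv_alg A) f x h b" by auto
    then have "b \<in> carrier A" unfolding has_ddir_def using limitin_topspace by fastforce
    then show ?thesis using ddir_alg[OF b] by simp
  qed
  have "ddir (tv_alg A) f x (c *\<^sub>C h) = c \<odot>\<^bsub>A\<^esub> ddir (tv_alg A) f x h" if "x \<in> U" for x c h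
    using f that by (simp add: holo_to_def tv_alg_def)
  then show ?thesis unfolding cholo_on_def
    using smooth_to_c1_on[OF smooth_to_clin(1)[OF l s]] smooth_to_clin(2)[OF l s] inA clin_smult[OF l(1)] by simp
qed

end

section \<open>The canonical map into the host algebra is continuous and holomorphic\<close>

lemma finite_support_induct [consumes 1, case_names zero step]:
  fixes f :: "'s => complex"
  assumes f: "finite {s. f s \<noteq> 0}" and zero: "P (\<lambda>s. 0)"
    and step: "\<And>c s g. finite {t. g t \<noteq> 0} ==> P g ==> P (\<lambda>t. c * delta s t + g t)"
  shows "P f"
proof -
  have "P f" if "finite F" "{s. f s \<noteq> 0} = F" for F and f :: "'s => complex"
    using that
  proof (induction F arbitrary: f)
    case empty
    then have "f = (\<lambda>s. 0)" by auto
    then show ?case using zero by simp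
  next
    case (insert s F)
    define g where "g = f(s := 0)"
    have g: "{t. g t \<noteq> 0} = F" using insert(2,4) by (auto simp: g_def)
    have "f = (\<lambda>t. f s * delta s t + g t)" by (auto simp: g_def delta_def)
    then show ?case using step[of g "f s" s] insert(1) insert(3)[OF g] g by metis
  qed
  then show ?thesis using f by blast
qed

text \<open>The limit is taken along one sequence tending to 0; the linear Cauchy rate then holds
  between that limit and every h.\<close>

lemma punctured_Cauchy_limit:
  fixes q :: "complex => complex"
  assumes r: "r > 0" and q: "\<And>h k. h \<noteq> 0 ==> k \<noteq> 0 ==> cmod h < r ==> cmod k < r ==> cmod (q h - q k) \<le> K * (cmod h + cmod k)"
  shows "\<exists>l. (q \<longlongrightarrow> l) (at 0)"
proof -
  define x where "x n = complex_of_real (r / (2 + real n))" for n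
  have x: "x n \<noteq> 0" "cmod (x n) < r" for n
  proof -
    have "r / (2 + real n) > 0" "r / (2 + real n) < r" using r by (simp_all add: divide_less_eq)
    then show "x n \<noteq> 0" "cmod (x n) < r" by (simp_all add: x_def del: of_real_divide of_real_add)
  qed
  have x0: "(\<lambda>n. cmod (x n)) \<longlonglongrightarrow> 0"
  proof -
    have "(\<lambda>n. r / (2 + real n)) \<longlonglongrightarrow> 0" by real_asymp
    then have "(\<lambda>n. \<bar>r / (2 + real n)\<bar>) \<longlonglongrightarrow> 0" by (rule tendsto_rabs_zero)
    then show ?thesis by (simp add: x_def del: of_real_divide)
  qed
  have K: "K \<ge> 0"
  proof -
    have "0 \<le> K * (cmod (x 0) + cmod (x 0))" using q[of "x 0" "x 0"] x by simp
    then show ?thesis using x(1)[of 0] by (simp add: zero_le_mult_iff)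
  qed
  have "Cauchy (\<lambda>n. q (x n))"
  proof (rule metric_CauchyI)
    fix e :: real assume e: "e > 0"
    have "(\<lambda>n. K * cmod (x n)) \<longlonglongrightarrow> 0" by (rule tendsto_mult_right_zero[OF x0])
    then obtain N where N: "\<And>n. n \<ge> N ==> K * cmod (x n) < e / 2"
      using order_tendstoD(2)[of _ 0 sequentially "e/2"] e by (auto simp: eventually_sequentially)
    have "dist (q (x m)) (q (x n)) < e" if "m \<ge> N" "n \<ge> N" for m n
      using q[of "x m" "x n"] x N[OF that(1)] N[OF that(2)] by (simp add: dist_norm distrib_left)
    then show "\<exists>M. \<forall>m\<ge>M. \<forall>n\<ge>M. dist (q (x m)) (q (x n)) < e" by blast
  qed
  then obtain l where l: "(\<lambda>n. q (x n)) \<longlonglongrightarrow> l" using Cauchy_convergent_iff convergent_def by blast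
  have le: "cmod (q h - l) \<le> K * cmod h" if h: "h \<noteq> 0" "cmod h < r" for h
  proof (rule LIMSEQ_le)
    show "(\<lambda>n. cmod (q h - q (x n))) \<longlonglongrightarrow> cmod (q h - l)" by (intro tendsto_intros l)
    show "(\<lambda>n. K * (cmod h + cmod (x n))) \<longlonglongrightarrow> K * cmod h"
      using tendsto_mult[OF tendsto_const tendsto_add[OF tendsto_const x0]] by force
    show "\<exists>N. \<forall>n\<ge>N. cmod (q h - q (x n)) \<le> K * (cmod h + cmod (x n))" using q[OF h(1) x(1) h(2) x(2)] by blast
  qed
  have "((\<lambda>h. q h - l) \<longlongrightarrow> 0) (at 0)"
  proof (rule Lim_null_comparison)
    show "\<forall>\<^sub>F h in at 0. norm (q h - l) \<le> K * cmod h"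
      unfolding eventually_at using le r by (intro exI[of _ r]) (auto simp: dist_norm)
    show "((\<lambda>h. K * cmod h) \<longlongrightarrow> 0) (at 0)" by (intro tendsto_eq_intros) auto
  qed
  then have "(q \<longlongrightarrow> l) (at 0)" by (rule LIM_zero_cancel)
  then show ?thesis by blast
qed

text \<open>The point is a constant that depends on C and \<rho> but not on G. The Cauchy estimate
  on discs of radius \<rho>/4 bounds the second derivative by 2! C / (\<rho>/4)^2, whence 32, and
  the Taylor formula of first order follows.\<close>

lemma holomorphic_first_order_bound:
  assumes G: "G holomorphic_on ball z0 \<rho>" and bd: "\<And>w. w \<in> ball z0 \<rho> ==> cmod (G w) < C" and \<rho>: "\<rho> > 0"
    and h: "cmod h < \<rho> / 4" "h \<noteq> 0"
  shows "cmod ((G (z0 + h) - G z0) / h - deriv G z0) \<le> 32 * C / \<rho>\<^sup>2 * cmod h"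
proof -
  have der2: "cmod ((deriv ^^ 2) G w) \<le> 32 * C / \<rho>\<^sup>2" if w: "w \<in> ball z0 (\<rho> / 4)" for w
  proof -
    have sub: "cball w (\<rho> / 4) \<subseteq> ball z0 \<rho>"
    proof
      fix v assume "v \<in> cball w (\<rho> / 4)"
      then show "v \<in> ball z0 \<rho>" using w dist_triangle[of z0 v w] \<rho> by simp
    qed
    have "cmod ((deriv ^^ 2) G w) \<le> fact 2 * C / (\<rho> / 4) ^ 2"
    proof (rule Cauchy_higher_deriv_bound[where y = 0])
      show "G holomorphic_on ball w (\<rho> / 4)" by (rule holomorphic_on_subset[OF G]) (use sub in auto)
      show "continuous_on (cball w (\<rho> / 4)) G"
        by (rule holomorphic_on_imp_continuous_on, rule holomorphic_on_subset[OF G sub])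
      show "G v \<in> ball 0 C" if "v \<in> ball w (\<rho> / 4)" for v using bd[of v] sub that by (force simp: subset_iff)
    qed (use \<rho> in simp_all)
    also have "\<dots> = 32 * C / \<rho>\<^sup>2" by (simp add: power_divide)
    finally show ?thesis .
  qed
  have sub: "ball z0 (\<rho> / 4) \<subseteq> ball z0 \<rho>" using \<rho> by (simp add: subset_ball)
  have G': "G holomorphic_on ball z0 (\<rho> / 4)" by (rule holomorphic_on_subset[OF G sub])
  have "cmod ((deriv ^^ 0) G (z0 + h) - (\<Sum>i\<le>1. (deriv ^^ i) G z0 * (z0 + h - z0) ^ i / fact i)) \<le>
      32 * C / \<rho>\<^sup>2 * cmod (z0 + h - z0) ^ (Suc 1) / fact 1"
  proof (rule complex_Taylor[where S = "ball z0 (\<rho> / 4)"])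
    fix i and x assume x: "x \<in> ball z0 (\<rho> / 4)"
    have "(deriv ^^ i) G holomorphic_on ball z0 (\<rho> / 4)" by (intro holomorphic_higher_deriv G') simp
    then show "((deriv ^^ i) G has_field_derivative (deriv ^^ Suc i) G x) (at x within ball z0 (\<rho> / 4))"
      using holomorphic_derivI[OF _ open_ball x] by simp
  next
    fix x assume "x \<in> ball z0 (\<rho> / 4)"
    then show "cmod ((deriv ^^ Suc 1) G x) \<le> 32 * C / \<rho>\<^sup>2" using der2 by (simp add: numeral_2_eq_2)
  qed (use \<rho> h in \<open>auto simp: dist_norm\<close>)
  then have "cmod (G (z0 + h) - G z0 - deriv G z0 * h) \<le> 32 * C / \<rho>\<^sup>2 * (cmod h)\<^sup>2"
    by (simp add: algebra_simps power2_eq_square)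
  then have "cmod (G (z0 + h) - G z0 - deriv G z0 * h) / cmod h \<le> 32 * C / \<rho>\<^sup>2 * cmod h"
    using h by (simp add: divide_le_eq power2_eq_square mult_ac)
  moreover have "(G (z0 + h) - G z0) / h - deriv G z0 = (G (z0 + h) - G z0 - deriv G z0 * h) / h"
    using h by (simp add: field_simps)
  ultimately show ?thesis by (simp add: norm_divide)
qed

locale bounded_semigroup = valued_semigroup +
  assumes loc_bdd: "locally_bounded_on UNIV \<alpha>"
begin

text \<open>All scalar functions on S that test the norm of the host algebra. They are locally
  holomorphic and dominated by \<alpha>, so bounds that are uniform on this set become norm bounds
  by \<open>nrm_\<iota>_le\<close>.\<close>

definition scalars :: "('a => complex) set" where
  "scalars = {(\<lambda>s. l (\<beta> s)) |B \<beta> l. (B, \<beta>) \<in> holo_morphisms S \<alpha> \<and> star_algebra.clin B l \<and>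
     (\<forall>y\<in>carrier B. cmod (l y) \<le> nrm B y)}"

lemma scalars_le: "\<Lambda> \<in> scalars ==> cmod (\<Lambda> s) \<le> \<alpha> s"
proof -
  assume "\<Lambda> \<in> scalars"
  then obtain B \<beta> l where i: "(B, \<beta>) \<in> holo_morphisms S \<alpha>" "\<Lambda> = (\<lambda>s. l (\<beta> s))" "\<forall>y\<in>carrier B. cmod (l y) \<le> nrm B y"
    unfolding scalars_def by blast
  interpret semigroup_morphism S \<alpha> B \<beta> using i(1) by (rule morphism)
  have "cmod (l (\<beta> s)) \<le> nrm B (\<beta> s)" using i(3) \<beta>_in[of s] by (rule bspec)
  then show ?thesis unfolding i(2) using \<beta>_le[of s] by (rule order_trans)
qed

lemma scalars_chart:
  assumes "\<Lambda> \<in> scalars" "(U, \<phi>) \<in> sg_charts S"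
  shows "\<exists>D. cholo_on (\<phi> ` U) (\<lambda>x. \<Lambda> (inv_into U \<phi> x)) D"
proof -
  obtain B \<beta> l where i: "(B, \<beta>) \<in> holo_morphisms S \<alpha>" "\<Lambda> = (\<lambda>s. l (\<beta> s))" "star_algebra.clin B l"
    "\<forall>y\<in>carrier B. cmod (l y) \<le> nrm B y"
    using assms(1) unfolding scalars_def by blast
  interpret semigroup_morphism S \<alpha> B \<beta> using i(1) by (rule morphism)
  have "holo_to (tv_alg B) (\<phi> ` U) (\<beta> \<circ> inv_into U \<phi>)"
    using i(1) assms(2) by (auto simp: holo_morphisms_def mfd_holo_to_def)
  moreover have "cmod (l y) \<le> 1 * nrm B y" if "y \<in> carrier B" for y using i(4) that by simp
  ultimately have "cholo_on (\<phi> ` U) (\<lambda>x. l ((\<beta> \<circ> inv_into U \<phi>) x)) (ddir tv_real (\<lambda>x. l ((\<beta> \<circ> inv_into U \<phi>) x)))"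
    by (intro B.holo_to_clin[OF i(3)])
  then show ?thesis unfolding i(2) comp_def by blast
qed

lemma nrm_\<iota>_le:
  assumes "finite {s. f s \<noteq> 0}" "\<And>\<Lambda>. \<Lambda> \<in> scalars ==> cmod (pairing f \<Lambda>) \<le> K"
  shows "nrm (host_cstar S \<alpha>) (\<iota> f) \<le> K"
  by (rule \<iota>_le[OF assms(1)], rule assms(2)) (auto simp: scalars_def)

lemma clin_\<iota>:
  assumes l: "star_algebra.clin (host_cstar S \<alpha>) l" and f: "finite {s. f s \<noteq> 0}"
  shows "l (\<iota> f) = pairing f (\<lambda>s. l (\<eta>\<alpha> s))"
proof -
  interpret A: pre_cstar "host_cstar S \<alpha>" by (rule host_pre_cstar)
  show ?thesis using f
  proof (induction rule: finite_support_induct)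
    case zero
    have "\<iota> (\<lambda>s. 0) = \<zero>\<^bsub>host_cstar S \<alpha>\<^esub>"
      using \<iota>_hom(4)[OF finite_delta finite_delta, of 0] \<iota>_hom(1)[OF finite_delta finite_delta] by simp
    then show ?case using A.clin_zero[OF l] by simp
  next
    case (step c s g)
    have c: "finite {t. c * delta s t \<noteq> 0}" by (rule finite_smult[OF finite_delta])
    show ?case using step \<iota>_hom(2)[OF c step(1)] \<iota>_hom(4)[OF finite_delta finite_delta, of c s] \<iota>_hom(1)[OF step(1) step(1)]
      pairing_add[OF c step(1)] pairing_smult[OF finite_delta, of c s]
      by (simp add: eta_eq[symmetric] A.clin_add[OF l] A.clin_smult[OF l])
  qed
qed

lemma eta_minus: "\<eta>\<alpha> s \<ominus>\<^bsub>host_cstar S \<alpha>\<^esub> \<eta>\<alpha> t = \<iota> (\<lambda>u. delta s u + (-1) * delta t u)"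
proof -
  interpret A: pre_cstar "host_cstar S \<alpha>" by (rule host_pre_cstar)
  show ?thesis
    using \<iota>_hom(2)[OF finite_delta finite_smult[OF finite_delta], of s "-1" t] \<iota>_hom(4)[OF finite_delta finite_delta, of "-1" t]
    using A.minus_sm[OF eta_in[of s] eta_in[of t]] by (simp add: eta_eq)
qed

lemma chart_at:
  obtains U \<phi> where "(U, \<phi>) \<in> sg_charts S" "s \<in> U" "open U" "open (\<phi> ` U)" "inj_on \<phi> U"
    "continuous_on U \<phi>" "continuous_on (\<phi> ` U) (inv_into U \<phi>)"
proof -
  have at: "is_atlas (holo_to tv_cplx) (sg_charts S)" using S by (simp add: complex_inv_semigroup_def)
  then have "s \<in> \<Union> (fst ` sg_charts S)" unfolding is_atlas_def by simp
  then obtain c where c: "c \<in> sg_charts S" "s \<in> fst c" by blast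
  then have "is_chart c" using at by (auto simp: is_atlas_def)
  then show thesis using that[of "fst c" "snd c"] c by (cases c) (auto simp: is_chart_def homeomorphism_def)
qed

text \<open>On complex discs through \<open>s\<close> of large radius the functions in \<open>scalars\<close> are uniformly bounded,
  so they are equicontinuous at \<open>s\<close> by the Schwarz lemma.\<close>

lemma scalars_equicontinuous:
  assumes e: "e > 0"
  shows "\<forall>\<^sub>F s' in nhds s. \<forall>\<Lambda>\<in>scalars. cmod (\<Lambda> s' - \<Lambda> s) \<le> e"
proof -
  obtain W where W: "open W" "s \<in> W" "bounded (\<alpha> ` W)"
    using loc_bdd unfolding locally_bounded_on_def by auto
  then obtain C where C: "C > 0" "\<And>t. t \<in> W ==> \<alpha> t \<le> C"
    unfolding bounded_pos by (force simp: abs_le_iff)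
  obtain U \<phi> where ch: "(U, \<phi>) \<in> sg_charts S" "s \<in> U" "open U" "open (\<phi> ` U)" "inj_on \<phi> U"
    "continuous_on U \<phi>" "continuous_on (\<phi> ` U) (inv_into U \<phi>)" by (rule chart_at)
  define x where "x = \<phi> s"
  define \<Omega> where "\<Omega> = \<phi> ` U \<inter> inv_into U \<phi> -` W"
  have \<Omega>: "open \<Omega>" unfolding \<Omega>_def
    using continuous_on_open_vimage[OF ch(4)] ch(7) W(1) by (metis Int_commute)
  have x\<Omega>: "x \<in> \<Omega>" using ch W by (simp add: \<Omega>_def x_def)
  define P where "P = nhds (0::complex) \<times>\<^sub>F nhds (0::'b)"
  have "((\<lambda>p. x + fst p *\<^sub>C snd p) \<longlongrightarrow> x + 0 *\<^sub>C 0) P"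
    unfolding P_def nhds_prod[symmetric]
    by (intro tendsto_add tendsto_const tendsto_scaleC_lcs tendsto_fst_nhds tendsto_snd_nhds)
  moreover have "(0::complex) *\<^sub>C (0::'b) = 0" using scaleC_of_real[of 0 "0::'b"] by simp
  ultimately have "\<forall>\<^sub>F p in P. x + fst p *\<^sub>C snd p \<in> \<Omega>"
    using topological_tendstoD \<Omega> x\<Omega> by fastforce
  then obtain A V where A: "eventually A (nhds 0)" and V: "eventually V (nhds 0)"
    and AV: "\<And>c v. A c ==> V v ==> x + c *\<^sub>C v \<in> \<Omega>"
    unfolding P_def eventually_prod_filter by auto
  obtain \<delta> where \<delta>: "\<delta> > 0" "\<And>c. cmod c < \<delta> ==> A c"
    using A unfolding eventually_nhds_metric by auto
  \<comment> \<open>R > 1 puts 1/R inside the unit disc, and (2C + 1)/R \<le> e is the bound that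
    the Schwarz lemma will give at 1/R.\<close>
  define R where "R = (2 * C + 1) / e + 1"
  have R: "R > 1" using C e by (simp add: R_def)
  \<comment> \<open>For y close to x the vector y - x stays in V even after scaling by R/\<delta>.
    Hence the whole complex disc of radius R in the direction y - x remains in \<Omega>, where the
    functions are bounded by C.\<close>
  have "((\<lambda>y. complex_of_real (R / \<delta>) *\<^sub>C (y - x)) \<longlongrightarrow> complex_of_real (R / \<delta>) *\<^sub>C (x - x)) (nhds x)"
    by (intro tendsto_scaleC_lcs tendsto_const tendsto_diff filterlim_ident)
  moreover have "complex_of_real (R / \<delta>) *\<^sub>C (x - x) = 0" by (simp only: scaleC_of_real) simp
  ultimately have "\<forall>\<^sub>F y in nhds x. V (complex_of_real (R / \<delta>) *\<^sub>C (y - x))"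
    using V unfolding filterlim_iff by simp
  moreover have "(\<phi> \<longlongrightarrow> x) (nhds s)"
    using ch unfolding x_def by (metis continuous_on_eq_continuous_at isCont_def tendsto_at_iff_tendsto_nhds)
  ultimately have ev1: "\<forall>\<^sub>F s' in nhds s. V (complex_of_real (R / \<delta>) *\<^sub>C (\<phi> s' - x))"
    unfolding filterlim_iff by blast
  have ev2: "\<forall>\<^sub>F s' in nhds s. s' \<in> U" using ch by (simp add: eventually_nhds_in_open)
  show ?thesis using ev1 ev2
  proof eventually_elim
    case (elim s')
    define h where "h = \<phi> s' - x"
    have ball: "x + c *\<^sub>C h \<in> \<Omega>" if "cmod c < R" for c
    proof -
      have "c *\<^sub>C h = (c * complex_of_real (\<delta> / R)) *\<^sub>C complex_of_real (R / \<delta>) *\<^sub>C h"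
        using R \<delta> by (simp add: scaleC_scaleC)
      moreover have "cmod (c * complex_of_real (\<delta> / R)) < \<delta>"
        using that R \<delta> by (simp add: norm_mult norm_divide field_simps)
      ultimately show ?thesis using AV[OF \<delta>(2)] elim by (simp add: h_def)
    qed
    show ?case
    proof
      fix \<Lambda> assume \<Lambda>: "\<Lambda> \<in> scalars"
      obtain D where D: "cholo_on (\<phi> ` U) (\<lambda>x. \<Lambda> (inv_into U \<phi> x)) D" using scalars_chart[OF \<Lambda> ch(1)] by blast
      define g where "g c = \<Lambda> (inv_into U \<phi> (x + c *\<^sub>C h))" for c
      have hol: "g holomorphic_on ball 0 R"
        unfolding g_def
      proof (rule cholo_on_curve[OF D open_ball, where ?\<gamma>1.0 = "\<lambda>_. h"])
        show "(\<lambda>c. x + c *\<^sub>C h) ` ball 0 R \<subseteq> \<phi> ` U" using ball by (auto simp: \<Omega>_def)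
        show "continuous_on (ball 0 R) (\<lambda>c. x + c *\<^sub>C h)"
          unfolding continuous_on_def by (intro ballI tendsto_add tendsto_const tendsto_scaleC_lcs tendsto_ident_at)
        fix z d :: complex
        have "(1 / t) *\<^sub>R ((x + (z + t *\<^sub>R d) *\<^sub>C h) - (x + z *\<^sub>C h)) = d *\<^sub>C h" if "t \<noteq> 0" for t :: real
        proof -
          have "(x + (z + t *\<^sub>R d) *\<^sub>C h) - (x + z *\<^sub>C h) = t *\<^sub>R (d *\<^sub>C h)"
            by (simp add: scaleC_add_left scaleR_conv_of_real scaleC_scaleC[symmetric] scaleC_of_real)
          then show ?thesis using that by simp
        qed
        then have "\<forall>\<^sub>F t in at 0. d *\<^sub>C h = (1 / t) *\<^sub>R ((x + (z + t *\<^sub>R d) *\<^sub>C h) - (x + z *\<^sub>C h))"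
          by (auto simp: eventually_at_filter)
        then show "((\<lambda>t. (1 / t) *\<^sub>R ((x + (z + t *\<^sub>R d) *\<^sub>C h) - (x + z *\<^sub>C h))) \<longlongrightarrow> d *\<^sub>C h) (at 0)"
          by (rule Lim_transform_eventually[OF tendsto_const])
      qed simp
      have gC: "cmod (g c) \<le> C" if "cmod c < R" for c
        using scalars_le[OF \<Lambda>, of "inv_into U \<phi> (x + c *\<^sub>C h)"] C(2)[of "inv_into U \<phi> (x + c *\<^sub>C h)"] ball[OF that]
        unfolding g_def \<Omega>_def by force
      \<comment> \<open>The oscillation of g is at most 2C; dividing by 2C + 1 gives the strict
        inequality that the Schwarz lemma asks for.\<close>
      define k where "k w = (g (complex_of_real R * w) - g 0) / complex_of_real (2 * C + 1)" for w
      have in_ball: "cmod (complex_of_real R * w) < R" if "cmod w < 1" for w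
        using that R by (simp add: norm_mult)
      have "cmod (k (complex_of_real (1 / R))) \<le> cmod (complex_of_real (1 / R))"
      proof (rule Schwarz_Lemma)
        show "k holomorphic_on ball 0 1"
          unfolding k_def
          by (intro holomorphic_intros holomorphic_on_compose_gen[OF _ hol, unfolded comp_def])
            (use in_ball C in \<open>auto simp: complex_eq_iff\<close>)
        show "k 0 = 0" by (simp add: k_def)
        show "cmod (k z) < 1" if "cmod z < 1" for z
        proof -
          have "cmod (g (complex_of_real R * z) - g 0) \<le> C + C"
            using gC[OF in_ball[OF that]] gC[of 0] R norm_triangle_ineq4[of "g (complex_of_real R * z)" "g 0"] by simp
          also have "\<dots> < 2 * C + 1" by simp
          finally show ?thesis using C unfolding k_def norm_divide norm_of_real by (simp add: divide_less_eq)
        qed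
        show "cmod (complex_of_real (1 / R)) < 1" using R by (simp add: norm_divide)
      qed
      then have "cmod (g 1 - g 0) / (2 * C + 1) \<le> 1 / R"
        using R C unfolding k_def norm_divide norm_of_real by (simp add: norm_divide)
      then have "cmod (g 1 - g 0) \<le> (2 * C + 1) / R" using C by (simp add: divide_le_eq)
      also have "\<dots> \<le> e"
      proof -
        have "e * R = 2 * C + 1 + e" using e by (simp add: R_def field_simps)
        then show ?thesis using e R by (simp add: divide_le_eq)
      qed
      also have "g 1 = \<Lambda> s'"
        using scaleC_of_real[of 1 h] elim ch by (simp add: g_def h_def inv_into_f_f)
      also have "g 0 = \<Lambda> s"
        using scaleC_of_real[of 0 h] ch by (simp add: g_def x_def inv_into_f_f)
      finally show "cmod (\<Lambda> s' - \<Lambda> s) \<le> e" .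
    qed
  qed
qed

text \<open>Equicontinuity of \<open>scalars\<close> at the limit point is norm continuity of
  \<open>\<eta>\<alpha>\<close>, by testing the difference of two point masses.\<close>

lemma eta_continuous:
  assumes "(s \<longlongrightarrow> s0) F"
  shows "((\<lambda>i. nrm (host_cstar S \<alpha>) (\<eta>\<alpha> (s i) \<ominus>\<^bsub>host_cstar S \<alpha>\<^esub> \<eta>\<alpha> s0)) \<longlongrightarrow> 0) F"
proof (rule tendstoI)
  interpret A: pre_cstar "host_cstar S \<alpha>" by (rule host_pre_cstar)
  fix e :: real assume e: "e > 0"
  have "\<forall>\<^sub>F i in F. \<forall>\<Lambda>\<in>scalars. cmod (\<Lambda> (s i) - \<Lambda> s0) \<le> e / 2"
    by (rule eventually_compose_filterlim[OF scalars_equicontinuous assms]) (use e in simp)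
  then show "\<forall>\<^sub>F i in F. dist (nrm (host_cstar S \<alpha>) (\<eta>\<alpha> (s i) \<ominus>\<^bsub>host_cstar S \<alpha>\<^esub> \<eta>\<alpha> s0)) 0 < e"
  proof (rule eventually_mono)
    fix i assume *: "\<forall>\<Lambda>\<in>scalars. cmod (\<Lambda> (s i) - \<Lambda> s0) \<le> e / 2"
    have "nrm (host_cstar S \<alpha>) (\<eta>\<alpha> (s i) \<ominus>\<^bsub>host_cstar S \<alpha>\<^esub> \<eta>\<alpha> s0) \<le> e / 2"
      unfolding eta_minus
    proof (rule nrm_\<iota>_le)
      show "finite {u. delta (s i) u + - 1 * delta s0 u \<noteq> 0}"
        by (intro finite_add finite_smult finite_delta)
      show "cmod (pairing (\<lambda>u. delta (s i) u + (-1) * delta s0 u) \<Lambda>) \<le> e / 2" if "\<Lambda> \<in> scalars" for \<Lambda>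
        using * that pairing_add[OF finite_delta finite_smult[OF finite_delta], of "s i" "-1" s0 \<Lambda>]
          pairing_smult[OF finite_delta, of "-1" s0 \<Lambda>] by simp
    qed
    then show "dist (nrm (host_cstar S \<alpha>) (\<eta>\<alpha> (s i) \<ominus>\<^bsub>host_cstar S \<alpha>\<^esub> \<eta>\<alpha> s0)) 0 < e"
      using e A.nrm_nonneg[of "\<eta>\<alpha> (s i) \<ominus>\<^bsub>host_cstar S \<alpha>\<^esub> \<eta>\<alpha> s0"] by simp
  qed
qed

text \<open>Holomorphy is local. Near each point the curve lies in one chart, where complex
  linearity of its differential makes the derivative in the direction 1 a complex
  derivative.\<close>

lemma scalars_curve:
  assumes \<Lambda>: "\<Lambda> \<in> scalars" and \<gamma>: "mfd_holo \<Omega> id_charts (sg_charts S) \<gamma>"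
  shows "(\<lambda>z. \<Lambda> (\<gamma> z)) holomorphic_on \<Omega>"
proof -
  have \<Omega>: "open \<Omega>" and cont: "continuous_on \<Omega> \<gamma>"
    and h: "\<And>V \<psi>. (V, \<psi>) \<in> sg_charts S ==> holo_to tv_cplx (\<Omega> \<inter> \<gamma> -` V) (\<lambda>z. \<psi> (\<gamma> z))"
    using \<gamma> by (auto simp: mfd_map_def id_charts_def comp_def inv_into_def)
  have "\<exists>T. open T \<and> z \<in> T \<and> (\<lambda>z. \<Lambda> (\<gamma> z)) holomorphic_on T" if z: "z \<in> \<Omega>" for z
  proof -
    obtain V \<psi> where ch: "(V, \<psi>) \<in> sg_charts S" "\<gamma> z \<in> V" "open V" "open (\<psi> ` V)" "inj_on \<psi> V"
      "continuous_on V \<psi>" "continuous_on (\<psi> ` V) (inv_into V \<psi>)" by (rule chart_at)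
    define T where "T = \<Omega> \<inter> \<gamma> -` V"
    have T: "open T" "z \<in> T" unfolding T_def using continuous_on_open_vimage[OF \<Omega>] cont ch z by (metis Int_commute) (use z ch in simp)
    define g where "g z = \<psi> (\<gamma> z)" for z
    have hg: "holo_to tv_cplx T g" using h[OF ch(1)] by (simp add: T_def g_def[abs_def])
    then have s: "smooth_to tv_cplx T g"
      and lin: "\<And>z c. z \<in> T ==> ddir tv_cplx g z (c *\<^sub>C 1) = c *\<^sub>C ddir tv_cplx g z 1"
      by (simp_all add: holo_to_def tv_cplx_def)
    have top: "tv_top (tv_cplx :: 'b ctvs) = euclidean" by (simp add: tv_cplx_def)
    have contk: "continuous_on (T \<times> UNIV) (\<lambda>(x, h). iter_ddir tv_cplx g h k x)" for k
      using s unfolding smooth_to_def top by simp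
    have curve: "continuous_on T (\<lambda>z. iter_ddir tv_cplx g (\<lambda>_. d) k z)" for k d
    proof -
      have "continuous_on T ((\<lambda>(x, h). iter_ddir tv_cplx g h k x) \<circ> (\<lambda>z. (z, \<lambda>_. d)))"
        by (intro continuous_on_compose continuous_intros continuous_on_subset[OF contk]) auto
      then show ?thesis by (simp add: comp_def)
    qed
    obtain D where D: "cholo_on (\<psi> ` V) (\<lambda>x. \<Lambda> (inv_into V \<psi> x)) D" using scalars_chart[OF \<Lambda> ch(1)] by blast
    have "(\<lambda>z. \<Lambda> (inv_into V \<psi> (g z))) holomorphic_on T"
    proof (rule cholo_on_curve[OF D T(1), where ?\<gamma>1.0 = "\<lambda>z. ddir tv_cplx g z 1"])
      show "g ` T \<subseteq> \<psi> ` V" by (auto simp: T_def g_def)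
      show "continuous_on T g"
        using curve[of 0 0] by simp
      show "continuous_on T (\<lambda>z. ddir tv_cplx g z 1)"
        using curve[of 1 1] by simp
      fix z d assume z: "z \<in> T"
      have "\<exists>b. has_ddir tv_cplx (iter_ddir tv_cplx g (\<lambda>_. d) 0) z d b"
        using s z unfolding smooth_to_def by blast
      then obtain b where b: "has_ddir tv_cplx g z d b" by auto
      have "d *\<^sub>C ddir tv_cplx g z 1 = b"
        using lin[OF z, of d] ddir_cplx[OF b] by (simp add: scaleC_complex_def)
      then show "((\<lambda>t. (1 / t) *\<^sub>R (g (z + t *\<^sub>R d) - g z)) \<longlongrightarrow> d *\<^sub>C ddir tv_cplx g z 1) (at 0)"
        using b by (simp add: has_ddir_cplx)
    qed
    then have "(\<lambda>z. \<Lambda> (\<gamma> z)) holomorphic_on T"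
      by (rule holomorphic_transform) (use ch in \<open>auto simp: g_def T_def inv_into_f_f\<close>)
    then show ?thesis using T by blast
  qed
  then show ?thesis
    by (meson \<Omega> holomorphic_on_def field_differentiable_at_within holomorphic_on_imp_differentiable_at)
qed

text \<open>The difference quotients of \<open>\<Lambda> \<circ> \<gamma>\<close> are Cauchy at a rate independent of \<open>\<Lambda>\<close>.\<close>

lemma eta_curve_holomorphic:
  assumes l: "star_algebra.clin (host_cstar S \<alpha>) l"
    and K: "\<And>x. x \<in> carrier (host_cstar S \<alpha>) ==> cmod (l x) \<le> nrm (host_cstar S \<alpha>) x"
    and \<gamma>: "mfd_holo \<Omega> id_charts (sg_charts S) \<gamma>"
  shows "(\<lambda>z. l (\<eta>\<alpha> (\<gamma> z))) holomorphic_on \<Omega>"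
proof -
  have \<Omega>: "open \<Omega>" and cont: "continuous_on \<Omega> \<gamma>" using \<gamma> by (auto simp: mfd_map_def)
  define H where "H z = l (\<eta>\<alpha> (\<gamma> z))" for z
  have "\<exists>d. (H has_field_derivative d) (at z)" if z: "z \<in> \<Omega>" for z
  proof -
    obtain W where W: "open W" "\<gamma> z \<in> W" "bounded (\<alpha> ` W)"
      using loc_bdd unfolding locally_bounded_on_def by auto
    then obtain C where C: "C > 0" "\<And>t. t \<in> W ==> \<alpha> t < C"
      unfolding bounded_pos_less by (force simp: abs_less_iff)
    have "open (\<Omega> \<inter> \<gamma> -` W)" using continuous_on_open_vimage[OF \<Omega>] cont W(1) by (metis Int_commute)
    then obtain \<rho> where \<rho>: "\<rho> > 0" "ball z \<rho> \<subseteq> \<Omega> \<inter> \<gamma> -` W" using z W by (meson IntI open_contains_ball vimageI2)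
    define q where "q h = (H (z + h) - H z) / h" for h
    have "cmod (q h - q k) \<le> 32 * C / \<rho>\<^sup>2 * (cmod h + cmod k)"
      if hk: "h \<noteq> 0" "k \<noteq> 0" "cmod h < \<rho> / 4" "cmod k < \<rho> / 4" for h k
    proof -
      \<comment> \<open>The difference of the difference quotients at h and k, as an element of the
        semigroup algebra. Its norm is controlled by pairings with \<open>scalars\<close>, each of
        which obeys the bound with the same C and \<rho>.\<close>
      define f where "f s = (1 / h) * delta (\<gamma> (z + h)) s + ((- 1 / k) * delta (\<gamma> (z + k)) s + (1 / k - 1 / h) * delta (\<gamma> z) s)" for s
      have pf: "pairing f \<Lambda> = (\<Lambda> (\<gamma> (z + h)) - \<Lambda> (\<gamma> z)) / h - (\<Lambda> (\<gamma> (z + k)) - \<Lambda> (\<gamma> z)) / k" for \<Lambda>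
      proof -
        have "pairing f \<Lambda> = (1 / h) * \<Lambda> (\<gamma> (z + h)) + ((- 1 / k) * \<Lambda> (\<gamma> (z + k)) + (1 / k - 1 / h) * \<Lambda> (\<gamma> z))"
          unfolding f_def by (simp only: pairing_add pairing_smult finite_add finite_smult finite_delta pairing_delta)
        then show ?thesis by (simp add: diff_divide_distrib algebra_simps)
      qed
      have fin: "finite {s. f s \<noteq> 0}" unfolding f_def by (intro finite_add finite_smult finite_delta)
      have "cmod (pairing f \<Lambda>) \<le> 32 * C / \<rho>\<^sup>2 * (cmod h + cmod k)" if \<Lambda>: "\<Lambda> \<in> scalars" for \<Lambda>
      proof -
        define G where "G w = \<Lambda> (\<gamma> w)" for w
        have G: "G holomorphic_on ball z \<rho>"
          unfolding G_def by (rule holomorphic_on_subset[OF scalars_curve[OF \<Lambda> \<gamma>]]) (use \<rho> in blast)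
        have bd: "cmod (G w) < C" if "w \<in> ball z \<rho>" for w
          using scalars_le[OF \<Lambda>, of "\<gamma> w"] C(2)[of "\<gamma> w"] \<rho>(2) that unfolding G_def by force
        have "pairing f \<Lambda> = ((G (z + h) - G z) / h - deriv G z) - ((G (z + k) - G z) / k - deriv G z)"
          by (simp add: pf G_def)
        then have "cmod (pairing f \<Lambda>) \<le> cmod ((G (z + h) - G z) / h - deriv G z) + cmod ((G (z + k) - G z) / k - deriv G z)"
          by (simp only: norm_triangle_ineq4)
        also have "\<dots> \<le> 32 * C / \<rho>\<^sup>2 * cmod h + 32 * C / \<rho>\<^sup>2 * cmod k"
          by (intro add_mono holomorphic_first_order_bound[OF G bd \<rho>(1)] hk)
        finally show ?thesis by (simp add: distrib_left)
      qed
      from nrm_\<iota>_le[OF fin this] have "cmod (l (\<iota> f)) \<le> 32 * C / \<rho>\<^sup>2 * (cmod h + cmod k)"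
        using K[OF \<iota>_hom(1)[OF fin fin]] by linarith
      then show ?thesis by (simp add: clin_\<iota>[OF l fin] pf q_def H_def)
    qed
    then have "\<exists>d. (q \<longlongrightarrow> d) (at 0)"
      using \<rho>(1) by (intro punctured_Cauchy_limit[of "\<rho> / 4" _ "32 * C / \<rho>\<^sup>2"]) simp_all
    then show ?thesis unfolding DERIV_def q_def by blast
  qed
  then show ?thesis unfolding H_def[symmetric] holomorphic_on_def
    by (auto simp: field_differentiable_def intro: has_field_derivative_at_within)
qed

end

section \<open>States and the GNS construction\<close>

text \<open>The discriminant argument in abstract form: A and B need not be values of a form on
  vectors at hand, which later allows the missing unit to take the role of a vector. The choice is c
  = -t cnj z with t = 1/B.\<close>

lemma quadratic_form_CS:
  fixes z :: complex
  assumes A: "A \<ge> 0" and B: "B \<ge> 0" and q: "\<And>c. 0 \<le> A + 2 * Re (c * z) + (cmod c)\<^sup>2 * B"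
  shows "(cmod z)\<^sup>2 \<le> A * B"
proof -
  have r: "0 \<le> A - 2 * t * (cmod z)\<^sup>2 + t\<^sup>2 * (cmod z)\<^sup>2 * B" for t
  proof -
    have "Re (- complex_of_real t * cnj z * z) = - t * (cmod z)\<^sup>2"
      unfolding cmod_power2 by (simp add: power2_eq_square algebra_simps)
    then show ?thesis using q[of "- complex_of_real t * cnj z"] by (simp add: norm_mult power_mult_distrib)
  qed
  show ?thesis
  proof (cases "B = 0")
    case True
    have "(cmod z)\<^sup>2 = 0"
    proof (rule ccontr)
      assume n: "(cmod z)\<^sup>2 \<noteq> 0"
      \<comment> \<open>With B = 0 this t turns the form into A - 2 (A + 1), which is
        negative.\<close>
      then show False using r[of "(A + 1) / (cmod z)\<^sup>2"] True A by simp
    qed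
    then show ?thesis using True by simp
  next
    case False
    then have "(1 / B)\<^sup>2 * (cmod z)\<^sup>2 * B = (1 / B) * (cmod z)\<^sup>2" by (simp add: power2_eq_square)
    then have "0 \<le> A - (1 / B) * (cmod z)\<^sup>2" using r[of "1 / B"] by simp
    then show ?thesis using False B by (simp add: field_simps)
  qed
qed

lemma le_of_power_growth:
  fixes r C M :: real
  assumes C: "C > 0" and le: "\<And>k::nat. r ^ (2 ^ k) \<le> M * C ^ (2 ^ k)"
  shows "r \<le> C"
proof (rule ccontr)
  assume "\<not> r \<le> C"
  then have q: "r / C > 1" using C by simp
  obtain n where n: "M < (r / C) ^ n" using real_arch_pow[OF q] by blast
  have "(r / C) ^ n \<le> (r / C) ^ (2 ^ n)" using q by (intro power_increasing) (auto simp: less_imp_le)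
  also have "\<dots> \<le> M" using le[of n] C by (simp add: power_divide divide_le_eq)
  finally show False using n by simp
qed

locale positive_functional = pre_cstar A for A :: "'a normed_star_algebra" (structure) +
  fixes \<phi> :: "'a => complex"
  assumes lin: "clin \<phi>" and pos: "x \<in> carrier A ==> \<phi> (star A x \<otimes> x) \<in> \<real>\<^sub>\<ge>\<^sub>0"
    and contr: "x \<in> carrier A ==> cmod (\<phi> x) \<le> nrm A x"
begin

lemmas \<phi>_lin = clin_add[OF lin] clin_smult[OF lin] clin_minus[OF lin]

text \<open>The square of the GNS seminorm of x.\<close>

definition sq :: "'a => real" where "sq x = Re (\<phi> (star A x \<otimes> x))"

lemma sq: "x \<in> carrier A ==> \<phi> (star A x \<otimes> x) = complex_of_real (sq x)"
  and sq_nonneg: "x \<in> carrier A ==> 0 \<le> sq x"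
  using pos[of x] by (auto simp: sq_def complex_nonneg_Reals_iff complex_eq_iff)

lemma sq_le: "x \<in> carrier A ==> sq x \<le> (nrm A x)\<^sup>2"
  using contr[of "star A x \<otimes> x"] sq[of x] sq_nonneg[of x] by (simp add: nrm_star_mult)

lemma expand:
  assumes [simp]: "x \<in> carrier A" "y \<in> carrier A"
  shows "\<phi> (star A (x \<oplus> c \<odot> y) \<otimes> (x \<oplus> c \<odot> y)) =
    \<phi> (star A x \<otimes> x) + c * \<phi> (star A x \<otimes> y) + cnj c * \<phi> (star A y \<otimes> x) + (cnj c * c) * \<phi> (star A y \<otimes> y)"
  by (simp add: star_add star_smult l_distr r_distr smult_l smult_r sm_assoc \<phi>_lin algebra_simps)

text \<open>The values of \<phi> on squares are real. In the expansion of the square of x + cy, this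
  makes the imaginary part of the mixed terms vanish, and c = 1 and c = i determine both
  components.\<close>

lemma hermitian:
  assumes [simp]: "x \<in> carrier A" "y \<in> carrier A"
  shows "\<phi> (star A y \<otimes> x) = cnj (\<phi> (star A x \<otimes> y))"
proof -
  have im: "Im (c * \<phi> (star A x \<otimes> y) + cnj c * \<phi> (star A y \<otimes> x)) = 0" for c
  proof -
    have "Im (\<phi> (star A (x \<oplus> c \<odot> y) \<otimes> (x \<oplus> c \<odot> y))) = 0" by (simp add: sq del: star_smult)
    moreover have "Im ((cnj c * c) * complex_of_real (sq y)) = 0"
      using complex_norm_square[of c] by (simp add: mult.commute)
    ultimately show ?thesis unfolding expand[OF assms] by (simp add: sq)
  qed
  show ?thesis using im[of 1] im[of \<i>] by (simp add: complex_eq_iff)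
qed

lemma sq_expand:
  assumes [simp]: "x \<in> carrier A" "y \<in> carrier A"
  shows "sq (x \<oplus> c \<odot> y) = sq x + 2 * Re (c * \<phi> (star A x \<otimes> y)) + (cmod c)\<^sup>2 * sq y"
proof -
  have "Re (cnj c * \<phi> (star A y \<otimes> x)) = Re (c * \<phi> (star A x \<otimes> y))"
    using hermitian[of x y] by simp
  moreover have "Re ((cnj c * c) * complex_of_real (sq y)) = (cmod c)\<^sup>2 * sq y"
    using complex_norm_square[of c] by (metis Re_complex_of_real mult.commute of_real_mult of_real_power)
  ultimately show ?thesis unfolding sq_def[of "x \<oplus> c \<odot> y"] expand[OF assms] by (simp add: sq)
qed

lemma Cauchy_Schwarz:
  assumes [simp]: "x \<in> carrier A" "y \<in> carrier A"
  shows "(cmod (\<phi> (star A x \<otimes> y)))\<^sup>2 \<le> sq x * sq y"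
proof (rule quadratic_form_CS)
  fix c
  have "0 \<le> sq (x \<oplus> c \<odot> y)" by (rule sq_nonneg) simp
  then show "0 \<le> sq x + 2 * Re (c * \<phi> (star A x \<otimes> y)) + (cmod c)\<^sup>2 * sq y" by (simp only: sq_expand[OF assms])
qed (simp_all add: sq_nonneg)

text \<open>\<open>hermitian\<close> concerns products of two elements. An approximate unit u
  replaces x by ux up to a small error, and the adjoint of ux is x'u for x' the adjoint of
  x.\<close>

lemma star_conj:
  assumes [simp]: "x \<in> carrier A"
  shows "\<phi> (star A x) = cnj (\<phi> x)"
proof -
  have "cmod (\<phi> (star A x) - cnj (\<phi> x)) \<le> 0 + e" if e: "e > 0" for e
  proof -
    obtain u where u [simp]: "u \<in> carrier A" "star A u = u" "nrm A (x \<ominus> u \<otimes> x) < e / 2"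
      using approximate_unit[of x "e/2"] e by auto
    have 1: "cmod (\<phi> x - \<phi> (u \<otimes> x)) \<le> nrm A (x \<ominus> u \<otimes> x)" using contr[of "x \<ominus> u \<otimes> x"] by (simp add: \<phi>_lin)
    have "star A (x \<ominus> u \<otimes> x) = star A x \<ominus> star A x \<otimes> u"
      by (simp add: minus_sm star_add star_smult star_mult)
    then have 2: "cmod (\<phi> (star A x) - \<phi> (star A x \<otimes> u)) \<le> nrm A (x \<ominus> u \<otimes> x)"
      using contr[of "star A (x \<ominus> u \<otimes> x)"] nrm_star[of "x \<ominus> u \<otimes> x"] by (simp add: \<phi>_lin)
    have "\<phi> (u \<otimes> x) = cnj (\<phi> (star A x \<otimes> u))" using hermitian[of x u] by simp
    then have "\<phi> (star A x) - cnj (\<phi> x) = (\<phi> (star A x) - \<phi> (star A x \<otimes> u)) - cnj (\<phi> x - \<phi> (u \<otimes> x))" by simp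
    then have "cmod (\<phi> (star A x) - cnj (\<phi> x)) \<le> cmod (\<phi> (star A x) - \<phi> (star A x \<otimes> u)) + cmod (\<phi> x - \<phi> (u \<otimes> x))"
      by (metis complex_mod_cnj norm_triangle_ineq4)
    then show ?thesis using 1 2 u(3) by linarith
  qed
  then have "cmod (\<phi> (star A x) - cnj (\<phi> x)) \<le> 0" by (rule field_le_epsilon)
  then show ?thesis by simp
qed

text \<open>The Cauchy-Schwarz inequality for x and an approximate unit of norm at most 1 in the
  place of 1.\<close>

lemma kadison:
  assumes [simp]: "x \<in> carrier A"
  shows "(cmod (\<phi> x))\<^sup>2 \<le> sq x"
proof -
  have "cmod (\<phi> x) \<le> sqrt (sq x)"
  proof (rule field_le_epsilon)
    fix e :: real assume e: "e > 0"
    obtain u where u [simp]: "u \<in> carrier A" "star A u = u" "nrm A u \<le> 1" "nrm A (x \<ominus> u \<otimes> x) < e"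
      using approximate_unit[of x e] e by auto
    have 1: "cmod (\<phi> x - \<phi> (u \<otimes> x)) \<le> nrm A (x \<ominus> u \<otimes> x)" using contr[of "x \<ominus> u \<otimes> x"] by (simp add: \<phi>_lin)
    have "(cmod (\<phi> (u \<otimes> x)))\<^sup>2 \<le> sq u * sq x" using Cauchy_Schwarz[of u x] by simp
    also have "\<dots> \<le> 1 * sq x"
      using sq_le[of u] power_le_one[OF nrm_nonneg[of u] u(3), of 2] by (intro mult_right_mono sq_nonneg) auto
    finally have "cmod (\<phi> (u \<otimes> x)) \<le> sqrt (sq x)" by (simp add: real_le_rsqrt)
    moreover have "cmod (\<phi> x) \<le> cmod (\<phi> (u \<otimes> x)) + cmod (\<phi> x - \<phi> (u \<otimes> x))"
      using norm_triangle_ineq[of "\<phi> (u \<otimes> x)" "\<phi> x - \<phi> (u \<otimes> x)"] by simp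
    ultimately show "cmod (\<phi> x) \<le> sqrt (sq x) + e" using 1 u(4) by linarith
  qed
  then have "(cmod (\<phi> x))\<^sup>2 \<le> (sqrt (sq x))\<^sup>2" by (intro power_mono) simp_all
  then show ?thesis using sq_nonneg[of x] by simp
qed

text \<open>Iterating the Cauchy-Schwarz inequality bounds a symmetric operator by the growth rate of its powers.\<close>

lemma symmetric_operator_bound:
  assumes T: "\<And>x. x \<in> carrier A ==> T x \<in> carrier A"
    and sym: "\<And>x y. x \<in> carrier A ==> y \<in> carrier A ==> star A (T x) \<otimes> y = star A x \<otimes> T y"
    and C: "C > 0" "\<And>x. x \<in> carrier A ==> nrm A (T x) \<le> C * nrm A x"
    and x [simp]: "x \<in> carrier A"
  shows "cmod (\<phi> (star A x \<otimes> T x)) \<le> C * sq x"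
proof -
  have Tn [simp]: "(T ^^ n) y \<in> carrier A" if "y \<in> carrier A" for n y
    using that by (induction n) (simp_all add: T)
  have symn: "star A ((T ^^ n) y) \<otimes> z = star A y \<otimes> (T ^^ n) z" if "y \<in> carrier A" "z \<in> carrier A" for n y z
    using that
  proof (induction n arbitrary: z)
    case (Suc n)
    have "star A ((T ^^ Suc n) y) \<otimes> z = star A ((T ^^ n) y) \<otimes> T z" using Suc.prems by (simp add: sym)
    also have "\<dots> = star A y \<otimes> (T ^^ n) (T z)" using Suc.prems T by (intro Suc.IH) simp_all
    finally show ?case by (simp add: funpow_swap1)
  qed simp
  have nrmn: "nrm A ((T ^^ n) x) \<le> C ^ n * nrm A x" for n
  proof (induction n)
    case (Suc n)
    have "nrm A ((T ^^ Suc n) x) \<le> C * nrm A ((T ^^ n) x)" by (simp add: C)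
    also have "\<dots> \<le> C * (C ^ n * nrm A x)" using Suc C by (intro mult_left_mono) auto
    finally show ?case by simp
  qed simp
  define s where "s n = cmod (\<phi> (star A x \<otimes> (T ^^ n) x))" for n
  \<comment> \<open>One half of the power 2n is moved to the other side by symmetry, so s(2n) is the
    square seminorm of the n-th iterate. Iterated doubling compares the ratio s 1 / sq x with the
    growth rate of the powers and loses only a fixed factor.\<close>
  have step: "(s n)\<^sup>2 \<le> sq x * s (2 * n)" for n
  proof -
    have "(s n)\<^sup>2 \<le> sq x * sq ((T ^^ n) x)" unfolding s_def by (rule Cauchy_Schwarz) simp_all
    also have "sq ((T ^^ n) x) = s (2 * n)"
    proof -
      have "star A ((T ^^ n) x) \<otimes> (T ^^ n) x = star A x \<otimes> (T ^^ (2 * n)) x"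
        by (simp add: symn mult_2 funpow_add)
      then have "complex_of_real (sq ((T ^^ n) x)) = \<phi> (star A x \<otimes> (T ^^ (2 * n)) x)" using sq[of "(T ^^ n) x"] by simp
      then show ?thesis unfolding s_def using sq_nonneg[of "(T ^^ n) x"] by (metis Tn abs_of_nonneg norm_of_real x)
    qed
    finally show ?thesis .
  qed
  have bound: "s n \<le> (nrm A x)\<^sup>2 * C ^ n" for n
  proof -
    have "s n \<le> nrm A (star A x \<otimes> (T ^^ n) x)" unfolding s_def by (rule contr) simp
    also have "\<dots> \<le> nrm A x * nrm A ((T ^^ n) x)" using nrm_mult[of "star A x" "(T ^^ n) x"] by simp
    also have "\<dots> \<le> nrm A x * (C ^ n * nrm A x)" by (intro mult_left_mono nrmn nrm_nonneg) simp
    finally show ?thesis by (simp add: power2_eq_square mult_ac)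
  qed
  show ?thesis
  proof (cases "sq x = 0")
    case True
    then have "(s 1)\<^sup>2 \<le> 0" using step[of 1] by simp
    then show ?thesis using True by (simp add: s_def)
  next
    case False
    then have N: "sq x > 0" using sq_nonneg[of x] by simp
    have s0: "s n \<ge> 0" for n by (simp add: s_def)
    have "(s 1 / sq x) ^ (2 ^ k) \<le> s (2 ^ k) / sq x" for k
    proof (induction k)
      case (Suc k)
      have "(s 1 / sq x) ^ (2 ^ Suc k) = ((s 1 / sq x) ^ (2 ^ k))\<^sup>2" by (simp add: power_mult[symmetric] mult.commute)
      also have "\<dots> \<le> (s (2 ^ k) / sq x)\<^sup>2" using Suc s0 N by (intro power_mono) simp_all
      also have "\<dots> \<le> (sq x * s (2 * 2 ^ k)) / (sq x)\<^sup>2" using step[of "2 ^ k"] N by (simp add: power_divide divide_right_mono)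
      also have "\<dots> = s (2 ^ Suc k) / sq x" using N by (simp add: power2_eq_square)
      finally show ?case .
    qed simp
    also have "s (2 ^ k) / sq x \<le> ((nrm A x)\<^sup>2 / sq x) * C ^ (2 ^ k)" for k
      using bound[of "2 ^ k"] N by (simp add: divide_right_mono)
    finally have "s 1 / sq x \<le> C" by (rule le_of_power_growth[OF C(1)])
    then show ?thesis using N by (simp add: s_def divide_le_eq)
  qed
qed

text \<open>The bound for the symmetric operator x -> a'ax, with a' the adjoint of a. The positive d
  is added because \<open>symmetric_operator_bound\<close> is stated for a positive constant, and a
  may be 0.\<close>

lemma sq_left_mult:
  assumes [simp]: "a \<in> carrier A" "x \<in> carrier A"
  shows "sq (a \<otimes> x) \<le> (nrm A a)\<^sup>2 * sq x"
proof (rule field_le_epsilon)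
  fix e :: real assume e: "e > 0"
  define d where "d = e / (1 + sq x)"
  have d: "d > 0" "d * sq x \<le> e" using e sq_nonneg[of x] by (simp_all add: d_def field_simps)
  have "cmod (\<phi> (star A x \<otimes> (star A a \<otimes> (a \<otimes> x)))) \<le> ((nrm A a)\<^sup>2 + d) * sq x"
  proof (rule symmetric_operator_bound)
    fix y assume [simp]: "y \<in> carrier A"
    have "nrm A (star A a \<otimes> (a \<otimes> y)) \<le> nrm A a * (nrm A a * nrm A y)"
      using nrm_mult[of "star A a" "a \<otimes> y"] nrm_mult[of a y] nrm_nonneg[of a] by (simp add: mult_left_mono order_trans)
    also have "\<dots> \<le> ((nrm A a)\<^sup>2 + d) * nrm A y"
      using d nrm_nonneg[of y] by (simp add: power2_eq_square distrib_right)
    finally show "nrm A (star A a \<otimes> (a \<otimes> y)) \<le> ((nrm A a)\<^sup>2 + d) * nrm A y" .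
  qed (use d in \<open>simp_all add: star_mult m_assoc add_nonneg_pos\<close>)
  moreover have "sq (a \<otimes> x) = cmod (\<phi> (star A x \<otimes> (star A a \<otimes> (a \<otimes> x))))"
    using sq[of "a \<otimes> x"] sq_nonneg[of "a \<otimes> x"] by (simp add: star_mult m_assoc)
  ultimately show "sq (a \<otimes> x) \<le> (nrm A a)\<^sup>2 * sq x + e" using d by (simp add: distrib_right)
qed

end

subsection \<open>Multipliers\<close>

context pre_cstar
begin

abbreviation "MA \<equiv> multiplier_algebra A"

lemma multiplier_l:
  assumes "m \<in> carrier MA"
  shows "x \<in> carrier A ==> fst m x \<in> carrier A" "x \<in> carrier A ==> snd m x \<in> carrier A"
    "x \<in> carrier A ==> y \<in> carrier A ==> fst m (x \<oplus> y) = fst m x \<oplus> fst m y"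
    "x \<in> carrier A ==> fst m (c \<odot> x) = c \<odot> fst m x"
    "x \<in> carrier A ==> y \<in> carrier A ==> x \<otimes> fst m y = snd m x \<otimes> y"
    "x \<in> carrier A ==> y \<in> carrier A ==> fst m (x \<otimes> y) = fst m x \<otimes> y"
  using assms by (auto simp: multiplier_algebra_def PiE_def)

lemma multiplier_bound:
  assumes m: "m \<in> carrier MA"
  obtains C where "C > 0" "\<And>x. x \<in> carrier A ==> nrm A (fst m x) \<le> C * nrm A x"
    "\<And>x. x \<in> carrier A ==> nrm A (snd m x) \<le> C * nrm A x"
proof -
  obtain C D where CD: "\<forall>x\<in>carrier A. nrm A (fst m x) \<le> C * nrm A x" "\<forall>x\<in>carrier A. nrm A (snd m x) \<le> D * nrm A x"
    using m by (cases m) (auto simp: multiplier_algebra_def)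
  define K where "K = max 1 (max C D)"
  have "nrm A (fst m x) \<le> K * nrm A x" "nrm A (snd m x) \<le> K * nrm A x" if "x \<in> carrier A" for x
    using CD that nrm_nonneg[OF that]
    by (auto intro!: order_trans[OF bspec[OF CD(1)]] order_trans[OF bspec[OF CD(2)]] mult_right_mono simp: K_def)
  then show thesis using that[of K] by (simp add: K_def)
qed

text \<open>The left component of the adjoint multiplier, without the extensional cut-off of
  \<open>multiplier_algebra\<close>.\<close>

definition adj :: "('a => 'a) \<times> ('a => 'a) => 'a => 'a" where
  "adj m x = star A (snd m (star A x))"

lemma adj_in: "m \<in> carrier MA ==> x \<in> carrier A ==> adj m x \<in> carrier A"
  by (simp add: adj_def multiplier_l(2))

lemma adj_eq:
  assumes m: "m \<in> carrier MA" and [simp]: "x \<in> carrier A" "y \<in> carrier A"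
  shows "star A (fst m x) \<otimes> y = star A x \<otimes> adj m y"
proof -
  have "star A (fst m x) \<otimes> y = star A (star A y \<otimes> fst m x)" by (simp add: star_mult multiplier_l(1)[OF m])
  also have "\<dots> = star A (snd m (star A y) \<otimes> x)" using multiplier_l(5)[OF m, of "star A y" x] by simp
  also have "\<dots> = star A x \<otimes> adj m y" by (simp add: star_mult adj_def multiplier_l(2)[OF m])
  finally show "star A (fst m x) \<otimes> y = star A x \<otimes> adj m y" .
qed

lemma fst_star_MA: "m \<in> carrier MA ==> x \<in> carrier A ==> fst (star MA m) x = adj m x"
  by (simp add: multiplier_algebra_def adj_def case_prod_unfold)

end

context positive_functional
begin

text \<open>The argument of \<open>sq_left_mult\<close> for the symmetric operator given by a
  multiplier followed by its adjoint; this makes multipliers bounded on the GNS space.\<close>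

lemma sq_multiplier:
  assumes m: "m \<in> carrier MA"
  obtains C where "C > 0" "\<And>x. x \<in> carrier A ==> sq (fst m x) \<le> C\<^sup>2 * sq x"
proof -
  obtain C where C: "C > 0" "\<And>x. x \<in> carrier A ==> nrm A (fst m x) \<le> C * nrm A x"
    "\<And>x. x \<in> carrier A ==> nrm A (snd m x) \<le> C * nrm A x" using multiplier_bound[OF m] by metis
  have "sq (fst m x) \<le> C\<^sup>2 * sq x" if x [simp]: "x \<in> carrier A" for x
  proof -
    have "cmod (\<phi> (star A x \<otimes> adj m (fst m x))) \<le> C\<^sup>2 * sq x"
    proof (rule symmetric_operator_bound)
      fix x y assume [simp]: "x \<in> carrier A" "y \<in> carrier A"
      show "adj m (fst m x) \<in> carrier A" by (intro adj_in m multiplier_l(1)) simp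
      have "star A (adj m (fst m x)) \<otimes> y = star A (star A y \<otimes> adj m (fst m x))"
        using adj_in[OF m multiplier_l(1)[OF m], of x] by (simp add: star_mult)
      also have "\<dots> = star A (star A (fst m y) \<otimes> fst m x)" using adj_eq[OF m, of y "fst m x"] multiplier_l(1)[OF m] by simp
      also have "\<dots> = star A (fst m x) \<otimes> fst m y" using multiplier_l(1)[OF m] by (simp add: star_mult)
      also have "\<dots> = star A x \<otimes> adj m (fst m y)" using adj_eq[OF m, of x "fst m y"] multiplier_l(1)[OF m] by simp
      finally show "star A (adj m (fst m x)) \<otimes> y = star A x \<otimes> adj m (fst m y)" .
      have "nrm A (adj m (fst m x)) \<le> C * nrm A (fst m x)"
        using C(3)[of "star A (fst m x)"] multiplier_l(1,2)[OF m] by (simp add: adj_def)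
      also have "\<dots> \<le> C * (C * nrm A x)" using C(1) C(2)[of x] by (intro mult_left_mono) auto
      finally show "nrm A (adj m (fst m x)) \<le> C\<^sup>2 * nrm A x" by (simp add: power2_eq_square)
    qed (use C in simp_all)
    moreover have "star A (fst m x) \<otimes> fst m x = star A x \<otimes> adj m (fst m x)"
      using adj_eq[OF m, of x "fst m x"] multiplier_l(1)[OF m] by simp
    then have "sq (fst m x) \<le> cmod (\<phi> (star A x \<otimes> adj m (fst m x)))"
      unfolding sq_def by (metis complex_Re_le_cmod)
    ultimately show ?thesis by linarith
  qed
  then show thesis using that C(1) by blast
qed

end

subsection \<open>States\<close>

text \<open>The sequence a stands in for the unit: it lies in the unit ball and \<phi>(a n) tends to
  1, the value that \<phi> would take at 1.\<close>

locale state_functional = positive_functional +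
  fixes a :: "nat => 'a"
  assumes a_in [simp]: "a n \<in> carrier A" and a_le: "nrm A (a n) \<le> 1" and a_lim: "(\<lambda>n. \<phi> (a n)) \<longlonglongrightarrow> 1"
begin

text \<open>An upper bound for the square seminorm of 1 - a n, which formally is 1 - 2 Re \<phi>(a
  n) + sq (a n), because sq (a n) \<le> 1.\<close>

definition er :: "nat => real" where "er n = 2 - 2 * Re (\<phi> (a n))"

lemma er_lim: "er \<longlonglongrightarrow> 0"
proof -
  have "er \<longlonglongrightarrow> 2 - 2 * Re 1" unfolding er_def[abs_def] by (intro tendsto_intros a_lim)
  then show ?thesis by simp
qed

lemma sq_a_le: "sq (a n) \<le> 1"
  using sq_le[of "a n"] power_le_one[OF nrm_nonneg a_le, of n 2] by simp

lemma er_nonneg: "0 \<le> er n"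
  using contr[of "a n"] a_le[of n] complex_Re_le_cmod[of "\<phi> (a n)"] by (simp add: er_def)

text \<open>\<open>a n\<close> behaves like \<open>1\<close>: the Cauchy-Schwarz inequality for \<open>x\<close> and \<open>1 - a n\<close>.\<close>

lemma left_approx:
  assumes [simp]: "x \<in> carrier A"
  shows "(cmod (\<phi> x - \<phi> (star A (a n) \<otimes> x)))\<^sup>2 \<le> er n * sq x"
proof (rule quadratic_form_CS[OF er_nonneg sq_nonneg])
  fix c
  \<comment> \<open>The form in question is the square seminorm of w + 1, written out as sq w + 2 Re
    \<phi>(w) + 1. Its nonnegativity is the Kadison inequality for w together with the square of
    |\<phi>(w) + 1|.\<close>
  define w where "w = c \<odot> x \<oplus> (-1) \<odot> a n"
  have w [simp]: "w \<in> carrier A" by (simp add: w_def)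
  have "0 \<le> (cmod (\<phi> w + 1))\<^sup>2" by simp
  also have "(cmod (\<phi> w + 1))\<^sup>2 = (cmod (\<phi> w))\<^sup>2 + 2 * Re (\<phi> w) + 1"
    unfolding cmod_power2 by (simp add: power2_eq_square algebra_simps)
  also have "\<dots> \<le> sq w + 2 * Re (\<phi> w) + 1" using kadison[OF w] by simp
  also have "sq w = (cmod c)\<^sup>2 * sq x - 2 * Re (c * \<phi> (star A (a n) \<otimes> x)) + sq (a n)"
  proof -
    have "w = (-1) \<odot> a n \<oplus> c \<odot> x" by (simp add: w_def a_comm)
    moreover have "sq ((-1) \<odot> a n) = sq (a n)" by (simp add: sq_def star_smult smult_l smult_r sm_assoc)
    moreover have "\<phi> (star A ((-1) \<odot> a n) \<otimes> x) = - \<phi> (star A (a n) \<otimes> x)"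
      by (simp add: star_smult smult_l \<phi>_lin)
    ultimately show ?thesis by (simp add: sq_expand)
  qed
  also have "\<dots> + 2 * Re (\<phi> w) + 1 \<le> er n + 2 * Re (c * (\<phi> x - \<phi> (star A (a n) \<otimes> x))) + (cmod c)\<^sup>2 * sq x"
    using sq_a_le[of n] by (simp add: w_def \<phi>_lin er_def algebra_simps)
  finally show "0 \<le> er n + 2 * Re (c * (\<phi> x - \<phi> (star A (a n) \<otimes> x))) + (cmod c)\<^sup>2 * sq x" .
qed simp

lemma right_approx:
  assumes [simp]: "x \<in> carrier A"
  shows "(cmod (\<phi> x - \<phi> (x \<otimes> a n)))\<^sup>2 \<le> er n * sq (star A x)"
proof -
  have "\<phi> x - \<phi> (x \<otimes> a n) = cnj (\<phi> (star A x) - \<phi> (star A (a n) \<otimes> star A x))"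
    using star_conj[of x] star_conj[of "x \<otimes> a n"] by (simp add: star_mult)
  then show ?thesis using left_approx[of "star A x" n] by (metis complex_mod_cnj star_closed' assms)
qed

lemma left_lim:
  assumes x: "\<And>n. x n \<in> carrier A" "\<And>n. sq (x n) \<le> K" and l: "(\<lambda>n. \<phi> (x n)) \<longlonglongrightarrow> l"
  shows "(\<lambda>n. \<phi> (star A (a n) \<otimes> x n)) \<longlonglongrightarrow> l"
proof -
  have "(\<lambda>n. \<phi> (x n) - \<phi> (star A (a n) \<otimes> x n)) \<longlonglongrightarrow> 0"
  proof (rule Lim_null_comparison)
    have "cmod (\<phi> (x n) - \<phi> (star A (a n) \<otimes> x n)) \<le> sqrt (er n * K)" for n
      using left_approx[OF x(1), of n n] mult_left_mono[OF x(2)[of n] er_nonneg[of n]] by (simp add: real_le_rsqrt)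
    then show "\<forall>\<^sub>F n in sequentially. norm (\<phi> (x n) - \<phi> (star A (a n) \<otimes> x n)) \<le> sqrt (er n * K)" by simp
    have "(\<lambda>n. sqrt (er n * K)) \<longlonglongrightarrow> sqrt (0 * K)" by (intro tendsto_intros er_lim)
    then show "(\<lambda>n. sqrt (er n * K)) \<longlonglongrightarrow> 0" by simp
  qed
  from tendsto_diff[OF l this] show ?thesis by simp
qed

lemma right_lim:
  assumes [simp]: "x \<in> carrier A"
  shows "(\<lambda>n. \<phi> (x \<otimes> a n)) \<longlonglongrightarrow> \<phi> x"
proof -
  have "(\<lambda>n. \<phi> x - \<phi> (x \<otimes> a n)) \<longlonglongrightarrow> 0"
  proof (rule Lim_null_comparison)
    have "cmod (\<phi> x - \<phi> (x \<otimes> a n)) \<le> sqrt (er n * sq (star A x))" for n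
      using right_approx[of x n] by (simp add: real_le_rsqrt)
    then show "\<forall>\<^sub>F n in sequentially. norm (\<phi> x - \<phi> (x \<otimes> a n)) \<le> sqrt (er n * sq (star A x))" by simp
    have "(\<lambda>n. sqrt (er n * sq (star A x))) \<longlonglongrightarrow> sqrt (0 * sq (star A x))" by (intro tendsto_intros er_lim)
    then show "(\<lambda>n. sqrt (er n * sq (star A x))) \<longlonglongrightarrow> 0" by simp
  qed
  from tendsto_diff[OF tendsto_const[of "\<phi> x"] this] show ?thesis by simp
qed

text \<open>Both \<open>a m\<close> and \<open>a n\<close> are close to \<open>1\<close>, hence to each other.\<close>

lemma sq_a_diff: "sq (a m \<ominus> a n) \<le> 2 * (er m + er n)"
proof -
  \<comment> \<open>Parallelogram law: the difference is small because the sum w is large, sq w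
    being at least the square of |\<phi>(w)|, hence at least 4 Re \<phi>(w) - 4.\<close>
  define w where "w = a m \<oplus> 1 \<odot> a n"
  have "(cmod (\<phi> w))\<^sup>2 \<le> sq w" by (rule kadison) (simp add: w_def)
  moreover have "0 \<le> (cmod (\<phi> w - 2))\<^sup>2" by simp
  then have "4 * Re (\<phi> w) - 4 \<le> (cmod (\<phi> w))\<^sup>2" unfolding cmod_power2 by (simp add: power2_eq_square algebra_simps)
  moreover have "Re (\<phi> w) = Re (\<phi> (a m)) + Re (\<phi> (a n))" by (simp add: w_def \<phi>_lin)
  moreover have "sq (a m \<ominus> a n) = 2 * sq (a m) + 2 * sq (a n) - sq w"
    using sq_expand[of "a m" "a n" 1] sq_expand[of "a m" "a n" "-1"] by (simp add: w_def minus_sm)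
  ultimately show ?thesis using sq_a_le[of m] sq_a_le[of n] by (simp add: er_def)
qed

end

text \<open>The definition of a state provides only the supremum 1 of |\<phi>| on the unit ball.
  Multiplying near-maximizers by a phase makes the values of \<phi> real and convergent to
  1.\<close>

lemma (in pre_cstar) state_sequence:
  assumes st: "state A \<phi>"
  shows "clin \<phi>" "\<And>x. x \<in> carrier A ==> cmod (\<phi> x) \<le> nrm A x"
    "\<exists>a. (\<forall>n. a n \<in> carrier A \<and> nrm A (a n) \<le> 1) \<and> (\<lambda>n. \<phi> (a n)) \<longlonglongrightarrow> 1"
proof -
  define B where "B = {cmod (\<phi> a) |a. a \<in> carrier A \<and> nrm A a \<le> 1}"
  have B: "bdd_above B" "Sup B = 1" using st by (auto simp: state_def B_def)
  show lin: "clin \<phi>" using st by (simp add: state_def clin_def)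
  show "cmod (\<phi> x) \<le> nrm A x" if x [simp]: "x \<in> carrier A" for x
  proof (cases "nrm A x = 0")
    case True
    then show ?thesis using clin_zero[OF lin] nrm_eq_0[of x] by simp
  next
    case False
    then have p: "nrm A x > 0" using nrm_nonneg[of x] by simp
    define y where "y = complex_of_real (1 / nrm A x) \<odot> x"
    have "nrm A y \<le> 1" using p by (simp add: y_def nrm_smult norm_divide)
    then have "cmod (\<phi> y) \<in> B" by (auto simp: B_def y_def)
    then have "cmod (\<phi> y) \<le> 1" using cSup_upper[OF _ B(1)] B(2) by metis
    then show ?thesis using p by (simp add: y_def clin_smult[OF lin] norm_mult norm_divide divide_le_eq)
  qed
  have "\<exists>b\<in>carrier A. nrm A b \<le> 1 \<and> 1 - 1 / real (Suc n) < Re (\<phi> b) \<and> Im (\<phi> b) = 0 \<and> Re (\<phi> b) \<le> 1" for n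
  proof -
    have "B \<noteq> {}" unfolding B_def using nrm_zero by (auto intro!: exI[of _ \<zero>])
    moreover have "1 - 1 / real (Suc n) < Sup B" using B by simp
    ultimately obtain r where "r \<in> B" "1 - 1 / real (Suc n) < r" using less_cSup_iff[OF _ B(1)] by blast
    then obtain b where b: "b \<in> carrier A" "nrm A b \<le> 1" "1 - 1 / real (Suc n) < cmod (\<phi> b)" by (auto simp: B_def)
    have "cmod (\<phi> b) \<in> B" using b by (auto simp: B_def)
    then have "cmod (\<phi> b) \<le> 1" using cSup_upper[OF _ B(1)] B(2) by metis
    have "1 - 1 / real (Suc n) \<ge> 0" by simp
    then have nz: "\<phi> b \<noteq> 0" using b(3) by auto
    define u where "u = cnj (\<phi> b) / complex_of_real (cmod (\<phi> b))"
    have "cmod u = 1" using nz by (simp add: u_def norm_divide)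
    have "u * \<phi> b = complex_of_real (cmod (\<phi> b))"
      using nz complex_norm_square[of "\<phi> b"] by (simp add: u_def power2_eq_square field_simps)
    then have "\<phi> (u \<odot> b) = complex_of_real (cmod (\<phi> b))" using b by (simp add: clin_smult[OF lin])
    then show ?thesis using b \<open>cmod u = 1\<close> \<open>cmod (\<phi> b) \<le> 1\<close> by (intro bexI[of _ "u \<odot> b"]) (simp_all add: nrm_smult)
  qed
  then obtain a where a: "\<And>n. a n \<in> carrier A" "\<And>n. nrm A (a n) \<le> 1" "\<And>n. 1 - 1 / real (Suc n) < Re (\<phi> (a n))"
    "\<And>n. Im (\<phi> (a n)) = 0" "\<And>n. Re (\<phi> (a n)) \<le> 1" by metis
  have "(\<lambda>n. Re (\<phi> (a n))) \<longlonglongrightarrow> 1"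
  proof (rule tendsto_sandwich)
    show "\<forall>\<^sub>F n in sequentially. 1 - 1 / real (Suc n) \<le> Re (\<phi> (a n))" using a(3) less_imp_le by (auto intro: always_eventually)
    show "\<forall>\<^sub>F n in sequentially. Re (\<phi> (a n)) \<le> 1" using a(5) by simp
    show "(\<lambda>n. 1 - 1 / real (Suc n)) \<longlonglongrightarrow> 1" by real_asymp
  qed simp
  then have "(\<lambda>n. \<phi> (a n)) \<longlonglongrightarrow> 1" unfolding tendsto_complex_iff using a(4) by simp
  then show "\<exists>a. (\<forall>n. a n \<in> carrier A \<and> nrm A (a n) \<le> 1) \<and> (\<lambda>n. \<phi> (a n)) \<longlonglongrightarrow> 1" using a by blast
qed

subsection \<open>The Hilbert space of a positive functional\<close>

context positive_functional
begin

text \<open>A with the GNS seminorm in the place of its norm, so that the linear part of the theory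
  of completions applies.\<close>

definition E :: "'a normed_star_algebra" where
  "E = A\<lparr>nrm := \<lambda>x. sqrt (sq x)\<rparr>"

lemma E_simps [simp]:
  "carrier E = carrier A" "add E = add A" "mult E = mult A" "zero E = zero A" "module.smult E = module.smult A"
  "star E = star A" "nrm E = (\<lambda>x. sqrt (sq x))" "x \<ominus>\<^bsub>E\<^esub> y = x \<ominus> y"
  by (simp_all add: E_def minus_nrm_update)

lemma sq_smult: "x \<in> carrier A ==> sq (c \<odot> x) = (cmod c)\<^sup>2 * sq x"
  using sq_expand[of \<zero> x c] clin_zero[OF lin] by (simp add: sq_def)

lemma sqrt_sq_add: assumes [simp]: "x \<in> carrier A" "y \<in> carrier A" shows "sqrt (sq (x \<oplus> y)) \<le> sqrt (sq x) + sqrt (sq y)"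
proof -
  have "cmod (\<phi> (star A x \<otimes> y)) \<le> sqrt (sq x * sq y)" using Cauchy_Schwarz[of x y] by (simp add: real_le_rsqrt)
  then have "Re (\<phi> (star A x \<otimes> y)) \<le> sqrt (sq x) * sqrt (sq y)"
    using complex_Re_le_cmod[of "\<phi> (star A x \<otimes> y)"] by (simp add: real_sqrt_mult)
  then have "sq (x \<oplus> y) \<le> (sqrt (sq x) + sqrt (sq y))\<^sup>2"
    using sq_expand[of x y 1] sq_nonneg[of x] sq_nonneg[of y] by (simp add: power2_sum)
  then show ?thesis by (rule real_le_lsqrt[rotated -1]) (simp_all add: sq_nonneg)
qed

lemma E_seminormed: "seminormed E"
proof -
  interpret EA: star_algebra E unfolding E_def by (rule star_algebra_nrm_update[OF star_algebra])
  show ?thesis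
    by unfold_locales (simp_all add: sq_nonneg sq_smult real_sqrt_mult sqrt_sq_add)
qed

text \<open>Canonical representative of a class of Cauchy sequences. The GNS space consists of
  representatives rather than classes because \<open>state_ext\<close> ranges over Hilbert spaces
  whose vectors are sequences in A.\<close>

definition R :: "(nat => 'a) => nat => 'a" where
  "R X = cauchy_rep (cauchy_class E X)"

abbreviation ecau :: "(nat => 'a) => bool" where "ecau \<equiv> alg_cauchy E"

definition gns :: "(nat => 'a) hilbert" where
  "gns = \<lparr>carrier = R ` {X. ecau X}, mult = undefined, one = undefined, zero = R (\<lambda>n. \<zero>),
    add = (\<lambda>\<xi> \<zeta>. R (\<lambda>n. \<xi> n \<oplus> \<zeta> n)), smult = (\<lambda>c \<xi>. R (\<lambda>n. c \<odot> \<xi> n)),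
    hinner = (\<lambda>\<xi> \<zeta>. lim (\<lambda>n. \<phi> (star A (\<zeta> n) \<otimes> \<xi> n)))\<rparr>"

abbreviation esim :: "(nat => 'a) => (nat => 'a) => bool" where "esim \<equiv> seminormed.sim E"

lemmas EE_abs_diff_le = seminormed.abs_diff_le[OF E_seminormed]
  and EE_cau_add = seminormed.cau_add[OF E_seminormed]
  and EE_cau_const = seminormed.cau_const[OF E_seminormed]
  and EE_cau_dominated = seminormed.cau_dominated[OF E_seminormed]
  and EE_cau_in = seminormed.cau_in[OF E_seminormed]
  and EE_cau_smult = seminormed.cau_smult[OF E_seminormed]
  and EE_class_eq = seminormed.class_eq[OF E_seminormed]
  and EE_class_rep = seminormed.class_rep[OF E_seminormed]
  and EE_lim_eq_of_sim = seminormed.lim_eq_of_sim[OF E_seminormed]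
  and EE_lim_nrm = seminormed.lim_nrm[OF E_seminormed]
  and EE_minus_commute = seminormed.minus_commute[OF E_seminormed]
  and EE_minus_triangle = seminormed.minus_triangle[OF E_seminormed]
  and EE_sim_add = seminormed.sim_add[OF E_seminormed]
  and EE_sim_def = seminormed.sim_def[OF E_seminormed]
  and EE_sim_dominated = seminormed.sim_dominated[OF E_seminormed]
  and EE_sim_refl = seminormed.sim_refl[OF E_seminormed]
  and EE_sim_smult = seminormed.sim_smult[OF E_seminormed]
  and EE_sim_sym = seminormed.sim_sym[OF E_seminormed]
  and EE_sim_trans = seminormed.sim_trans[OF E_seminormed]

lemma E_quotient: "quotient_space E R (\<lambda>\<xi>. \<xi>)"
proof (rule quotient_space.intro[OF E_seminormed], unfold_locales)
  fix X Y assume c: "ecau X" "ecau Y"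
  have r: "ecau (R X)" "esim (R X) X" "ecau (R Y)" "esim (R Y) Y"
    using EE_class_rep c by (auto simp: R_def)
  show "R X = R Y \<longleftrightarrow> esim X Y"
  proof
    assume e: "R X = R Y"
    have "esim X (R X)" using r c by (blast intro: EE_sim_sym)
    then show "esim X Y" using r c unfolding e by (blast intro: EE_sim_trans)
  next
    assume "esim X Y"
    then have "cauchy_class E X = cauchy_class E Y" using EE_class_eq c by blast
    then show "R X = R Y" by (simp add: R_def)
  qed
next
  fix X assume "ecau X"
  then show "ecau (R X) \<and> esim (R X) X" using EE_class_rep by (auto simp: R_def)
qed

lemmas EQ_eq = quotient_space.Q_eq[OF E_quotient] and EQ_rep = quotient_space.rep_Q[OF E_quotient]
  and EQ_add = quotient_space.Q_add[OF E_quotient] and EQ_smult = quotient_space.Q_smult[OF E_quotient]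

lemma ecau_in [simp]: "ecau X ==> X n \<in> carrier A"
  using EE_cau_in by simp

lemma sq_lim:
  assumes "ecau X"
  shows "\<exists>l. (\<lambda>n. sq (X n)) \<longlonglongrightarrow> l \<and> (\<forall>Y. ecau Y \<and> esim Y X \<longrightarrow> (\<lambda>n. sq (Y n)) \<longlonglongrightarrow> l)"
proof -
  define r where "r = lim (\<lambda>n. nrm E (X n))"
  have 1: "(\<lambda>n. nrm E (X n)) \<longlonglongrightarrow> r" unfolding r_def by (rule EE_lim_nrm[OF assms])
  have *: "(\<lambda>n. sq (Y n)) \<longlonglongrightarrow> r\<^sup>2" if Y: "ecau Y" "esim Y X" for Y
  proof -
    have "(\<lambda>n. nrm E (Y n)) \<longlonglongrightarrow> r"
      by (rule EE_lim_eq_of_sim[OF assms Y(1) EE_sim_sym[OF Y(1) assms Y(2)] EE_abs_diff_le 1]) simp_all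
    then have "(\<lambda>n. (nrm E (Y n))\<^sup>2) \<longlonglongrightarrow> r\<^sup>2" by (rule tendsto_power)
    then show ?thesis using Y by (simp add: sq_nonneg)
  qed
  show ?thesis using * *[OF assms EE_sim_refl[OF assms]] by blast
qed

lemma polarization:
  assumes [simp]: "x \<in> carrier A" "y \<in> carrier A"
  shows "\<phi> (star A y \<otimes> x) = Complex ((sq (x \<oplus> 1 \<odot> y) - sq (x \<oplus> (-1) \<odot> y)) / 4)
    ((sq (x \<oplus> \<i> \<odot> y) - sq (x \<oplus> (-\<i>) \<odot> y)) / 4)"
  using hermitian[of x y] sq_expand[of x y 1] sq_expand[of x y "-1"] sq_expand[of x y \<i>] sq_expand[of x y "-\<i>"]
  by (simp add: complex_eq_iff)

text \<open>By polarization the inner products are combinations of four square seminorms. Their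
  limits exist and agree for equivalent sequences, so the inner product is independent of the
  representatives.\<close>

lemma inner_lim:
  assumes X: "ecau X" and Y: "ecau Y"
  shows "(\<lambda>n. \<phi> (star A (Y n) \<otimes> X n)) \<longlonglongrightarrow> hinner gns (R X) (R Y)"
proof -
  have r: "ecau (R X)" "esim (R X) X" "ecau (R Y)" "esim (R Y) Y"
    using EQ_rep X Y by auto
  have "\<exists>l. (\<lambda>n. sq (X n \<oplus> c \<odot> Y n)) \<longlonglongrightarrow> l \<and> (\<lambda>n. sq (R X n \<oplus> c \<odot> R Y n)) \<longlonglongrightarrow> l" for c
  proof -
    have e1: "ecau (\<lambda>n. X n \<oplus> c \<odot> Y n)" using EE_cau_add[OF X EE_cau_smult[OF Y, of c]] by simp
    have e2: "ecau (\<lambda>n. R X n \<oplus> c \<odot> R Y n)" using EE_cau_add[OF r(1) EE_cau_smult[OF r(3), of c]] by simp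
    have e3: "esim (\<lambda>n. R X n \<oplus> c \<odot> R Y n) (\<lambda>n. X n \<oplus> c \<odot> Y n)"
      using EE_sim_add[OF r(1) EE_cau_smult[OF r(3)] X EE_cau_smult[OF Y] r(2) EE_sim_smult[OF r(3) Y r(4)], of c] by simp
    obtain l where l: "(\<lambda>n. sq (X n \<oplus> c \<odot> Y n)) \<longlonglongrightarrow> l \<and>
        (\<forall>Z. ecau Z \<and> esim Z (\<lambda>n. X n \<oplus> c \<odot> Y n) \<longrightarrow> (\<lambda>n. sq (Z n)) \<longlonglongrightarrow> l)"
      using sq_lim[OF e1] by (rule exE)
    then have "(\<lambda>n. sq (R X n \<oplus> c \<odot> R Y n)) \<longlonglongrightarrow> l" using e2 e3 by simp
    with l show ?thesis by (intro exI[of _ l] conjI) simp_all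
  qed
  then have "\<exists>l. \<forall>c. (\<lambda>n. sq (X n \<oplus> c \<odot> Y n)) \<longlonglongrightarrow> l c \<and> (\<lambda>n. sq (R X n \<oplus> c \<odot> R Y n)) \<longlonglongrightarrow> l c"
    by (intro choice allI)
  then obtain l where "\<forall>c. (\<lambda>n. sq (X n \<oplus> c \<odot> Y n)) \<longlonglongrightarrow> l c \<and> (\<lambda>n. sq (R X n \<oplus> c \<odot> R Y n)) \<longlonglongrightarrow> l c"
    by (rule exE)
  then have l: "(\<lambda>n. sq (X n \<oplus> c \<odot> Y n)) \<longlonglongrightarrow> l c"
    "(\<lambda>n. sq (R X n \<oplus> c \<odot> R Y n)) \<longlonglongrightarrow> l c" for c by simp_all
  define L where "L = Complex ((l 1 - l (-1)) / 4) ((l \<i> - l (-\<i>)) / 4)"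
  have *: "(\<lambda>n. \<phi> (star A (V n) \<otimes> U n)) \<longlonglongrightarrow> L"
    if "\<And>c. (\<lambda>n. sq (U n \<oplus> c \<odot> V n)) \<longlonglongrightarrow> l c" "\<And>n. U n \<in> carrier A" "\<And>n. V n \<in> carrier A" for U V
    unfolding polarization[OF that(2,3)] L_def tendsto_complex_iff complex.sel
    by (intro conjI tendsto_divide tendsto_diff that) simp_all
  have "(\<lambda>n. \<phi> (star A (R Y n) \<otimes> R X n)) \<longlonglongrightarrow> L" by (rule *) (use l r in auto)
  then have "hinner gns (R X) (R Y) = L" by (simp add: gns_def limI)
  moreover have "(\<lambda>n. \<phi> (star A (Y n) \<otimes> X n)) \<longlonglongrightarrow> L" by (rule *) (use l X Y in auto)
  ultimately show ?thesis by simp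
qed

lemma gns_ops:
  assumes "ecau X" "ecau Y"
  shows "R X \<oplus>\<^bsub>gns\<^esub> R Y = R (\<lambda>n. X n \<oplus> Y n)" "c \<odot>\<^bsub>gns\<^esub> R X = R (\<lambda>n. c \<odot> X n)"
  using EQ_add[OF assms] EQ_smult[OF assms(1)] by (simp_all add: gns_def)

lemma gns_cases:
  assumes "\<xi> \<in> carrier gns" obtains X where "ecau X" "\<xi> = R X"
  using assms by (auto simp: gns_def)

lemma R_in [simp]: "ecau X ==> R X \<in> carrier gns"
  by (simp add: gns_def)

lemmas ecau_ops = EE_cau_add[simplified] EE_cau_smult[simplified] EE_cau_const[simplified]

lemma hnorm_gns:
  assumes "ecau X"
  shows "(\<lambda>n. sqrt (sq (X n))) \<longlonglongrightarrow> hnorm gns (R X)"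
proof -
  have "(\<lambda>n. Re (\<phi> (star A (X n) \<otimes> X n))) \<longlonglongrightarrow> Re (hinner gns (R X) (R X))"
    by (intro tendsto_Re inner_lim assms)
  then show ?thesis unfolding hnorm_def sq_def by (rule tendsto_real_sqrt)
qed

lemma hnorm_const: "x \<in> carrier A ==> hnorm gns (R (\<lambda>n. x)) = sqrt (sq x)"
  using hnorm_gns[of "\<lambda>n. x"] by (simp add: ecau_ops LIMSEQ_const_iff)

lemma gns_module: "Module.module complex_ring gns"
  by (rule quotient_space.quotient_module[OF E_quotient]) (simp_all add: gns_def)

lemma gns_minus:
  assumes X: "ecau X" and Y: "ecau Y"
  shows "R X \<ominus>\<^bsub>gns\<^esub> R Y = R (\<lambda>n. X n \<ominus> Y n)"
proof -
  interpret G: Module.module complex_ring gns by (rule gns_module)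
  have c: "ecau (\<lambda>n. (-1) \<odot> Y n)" using Y by (rule ecau_ops)
  have z: "R (\<lambda>n. (-1) \<odot> Y n) \<oplus>\<^bsub>gns\<^esub> R Y = \<zero>\<^bsub>gns\<^esub>"
    using Y c by (simp add: gns_ops sm_collect) (simp add: gns_def)
  have "\<ominus>\<^bsub>gns\<^esub> R Y = R (\<lambda>n. (-1) \<odot> Y n)"
    by (rule G.minus_equality[OF z]) (use Y c in simp_all)
  then show ?thesis using X Y c by (simp add: a_minus_def gns_ops sm_minus)
qed

lemma ecau_minus: "ecau X ==> ecau Y ==> ecau (\<lambda>n. X n \<ominus> Y n)"
  using ecau_ops(1)[OF _ ecau_ops(2), of X Y "-1"] by (simp add: minus_sm)

lemma hnorm_minus_triangle:
  assumes "ecau X" "ecau Y" "ecau Z"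
  shows "hnorm gns (R X \<ominus>\<^bsub>gns\<^esub> R Z) \<le> hnorm gns (R X \<ominus>\<^bsub>gns\<^esub> R Y) + hnorm gns (R Y \<ominus>\<^bsub>gns\<^esub> R Z)"
  unfolding gns_minus[OF assms(1,3)] gns_minus[OF assms(1,2)] gns_minus[OF assms(2,3)]
proof (rule LIMSEQ_le[OF hnorm_gns tendsto_add[OF hnorm_gns hnorm_gns]])
  show "\<exists>N. \<forall>n\<ge>N. sqrt (sq (X n \<ominus> Z n)) \<le> sqrt (sq (X n \<ominus> Y n)) + sqrt (sq (Y n \<ominus> Z n))"
    using EE_minus_triangle assms by force
qed (use assms ecau_minus in auto)

lemma hnorm_minus_commute:
  assumes "ecau X" "ecau Y"
  shows "hnorm gns (R X \<ominus>\<^bsub>gns\<^esub> R Y) = hnorm gns (R Y \<ominus>\<^bsub>gns\<^esub> R X)"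
proof (rule LIMSEQ_unique)
  show "(\<lambda>n. sqrt (sq (X n \<ominus> Y n))) \<longlonglongrightarrow> hnorm gns (R X \<ominus>\<^bsub>gns\<^esub> R Y)"
    unfolding gns_minus[OF assms] by (intro hnorm_gns ecau_minus assms)
  have "sqrt (sq (X n \<ominus> Y n)) = sqrt (sq (Y n \<ominus> X n))" for n
    using EE_minus_commute[of "X n" "Y n"] assms by simp
  then show "(\<lambda>n. sqrt (sq (X n \<ominus> Y n))) \<longlonglongrightarrow> hnorm gns (R Y \<ominus>\<^bsub>gns\<^esub> R X)"
    unfolding gns_minus[OF assms(2,1)] using hnorm_gns[OF ecau_minus[OF assms(2,1)]] by simp
qed

lemma ecauD: "ecau X ==> e > 0 ==> \<exists>N. \<forall>m\<ge>N. \<forall>n\<ge>N. sqrt (sq (X m \<ominus> X n)) < e"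
  by (simp add: alg_cauchy_def)

lemma hnorm_const_lim:
  assumes X: "ecau X" and N: "\<And>m n. m \<ge> N ==> n \<ge> N ==> sqrt (sq (X m \<ominus> X n)) < e" and m: "m \<ge> N"
  shows "hnorm gns (R (\<lambda>n. X m) \<ominus>\<^bsub>gns\<^esub> R X) \<le> e"
proof -
  have c: "ecau (\<lambda>n. X m)" using X by (simp add: ecau_ops)
  have "(\<lambda>n. sqrt (sq (X m \<ominus> X n))) \<longlonglongrightarrow> hnorm gns (R (\<lambda>n. X m) \<ominus>\<^bsub>gns\<^esub> R X)"
    unfolding gns_minus[OF c X] by (rule hnorm_gns[OF ecau_minus[OF c X]])
  then show ?thesis by (rule LIMSEQ_le_const2) (use N m less_imp_le in blast)
qed

text \<open>Diagonal argument: the k-th vector is replaced by a constant sequence x k at distance at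
  most 1/(k+1). The sequence x is then itself Cauchy in A for the GNS seminorm, and its
  representative is the limit.\<close>

lemma gns_complete:
  assumes \<Xi>: "\<And>k. \<Xi> k \<in> carrier gns"
    and C: "\<And>e. e > 0 ==> \<exists>N. \<forall>m\<ge>N. \<forall>n\<ge>N. hnorm gns (\<Xi> m \<ominus>\<^bsub>gns\<^esub> \<Xi> n) < e"
  shows "\<exists>v\<in>carrier gns. (\<lambda>n. hnorm gns (\<Xi> n \<ominus>\<^bsub>gns\<^esub> v)) \<longlonglongrightarrow> 0"
proof -
  have "\<forall>k. \<exists>X. ecau X \<and> \<Xi> k = R X" using \<Xi> gns_cases by metis
  then obtain X where X: "\<And>k. ecau (X k)" "\<And>k. \<Xi> k = R (X k)" by metis
  define j where "j x = R (\<lambda>n::nat. x)" for x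
  have "\<exists>x\<in>carrier A. hnorm gns (j x \<ominus>\<^bsub>gns\<^esub> \<Xi> k) \<le> 1 / real (Suc k)" for k
  proof -
    obtain N where N: "\<forall>m\<ge>N. \<forall>n\<ge>N. sqrt (sq (X k m \<ominus> X k n)) < 1 / real (Suc k)"
      using ecauD[OF X(1)[of k], of "1 / real (Suc k)"] by auto
    then have "hnorm gns (j (X k N) \<ominus>\<^bsub>gns\<^esub> \<Xi> k) \<le> 1 / real (Suc k)"
      unfolding X(2) j_def by (intro hnorm_const_lim[OF X(1), of N]) auto
    then show ?thesis using X(1) by (intro bexI[of _ "X k N"]) simp_all
  qed
  then obtain x where x: "\<And>k. x k \<in> carrier A" "\<And>k. hnorm gns (j (x k) \<ominus>\<^bsub>gns\<^esub> \<Xi> k) \<le> 1 / real (Suc k)" by metis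
  have cx: "ecau (\<lambda>n. x k)" for k by (simp add: ecau_ops x)
  have small: "\<exists>N. \<forall>k\<ge>N. 1 / real (Suc k) < e" if "e > 0" for e
  proof -
    obtain N where N: "1 / real (Suc N) < e" by (rule nat_approx_posE[OF \<open>e > 0\<close>])
    have "1 / real (Suc k) < e" if "k \<ge> N" for k
      by (rule le_less_trans[OF _ N]) (use that in \<open>simp add: frac_le\<close>)
    then show ?thesis by (intro exI[of _ N] allI impI)
  qed
  have ex: "ecau x"
    unfolding alg_cauchy_def
  proof (intro conjI allI impI)
    fix e :: real assume e: "e > 0"
    obtain N1 where N1: "\<forall>m\<ge>N1. \<forall>n\<ge>N1. hnorm gns (\<Xi> m \<ominus>\<^bsub>gns\<^esub> \<Xi> n) < e / 3" using C[of "e/3"] e by auto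
    obtain N2 where N2: "\<forall>k\<ge>N2. 1 / real (Suc k) < e / 3" using small[of "e/3"] e by auto
    have "nrm E (x m \<ominus>\<^bsub>E\<^esub> x n) < e" if mn: "m \<ge> max N1 N2" "n \<ge> max N1 N2" for m n
    proof -
      have "sqrt (sq (x m \<ominus> x n)) = hnorm gns (j (x m) \<ominus>\<^bsub>gns\<^esub> j (x n))"
        unfolding j_def gns_minus[OF cx cx] by (simp add: hnorm_const x)
      also have "\<dots> \<le> hnorm gns (j (x m) \<ominus>\<^bsub>gns\<^esub> \<Xi> m) + (hnorm gns (\<Xi> m \<ominus>\<^bsub>gns\<^esub> \<Xi> n) + hnorm gns (\<Xi> n \<ominus>\<^bsub>gns\<^esub> j (x n)))"
        unfolding j_def X(2) using hnorm_minus_triangle[OF cx[of m] X(1)[of m] cx[of n]] hnorm_minus_triangle[OF X(1)[of m] X(1)[of n] cx[of n]] by linarith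
      also have "hnorm gns (\<Xi> n \<ominus>\<^bsub>gns\<^esub> j (x n)) = hnorm gns (j (x n) \<ominus>\<^bsub>gns\<^esub> \<Xi> n)"
        unfolding j_def X(2) by (rule hnorm_minus_commute[OF X(1) cx])
      also have "hnorm gns (j (x m) \<ominus>\<^bsub>gns\<^esub> \<Xi> m) + (hnorm gns (\<Xi> m \<ominus>\<^bsub>gns\<^esub> \<Xi> n) + hnorm gns (j (x n) \<ominus>\<^bsub>gns\<^esub> \<Xi> n)) < e"
      proof -
        have "hnorm gns (\<Xi> m \<ominus>\<^bsub>gns\<^esub> \<Xi> n) < e / 3" "1 / real (Suc m) < e / 3" "1 / real (Suc n) < e / 3"
          using N1 N2 mn by simp_all
        then show ?thesis using x(2)[of m] x(2)[of n] by linarith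
      qed
      finally show ?thesis by simp
    qed
    then show "\<exists>N. \<forall>m\<ge>N. \<forall>n\<ge>N. nrm E (x m \<ominus>\<^bsub>E\<^esub> x n) < e" by blast
  qed (use x in auto)
  have "(\<lambda>n. hnorm gns (\<Xi> n \<ominus>\<^bsub>gns\<^esub> R x)) \<longlonglongrightarrow> 0"
  proof (rule LIMSEQ_I)
    fix e :: real assume e: "e > 0"
    obtain N1 where N1: "\<forall>m\<ge>N1. \<forall>n\<ge>N1. sqrt (sq (x m \<ominus> x n)) < e / 3" using ecauD[OF ex, of "e/3"] e by auto
    obtain N2 where N2: "\<forall>k\<ge>N2. 1 / real (Suc k) < e / 3" using small[of "e/3"] e by auto
    have "norm (hnorm gns (\<Xi> n \<ominus>\<^bsub>gns\<^esub> R x) - 0) < e" if n: "n \<ge> max N1 N2" for n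
    proof -
      have "hnorm gns (\<Xi> n \<ominus>\<^bsub>gns\<^esub> R x) \<le> hnorm gns (\<Xi> n \<ominus>\<^bsub>gns\<^esub> j (x n)) + hnorm gns (j (x n) \<ominus>\<^bsub>gns\<^esub> R x)"
        unfolding X(2) j_def by (rule hnorm_minus_triangle[OF X(1) cx ex])
      also have "hnorm gns (\<Xi> n \<ominus>\<^bsub>gns\<^esub> j (x n)) = hnorm gns (j (x n) \<ominus>\<^bsub>gns\<^esub> \<Xi> n)"
        unfolding j_def X(2) by (rule hnorm_minus_commute[OF X(1) cx])
      also have "\<dots> + hnorm gns (j (x n) \<ominus>\<^bsub>gns\<^esub> R x) \<le> e / 3 + e / 3"
      proof (rule add_mono)
        have "1 / real (Suc n) < e / 3" using N2 n by simp
        then show "hnorm gns (j (x n) \<ominus>\<^bsub>gns\<^esub> \<Xi> n) \<le> e / 3" using x(2)[of n] by linarith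
        show "hnorm gns (j (x n) \<ominus>\<^bsub>gns\<^esub> R x) \<le> e / 3"
          unfolding j_def by (rule hnorm_const_lim[OF ex, of N1]) (use N1 n in simp_all)
      qed
      also have "\<dots> < e" using e by simp
      finally have "hnorm gns (\<Xi> n \<ominus>\<^bsub>gns\<^esub> R x) < e" .
      moreover have "0 \<le> hnorm gns (\<Xi> n \<ominus>\<^bsub>gns\<^esub> R x)"
        unfolding X(2) gns_minus[OF X(1) ex]
        by (rule LIMSEQ_le_const[OF hnorm_gns[OF ecau_minus[OF X(1) ex]]]) (use X(1) ex in \<open>auto simp: sq_nonneg\<close>)
      ultimately show ?thesis by simp
    qed
    then show "\<exists>N. \<forall>n\<ge>N. norm (hnorm gns (\<Xi> n \<ominus>\<^bsub>gns\<^esub> R x) - 0) < e" by blast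
  qed
  then show ?thesis using R_in[OF ex] by (intro bexI[of _ "R x"])
qed

lemma gns_hilbert: "hilbert gns"
proof -
  interpret G: Module.module complex_ring gns by (rule gns_module)
  show ?thesis
  proof (unfold_locales, goal_cases)
    case (1 u v w)
    obtain X where X: "ecau X" "u = R X" using 1(1) by (rule gns_cases)
    obtain Y where Y: "ecau Y" "v = R Y" using 1(2) by (rule gns_cases)
    obtain Z where Z: "ecau Z" "w = R Z" using 1(3) by (rule gns_cases)
    have "(\<lambda>n. \<phi> (star A (Z n) \<otimes> (X n \<oplus> Y n))) \<longlonglongrightarrow> hinner gns (u \<oplus>\<^bsub>gns\<^esub> v) w"
      using inner_lim[OF ecau_ops(1)[OF X(1) Y(1)] Z(1)] X Y Z by (simp add: gns_ops)
    moreover have "(\<lambda>n. \<phi> (star A (Z n) \<otimes> (X n \<oplus> Y n))) \<longlonglongrightarrow> hinner gns u w + hinner gns v w"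
      using tendsto_add[OF inner_lim[OF X(1) Z(1)] inner_lim[OF Y(1) Z(1)]] X Y Z by (simp add: r_distr \<phi>_lin)
    ultimately show ?case by (rule LIMSEQ_unique)
  next
    case (2 v w c)
    obtain Y where Y: "ecau Y" "v = R Y" using 2(1) by (rule gns_cases)
    obtain Z where Z: "ecau Z" "w = R Z" using 2(2) by (rule gns_cases)
    have "(\<lambda>n. \<phi> (star A (Z n) \<otimes> (c \<odot> Y n))) \<longlonglongrightarrow> hinner gns (c \<odot>\<^bsub>gns\<^esub> v) w"
      using inner_lim[OF ecau_ops(2)[OF Y(1)] Z(1), of c] Y Z by (simp add: gns_ops)
    moreover have "(\<lambda>n. \<phi> (star A (Z n) \<otimes> (c \<odot> Y n))) \<longlonglongrightarrow> c * hinner gns v w"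
      using tendsto_mult_left[OF inner_lim[OF Y(1) Z(1)], of c] Y Z by (simp add: smult_r \<phi>_lin)
    ultimately show ?case by (rule LIMSEQ_unique)
  next
    case (3 v w)
    obtain Y where Y: "ecau Y" "v = R Y" using 3(1) by (rule gns_cases)
    obtain Z where Z: "ecau Z" "w = R Z" using 3(2) by (rule gns_cases)
    have "(\<lambda>n. \<phi> (star A (Y n) \<otimes> Z n)) \<longlonglongrightarrow> hinner gns w v" using inner_lim[OF Z(1) Y(1)] Y Z by simp
    moreover have "(\<lambda>n. \<phi> (star A (Y n) \<otimes> Z n)) \<longlonglongrightarrow> cnj (hinner gns v w)"
    proof -
      have "\<phi> (star A (Y n) \<otimes> Z n) = cnj (\<phi> (star A (Z n) \<otimes> Y n))" for n
        using Y Z by (intro hermitian) simp_all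
      then show ?thesis using tendsto_cnj[OF inner_lim[OF Y(1) Z(1)]] Y Z by simp
    qed
    ultimately show ?case by (rule LIMSEQ_unique)
  next
    case (4 v)
    obtain X where X: "ecau X" "v = R X" using 4(1) by (rule gns_cases)
    have z: "ecau (\<lambda>n. \<zero>)" by (simp add: ecau_ops)
    have l: "(\<lambda>n. sq (X n)) \<longlonglongrightarrow> Re (hinner gns v v)"
      unfolding X(2) sq_def by (intro tendsto_Re inner_lim X)
    have "0 \<le> Re (hinner gns v v)" by (rule LIMSEQ_le_const[OF l]) (use X in \<open>auto simp: sq_nonneg\<close>)
    moreover have "Re (hinner gns v v) \<noteq> 0"
    proof
      assume "Re (hinner gns v v) = 0"
      then have "(\<lambda>n. sqrt (sq (X n))) \<longlonglongrightarrow> sqrt 0" using l by (intro tendsto_real_sqrt) simp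
      then have "esim X (\<lambda>n. \<zero>)" using X by (simp add: EE_sim_def minus_sm)
      then have "R X = R (\<lambda>n. \<zero>)" using EQ_eq[OF X(1) z] by simp
      then show False using 4(2) X by (simp add: gns_def)
    qed
    ultimately show ?case by simp
  next
    case (5 \<Xi>)
    have "\<Xi> k \<in> carrier gns" for k using 5(1) by (simp add: image_subset_iff)
    moreover have "\<exists>N. \<forall>m\<ge>N. \<forall>n\<ge>N. hnorm gns (\<Xi> m \<ominus>\<^bsub>gns\<^esub> \<Xi> n) < e" if "e > 0" for e
      using 5(2) that by simp
    ultimately show ?case by (rule gns_complete)
  qed
qed

subsection \<open>Operators on the GNS space\<close>

definition lift :: "('a => 'a) => (nat => 'a) => nat => 'a" where
  "lift T \<xi> = R (\<lambda>n. T (\<xi> n))"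

definition liftable :: "('a => 'a) => bool" where
  "liftable T \<longleftrightarrow> (\<forall>x\<in>carrier A. T x \<in> carrier A) \<and>
     (\<forall>x\<in>carrier A. \<forall>y\<in>carrier A. T (x \<oplus> y) = T x \<oplus> T y) \<and>
     (\<forall>c. \<forall>x\<in>carrier A. T (c \<odot> x) = c \<odot> T x) \<and>
     (\<exists>C\<ge>0. \<forall>x\<in>carrier A. sqrt (sq (T x)) \<le> C * sqrt (sq x))"

lemma liftable_ecau:
  assumes T: "liftable T" and X: "ecau X"
  shows "ecau (\<lambda>n. T (X n))" "lift T (R X) = R (\<lambda>n. T (X n))"
proof -
  obtain C where C: "C \<ge> 0" "\<And>x. x \<in> carrier A ==> sqrt (sq (T x)) \<le> C * sqrt (sq x)"
    using T by (auto simp: liftable_def)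
  have in_A: "T x \<in> carrier A" if "x \<in> carrier A" for x using T that by (simp add: liftable_def)
  have diff: "sqrt (sq (T x \<ominus> T y)) \<le> C * (sqrt (sq (x \<ominus> y)) + sqrt (sq (x \<ominus> y)))" if xy: "x \<in> carrier A" "y \<in> carrier A" for x y
  proof -
    have "T x \<ominus> T y = T (x \<ominus> y)" using T xy by (simp add: liftable_def minus_sm)
    then have "sqrt (sq (T x \<ominus> T y)) \<le> C * sqrt (sq (x \<ominus> y))" using C(2)[of "x \<ominus> y"] xy by simp
    also have "\<dots> \<le> C * (sqrt (sq (x \<ominus> y)) + sqrt (sq (x \<ominus> y)))"
      using C(1) xy by (intro mult_left_mono) (simp_all add: sq_nonneg)
    finally show ?thesis .
  qed
  have ec: "ecau (\<lambda>n. T (Y n))" if Y: "ecau Y" for Y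
    by (rule EE_cau_dominated[OF Y Y _ C(1)]) (use Y diff in_A in simp_all)
  show "ecau (\<lambda>n. T (X n))" by (rule ec[OF X])
  have r: "ecau (R X)" "esim (R X) X" using EQ_rep X by auto
  have "esim (\<lambda>n. T (R X n)) (\<lambda>n. T (X n))"
    by (rule EE_sim_dominated[OF r(2) r(2), where K = C]) (use r X diff in_A in simp_all)
  then show "lift T (R X) = R (\<lambda>n. T (X n))" unfolding lift_def using EQ_eq[OF ec[OF r(1)] ec[OF X]] by simp
qed

lemma lift_bounded: assumes T: "liftable T" shows "lift T \<in> bounded_operators gns"
proof -
  obtain C where C: "C \<ge> 0" "\<And>x. x \<in> carrier A ==> sqrt (sq (T x)) \<le> C * sqrt (sq x)"
    using T by (auto simp: liftable_def)
  have "hnorm gns (lift T \<xi>) \<le> C * hnorm gns \<xi>" if \<xi>: "\<xi> \<in> carrier gns" for \<xi>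
  proof -
    obtain X where X: "ecau X" "\<xi> = R X" using \<xi> by (rule gns_cases)
    show ?thesis unfolding X(2) liftable_ecau(2)[OF T X(1)]
      by (rule LIMSEQ_le[OF hnorm_gns[OF liftable_ecau(1)[OF T X(1)]] tendsto_mult_left[OF hnorm_gns[OF X(1)]]])
        (use C X in auto)
  qed
  moreover have "lift T (\<xi> \<oplus>\<^bsub>gns\<^esub> \<zeta>) = lift T \<xi> \<oplus>\<^bsub>gns\<^esub> lift T \<zeta>" if \<xi>\<zeta>: "\<xi> \<in> carrier gns" "\<zeta> \<in> carrier gns" for \<xi> \<zeta>
  proof -
    obtain X where X: "ecau X" "\<xi> = R X" using \<xi>\<zeta>(1) by (rule gns_cases)
    obtain Y where Y: "ecau Y" "\<zeta> = R Y" using \<xi>\<zeta>(2) by (rule gns_cases)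
    have "T (X n \<oplus> Y n) = T (X n) \<oplus> T (Y n)" for n using T X Y by (simp add: liftable_def)
    then show ?thesis using X Y by (simp add: gns_ops liftable_ecau[OF T] ecau_ops)
  qed
  moreover have "lift T (c \<odot>\<^bsub>gns\<^esub> \<xi>) = c \<odot>\<^bsub>gns\<^esub> lift T \<xi>" if \<xi>: "\<xi> \<in> carrier gns" for c \<xi>
  proof -
    obtain X where X: "ecau X" "\<xi> = R X" using \<xi> by (rule gns_cases)
    have "T (c \<odot> X n) = c \<odot> T (X n)" for n using T X by (simp add: liftable_def)
    then show ?thesis using X gns_ops(2)[OF X(1) X(1)] gns_ops(2)[OF liftable_ecau(1)[OF T X(1)] X(1)]
      by (simp add: liftable_ecau[OF T] ecau_ops)
  qed
  moreover have "lift T \<xi> \<in> carrier gns" if \<xi>: "\<xi> \<in> carrier gns" for \<xi>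
  proof -
    obtain X where X: "ecau X" "\<xi> = R X" using \<xi> by (rule gns_cases)
    then show ?thesis by (simp add: liftable_ecau[OF T])
  qed
  ultimately show ?thesis unfolding bounded_operators_def by blast
qed

lemma lift_adjoint:
  assumes T: "liftable T" "liftable T'" and \<xi>\<zeta>: "\<xi> \<in> carrier gns" "\<zeta> \<in> carrier gns"
    and adj: "\<And>x y. x \<in> carrier A ==> y \<in> carrier A ==> star A y \<otimes> T x = star A (T' y) \<otimes> x"
  shows "hinner gns (lift T \<xi>) \<zeta> = hinner gns \<xi> (lift T' \<zeta>)"
proof -
  obtain X where X: "ecau X" "\<xi> = R X" using \<xi>\<zeta>(1) by (rule gns_cases)
  obtain Y where Y: "ecau Y" "\<zeta> = R Y" using \<xi>\<zeta>(2) by (rule gns_cases)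
  have "(\<lambda>n. \<phi> (star A (Y n) \<otimes> T (X n))) \<longlonglongrightarrow> hinner gns (lift T \<xi>) \<zeta>"
    using inner_lim[OF liftable_ecau(1)[OF T(1) X(1)] Y(1)] X Y by (simp add: liftable_ecau[OF T(1)])
  moreover have "(\<lambda>n. \<phi> (star A (Y n) \<otimes> T (X n))) \<longlonglongrightarrow> hinner gns \<xi> (lift T' \<zeta>)"
    using inner_lim[OF X(1) liftable_ecau(1)[OF T(2) Y(1)]] X Y by (simp add: liftable_ecau[OF T(2)] adj)
  ultimately show ?thesis by (rule LIMSEQ_unique)
qed

lemma lift_cong: "(\<And>x. x \<in> carrier A ==> T x = T' x) ==> \<xi> \<in> carrier gns ==> lift T \<xi> = lift T' \<xi>"
proof -
  assume e: "\<And>x. x \<in> carrier A ==> T x = T' x" and \<xi>: "\<xi> \<in> carrier gns"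
  obtain X where X: "ecau X" "\<xi> = R X" using \<xi> by (rule gns_cases)
  have "ecau \<xi>" using EQ_rep X by auto
  then show ?thesis unfolding lift_def using e by simp
qed

lemma lift_add:
  assumes T: "liftable T" "liftable T'" and \<xi>: "\<xi> \<in> carrier gns"
  shows "lift (\<lambda>x. T x \<oplus> T' x) \<xi> = lift T \<xi> \<oplus>\<^bsub>gns\<^esub> lift T' \<xi>"
proof -
  obtain X where X: "ecau X" "\<xi> = R X" using \<xi> by (rule gns_cases)
  have "ecau \<xi>" using EQ_rep X by auto
  then have "ecau (\<lambda>n. T (\<xi> n))" "ecau (\<lambda>n. T' (\<xi> n))" using liftable_ecau(1) T by simp_all
  then show ?thesis unfolding lift_def using gns_ops(1)[of "\<lambda>n. T (\<xi> n)" "\<lambda>n. T' (\<xi> n)"] by simp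
qed

lemma lift_smult:
  assumes T: "liftable T" and \<xi>: "\<xi> \<in> carrier gns"
  shows "lift (\<lambda>x. c \<odot> T x) \<xi> = c \<odot>\<^bsub>gns\<^esub> lift T \<xi>"
proof -
  obtain X where X: "ecau X" "\<xi> = R X" using \<xi> by (rule gns_cases)
  have "ecau \<xi>" using EQ_rep X by auto
  then have e: "ecau (\<lambda>n. T (\<xi> n))" using liftable_ecau(1) T by simp
  show ?thesis unfolding lift_def using gns_ops(2)[OF e e] by simp
qed

lemma lift_mult:
  assumes T: "liftable T" "liftable T'" and \<xi>: "\<xi> \<in> carrier gns"
  shows "lift (\<lambda>x. T (T' x)) \<xi> = lift T (lift T' \<xi>)"
proof -
  obtain X where X: "ecau X" "\<xi> = R X" using \<xi> by (rule gns_cases)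
  have "ecau \<xi>" using EQ_rep X by auto
  then have e: "ecau (\<lambda>n. T' (\<xi> n))" using liftable_ecau(1) T by simp
  show ?thesis using liftable_ecau(2)[OF T(1) e] by (simp add: lift_def)
qed

lemma liftable_left: assumes [simp]: "b \<in> carrier A" shows "liftable (\<lambda>x. b \<otimes> x)"
proof -
  have "sqrt (sq (b \<otimes> x)) \<le> nrm A b * sqrt (sq x)" if [simp]: "x \<in> carrier A" for x
  proof -
    have "sqrt (sq (b \<otimes> x)) \<le> sqrt ((nrm A b)\<^sup>2 * sq x)" by (simp add: sq_left_mult)
    then show ?thesis by (simp add: real_sqrt_mult nrm_nonneg)
  qed
  then show ?thesis unfolding liftable_def
    using nrm_nonneg[of b] by (auto simp: r_distr smult_r intro!: exI[of _ "nrm A b"])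
qed

lemma liftable_multiplier: assumes m: "m \<in> carrier MA" shows "liftable (fst m)"
proof -
  obtain C where C: "C > 0" "\<And>x. x \<in> carrier A ==> sq (fst m x) \<le> C\<^sup>2 * sq x"
    using sq_multiplier[OF m] by metis
  have "sqrt (sq (fst m x)) \<le> C * sqrt (sq x)" if x: "x \<in> carrier A" for x
  proof -
    have "sqrt (sq (fst m x)) \<le> sqrt (C\<^sup>2 * sq x)" using C(2)[OF x] by simp
    then show ?thesis using C(1) by (simp add: real_sqrt_mult)
  qed
  then show ?thesis unfolding liftable_def
    using multiplier_l[OF m] C(1) by (auto intro!: exI[of _ C])
qed

lemma gns_rep: "star_rep A gns (\<lambda>b. lift (\<lambda>x. b \<otimes> x))"
  unfolding star_rep_def
proof (intro conjI ballI allI gns_hilbert)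
  fix b c \<xi> assume b: "b \<in> carrier A" "c \<in> carrier A" and \<xi>: "\<xi> \<in> carrier gns"
  show "lift (\<lambda>x. (b \<oplus> c) \<otimes> x) \<xi> = lift (\<lambda>x. b \<otimes> x) \<xi> \<oplus>\<^bsub>gns\<^esub> lift (\<lambda>x. c \<otimes> x) \<xi>"
    unfolding lift_add[OF liftable_left[OF b(1)] liftable_left[OF b(2)] \<xi>, symmetric]
    by (rule lift_cong[OF _ \<xi>]) (simp add: b l_distr)
  show "lift (\<lambda>x. (b \<otimes> c) \<otimes> x) \<xi> = lift (\<lambda>x. b \<otimes> x) (lift (\<lambda>x. c \<otimes> x) \<xi>)"
    unfolding lift_mult[OF liftable_left[OF b(1)] liftable_left[OF b(2)] \<xi>, symmetric]
    by (rule lift_cong[OF _ \<xi>]) (simp add: b m_assoc)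
next
  fix k b \<xi> assume b: "b \<in> carrier A" and \<xi>: "\<xi> \<in> carrier gns"
  show "lift (\<lambda>x. (k \<odot> b) \<otimes> x) \<xi> = k \<odot>\<^bsub>gns\<^esub> lift (\<lambda>x. b \<otimes> x) \<xi>"
    unfolding lift_smult[OF liftable_left[OF b] \<xi>, symmetric]
    by (rule lift_cong[OF _ \<xi>]) (simp add: b smult_l)
next
  fix b \<xi> \<zeta> assume b: "b \<in> carrier A" and \<xi>: "\<xi> \<in> carrier gns" "\<zeta> \<in> carrier gns"
  show "hinner gns (lift (\<lambda>x. b \<otimes> x) \<xi>) \<zeta> = hinner gns \<xi> (lift (\<lambda>x. star A b \<otimes> x) \<zeta>)"
    by (rule lift_adjoint[OF _ _ \<xi>]) (simp_all add: b liftable_left star_mult m_assoc)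
qed (rule lift_bounded[OF liftable_left])

lemma multiplierI:
  assumes "\<And>x. x \<in> carrier A ==>
      l x \<in> carrier A \<and> r x \<in> carrier A \<and> nrm A (l x) \<le> C * nrm A x \<and> nrm A (r x) \<le> C * nrm A x"
    and "\<And>x y. x \<in> carrier A ==> y \<in> carrier A ==> l (x \<oplus> y) = l x \<oplus> l y \<and> r (x \<oplus> y) = r x \<oplus> r y"
    and "\<And>x c. x \<in> carrier A ==> l (c \<odot> x) = c \<odot> l x \<and> r (c \<odot> x) = c \<odot> r x"
    and "\<And>x y. x \<in> carrier A ==> y \<in> carrier A ==> l (x \<otimes> y) = l x \<otimes> y \<and> r (x \<otimes> y) = x \<otimes> r y"
    and "\<And>x y. x \<in> carrier A ==> y \<in> carrier A ==> x \<otimes> l y = r x \<otimes> y"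
  shows "((\<lambda>x\<in>carrier A. l x), (\<lambda>x\<in>carrier A. r x)) \<in> carrier MA"
  using assms by (simp add: multiplier_algebra_def) (intro conjI exI[of _ C] ballI; simp)

lemma star_MA: assumes m: "m \<in> carrier MA" shows "star MA m \<in> carrier MA"
proof -
  obtain C where C: "\<And>x. x \<in> carrier A ==> nrm A (fst m x) \<le> C * nrm A x" "\<And>x. x \<in> carrier A ==> nrm A (snd m x) \<le> C * nrm A x"
    using multiplier_bound[OF m] by metis
  have s: "snd m (x \<oplus> y) = snd m x \<oplus> snd m y" "snd m (c \<odot> x) = c \<odot> snd m x" "snd m (x \<otimes> y) = x \<otimes> snd m y"
    if "x \<in> carrier A" "y \<in> carrier A" for x y c
    using m that by (auto simp: multiplier_algebra_def)
  note ml = multiplier_l[OF m]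
  have e: "star A x \<otimes> fst m y = snd m (star A x) \<otimes> y" if "x \<in> carrier A" "y \<in> carrier A" for x y using ml(5) that by simp
  have mid: "x \<otimes> star A (snd m (star A y)) = star A (fst m (star A x)) \<otimes> y" if xy: "x \<in> carrier A" "y \<in> carrier A" for x y
  proof -
    have "star A (star A (fst m (star A x)) \<otimes> y) = star A (x \<otimes> star A (snd m (star A y)))"
      using ml(5)[of "star A y" "star A x"] xy by (simp add: star_mult ml)
    then show ?thesis using xy ml by (metis m_closed star_closed star_star)
  qed
  have C': "nrm A (star A (fst m (star A x))) \<le> C * nrm A x" "nrm A (star A (snd m (star A x))) \<le> C * nrm A x"
    if "x \<in> carrier A" for x
    using C[of "star A x"] that ml by (simp_all add: nrm_star)
  have "((\<lambda>x\<in>carrier A. star A (snd m (star A x))), (\<lambda>x\<in>carrier A. star A (fst m (star A x)))) \<in> carrier MA"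
  proof (rule multiplierI)
    fix x assume x: "x \<in> carrier A"
    show "star A (snd m (star A x)) \<in> carrier A \<and> star A (fst m (star A x)) \<in> carrier A \<and>
        nrm A (star A (snd m (star A x))) \<le> C * nrm A x \<and> nrm A (star A (fst m (star A x))) \<le> C * nrm A x"
      using C'[OF x] ml(1,2)[of "star A x"] x by simp
    fix y c assume y: "y \<in> carrier A"
    show "x \<otimes> star A (snd m (star A y)) = star A (fst m (star A x)) \<otimes> y" by (rule mid[OF x y])
    show "star A (snd m (star A (x \<oplus> y))) = star A (snd m (star A x)) \<oplus> star A (snd m (star A y)) \<and>
        star A (fst m (star A (x \<oplus> y))) = star A (fst m (star A x)) \<oplus> star A (fst m (star A y))"
      using x y s(1)[of "star A x" "star A y"] ml by (simp add: star_add)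
    show "star A (snd m (star A (x \<otimes> y))) = star A (snd m (star A x)) \<otimes> y \<and>
        star A (fst m (star A (x \<otimes> y))) = x \<otimes> star A (fst m (star A y))"
      using x y s(3)[of "star A y" "star A x"] ml by (simp add: star_mult)
    show "star A (snd m (star A (c \<odot> x))) = c \<odot> star A (snd m (star A x)) \<and>
        star A (fst m (star A (c \<odot> x))) = c \<odot> star A (fst m (star A x))"
      using x s(2)[of "star A x" "star A x"] ml by (simp add: star_smult)
  qed
  then show ?thesis by (simp add: multiplier_algebra_def case_prod_unfold)
qed

lemma gns_multiplier_rep: "star_rep MA gns (\<lambda>m. lift (fst m))"
  unfolding star_rep_def
proof (intro conjI ballI allI gns_hilbert)
  fix b c \<xi> assume b: "b \<in> carrier MA" "c \<in> carrier MA" and \<xi>: "\<xi> \<in> carrier gns"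
  show "lift (fst (b \<oplus>\<^bsub>MA\<^esub> c)) \<xi> = lift (fst b) \<xi> \<oplus>\<^bsub>gns\<^esub> lift (fst c) \<xi>"
    unfolding lift_add[OF liftable_multiplier[OF b(1)] liftable_multiplier[OF b(2)] \<xi>, symmetric]
    by (rule lift_cong[OF _ \<xi>]) (simp add: multiplier_algebra_def case_prod_unfold)
  show "lift (fst (b \<otimes>\<^bsub>MA\<^esub> c)) \<xi> = lift (fst b) (lift (fst c) \<xi>)"
    unfolding lift_mult[OF liftable_multiplier[OF b(1)] liftable_multiplier[OF b(2)] \<xi>, symmetric]
    by (rule lift_cong[OF _ \<xi>]) (simp add: multiplier_algebra_def case_prod_unfold compose_def)
next
  fix k b \<xi> assume b: "b \<in> carrier MA" and \<xi>: "\<xi> \<in> carrier gns"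
  show "lift (fst (k \<odot>\<^bsub>MA\<^esub> b)) \<xi> = k \<odot>\<^bsub>gns\<^esub> lift (fst b) \<xi>"
    unfolding lift_smult[OF liftable_multiplier[OF b] \<xi>, symmetric]
    by (rule lift_cong[OF _ \<xi>]) (simp add: multiplier_algebra_def case_prod_unfold)
next
  fix b \<xi> \<zeta> assume b: "b \<in> carrier MA" and \<xi>: "\<xi> \<in> carrier gns" "\<zeta> \<in> carrier gns"
  show "hinner gns (lift (fst b) \<xi>) \<zeta> = hinner gns \<xi> (lift (fst (star MA b)) \<zeta>)"
  proof (rule lift_adjoint[OF liftable_multiplier[OF b] liftable_multiplier[OF star_MA[OF b]] \<xi>])
    fix x y assume xy: "x \<in> carrier A" "y \<in> carrier A"
    have "star A y \<otimes> fst b x = star A (star A (fst b x) \<otimes> y)" using xy multiplier_l(1)[OF b] by (simp add: star_mult)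
    also have "\<dots> = star A (star A x \<otimes> adj b y)" using adj_eq[OF b xy] by simp
    also have "\<dots> = star A (adj b y) \<otimes> x" using xy adj_in[OF b] by (simp add: star_mult)
    finally show "star A y \<otimes> fst b x = star A (fst (star MA b) y) \<otimes> x" using fst_star_MA[OF b] xy by simp
  qed
qed (rule lift_bounded[OF liftable_multiplier])

text \<open>A single summand is enough: a vector is close to a constant sequence x, and x is close
  to ux, the image of x under the operator of an approximate unit u.\<close>

lemma gns_nondegenerate: "nondegenerate_rep A gns (\<lambda>b. lift (\<lambda>x. b \<otimes> x))"
  unfolding nondegenerate_rep_def
proof (intro conjI gns_rep ballI allI impI)
  fix \<xi> and e :: real assume \<xi>: "\<xi> \<in> carrier gns" and e: "e > 0"
  interpret G: Module.module complex_ring gns by (rule gns_module)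
  obtain X where X: "ecau X" "\<xi> = R X" using \<xi> by (rule gns_cases)
  obtain N where N: "\<forall>m\<ge>N. \<forall>n\<ge>N. sqrt (sq (X m \<ominus> X n)) < e / 3" using ecauD[OF X(1), of "e/3"] e by auto
  define x where "x = X N"
  have x [simp]: "x \<in> carrier A" using X by (simp add: x_def)
  have cx: "ecau (\<lambda>n. x)" by (simp add: ecau_ops)
  have 1: "hnorm gns (\<xi> \<ominus>\<^bsub>gns\<^esub> R (\<lambda>n. x)) \<le> e / 3"
    using hnorm_const_lim[OF X(1), of N "e / 3" N] N hnorm_minus_commute[OF X(1) cx] unfolding X(2) x_def by simp
  obtain u where u [simp]: "u \<in> carrier A" and u2: "nrm A (x \<ominus> u \<otimes> x) < e / 3"
    using approximate_unit[of x "e/3"] e by auto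
  have cu: "ecau (\<lambda>n. u \<otimes> x)" by (simp add: ecau_ops)
  have "hnorm gns (R (\<lambda>n. x) \<ominus>\<^bsub>gns\<^esub> R (\<lambda>n. u \<otimes> x)) = sqrt (sq (x \<ominus> u \<otimes> x))"
    unfolding gns_minus[OF cx cu] by (simp add: hnorm_const)
  also have "\<dots> \<le> nrm A (x \<ominus> u \<otimes> x)"
    using sq_le[of "x \<ominus> u \<otimes> x"] nrm_nonneg[of "x \<ominus> u \<otimes> x"] by (simp add: real_le_lsqrt)
  finally have 2: "hnorm gns (R (\<lambda>n. x) \<ominus>\<^bsub>gns\<^esub> R (\<lambda>n. u \<otimes> x)) < e / 3" using u2 by simp
  have "hnorm gns (\<xi> \<ominus>\<^bsub>gns\<^esub> R (\<lambda>n. u \<otimes> x)) < e"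
    using hnorm_minus_triangle[OF X(1) cx cu] 1 2 e unfolding X(2) by linarith
  moreover have "R (\<lambda>n. u \<otimes> x) = lift (\<lambda>x. u \<otimes> x) (R (\<lambda>n. x))"
    using liftable_ecau(2)[OF liftable_left[OF u] cx] by simp
  moreover have "R (\<lambda>n. u \<otimes> x) \<in> carrier gns" using cu by simp
  ultimately have "hnorm gns (\<xi> \<ominus>\<^bsub>gns\<^esub> finsum gns (\<lambda>i. lift (\<lambda>x. u \<otimes> x) (R (\<lambda>n. x))) {..<1::nat}) < e"
    by (simp add: lessThan_Suc)
  then show "\<exists>(n::nat) b w. (\<forall>i<n. b i \<in> carrier A \<and> w i \<in> carrier gns) \<and>
      hnorm gns (\<xi> \<ominus>\<^bsub>gns\<^esub> finsum gns (\<lambda>i. lift (\<lambda>x. b i \<otimes> x) (w i)) {..<n}) < e"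
    using cx by (intro exI[of _ 1] exI[of _ "\<lambda>_. u"] exI[of _ "\<lambda>_. R (\<lambda>n. x)"]) auto
qed

end

subsection \<open>Canonical extension of states\<close>

context hilbert
begin

lemma hinner_minus:
  assumes "u \<in> carrier H" "v \<in> carrier H" "w \<in> carrier H"
  shows "hinner H (u \<ominus> v) w = hinner H u w - hinner H v w" "hinner H w (u \<ominus> v) = hinner H w u - hinner H w v"
proof -
  have "u = (u \<ominus> v) \<oplus> v" using assms by (simp add: a_minus_def a_assoc l_neg)
  then have *: "hinner H u w = hinner H (u \<ominus> v) w + hinner H v w"
    using hinner_add[of "u \<ominus> v" v w] assms by simp
  then show "hinner H (u \<ominus> v) w = hinner H u w - hinner H v w" by simp
  then show "hinner H w (u \<ominus> v) = hinner H w u - hinner H w v"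
    using hinner_cnj[of "u \<ominus> v" w] hinner_cnj[of u w] hinner_cnj[of v w] assms by simp
qed

lemma hinner_self: "v \<in> carrier H ==> hinner H v v = complex_of_real ((hnorm H v)\<^sup>2) \<and> 0 \<le> Re (hinner H v v)"
proof -
  assume v: "v \<in> carrier H"
  have im: "Im (hinner H v v) = 0" using hinner_cnj[OF v v] by (simp add: complex_eq_iff)
  have "0 \<le> Re (hinner H v v)"
  proof (cases "v = \<zero>")
    case True
    then show ?thesis using hinner_minus(1)[OF v v v] v by (simp add: a_minus_def r_neg)
  qed (use hinner_pos v in force)
  then show ?thesis using im by (simp add: hnorm_def complex_eq_iff)
qed

lemma hinner_CS:
  assumes u: "u \<in> carrier H" and v: "v \<in> carrier H"
  shows "cmod (hinner H u v) \<le> hnorm H u * hnorm H v"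
proof -
  have "(cmod (hinner H u v))\<^sup>2 \<le> (hnorm H v)\<^sup>2 * (hnorm H u)\<^sup>2"
  proof (rule quadratic_form_CS)
    fix c :: complex
    define w where "w = c \<odot>\<^bsub>H\<^esub> u"
    have w: "w \<in> carrier H" unfolding w_def using u by (intro smult_closed) (simp_all add: complex_ring_def)
    have wu: "hinner H w x = c * hinner H u x" if "x \<in> carrier H" for x using hinner_smult[OF u that] by (simp add: w_def)
    have uw: "hinner H x w = cnj c * hinner H x u" if "x \<in> carrier H" for x
      using hinner_cnj[OF w that] hinner_cnj[OF u that] wu[OF that] by simp
    have vw: "v \<oplus> w \<in> carrier H" using v w by simp
    have "hinner H x (v \<oplus> w) = hinner H x v + hinner H x w" if x: "x \<in> carrier H" for x
      using hinner_add[OF v w x] hinner_cnj[OF v x] hinner_cnj[OF w x] hinner_cnj[OF vw x] by simp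
    then have "hinner H (v \<oplus> w) (v \<oplus> w) = hinner H v v + hinner H v w + (hinner H w v + hinner H w w)"
      unfolding hinner_add[OF v w vw] using v w by simp
    moreover have "hinner H w w = complex_of_real ((cmod c)\<^sup>2 * (hnorm H u)\<^sup>2)"
    proof -
      have "hinner H w w = (c * cnj c) * hinner H u u" unfolding wu[OF w] uw[OF u] by simp
      then show ?thesis using hinner_self[OF u] complex_norm_square[of c] by simp
    qed
    moreover have "Re (hinner H v w) = Re (c * hinner H u v)"
      unfolding hinner_cnj[OF w v] wu[OF v] by simp
    ultimately have "Re (hinner H (v \<oplus> w) (v \<oplus> w)) = (hnorm H v)\<^sup>2 + 2 * Re (c * hinner H u v) + (cmod c)\<^sup>2 * (hnorm H u)\<^sup>2"
      using hinner_self[OF v] unfolding wu[OF v] by simp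
    then show "0 \<le> (hnorm H v)\<^sup>2 + 2 * Re (c * hinner H u v) + (cmod c)\<^sup>2 * (hnorm H u)\<^sup>2"
      using conjunct2[OF hinner_self[OF vw]] by (simp only:)
  qed simp_all
  then have "(cmod (hinner H u v))\<^sup>2 \<le> (hnorm H u * hnorm H v)\<^sup>2" by (simp add: power_mult_distrib mult.commute)
  then show ?thesis
    by (rule power2_le_imp_le) (use hinner_self u v in \<open>simp add: hnorm_def\<close>)
qed

end

context state_functional
begin

lemma embed_MA: assumes [simp]: "b \<in> carrier A" shows "alg_embed A b \<in> carrier MA"
proof -
  show ?thesis unfolding alg_embed_def
  proof (rule multiplierI[where C = "nrm A b"])
    fix x assume [simp]: "x \<in> carrier A"
    show "b \<otimes> x \<in> carrier A \<and> x \<otimes> b \<in> carrier A \<and> nrm A (b \<otimes> x) \<le> nrm A b * nrm A x \<and> nrm A (x \<otimes> b) \<le> nrm A b * nrm A x"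
      using nrm_mult[of b x] nrm_mult[of x b] by (simp add: mult.commute)
  qed (simp_all add: l_distr r_distr smult_l smult_r m_assoc)
qed

lemma mult_embed:
  assumes m: "m \<in> carrier MA" and [simp]: "b \<in> carrier A"
  shows "m \<otimes>\<^bsub>MA\<^esub> alg_embed A b = alg_embed A (fst m b)"
  using multiplier_l[OF m]
  by (auto simp: alg_embed_def multiplier_algebra_def case_prod_unfold compose_def fun_eq_iff)

text \<open>The vector representing \<open>\<phi>\<close> is the limit of \<open>\<pi>(a n) v\<close>, which determines the extension.\<close>

lemma extension_value:
  fixes H :: "('h, 'w) hilbert_scheme"
  assumes nd: "nondegenerate_rep A H \<pi>" and v: "v \<in> carrier H" "hnorm H v = 1"
    and \<pi>: "\<forall>b\<in>carrier A. \<phi> b = hinner H (\<pi> b v) v" and r: "star_rep MA H \<pi>'"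
    and ext: "\<forall>b\<in>carrier A. \<forall>w\<in>carrier H. \<pi>' (alg_embed A b) w = \<pi> b w"
    and m: "m \<in> carrier MA"
  shows "(\<lambda>n. \<phi> (fst m (a n))) \<longlonglongrightarrow> hinner H (\<pi>' m v) v"
proof -
  have rA: "star_rep A H \<pi>" using nd by (simp add: nondegenerate_rep_def)
  interpret hilbert H using rA by (simp add: star_rep_def)
  have op: "\<pi> b w \<in> carrier H" if "b \<in> carrier A" "w \<in> carrier H" for b w
    using rA that unfolding star_rep_def bounded_operators_def by auto
  have mo: "\<pi>' m \<in> bounded_operators H" using r m by (simp add: star_rep_def)
  then have "\<exists>C0. \<forall>w\<in>carrier H. hnorm H (\<pi>' m w) \<le> C0 * hnorm H w" by (simp add: bounded_operators_def)
  then obtain C0 where C0: "\<And>w. w \<in> carrier H ==> hnorm H (\<pi>' m w) \<le> C0 * hnorm H w" by auto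
  define C where "C = max C0 0"
  have hn: "0 \<le> hnorm H w" if "w \<in> carrier H" for w using hinner_self[OF that] by (simp add: hnorm_def)
  have C: "hnorm H (\<pi>' m w) \<le> C * hnorm H w" if "w \<in> carrier H" for w
    using C0[OF that] mult_right_mono[OF _ hn[OF that], of C0 C] by (simp add: C_def)
  \<comment> \<open>The square norm of w n is 1 - 2 Re \<phi>(a n) + sq (a n), hence at most
    \<open>er n\<close>. Applying the operator of m to v = w n + \<pi>(a n) v therefore differs from
    \<pi>(m a n) v by a vanishing error.\<close>
  define w where "w n = v \<ominus>\<^bsub>H\<^esub> \<pi> (a n) v" for n
  have w: "w n \<in> carrier H" for n using op[OF a_in v(1)] v by (simp add: w_def)
  have wn: "(hnorm H (w n))\<^sup>2 \<le> er n" for n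
  proof -
    have p: "\<pi> (a n) v \<in> carrier H" using op v by simp
    have "hinner H (\<pi> (a n) v) (\<pi> (a n) v) = \<phi> (star A (a n) \<otimes> a n)"
    proof -
      have "hinner H (\<pi> (a n) v) (\<pi> (a n) v) = cnj (hinner H (\<pi> (star A (a n)) (\<pi> (a n) v)) v)"
      proof -
        have "hinner H (\<pi> (star A (a n)) (\<pi> (a n) v)) v = hinner H (\<pi> (a n) v) (\<pi> (star A (star A (a n))) v)"
          using rA p v unfolding star_rep_def by simp
        then show ?thesis using hinner_cnj[OF p p] by simp
      qed
      also have "\<pi> (star A (a n)) (\<pi> (a n) v) = \<pi> (star A (a n) \<otimes> a n) v" using rA v unfolding star_rep_def by simp
      finally show ?thesis using \<pi> sq[of "a n"] by simp
    qed
    then have pp: "Re (hinner H (\<pi> (a n) v) (\<pi> (a n) v)) = sq (a n)" by (simp only: sq_def)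
    have pv: "hinner H (\<pi> (a n) v) v = \<phi> (a n)" using \<pi> by simp
    have "hinner H (w n) (w n) = hinner H v v - hinner H v (\<pi> (a n) v) -
        (hinner H (\<pi> (a n) v) v - hinner H (\<pi> (a n) v) (\<pi> (a n) v))"
      unfolding w_def using v p by (simp add: hinner_minus)
    also have "hinner H v (\<pi> (a n) v) = cnj (\<phi> (a n))" using hinner_cnj[OF p v(1)] pv by simp
    finally have "Re (hinner H (w n) (w n)) = 1 - 2 * Re (\<phi> (a n)) + sq (a n)"
      using hinner_self[OF v(1)] v(2) by (simp add: pp pv)
    also have "\<dots> \<le> er n" using sq_a_le[of n] by (simp add: er_def)
    finally show ?thesis using hinner_self[OF w] by simp
  qed
  have "(\<lambda>n. hinner H (\<pi>' m v) v - \<phi> (fst m (a n))) \<longlonglongrightarrow> 0"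
  proof (rule Lim_null_comparison)
    have "cmod (hinner H (\<pi>' m v) v - \<phi> (fst m (a n))) \<le> C * sqrt (er n)" for n
    proof -
      have p: "\<pi> (a n) v \<in> carrier H" using op v by simp
      have pm: "\<pi>' m x \<in> carrier H" if "x \<in> carrier H" for x using mo that by (auto simp: bounded_operators_def)
      have "\<pi>' m (\<pi> (a n) v) = \<pi>' m (\<pi>' (alg_embed A (a n)) v)" using ext v by simp
      also have "\<dots> = \<pi>' (m \<otimes>\<^bsub>MA\<^esub> alg_embed A (a n)) v" using r m v embed_MA unfolding star_rep_def by simp
      also have "\<dots> = \<pi> (fst m (a n)) v" using ext v multiplier_l(1)[OF m] by (simp add: mult_embed[OF m])
      finally have e1: "\<pi>' m (\<pi> (a n) v) = \<pi> (fst m (a n)) v" .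
      have "v = w n \<oplus>\<^bsub>H\<^esub> \<pi> (a n) v" using v p by (simp add: w_def a_minus_def a_assoc l_neg)
      then have "\<pi>' m v = \<pi>' m (w n \<oplus>\<^bsub>H\<^esub> \<pi> (a n) v)" by simp
      also have "\<dots> = \<pi>' m (w n) \<oplus>\<^bsub>H\<^esub> \<pi> (fst m (a n)) v"
        using mo w[of n] p e1 unfolding bounded_operators_def by simp
      finally have "\<pi>' m v = \<pi>' m (w n) \<oplus>\<^bsub>H\<^esub> \<pi> (fst m (a n)) v" .
      then have "hinner H (\<pi>' m v) v = hinner H (\<pi>' m (w n)) v + \<phi> (fst m (a n))"
        using hinner_add[OF pm[OF w] op[OF multiplier_l(1)[OF m a_in] v(1)] v(1)] \<pi> multiplier_l(1)[OF m] by simp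
      then have "cmod (hinner H (\<pi>' m v) v - \<phi> (fst m (a n))) \<le> hnorm H (\<pi>' m (w n))"
        using hinner_CS[OF pm[OF w] v(1), of n] v(2) by simp
      also have "\<dots> \<le> C * hnorm H (w n)" by (rule C[OF w])
      also have "\<dots> \<le> C * sqrt (er n)" using wn[of n] by (intro mult_left_mono real_le_rsqrt) (simp_all add: C_def)
      finally show ?thesis .
    qed
    then show "\<forall>\<^sub>F n in sequentially. norm (hinner H (\<pi>' m v) v - \<phi> (fst m (a n))) \<le> C * sqrt (er n)" by simp
    have "(\<lambda>n. C * sqrt (er n)) \<longlonglongrightarrow> C * sqrt 0" by (intro tendsto_intros er_lim)
    then show "(\<lambda>n. C * sqrt (er n)) \<longlonglongrightarrow> 0" by simp
  qed
  from tendsto_diff[OF tendsto_const[of "hinner H (\<pi>' m v) v"] this] show ?thesis by simp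
qed

lemma a_ecau: "ecau a"
  unfolding alg_cauchy_def
proof (intro conjI allI impI)
  fix e :: real assume e: "e > 0"
  have "e\<^sup>2 / 8 > 0" using e by simp
  from order_tendstoD(2)[OF er_lim this] obtain N where N: "\<forall>n\<ge>N. er n < e\<^sup>2 / 8"
    unfolding eventually_sequentially by (rule exE)
  have "nrm E (a m \<ominus>\<^bsub>E\<^esub> a n) < e" if "m \<ge> N" "n \<ge> N" for m n
  proof -
    have "er m < e\<^sup>2 / 8" "er n < e\<^sup>2 / 8" using N that by auto
    then have l: "2 * (er m + er n) < e\<^sup>2" using \<open>e\<^sup>2 / 8 > 0\<close> by argo
    have "sq (a m \<ominus> a n) < e\<^sup>2" by (rule le_less_trans[OF sq_a_diff l])
    then have "sqrt (sq (a m \<ominus> a n)) < sqrt (e\<^sup>2)" by (rule real_sqrt_less_mono)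
    then show ?thesis using e by simp
  qed
  then show "\<exists>N. \<forall>m\<ge>N. \<forall>n\<ge>N. nrm E (a m \<ominus>\<^bsub>E\<^esub> a n) < e" by blast
qed auto

lemma sq_a_lim: "(\<lambda>n. sq (a n)) \<longlonglongrightarrow> 1"
proof (rule tendsto_sandwich)
  show "\<forall>\<^sub>F n in sequentially. (cmod (\<phi> (a n)))\<^sup>2 \<le> sq (a n)" by (simp add: kadison)
  show "\<forall>\<^sub>F n in sequentially. sq (a n) \<le> 1" by (simp add: sq_a_le)
  have "(\<lambda>n. (cmod (\<phi> (a n)))\<^sup>2) \<longlonglongrightarrow> (cmod 1)\<^sup>2" by (intro tendsto_intros a_lim)
  then show "(\<lambda>n. (cmod (\<phi> (a n)))\<^sup>2) \<longlonglongrightarrow> 1" by simp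
qed simp

text \<open>Removes the sequence on both sides of b; this identifies the vector state of the GNS
  representation at the class of a with \<phi>.\<close>

lemma two_sided_lim:
  assumes b: "b \<in> carrier A"
  shows "(\<lambda>n. \<phi> (star A (a n) \<otimes> (b \<otimes> a n))) \<longlonglongrightarrow> \<phi> b"
proof (rule left_lim[OF _ _ right_lim[OF b]])
  show "sq (b \<otimes> a n) \<le> (nrm A b)\<^sup>2 * 1" for n
    using sq_left_mult[OF b a_in, of n] mult_left_mono[OF sq_a_le[of n], of "(nrm A b)\<^sup>2"] by simp
qed (use b in simp)

text \<open>Existence for the definite description comes from the GNS representation with the cyclic
  vector given by the sequence a, and uniqueness from \<open>extension_value\<close>. From here on
  the extended state is computed as a limit inside A.\<close>

lemma state_ext_lim:
  assumes m: "m \<in> carrier MA"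
  shows "(\<lambda>n. \<phi> (fst m (a n))) \<longlonglongrightarrow> state_ext A \<phi> m"
proof -
  define P where "P c \<longleftrightarrow> (\<exists>(H :: (nat => 'a) hilbert) \<pi> v \<pi>'.
     nondegenerate_rep A H \<pi> \<and> v \<in> carrier H \<and> hnorm H v = 1 \<and>
     (\<forall>a\<in>carrier A. \<phi> a = hinner H (\<pi> a v) v) \<and>
     star_rep MA H \<pi>' \<and>
     (\<forall>a\<in>carrier A. \<forall>w\<in>carrier H. \<pi>' (alg_embed A a) w = \<pi> a w) \<and>
     c = hinner H (\<pi>' m v) v)" for c
  have lim: "(\<lambda>n. \<phi> (fst m (a n))) \<longlonglongrightarrow> c" if "P c" for c
    using that unfolding P_def
    by (elim exE conjE) (hypsubst, rule extension_value[OF _ _ _ _ _ _ m], assumption+)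
  define v where "v = R a"
  have v: "v \<in> carrier gns" using a_ecau by (simp add: v_def)
  have "(\<lambda>n. sqrt (sq (a n))) \<longlonglongrightarrow> sqrt 1" by (intro tendsto_real_sqrt sq_a_lim)
  then have v1: "hnorm gns v = 1" using LIMSEQ_unique[OF hnorm_gns[OF a_ecau]] by (simp add: v_def)
  have rep: "\<phi> b = hinner gns (lift (\<lambda>x. b \<otimes> x) v) v" if b: "b \<in> carrier A" for b
  proof -
    have "(\<lambda>n. \<phi> (star A (a n) \<otimes> (b \<otimes> a n))) \<longlonglongrightarrow> hinner gns (lift (\<lambda>x. b \<otimes> x) v) v"
      unfolding v_def liftable_ecau(2)[OF liftable_left[OF b] a_ecau]
      by (rule inner_lim[OF liftable_ecau(1)[OF liftable_left[OF b] a_ecau] a_ecau])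
    then show ?thesis by (rule LIMSEQ_unique[OF two_sided_lim[OF b]])
  qed
  have emb: "lift (fst (alg_embed A b)) w = lift (\<lambda>x. b \<otimes> x) w" if "b \<in> carrier A" "w \<in> carrier gns" for b w
    by (rule lift_cong[OF _ that(2)]) (simp add: alg_embed_def)
  have ex: "P (hinner gns (lift (fst m) v) v)"
    unfolding P_def
    by (intro exI[of _ gns] exI[of _ "\<lambda>b. lift (\<lambda>x. b \<otimes> x)"] exI[of _ v] exI[of _ "\<lambda>m. lift (fst m)"]
        conjI ballI gns_nondegenerate v v1 rep gns_multiplier_rep emb refl)
  have "state_ext A \<phi> m = hinner gns (lift (fst m) v) v"
    unfolding state_ext_def P_def[symmetric] by (rule the_equality[of P, OF ex]) (rule LIMSEQ_unique[OF lim lim[OF ex]])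
  then show ?thesis using lim[OF ex] by simp
qed

end

section \<open>The lower bound for momenta\<close>

lemma has_vector_derivative_quotient:
  assumes "(f has_vector_derivative d) (at (x::real))"
  shows "((\<lambda>t. (f (x + t) - f x) /\<^sub>R t) \<longlongrightarrow> d) (at 0)"
proof -
  have l: "((\<lambda>t. norm (f (x + t) - f x - t *\<^sub>R d) / norm t) \<longlongrightarrow> 0) (at 0)"
    using assms unfolding has_vector_derivative_def has_derivative_at by blast
  have "((\<lambda>t. (f (x + t) - f x) /\<^sub>R t - d) \<longlongrightarrow> 0) (at 0)"
  proof (rule Lim_null_comparison[OF _ l])
    have "norm ((f (x + t) - f x) /\<^sub>R t - d) \<le> norm (f (x + t) - f x - t *\<^sub>R d) / norm t" if "t \<noteq> 0" for t
    proof -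
      have "(f (x + t) - f x) /\<^sub>R t - d = (f (x + t) - f x - t *\<^sub>R d) /\<^sub>R t" using that by (simp add: scaleR_diff_right)
      then show ?thesis by (simp add: divide_inverse mult.commute)
    qed
    then show "\<forall>\<^sub>F t in at 0. norm ((f (x + t) - f x) /\<^sub>R t - d) \<le> norm (f (x + t) - f x - t *\<^sub>R d) / norm t"
      by (simp add: eventually_at_filter)
  qed
  then show ?thesis by (simp add: LIM_zero_iff)
qed

subsection \<open>Boundary values of the scalar function\<close>

text \<open>Here F is the state on the open half plane and g the state on the boundary group. The
  derivative of F is matched with that of g at 0 by the inequality in \<open>ev\<close>: its first
  factor is of order t^2 since g is twice differentiable with maximal modulus at 0, and its second
  factor tends to 0 with s.\<close>

lemma derivative_boundary_bound:
  fixes F :: "complex => complex" and g g' :: "real => complex"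
  assumes F: "F holomorphic_on {z. Im z > 0}"
    and g1: "\<forall>\<^sub>F r in nhds 0. (g has_vector_derivative g' r) (at r)"
    and g2: "(g' has_vector_derivative g'') (at 0)" and g0: "g 0 = 1"
    and ev: "\<forall>\<^sub>F t in nhds 0. cmod (g t) \<le> 1 \<and> (\<forall>s>0. (cmod (F (Complex t s) - F (Complex 0 s) - g t + 1))\<^sup>2
      \<le> (2 - 2 * Re (g t)) * (Re (F (Complex 0 (2 * s))) - 2 * Re (F (Complex 0 s)) + 1))"
    and D0: "\<And>s. s > 0 ==> 0 \<le> Re (F (Complex 0 (2 * s))) - 2 * Re (F (Complex 0 s)) + 1"
    and lim: "((\<lambda>s. F (Complex 0 s)) \<longlongrightarrow> 1) (at_right 0)"
    and M: "M \<ge> 1" "\<And>n. cmod (F (Complex 0 (1 / 2 ^ n))) \<le> M powr (1 / 2 ^ n)"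
  shows "- ln M \<le> Im (g' 0)"
proof -
  define c where "c = g' 0"
  define D where "D s = Re (F (Complex 0 (2 * s))) - 2 * Re (F (Complex 0 s)) + 1" for s
  obtain \<delta> where \<delta>: "\<delta> > 0" and der: "\<And>r. \<bar>r\<bar> < \<delta> ==> (g has_vector_derivative g' r) (at r)"
    and le1: "\<And>r. \<bar>r\<bar> < \<delta> ==> cmod (g r) \<le> 1"
    and I: "\<And>t s. \<bar>t\<bar> < \<delta> ==> s > 0 ==> (cmod (F (Complex t s) - F (Complex 0 s) - g t + 1))\<^sup>2 \<le> (2 - 2 * Re (g t)) * D s"
    using eventually_conj[OF g1 ev] unfolding eventually_nhds_metric dist_real_def D_def by auto
  have Re_der: "((\<lambda>r. Re (g r)) has_real_derivative Re (g' r)) (at r)" if "\<bar>r\<bar> < \<delta>" for r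
    unfolding has_real_derivative_iff_has_vector_derivative
    by (rule bounded_linear.has_vector_derivative[OF bounded_linear_Re der[OF that]])
  \<comment> \<open>Re g has a local maximum at 0, since |g| \<le> 1 = g 0.\<close>
  have Rec: "Re c = 0"
    unfolding c_def
  proof (rule DERIV_local_max[OF Re_der[of 0] \<delta>])
    show "\<forall>y. \<bar>0 - y\<bar> < \<delta> \<longrightarrow> Re (g y) \<le> Re (g 0)"
      using le1 complex_Re_le_cmod g0 by (auto intro: order_trans)
  qed (use \<delta> in simp)
  have "((\<lambda>r. Re (g' r)) has_real_derivative Re g'') (at 0)"
    unfolding has_real_derivative_iff_has_vector_derivative
    by (rule bounded_linear.has_vector_derivative[OF bounded_linear_Re g2])
  then have "((\<lambda>y. Re (g' y) / y) \<longlongrightarrow> Re g'') (at 0)" using Rec by (simp add: has_field_derivative_iff c_def)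
  then have "((\<lambda>y. \<bar>Re (g' y) / y\<bar>) \<longlongrightarrow> \<bar>Re g''\<bar>) (at 0)" by (rule tendsto_rabs)
  then have "\<forall>\<^sub>F y in at 0. \<bar>Re (g' y) / y\<bar> < \<bar>Re g''\<bar> + 1" by (rule order_tendstoD(2)) simp
  then obtain \<delta>2 where \<delta>2: "\<delta>2 > 0" and q: "\<And>y. y \<noteq> 0 ==> \<bar>y\<bar> < \<delta>2 ==> \<bar>Re (g' y) / y\<bar> < \<bar>Re g''\<bar> + 1"
    unfolding eventually_at dist_real_def by auto
  define K where "K = \<bar>Re g''\<bar> + 1"
  \<comment> \<open>By the mean value theorem Re (g t) - 1 is t Re (g' z) with 0 < z < t, and |Re
    (g' z)| is at most K z because Re g' vanishes at 0 and is differentiable there.\<close>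
  have quad: "2 - 2 * Re (g t) \<le> 2 * K * t\<^sup>2" if t: "0 < t" "t < min \<delta> \<delta>2" for t
  proof -
    have "\<exists>z. 0 < z \<and> z < t \<and> Re (g t) - Re (g 0) = (t - 0) * Re (g' z)"
      using t by (intro MVT2 Re_der) auto
    then obtain z where z: "0 < z" "z < t" "Re (g t) - 1 = t * Re (g' z)" using g0 by auto
    have "\<bar>Re (g' z)\<bar> < K * z" using q[of z] z t by (simp add: K_def divide_less_eq)
    then have "- Re (g' z) \<le> K * t" using z mult_left_mono[of z t K] by (simp add: K_def)
    then have "t * (- Re (g' z)) \<le> t * (K * t)" using t by (intro mult_left_mono) auto
    then show ?thesis using z(3) by (simp add: power2_eq_square algebra_simps)
  qed
  have small: "\<forall>\<^sub>F t in at_right 0. 0 < t \<and> t < min \<delta> \<delta>2"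
    unfolding eventually_at_right_field using \<delta> \<delta>2 by (intro exI[of _ "min \<delta> \<delta>2"]) auto
  have op: "open {z. Im z > 0}" by (rule open_halfspace_Im_gt)
  have Fd: "(F has_field_derivative deriv F (Complex 0 s)) (at (Complex 0 s))" if "s > 0" for s
    using F op that by (intro holomorphic_derivI) auto
  \<comment> \<open>After division by t^2, the left side of the inequality tends to the squared
    modulus of the horizontal derivative of F minus g at t = 0, while the right side keeps only D
    s.\<close>
  have est: "(cmod (deriv F (Complex 0 s) - c))\<^sup>2 \<le> 2 * K * D s" if s: "s > 0" for s
  proof -
    have cv: "((\<lambda>t. Complex t s) has_vector_derivative 1) (at 0)"
    proof -
      have "((\<lambda>t. complex_of_real t + \<i> * complex_of_real s) has_vector_derivative 1 + 0) (at 0)"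
        using has_vector_derivative_of_real[of "\<lambda>t. t" 1 "at 0", where ?'a = complex]
        by (intro has_vector_derivative_add has_vector_derivative_const) simp_all
      then show ?thesis by (simp add: Complex_eq)
    qed
    have "((F \<circ> (\<lambda>t. Complex t s)) has_vector_derivative 1 * deriv F (Complex 0 s)) (at 0)"
      by (rule field_vector_diff_chain_at[OF cv Fd[OF s]])
    then have "((\<lambda>t. F (Complex t s)) has_vector_derivative deriv F (Complex 0 s)) (at 0)" by (simp add: o_def)
    then have "((\<lambda>t. F (Complex t s) - g t) has_vector_derivative deriv F (Complex 0 s) - c) (at 0)"
      unfolding c_def by (intro has_vector_derivative_diff der) (use \<delta> in simp_all)
    then have "((\<lambda>t. ((F (Complex t s) - g t) - (F (Complex 0 s) - g 0)) /\<^sub>R t) \<longlongrightarrow> deriv F (Complex 0 s) - c) (at 0)"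
      using has_vector_derivative_quotient[of "\<lambda>t. F (Complex t s) - g t" _ 0] by simp
    then have "((\<lambda>t. ((F (Complex t s) - g t) - (F (Complex 0 s) - g 0)) /\<^sub>R t) \<longlongrightarrow> deriv F (Complex 0 s) - c) (at_right 0)"
      by (rule filterlim_mono) (auto simp: at_le)
    then have "((\<lambda>t. (cmod (((F (Complex t s) - g t) - (F (Complex 0 s) - g 0)) /\<^sub>R t))\<^sup>2) \<longlongrightarrow> (cmod (deriv F (Complex 0 s) - c))\<^sup>2) (at_right 0)"
      by (intro tendsto_intros)
    then show ?thesis
    proof (rule tendsto_upperbound)
      show "\<forall>\<^sub>F t in at_right 0. (cmod (((F (Complex t s) - g t) - (F (Complex 0 s) - g 0)) /\<^sub>R t))\<^sup>2 \<le> 2 * K * D s"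
      proof (rule eventually_mono[OF small])
        fix t assume t: "0 < t \<and> t < min \<delta> \<delta>2"
        have "(cmod (F (Complex t s) - F (Complex 0 s) - g t + 1))\<^sup>2 \<le> (2 - 2 * Re (g t)) * D s" by (rule I) (use t s in auto)
        also have "\<dots> \<le> (2 * K * t\<^sup>2) * D s" using quad[of t] t D0[OF s] by (intro mult_right_mono) (auto simp: D_def)
        finally have "(cmod (F (Complex t s) - F (Complex 0 s) - g t + 1))\<^sup>2 / t\<^sup>2 \<le> 2 * K * D s" using t by (simp add: divide_le_eq mult_ac)
        moreover have e: "(F (Complex t s) - g t) - (F (Complex 0 s) - g 0) = F (Complex t s) - F (Complex 0 s) - g t + 1" by (simp add: g0)
        ultimately show "(cmod (((F (Complex t s) - g t) - (F (Complex 0 s) - g 0)) /\<^sub>R t))\<^sup>2 \<le> 2 * K * D s"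
          using t unfolding e by (simp add: power_mult_distrib power_divide divide_inverse power_inverse mult.commute)
      qed
    qed simp
  qed
  have pos: "\<forall>\<^sub>F s in at_right (0::real). s > 0" by (simp add: eventually_at_right_less)
  have lim2: "((\<lambda>s. F (Complex 0 (2 * s))) \<longlongrightarrow> 1) (at_right 0)"
  proof (rule filterlim_compose[OF lim])
    have "((\<lambda>s::real. 2 * s) \<longlongrightarrow> 2 * 0) (at_right 0)" by (intro tendsto_intros)
    then show "LIM s at_right 0. 2 * s :> at_right (0::real)"
      unfolding filterlim_at by (auto intro: eventually_mono[OF pos])
  qed
  have "((\<lambda>s. sqrt (2 * K * D s)) \<longlongrightarrow> sqrt (2 * K * (Re 1 - 2 * Re 1 + 1))) (at_right 0)"
    unfolding D_def by (intro tendsto_intros lim lim2)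
  then have Dl: "((\<lambda>s. sqrt (2 * K * D s)) \<longlongrightarrow> 0) (at_right 0)" by simp
  have "((\<lambda>s. deriv F (Complex 0 s) - c) \<longlongrightarrow> 0) (at_right 0)"
    by (rule Lim_null_comparison[OF _ Dl], rule eventually_mono[OF pos]) (use est in \<open>simp add: real_le_rsqrt\<close>)
  then have F'lim: "((\<lambda>s. deriv F (Complex 0 s)) \<longlongrightarrow> c) (at_right 0)" by (simp add: LIM_zero_iff)
  define f where "f s = Re (F (Complex 0 s))" for s
  have f': "(f has_real_derivative - Im (deriv F (Complex 0 s))) (at s)" if s: "s > 0" for s
  proof -
    have "((\<lambda>s. \<i> * complex_of_real s) has_vector_derivative \<i> * complex_of_real 1) (at s)"
      by (intro has_vector_derivative_mult_right has_vector_derivative_of_real) simp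
    then have cv: "((\<lambda>s. Complex 0 s) has_vector_derivative \<i>) (at s)" by (simp add: Complex_eq)
    have "((F \<circ> (\<lambda>s. Complex 0 s)) has_vector_derivative \<i> * deriv F (Complex 0 s)) (at s)"
      by (rule field_vector_diff_chain_at[OF cv Fd[OF s]])
    from bounded_linear.has_vector_derivative[OF bounded_linear_Re this] show ?thesis
      unfolding has_real_derivative_iff_has_vector_derivative by (simp add: f_def[abs_def] o_def)
  qed
  \<comment> \<open>Along the imaginary axis Re F has derivative -Im F', whose limit at 0 is known.
    The rule of l'Hospital converts this into the limit of the difference quotient formed with the
    boundary value 1.\<close>
  have quot: "((\<lambda>s. (f s - 1) / s) \<longlongrightarrow> - Im c) (at_right 0)"
  proof (rule lhopital_right_0)
    have "((\<lambda>s. f s - 1) \<longlongrightarrow> Re 1 - 1) (at_right 0)" unfolding f_def by (intro tendsto_intros lim)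
    then show "((\<lambda>s. f s - 1) \<longlongrightarrow> 0) (at_right 0)" by simp
    show "\<forall>\<^sub>F s in at_right 0. ((\<lambda>s. f s - 1) has_real_derivative - Im (deriv F (Complex 0 s))) (at s)"
      by (rule eventually_mono[OF pos]) (auto intro!: derivative_eq_intros f')
    show "((\<lambda>s. - Im (deriv F (Complex 0 s)) / 1) \<longlongrightarrow> - Im c) (at_right 0)"
      using tendsto_minus[OF tendsto_Im[OF F'lim]] by simp
  qed (auto intro: eventually_mono[OF pos])
  have seq: "LIM n sequentially. (1 / 2 ^ n :: real) :> at_right 0"
  proof -
    have "(\<lambda>n. 1 / 2 ^ n :: real) \<longlonglongrightarrow> 0" by real_asymp
    then show ?thesis by (simp add: filterlim_at)
  qed
  have "((\<lambda>s. M powr s) has_real_derivative ln M) (at 0)"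
    using has_real_derivative_const_powr[of "\<lambda>x. x" "\<lambda>_. 1" M 0] M by simp
  then have "((\<lambda>s. (M powr s - 1) / s) \<longlongrightarrow> ln M) (at 0)" using M by (simp add: has_field_derivative_iff)
  then have pq: "((\<lambda>s. (M powr s - 1) / s) \<longlongrightarrow> ln M) (at_right 0)" by (rule filterlim_mono) (auto simp: at_le)
  have "- Im c \<le> ln M"
  \<comment> \<open>The bound by powers of M is available at dyadic parameters only, which suffices
    for comparing two limits already known to exist.\<close>
  proof (rule tendsto_le[OF _ filterlim_compose[OF pq seq] filterlim_compose[OF quot seq]])
    have "(f (1 / 2 ^ n) - 1) / (1 / 2 ^ n) \<le> (M powr (1 / 2 ^ n) - 1) / (1 / 2 ^ n)" for n
      using M(2)[of n] complex_Re_le_cmod[of "F (Complex 0 (1 / 2 ^ n))"] by (intro divide_right_mono) (auto simp: f_def)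
    then show "\<forall>\<^sub>F n in sequentially. (f (1 / 2 ^ n) - 1) / (1 / 2 ^ n) \<le> (M powr (1 / 2 ^ n) - 1) / (1 / 2 ^ n)" by simp
  qed simp
  then show ?thesis by (simp add: c_def)
qed

subsection \<open>Unitary multipliers in states\<close>

context state_functional
begin

lemma multiplier_lim:
  assumes m: "m \<in> carrier MA"
  shows "(\<lambda>n. \<phi> (star A (a n) \<otimes> fst m (a n))) \<longlonglongrightarrow> state_ext A \<phi> m"
proof -
  obtain C where C: "C > 0" "\<And>x. x \<in> carrier A ==> sq (fst m x) \<le> C\<^sup>2 * sq x" using sq_multiplier[OF m] by metis
  show ?thesis
  proof (rule left_lim[OF _ _ state_ext_lim[OF m]])
    show "sq (fst m (a n)) \<le> C\<^sup>2 * 1" for n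
      using C(2)[OF a_in, of n] mult_left_mono[OF sq_a_le[of n], of "C\<^sup>2"] by simp
  qed (use multiplier_l(1)[OF m] in simp)
qed

lemma adj_swap:
  assumes m: "m \<in> carrier MA" and [simp]: "x \<in> carrier A" "y \<in> carrier A"
  shows "star A (adj m x) \<otimes> y = star A x \<otimes> fst m y"
proof -
  have [simp]: "adj m x \<in> carrier A" "fst m y \<in> carrier A" using adj_in[OF m] multiplier_l(1)[OF m] by simp_all
  have "star A (star A (fst m y) \<otimes> x) = star A (star A y \<otimes> adj m x)" using adj_eq[OF m, of y x] by simp
  then show ?thesis by (simp add: star_mult)
qed

context
  fixes U
  assumes U: "U \<in> carrier (alg_unitary_group A)"
begin

lemma U_in: "U \<in> carrier MA" using U by (simp add: alg_unitary_group_def Let_def)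

lemma U_adj: "x \<in> carrier A ==> fst U (adj U x) = x" "x \<in> carrier A ==> adj U (fst U x) = x"
proof -
  have c: "fst (m \<otimes>\<^bsub>MA\<^esub> m') x = fst m (fst m' x)" if "x \<in> carrier A" for m m' x
    using that by (simp add: multiplier_algebra_def case_prod_unfold compose_def)
  have o: "fst \<one>\<^bsub>MA\<^esub> x = x" if "x \<in> carrier A" for x using that by (simp add: multiplier_algebra_def)
  have u: "U \<otimes>\<^bsub>MA\<^esub> star MA U = \<one>\<^bsub>MA\<^esub>" "star MA U \<otimes>\<^bsub>MA\<^esub> U = \<one>\<^bsub>MA\<^esub>" using U by (simp_all add: alg_unitary_group_def Let_def)
  show "fst U (adj U x) = x" if x: "x \<in> carrier A"
    using c[OF x, of U "star MA U"] o[OF x] fst_star_MA[OF U_in x] unfolding u by simp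
  show "adj U (fst U x) = x" if x: "x \<in> carrier A"
    using c[OF x, of "star MA U" U] o[OF x] fst_star_MA[OF U_in multiplier_l(1)[OF U_in x]] unfolding u by simp
qed

lemma sq_U: assumes x: "x \<in> carrier A" shows "sq (fst U x) = sq x" "sq (adj U x) = sq x"
  using adj_eq[OF U_in x multiplier_l(1)[OF U_in x]] adj_swap[OF U_in x adj_in[OF U_in x]] U_adj[OF x] by (simp_all add: sq_def)

lemma state_ext_le: "cmod (state_ext A \<phi> U) \<le> 1"
proof (rule tendsto_upperbound[OF tendsto_norm[OF state_ext_lim[OF U_in]]])
  have "(cmod (\<phi> (fst U (a n))))\<^sup>2 \<le> 1" for n
    using kadison[OF multiplier_l(1)[OF U_in a_in], of n] sq_U(1)[OF a_in, of n] sq_a_le[of n] by simp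
  then show "\<forall>\<^sub>F n in sequentially. cmod (\<phi> (fst U (a n))) \<le> 1" by (simp add: abs_square_le_1)
qed simp

lemma sq_minus: assumes [simp]: "x \<in> carrier A" "y \<in> carrier A"
  shows "sq (x \<ominus> y) = sq x - 2 * Re (\<phi> (star A x \<otimes> y)) + sq y"
  using sq_expand[of x y "-1"] by (simp add: minus_sm)

text \<open>The Cauchy-Schwarz inequality for adj U - 1 and T - 1 under the extended state. Both are
  applied to a n in the place of 1, giving X n and Y n, and each term converges by
  \<open>multiplier_lim\<close>, \<open>two_sided_lim\<close> or \<open>sq_a_lim\<close>.\<close>

lemma mixed_estimate:
  assumes T [simp]: "T \<in> carrier A" "star A T = T"
  shows "(cmod (\<phi> (fst U T) - \<phi> T - state_ext A \<phi> U + 1))\<^sup>2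
      \<le> (2 - 2 * Re (state_ext A \<phi> U)) * (sq T - 2 * Re (\<phi> T) + 1)"
    "0 \<le> sq T - 2 * Re (\<phi> T) + 1"
proof -
  have UT [simp]: "fst U x \<in> carrier A" "adj U x \<in> carrier A" if "x \<in> carrier A" for x
    using that adj_in[OF U_in] multiplier_l(1)[OF U_in] by simp_all
  define X Y where "X n = adj U (a n) \<ominus> a n" and "Y n = (T \<otimes> a n) \<ominus> a n" for n
  have XY [simp]: "X n \<in> carrier A" "Y n \<in> carrier A" for n by (simp_all add: X_def Y_def)
  have a1: "(\<lambda>n. \<phi> (star A (a n) \<otimes> a n)) \<longlonglongrightarrow> 1"
    using tendsto_of_real[OF sq_a_lim, where ?'a = complex] by (simp add: sq)
  have "sq (X n) = sq (a n) - 2 * Re (\<phi> (star A (a n) \<otimes> fst U (a n))) + sq (a n)" for n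
    unfolding X_def by (simp add: sq_minus sq_U adj_swap[OF U_in])
  then have "(\<lambda>n. sq (X n)) \<longlonglongrightarrow> 1 - 2 * Re (state_ext A \<phi> U) + 1"
    by (simp only:) (intro tendsto_intros multiplier_lim U_in sq_a_lim)
  then have X: "(\<lambda>n. sq (X n)) \<longlonglongrightarrow> 2 - 2 * Re (state_ext A \<phi> U)" by simp
  have "sq (T \<otimes> a n) = Re (\<phi> (star A (a n) \<otimes> ((T \<otimes> T) \<otimes> a n)))" for n
    by (simp add: sq_def star_mult m_assoc)
  moreover have "star A (T \<otimes> a n) \<otimes> a n = star A (a n) \<otimes> (T \<otimes> a n)" for n by (simp add: star_mult m_assoc)
  ultimately have "sq (Y n) = Re (\<phi> (star A (a n) \<otimes> ((T \<otimes> T) \<otimes> a n))) - 2 * Re (\<phi> (star A (a n) \<otimes> (T \<otimes> a n))) + sq (a n)" for n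
    unfolding Y_def by (simp add: sq_minus)
  then have "(\<lambda>n. sq (Y n)) \<longlonglongrightarrow> Re (\<phi> (T \<otimes> T)) - 2 * Re (\<phi> T) + 1"
    by (simp only:) (intro tendsto_intros two_sided_lim sq_a_lim; simp)
  then have Y: "(\<lambda>n. sq (Y n)) \<longlonglongrightarrow> sq T - 2 * Re (\<phi> T) + 1" by (simp add: sq_def)
  show "0 \<le> sq T - 2 * Re (\<phi> T) + 1" by (rule tendsto_lowerbound[OF Y]) (simp_all add: sq_nonneg)
  have "\<phi> (star A (X n) \<otimes> Y n) = \<phi> (star A (a n) \<otimes> (fst U T \<otimes> a n)) - \<phi> (star A (a n) \<otimes> (T \<otimes> a n))
      - \<phi> (star A (a n) \<otimes> fst U (a n)) + \<phi> (star A (a n) \<otimes> a n)" for n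
  proof -
    have "star A (X n) = star A (adj U (a n)) \<ominus> star A (a n)" unfolding X_def by (simp add: minus_sm star_add star_smult)
    then have "star A (X n) \<otimes> Y n = star A (adj U (a n)) \<otimes> Y n \<ominus> star A (a n) \<otimes> Y n" by (simp add: minus_sm l_distr smult_l)
    also have "star A (adj U (a n)) \<otimes> Y n = star A (a n) \<otimes> (fst U T \<otimes> a n) \<ominus> star A (a n) \<otimes> fst U (a n)"
    proof -
      have "star A (adj U (a n)) \<otimes> Y n = star A (adj U (a n)) \<otimes> (T \<otimes> a n) \<ominus> star A (adj U (a n)) \<otimes> a n"
        unfolding Y_def by (simp add: minus_sm r_distr smult_r)
      then show ?thesis using multiplier_l(6)[OF U_in, of T "a n"] by (simp add: adj_swap[OF U_in])
    qed
    also have "star A (a n) \<otimes> Y n = star A (a n) \<otimes> (T \<otimes> a n) \<ominus> star A (a n) \<otimes> a n"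
      unfolding Y_def by (simp add: minus_sm r_distr smult_r)
    finally show ?thesis by (simp add: \<phi>_lin)
  qed
  then have "(\<lambda>n. \<phi> (star A (X n) \<otimes> Y n)) \<longlonglongrightarrow> \<phi> (fst U T) - \<phi> T - state_ext A \<phi> U + 1"
    by (simp only:) (intro tendsto_intros two_sided_lim multiplier_lim U_in a1; simp)
  from tendsto_le[OF _ tendsto_mult[OF X Y] tendsto_power[OF tendsto_norm[OF this], of 2]]
  show "(cmod (\<phi> (fst U T) - \<phi> T - state_ext A \<phi> U + 1))\<^sup>2
      \<le> (2 - 2 * Re (state_ext A \<phi> U)) * (sq T - 2 * Re (\<phi> T) + 1)"
    using Cauchy_Schwarz[OF XY] by simp
qed

end

end

subsection \<open>Holomorphic extensions of one-parameter groups\<close>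

locale upper_curve = bounded_semigroup +
  fixes \<gamma> :: "real => 'a mpair" and h :: "complex => 'a mpair"
  assumes approx_id: "has_approximate_identity S" and upper: "upper_extension S \<gamma> h" and \<gamma>0: "\<gamma> 0 = (id, id)"
begin

abbreviation "\<A> \<equiv> host_cstar S \<alpha>"

definition \<tau> :: "complex => 'a" where "\<tau> z = sg_elem S (h z)"

lemma sg_simps: "sg_mult S (sg_mult S a b) c = sg_mult S a (sg_mult S b c)" "sg_star S (sg_star S a) = a"
  "sg_star S (sg_mult S a b) = sg_mult S (sg_star S b) (sg_star S a)"
  using S by (simp_all add: complex_inv_semigroup_def)

text \<open>Equal left multiplications agree along the approximate identity, where they tend to a
  and b. This makes \<open>sg_elem\<close> the inverse of \<open>sg_embed\<close>.\<close>

lemma sg_embed_inj: assumes "sg_embed S a = sg_embed S b" shows "a = b"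
proof -
  obtain F where F: "F \<noteq> bot" "\<And>s. ((\<lambda>u. sg_mult S s u) \<longlongrightarrow> s) F" using approx_id unfolding has_approximate_identity_def by auto
  have "sg_mult S a = sg_mult S b" using assms by (simp add: sg_embed_def)
  then show ?thesis using tendsto_unique[OF F(1) F(2)[of a]] F(2)[of b] by simp
qed

lemma sg_elem_embed: "sg_elem S (sg_embed S a) = a"
  unfolding sg_elem_def by (rule the_equality) (auto intro: sg_embed_inj)

lemma h_\<tau>: assumes "Im z > 0" shows "h z = sg_embed S (\<tau> z)"
proof -
  obtain a where "h z = sg_embed S a" using upper assms unfolding upper_extension_def by blast
  then show ?thesis by (simp add: \<tau>_def sg_elem_embed)
qed

lemma h_props: "h (complex_of_real t) = \<gamma> t"
  "Im z \<ge> 0 ==> Im w \<ge> 0 ==> h (z + w) = mpair_mult (h z) (h w)"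
  "Im z \<ge> 0 ==> h (- cnj z) = mpair_star S (h z)"
  "Im z \<ge> 0 ==> h z \<in> sg_multipliers S"
  "continuous_on ({z. Im z \<ge> 0} \<times> UNIV) (\<lambda>(z, s). fst (h z) s)"
  "mfd_holo {z. Im z > 0} id_charts (sg_charts S) \<tau>"
  using upper by (simp_all add: upper_extension_def \<tau>_def[abs_def])

lemma \<tau>_mult: assumes "Im z > 0" "Im w > 0" shows "sg_mult S (\<tau> z) (\<tau> w) = \<tau> (z + w)"
proof (rule sg_embed_inj)
  have "sg_embed S (sg_mult S (\<tau> z) (\<tau> w)) = mpair_mult (sg_embed S (\<tau> z)) (sg_embed S (\<tau> w))"
    by (simp add: sg_embed_def mpair_mult_def fun_eq_iff sg_simps)
  then show "sg_embed S (sg_mult S (\<tau> z) (\<tau> w)) = sg_embed S (\<tau> (z + w))"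
    using assms h_props(2)[of z w] h_\<tau>[of z] h_\<tau>[of w] h_\<tau>[of "z + w"] by simp
qed

lemma \<tau>_star: assumes "Im z > 0" shows "sg_star S (\<tau> z) = \<tau> (- cnj z)"
proof (rule sg_embed_inj)
  have "sg_embed S (sg_star S (\<tau> z)) = mpair_star S (sg_embed S (\<tau> z))"
    by (simp add: sg_embed_def mpair_star_def fun_eq_iff sg_simps)
  then show "sg_embed S (sg_star S (\<tau> z)) = sg_embed S (\<tau> (- cnj z))"
    using assms h_props(3)[of z] h_\<tau>[of z] h_\<tau>[of "- cnj z"] by simp
qed

lemma \<tau>_act: assumes "Im z > 0" shows "fst (\<gamma> t) (\<tau> z) = \<tau> (complex_of_real t + z)"
proof (rule sg_embed_inj)
  have m: "\<gamma> t \<in> sg_multipliers S" using h_props(4)[of "complex_of_real t"] h_props(1) by simp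
  have "sg_embed S (fst (\<gamma> t) (\<tau> z)) = mpair_mult (\<gamma> t) (sg_embed S (\<tau> z))"
    using m by (auto simp: sg_embed_def mpair_mult_def fun_eq_iff sg_multipliers_def)
  then show "sg_embed S (fst (\<gamma> t) (\<tau> z)) = sg_embed S (\<tau> (complex_of_real t + z))"
    using assms h_props(2)[of "complex_of_real t" z] h_props(1)[of t] h_\<tau>[of z] h_\<tau>[of "complex_of_real t + z"] by simp
qed

text \<open>Continuity of the action on the closed half plane at z = 0, where the multiplier is the
  identity.\<close>

lemma \<tau>_mult_lim: "((\<lambda>s. sg_mult S (\<tau> (Complex 0 s)) u) \<longlongrightarrow> u) (at_right 0)"
proof -
  have c: "continuous_on {0..} (\<lambda>s. (case (Complex 0 s, u) of (z, s) => fst (h z) s))"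
    by (rule continuous_on_compose2[OF h_props(5)]) (auto simp: Complex_eq intro!: continuous_intros)
  then have "((\<lambda>s. fst (h (Complex 0 s)) u) \<longlongrightarrow> fst (h (Complex 0 0)) u) (at 0 within {0..})"
    by (simp add: continuous_on_def)
  then have "((\<lambda>s. fst (h (Complex 0 s)) u) \<longlongrightarrow> u) (at_right 0)"
    using h_props(1)[of 0] \<gamma>0 by (simp add: Complex_eq) (erule filterlim_mono; auto intro!: at_le)
  then show ?thesis
  proof (rule Lim_transform_eventually)
    have "fst (h (Complex 0 s)) u = sg_mult S (\<tau> (Complex 0 s)) u" if "s > 0" for s
      using h_\<tau>[of "Complex 0 s"] that by (simp add: sg_embed_def)
    then show "\<forall>\<^sub>F s in at_right 0. fst (h (Complex 0 s)) u = sg_mult S (\<tau> (Complex 0 s)) u"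
      by (auto intro: eventually_mono[OF eventually_at_right_less[of 0]])
  qed
qed

text \<open>The image of the positive imaginary axis, a semigroup of self-adjoint elements that
  plays the role of an approximate unit as s tends to 0.\<close>

definition T :: "real => _" where "T s = \<eta>\<alpha> (\<tau> (Complex 0 s))"

interpretation A: pre_cstar \<A> by (rule host_pre_cstar)

lemma T_in [simp]: "T s \<in> carrier \<A>" by (simp add: T_def)

lemma T_mult: assumes "s > 0" shows "T s \<otimes>\<^bsub>\<A>\<^esub> T s = T (2 * s)" "star \<A> (T s) = T s"
  using assms \<tau>_mult[of "Complex 0 s" "Complex 0 s"] \<tau>_star[of "Complex 0 s"]
  by (simp_all add: T_def eta_mult[symmetric] eta_star[symmetric] Complex_eq algebra_simps)

lemma T_nrm: assumes "s > 0" shows "(nrm \<A> (T s))\<^sup>2 = nrm \<A> (T (2 * s))"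
  using A.nrm_star_mult[OF T_in, of s] T_mult[OF assms] by simp

text \<open>Compactness of [1/2, 1] gives a bound there, and it descends by halving s because the
  square of the norm of T s is the norm of T (2s). The bound is taken at least 1 so that square
  roots do not exceed it.\<close>

lemma T_bounded: "\<exists>B\<ge>1. \<forall>s. 0 < s \<and> s \<le> 1 \<longrightarrow> nrm \<A> (T s) \<le> B"
proof -
  have \<tau>c: "continuous_on {z. Im z > 0} \<tau>" using h_props(6) by (simp add: mfd_map_def)
  have "continuous_on {1/2..1} (\<lambda>s. \<tau> (Complex 0 s))"
    by (rule continuous_on_compose2[OF \<tau>c]) (auto simp: Complex_eq intro!: continuous_intros)
  have "continuous_on {1/2..1} (\<lambda>s. nrm \<A> (T s))"
    unfolding continuous_on_def
  proof
    fix r :: real assume r: "r \<in> {1/2..1}"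
    have "((\<lambda>s. \<tau> (Complex 0 s)) \<longlongrightarrow> \<tau> (Complex 0 r)) (at r within {1/2..1})"
      using \<open>continuous_on {1/2..1} (\<lambda>s. \<tau> (Complex 0 s))\<close> r unfolding continuous_on_def by blast
    from eta_continuous[OF this] have l: "((\<lambda>s. nrm \<A> (T s \<ominus>\<^bsub>\<A>\<^esub> T r)) \<longlongrightarrow> 0) (at r within {1/2..1})" by (simp add: T_def)
    have "((\<lambda>s. nrm \<A> (T s) - nrm \<A> (T r)) \<longlongrightarrow> 0) (at r within {1/2..1})"
    proof (rule Lim_null_comparison[OF always_eventually l], rule allI)
      show "norm (nrm \<A> (T s) - nrm \<A> (T r)) \<le> nrm \<A> (T s \<ominus>\<^bsub>\<A>\<^esub> T r)" for s
        using A.nrm_minus_triangle[of "T s" "T r" "\<zero>\<^bsub>\<A>\<^esub>"] A.nrm_minus_triangle[of "T r" "T s" "\<zero>\<^bsub>\<A>\<^esub>"] A.nrm_minus_commute[of "T r" "T s"]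
        by (simp add: A.minus_sm)
    qed
    then show "((\<lambda>s. nrm \<A> (T s)) \<longlongrightarrow> nrm \<A> (T r)) (at r within {1/2..1})" by (simp add: LIM_zero_iff)
  qed
  then have "bounded ((\<lambda>s. nrm \<A> (T s)) ` {1/2..1})" by (intro compact_imp_bounded compact_continuous_image) auto
  then obtain B0 where "\<forall>s\<in>{1/2..1}. \<bar>nrm \<A> (T s)\<bar> \<le> B0" unfolding bounded_iff by auto
  then have B0: "\<And>s. s \<in> {1/2..1} ==> \<bar>nrm \<A> (T s)\<bar> \<le> B0" by (rule bspec)
  define B where "B = max 1 B0"
  have "\<forall>s. 1 / 2 ^ n \<le> s \<and> s \<le> 1 \<longrightarrow> nrm \<A> (T s) \<le> B" for n
  proof (induction n)
    case 0
    show ?case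
    proof (intro allI impI)
      fix s :: real assume "1 / 2 ^ 0 \<le> s \<and> s \<le> 1"
      then show "nrm \<A> (T s) \<le> B" using B0[of s] by (auto simp: B_def)
    qed
  next
    case (Suc n)
    show ?case
    proof (intro allI impI)
      fix s :: real assume s: "1 / 2 ^ Suc n \<le> s \<and> s \<le> 1"
      have s0: "s > 0" by (rule less_le_trans[of _ "1 / 2 ^ Suc n"]) (use s in simp_all)
      show "nrm \<A> (T s) \<le> B"
      proof (cases "s \<ge> 1/2")
        case True
        then show ?thesis using B0[of s] s by (auto simp: B_def)
      next
        case False
        have "1 / 2 ^ n \<le> 2 * s" using s by (simp add: field_simps)
        then have "nrm \<A> (T (2 * s)) \<le> B" using Suc False by auto
        then have "(nrm \<A> (T s))\<^sup>2 \<le> B * 1" using T_nrm[OF s0] by simp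
        also have "\<dots> \<le> B * B" by (intro mult_left_mono) (auto simp: B_def)
        finally have "(nrm \<A> (T s))\<^sup>2 \<le> B\<^sup>2" by (simp only: power2_eq_square)
        then show ?thesis by (rule power2_le_imp_le) (simp add: B_def)
      qed
    qed
  qed
  note le = this
  have "nrm \<A> (T s) \<le> B" if s: "0 < s \<and> s \<le> 1" for s
  proof -
    obtain n where "(1 / 2) ^ n < s" using real_arch_pow_inv[of s "1/2"] s by auto
    then have "1 / 2 ^ n \<le> s" by (simp add: power_one_over)
    then show ?thesis using le[of n] s by simp
  qed
  moreover have "B \<ge> 1" by (simp add: B_def)
  ultimately show ?thesis by (intro exI[of _ B] conjI allI impI)
qed

lemma T_approx_\<iota>:
  assumes "finite {s. f s \<noteq> 0}"
  shows "((\<lambda>s. nrm \<A> (T s \<otimes>\<^bsub>\<A>\<^esub> \<iota> f \<ominus>\<^bsub>\<A>\<^esub> \<iota> f)) \<longlongrightarrow> 0) (at_right 0)"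
  using assms
proof (induction rule: finite_support_induct)
  case zero
  have "\<iota> (\<lambda>s. 0) = \<zero>\<^bsub>\<A>\<^esub>" using \<iota>_hom(4)[OF finite_delta finite_delta, of 0] \<iota>_hom(1)[OF finite_delta finite_delta] by simp
  then show ?case by (simp add: A.minus_sm)
next
  case (step c u g)
  have i: "\<iota> (\<lambda>t. c * delta u t + g t) = c \<odot>\<^bsub>\<A>\<^esub> \<eta>\<alpha> u \<oplus>\<^bsub>\<A>\<^esub> \<iota> g"
    using \<iota>_hom(2)[of "\<lambda>t. c * delta u t" g] \<iota>_hom(4)[OF finite_delta finite_delta, of c u] step(1) finite_delta by (simp add: eta_eq)
  have [simp]: "\<iota> g \<in> carrier \<A>" using \<iota>_hom(1) step(1) by simp
  have l: "((\<lambda>s. cmod c * nrm \<A> (\<eta>\<alpha> (sg_mult S (\<tau> (Complex 0 s)) u) \<ominus>\<^bsub>\<A>\<^esub> \<eta>\<alpha> u) + nrm \<A> (T s \<otimes>\<^bsub>\<A>\<^esub> \<iota> g \<ominus>\<^bsub>\<A>\<^esub> \<iota> g)) \<longlongrightarrow> cmod c * 0 + 0) (at_right 0)"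
    by (intro tendsto_intros eta_continuous \<tau>_mult_lim step(2))
  show ?case
  proof (rule Lim_null_comparison[OF always_eventually])
    show "\<forall>s. norm (nrm \<A> (T s \<otimes>\<^bsub>\<A>\<^esub> \<iota> (\<lambda>t. c * delta u t + g t) \<ominus>\<^bsub>\<A>\<^esub> \<iota> (\<lambda>t. c * delta u t + g t)))
      \<le> cmod c * nrm \<A> (\<eta>\<alpha> (sg_mult S (\<tau> (Complex 0 s)) u) \<ominus>\<^bsub>\<A>\<^esub> \<eta>\<alpha> u) + nrm \<A> (T s \<otimes>\<^bsub>\<A>\<^esub> \<iota> g \<ominus>\<^bsub>\<A>\<^esub> \<iota> g)"
    proof
      fix s
      have e: "T s \<otimes>\<^bsub>\<A>\<^esub> (c \<odot>\<^bsub>\<A>\<^esub> \<eta>\<alpha> u \<oplus>\<^bsub>\<A>\<^esub> \<iota> g) \<ominus>\<^bsub>\<A>\<^esub> (c \<odot>\<^bsub>\<A>\<^esub> \<eta>\<alpha> u \<oplus>\<^bsub>\<A>\<^esub> \<iota> g)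
        = c \<odot>\<^bsub>\<A>\<^esub> (T s \<otimes>\<^bsub>\<A>\<^esub> \<eta>\<alpha> u \<ominus>\<^bsub>\<A>\<^esub> \<eta>\<alpha> u) \<oplus>\<^bsub>\<A>\<^esub> (T s \<otimes>\<^bsub>\<A>\<^esub> \<iota> g \<ominus>\<^bsub>\<A>\<^esub> \<iota> g)"
        by (simp add: A.minus_sm A.r_distr A.smult_r A.sm_add_r A.sm_assoc A.a_ac mult.commute)
      have "nrm \<A> (c \<odot>\<^bsub>\<A>\<^esub> (T s \<otimes>\<^bsub>\<A>\<^esub> \<eta>\<alpha> u \<ominus>\<^bsub>\<A>\<^esub> \<eta>\<alpha> u) \<oplus>\<^bsub>\<A>\<^esub> (T s \<otimes>\<^bsub>\<A>\<^esub> \<iota> g \<ominus>\<^bsub>\<A>\<^esub> \<iota> g))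
        \<le> cmod c * nrm \<A> (T s \<otimes>\<^bsub>\<A>\<^esub> \<eta>\<alpha> u \<ominus>\<^bsub>\<A>\<^esub> \<eta>\<alpha> u) + nrm \<A> (T s \<otimes>\<^bsub>\<A>\<^esub> \<iota> g \<ominus>\<^bsub>\<A>\<^esub> \<iota> g)"
        using A.nrm_triangle[of "c \<odot>\<^bsub>\<A>\<^esub> (T s \<otimes>\<^bsub>\<A>\<^esub> \<eta>\<alpha> u \<ominus>\<^bsub>\<A>\<^esub> \<eta>\<alpha> u)" "T s \<otimes>\<^bsub>\<A>\<^esub> \<iota> g \<ominus>\<^bsub>\<A>\<^esub> \<iota> g"] by (simp add: A.nrm_smult)
      then show "norm (nrm \<A> (T s \<otimes>\<^bsub>\<A>\<^esub> \<iota> (\<lambda>t. c * delta u t + g t) \<ominus>\<^bsub>\<A>\<^esub> \<iota> (\<lambda>t. c * delta u t + g t)))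
        \<le> cmod c * nrm \<A> (\<eta>\<alpha> (sg_mult S (\<tau> (Complex 0 s)) u) \<ominus>\<^bsub>\<A>\<^esub> \<eta>\<alpha> u) + nrm \<A> (T s \<otimes>\<^bsub>\<A>\<^esub> \<iota> g \<ominus>\<^bsub>\<A>\<^esub> \<iota> g)"
        unfolding i e by (simp add: A.nrm_nonneg eta_mult T_def[symmetric])
    qed
    show "((\<lambda>s. cmod c * nrm \<A> (\<eta>\<alpha> (sg_mult S (\<tau> (Complex 0 s)) u) \<ominus>\<^bsub>\<A>\<^esub> \<eta>\<alpha> u) + nrm \<A> (T s \<otimes>\<^bsub>\<A>\<^esub> \<iota> g \<ominus>\<^bsub>\<A>\<^esub> \<iota> g)) \<longlongrightarrow> 0) (at_right 0)"
      using l by simp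
  qed
qed

text \<open>Density reduces the claim to the range of \<iota>, where it is continuity of the action.
  The uniform bound of T near 0 controls the remainder.\<close>

lemma T_approx:
  assumes b [simp]: "b \<in> carrier \<A>" and e: "e > 0"
  shows "\<forall>\<^sub>F s in at_right 0. nrm \<A> (T s \<otimes>\<^bsub>\<A>\<^esub> b \<ominus>\<^bsub>\<A>\<^esub> b) < e"
proof -
  obtain B where B: "B \<ge> 1" "\<And>s. 0 < s ==> s \<le> 1 ==> nrm \<A> (T s) \<le> B" using T_bounded by blast
  have e': "e / (2 * (B + 1)) > 0" using e B by simp
  obtain f where f: "finite {s. f s \<noteq> 0}" "nrm \<A> (b \<ominus>\<^bsub>\<A>\<^esub> \<iota> f) < e / (2 * (B + 1))" using \<iota>_dense[OF b e'] .
  have [simp]: "\<iota> f \<in> carrier \<A>" using \<iota>_hom(1) f(1) by simp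
  define d where "d = b \<ominus>\<^bsub>\<A>\<^esub> \<iota> f"
  have [simp]: "d \<in> carrier \<A>" by (simp add: d_def)
  have bd: "b = d \<oplus>\<^bsub>\<A>\<^esub> \<iota> f" by (simp add: d_def A.minus_sm A.a_assoc A.sm_collect)
  have "\<forall>\<^sub>F s in at_right 0. nrm \<A> (T s \<otimes>\<^bsub>\<A>\<^esub> \<iota> f \<ominus>\<^bsub>\<A>\<^esub> \<iota> f) < e / 2"
    using order_tendstoD(2)[OF T_approx_\<iota>[OF f(1)], of "e / 2"] e by simp
  moreover have "\<forall>\<^sub>F s in at_right 0. 0 < s \<and> s < (1::real)"
    unfolding eventually_at_right_field by (intro exI[of _ 1]) auto
  ultimately show ?thesis
  proof eventually_elim
    case (elim s)
    have eq: "T s \<otimes>\<^bsub>\<A>\<^esub> b \<ominus>\<^bsub>\<A>\<^esub> b = (T s \<otimes>\<^bsub>\<A>\<^esub> d \<oplus>\<^bsub>\<A>\<^esub> (-1) \<odot>\<^bsub>\<A>\<^esub> d) \<oplus>\<^bsub>\<A>\<^esub> (T s \<otimes>\<^bsub>\<A>\<^esub> \<iota> f \<ominus>\<^bsub>\<A>\<^esub> \<iota> f)"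
      unfolding bd by (simp add: A.minus_sm A.r_distr A.sm_add_r A.a_ac)
    have "nrm \<A> (T s \<otimes>\<^bsub>\<A>\<^esub> d \<oplus>\<^bsub>\<A>\<^esub> (-1) \<odot>\<^bsub>\<A>\<^esub> d) \<le> nrm \<A> (T s \<otimes>\<^bsub>\<A>\<^esub> d) + nrm \<A> d"
      using A.nrm_triangle[of "T s \<otimes>\<^bsub>\<A>\<^esub> d" "(-1) \<odot>\<^bsub>\<A>\<^esub> d"] by (simp add: A.nrm_smult)
    also have "\<dots> \<le> (B + 1) * nrm \<A> d"
      using A.nrm_mult[of "T s" d] mult_right_mono[OF B(2)[of s] A.nrm_nonneg[of d]] elim by (simp add: algebra_simps)
    also have "\<dots> < e / 2" using f(2) B(1) by (simp add: d_def[symmetric] field_simps)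
    finally show ?case unfolding eq
      using A.nrm_triangle[of "T s \<otimes>\<^bsub>\<A>\<^esub> d \<oplus>\<^bsub>\<A>\<^esub> (-1) \<odot>\<^bsub>\<A>\<^esub> d" "T s \<otimes>\<^bsub>\<A>\<^esub> \<iota> f \<ominus>\<^bsub>\<A>\<^esub> \<iota> f"] elim by simp
  qed
qed

text \<open>A member a n with \<phi>(a n) close to 1 is fixed first. Replacing T s by T s times a n
  costs an error uniform in s, since T is bounded; then T s a n tends to a n in norm.\<close>

lemma state_T_lim:
  assumes st: "state_functional \<A> \<phi> a"
  shows "((\<lambda>s. \<phi> (T s)) \<longlongrightarrow> 1) (at_right 0)"
proof (rule tendstoI)
  fix e :: real assume e: "e > 0"
  interpret P: state_functional \<A> \<phi> a by (rule st)
  obtain B where B: "B \<ge> 1" "\<And>s. 0 < s ==> s \<le> 1 ==> nrm \<A> (T s) \<le> B" using T_bounded by blast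
  have "(\<lambda>n. sqrt (P.er n) * B + cmod (\<phi> (a n) - 1)) \<longlonglongrightarrow> sqrt 0 * B + cmod (1 - 1)"
    by (intro tendsto_intros P.er_lim P.a_lim)
  then have "\<forall>\<^sub>F n in sequentially. sqrt (P.er n) * B + cmod (\<phi> (a n) - 1) < e / 2" by (rule order_tendstoD(2)) (use e in simp)
  then obtain n where n: "sqrt (P.er n) * B + cmod (\<phi> (a n) - 1) < e / 2" by (auto simp: eventually_sequentially)
  have "\<forall>\<^sub>F s in at_right 0. nrm \<A> (T s \<otimes>\<^bsub>\<A>\<^esub> a n \<ominus>\<^bsub>\<A>\<^esub> a n) < e / 2" by (rule T_approx) (use e in simp_all)
  moreover have "\<forall>\<^sub>F s in at_right 0. 0 < s \<and> s < (1::real)"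
    unfolding eventually_at_right_field by (intro exI[of _ 1]) auto
  ultimately show "\<forall>\<^sub>F s in at_right 0. dist (\<phi> (T s)) 1 < e"
  proof eventually_elim
    case (elim s)
    have "P.sq (star \<A> (T s)) \<le> (nrm \<A> (T s))\<^sup>2" using P.sq_le[of "T s"] T_mult(2)[of s] elim by simp
    also have "\<dots> \<le> B\<^sup>2" using B elim by (intro power_mono) (auto simp: A.nrm_nonneg)
    finally have "(cmod (\<phi> (T s) - \<phi> (T s \<otimes>\<^bsub>\<A>\<^esub> a n)))\<^sup>2 \<le> P.er n * B\<^sup>2"
      by (intro order_trans[OF P.right_approx[OF T_in]] mult_left_mono P.er_nonneg)
    also have "\<dots> = (sqrt (P.er n) * B)\<^sup>2" by (simp add: power_mult_distrib P.er_nonneg)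
    finally have 1: "cmod (\<phi> (T s) - \<phi> (T s \<otimes>\<^bsub>\<A>\<^esub> a n)) \<le> sqrt (P.er n) * B"
      by (rule power2_le_imp_le) (use B P.er_nonneg in simp)
    have 2: "cmod (\<phi> (T s \<otimes>\<^bsub>\<A>\<^esub> a n) - \<phi> (a n)) < e / 2"
      using P.contr[of "T s \<otimes>\<^bsub>\<A>\<^esub> a n \<ominus>\<^bsub>\<A>\<^esub> a n"] elim by (simp add: P.\<phi>_lin)
    have "cmod (\<phi> (T s) - 1) \<le> cmod (\<phi> (T s) - \<phi> (T s \<otimes>\<^bsub>\<A>\<^esub> a n)) + cmod (\<phi> (T s \<otimes>\<^bsub>\<A>\<^esub> a n) - \<phi> (a n)) + cmod (\<phi> (a n) - 1)"
      using dist_triangle[of "\<phi> (T s)" 1 "\<phi> (T s \<otimes>\<^bsub>\<A>\<^esub> a n)"] dist_triangle[of "\<phi> (T s \<otimes>\<^bsub>\<A>\<^esub> a n)" 1 "\<phi> (a n)"]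
      unfolding dist_norm by linarith
    then show ?case using 1 2 n by (simp add: dist_norm)
  qed
qed

text \<open>Supplies \<open>derivative_boundary_bound\<close> with F = \<phi> along
  \<open>\<tau>\<close>. Holomorphy comes from \<open>eta_curve_holomorphic\<close>, the mixed
  inequality from unitarity, and the boundary value from the approximate unit T.\<close>

lemma momentum_bound:
  assumes st: "state \<A> \<phi>"
    and U: "\<And>t. U t \<in> carrier (alg_unitary_group \<A>)" "\<And>t s. fst (U t) (\<eta>\<alpha> s) = \<eta>\<alpha> (fst (\<gamma> t) s)"
    and U0: "\<And>b. b \<in> carrier \<A> ==> fst (U 0) b = b"
    and g: "\<forall>\<^sub>F t in nhds 0. g t = state_ext \<A> \<phi> (U t)"
    and g1: "\<forall>\<^sub>F r in nhds 0. (g has_vector_derivative g' r) (at r)" and g2: "(g' has_vector_derivative g'') (at 0)"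
  shows "- ln (1 + \<alpha> (\<tau> \<i>)) \<le> Im (g' 0)"
proof -
  note seq = A.state_sequence[OF st]
  obtain a where a: "\<forall>n. a n \<in> carrier \<A> \<and> nrm \<A> (a n) \<le> 1" "(\<lambda>n. \<phi> (a n)) \<longlonglongrightarrow> 1" using seq(3) by blast
  interpret P: state_functional \<A> \<phi> a
    by unfold_locales (use a seq(1,2) st in \<open>simp_all add: state_def\<close>)
  define F where "F z = \<phi> (\<eta>\<alpha> (\<tau> z))" for z
  have FT: "F (Complex 0 s) = \<phi> (T s)" for s by (simp add: F_def T_def)
  have sqT: "P.sq (T s) = Re (F (Complex 0 (2 * s)))" if "s > 0" for s
    using T_mult[OF that] by (simp add: P.sq_def FT)
  have FU: "F (Complex t s) = \<phi> (fst (U t) (T s))" if "s > 0" for t s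
    using \<tau>_act[of "Complex 0 s" t] that by (simp add: F_def T_def U(2) Complex_eq)
  have \<alpha>0: "\<alpha> u \<ge> 0" for u using \<alpha> by (simp add: absolute_value_def)
  show ?thesis
  proof (rule derivative_boundary_bound[where F = F and g = g and g'' = g''])
    show "F holomorphic_on {z. Im z > 0}"
      unfolding F_def by (rule eta_curve_holomorphic[OF P.lin P.contr h_props(6)])
    have "(\<lambda>n. \<phi> (a n)) \<longlonglongrightarrow> state_ext \<A> \<phi> (U 0)"
      using P.state_ext_lim[OF P.U_in[OF U(1)[of 0]]] by (simp add: U0)
    then show "g 0 = 1" using LIMSEQ_unique[OF a(2)] eventually_nhds_x_imp_x[OF g] by simp
    show "\<forall>\<^sub>F t in nhds 0. cmod (g t) \<le> 1 \<and> (\<forall>s>0. (cmod (F (Complex t s) - F (Complex 0 s) - g t + 1))\<^sup>2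
      \<le> (2 - 2 * Re (g t)) * (Re (F (Complex 0 (2 * s))) - 2 * Re (F (Complex 0 s)) + 1))"
    proof (rule eventually_mono[OF g], intro conjI allI impI)
      fix t assume t: "g t = state_ext \<A> \<phi> (U t)"
      show "cmod (g t) \<le> 1" unfolding t by (rule P.state_ext_le[OF U(1)])
      fix s :: real assume s: "s > 0"
      show "(cmod (F (Complex t s) - F (Complex 0 s) - g t + 1))\<^sup>2
        \<le> (2 - 2 * Re (g t)) * (Re (F (Complex 0 (2 * s))) - 2 * Re (F (Complex 0 s)) + 1)"
        using P.mixed_estimate(1)[OF U(1)[of t] T_in T_mult(2)[OF s]] unfolding t FU[OF s, of t] sqT[OF s] FT .
    qed
    show "0 \<le> Re (F (Complex 0 (2 * s))) - 2 * Re (F (Complex 0 s)) + 1" if s: "s > 0" for s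
      using P.mixed_estimate(2)[OF U(1)[of 0] T_in T_mult(2)[OF s]] unfolding sqT[OF s] FT .
    show "((\<lambda>s. F (Complex 0 s)) \<longlongrightarrow> 1) (at_right 0)"
      unfolding FT by (rule state_T_lim) unfold_locales
    \<comment> \<open>The summand 1 keeps the base at least 1 also where \<alpha> vanishes, as is
      required for its powers and logarithm.\<close>
    show M: "1 \<le> 1 + \<alpha> (\<tau> \<i>)" using \<alpha>0 by simp
    show "cmod (F (Complex 0 (1 / 2 ^ n))) \<le> (1 + \<alpha> (\<tau> \<i>)) powr (1 / 2 ^ n)" for n
    proof (induction n)
      case 0
      have "cmod (F (Complex 0 1)) \<le> nrm \<A> (\<eta>\<alpha> (\<tau> (Complex 0 1)))" unfolding F_def by (rule P.contr) simp
      also have "\<dots> \<le> \<alpha> (\<tau> \<i>)" using eta_le[of "\<tau> \<i>"] by (simp add: Complex_eq)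
      finally show ?case using \<alpha>0[of "\<tau> \<i>"] by simp
    next
      \<comment> \<open>T is self-adjoint with T s squared equal to T (2s), so the Kadison
        inequality bounds the square of |F(is)| by Re F(2is): halving s halves the exponent.\<close>
      case (Suc n)
      have "(cmod (F (Complex 0 (1 / 2 ^ Suc n))))\<^sup>2 \<le> Re (F (Complex 0 (2 * (1 / 2 ^ Suc n))))"
        using P.kadison[OF T_in, of "1 / 2 ^ Suc n"] sqT[of "1 / 2 ^ Suc n"] by (simp add: FT)
      also have "\<dots> \<le> cmod (F (Complex 0 (1 / 2 ^ n)))" using complex_Re_le_cmod by simp
      also have "\<dots> \<le> ((1 + \<alpha> (\<tau> \<i>)) powr (1 / 2 ^ Suc n))\<^sup>2"
      proof -
        have "((1 + \<alpha> (\<tau> \<i>)) powr (1 / 2 ^ Suc n))\<^sup>2 = (1 + \<alpha> (\<tau> \<i>)) powr (1 / 2 ^ Suc n + 1 / 2 ^ Suc n)"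
          by (simp add: power2_eq_square powr_add[symmetric])
        then show ?thesis using Suc.IH by (simp add: field_simps)
      qed
      finally show ?case by (rule power2_le_imp_le) simp
    qed
  qed (use g1 g2 in simp_all)
qed

end

section \<open>Momentum sets\<close>

text \<open>In the chart the curve is t -> E(tx) for a smooth map E, so it has a second derivative
  at 0. Its first derivative there is x because the Lie algebra is realized by this very
  chart.\<close>

lemma exponential_curve:
  assumes G: "lie_group G" and ex: "exponential_function G ex" and c: "lie_chart1 G = (V, \<psi>)"
  obtains \<gamma>' w where
    "\<forall>\<^sub>F r in nhds 0. ((\<lambda>t. (1 / t) *\<^sub>R (\<psi> (ex ((r + t) *\<^sub>R x)) - \<psi> (ex (r *\<^sub>R x)))) \<longlongrightarrow> \<gamma>' r) (at 0)"
    "\<forall>\<^sub>F r in nhds 0. ex (r *\<^sub>R x) \<in> V" "\<gamma>' 0 = x" "((\<lambda>t. (1 / t) *\<^sub>R (\<gamma>' t - \<gamma>' 0)) \<longlongrightarrow> w) (at 0)"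
    "ex 0 = \<one>\<^bsub>G\<^esub>"
proof -
  have gr: "group G" and car: "carrier G = UNIV" and one: "\<one>\<^bsub>G\<^esub> \<in> V" and V: "(V, \<psi>) \<in> lie_charts G"
    using G c by (auto simp: lie_group_def)
  interpret group G by (rule gr)
  have "ex ((0 + 0) *\<^sub>R x) = ex (0 *\<^sub>R x) \<otimes>\<^bsub>G\<^esub> ex (0 *\<^sub>R x)"
    using ex unfolding exponential_function_def by blast
  then have e0: "ex 0 = \<one>\<^bsub>G\<^esub>" using l_cancel_one[of "ex 0" "ex 0"] by (simp add: car)
  define E where "E = \<psi> \<circ> ex"
  define D where "D = ex -` V"
  have sm: "smooth_to tv_real D E"
    using ex V unfolding exponential_function_def mfd_map_def id_charts_def by (fastforce simp: E_def D_def)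
  have dd: "has_ddir tv_real E y x (ddir tv_real E y x)" "\<exists>l. has_ddir tv_real (\<lambda>y. ddir tv_real E y x) y x l" if y: "y \<in> D" for y
  proof -
    have *: "\<exists>l. has_ddir tv_real (iter_ddir tv_real E (\<lambda>_. x) k) y x l" for k using sm y unfolding smooth_to_def by blast
    obtain l where "has_ddir tv_real E y x l" using *[of 0] by auto
    then show "has_ddir tv_real E y x (ddir tv_real E y x)" using ddir_real by metis
    show "\<exists>l. has_ddir tv_real (\<lambda>y. ddir tv_real E y x) y x l" using *[of 1] by simp
  qed
  have "((\<lambda>r. r *\<^sub>R x) \<longlongrightarrow> 0 *\<^sub>R x) (nhds 0)" by (intro tendsto_scaleR_lcs tendsto_const filterlim_ident)
  then have ev: "\<forall>\<^sub>F r in nhds 0. r *\<^sub>R x \<in> D"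
    by (rule topological_tendstoD) (use sm one in \<open>auto simp: smooth_to_def D_def e0\<close>)
  have 0: "0 \<in> D" using one by (simp add: D_def e0)
  define \<gamma>' where "\<gamma>' r = ddir tv_real E (r *\<^sub>R x) x" for r
  have der: "((\<lambda>t. (1 / t) *\<^sub>R (\<psi> (ex ((r + t) *\<^sub>R x)) - \<psi> (ex (r *\<^sub>R x)))) \<longlongrightarrow> \<gamma>' r) (at 0)" if "r *\<^sub>R x \<in> D" for r
    using dd(1)[OF that] by (simp add: has_ddir_real \<gamma>'_def E_def scaleR_add_left)
  have "has_ddir tv_real (\<lambda>t. \<psi> (ex (t *\<^sub>R x))) (0::real) 1 x" using ex c by (simp add: exponential_function_def)
  then have "((\<lambda>t. (1 / t) *\<^sub>R (\<psi> (ex ((0 + t) *\<^sub>R x)) - \<psi> (ex (0 *\<^sub>R x)))) \<longlongrightarrow> x) (at 0)" by (simp add: has_ddir_real)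
  then have g0: "\<gamma>' 0 = x" using LIM_unique[OF der[of 0]] 0 by simp
  obtain w where "has_ddir tv_real (\<lambda>y. ddir tv_real E y x) 0 x w" using dd(2)[OF 0] by blast
  then have w: "((\<lambda>t. (1 / t) *\<^sub>R (\<gamma>' t - \<gamma>' 0)) \<longlongrightarrow> w) (at 0)" by (simp add: has_ddir_real \<gamma>'_def)
  show ?thesis by (rule that[OF eventually_mono[OF ev der] eventually_mono[OF ev] g0 w e0]) (simp_all add: D_def)
qed

lemma smooth_in_chart1:
  fixes G :: "('g::t2_space, 'e::lcs) lie_group" and \<Phi> :: "'g => complex"
  assumes G: "lie_group G" and c: "lie_chart1 G = (V, \<psi>)" and \<Phi>: "mfd_smooth UNIV (lie_charts G) id_charts \<Phi>"
  shows "smooth_to tv_real (\<psi> ` V) (\<Phi> \<circ> inv_into V \<psi>)" "\<psi> \<one>\<^bsub>G\<^esub> \<in> \<psi> ` V" "inj_on \<psi> V"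
proof -
  have V: "(V, \<psi>) \<in> lie_charts G" and one: "\<one>\<^bsub>G\<^esub> \<in> V" using G c by (auto simp: lie_group_def)
  show "smooth_to tv_real (\<psi> ` V) (\<Phi> \<circ> inv_into V \<psi>)"
    using \<Phi> V unfolding mfd_map_def id_charts_def by fastforce
  show "\<psi> \<one>\<^bsub>G\<^esub> \<in> \<psi> ` V" using one by simp
  show "inj_on \<psi> V" using G V by (auto simp: lie_group_def is_atlas_def is_chart_def)
qed

text \<open>Linearity and continuity are those of the differential of a C^1 map at one point. They
  place momenta in the dual, so that the closure in \<open>momentum_set\<close> contains the momenta
  themselves.\<close>

lemma momentum_map_in_dual:
  fixes G :: "('g::t2_space, 'e::lcs) lie_group"
  assumes G: "lie_group G" and \<phi>: "\<phi> \<in> smooth_states G A \<eta>"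
  shows "linear (momentum_map G A \<eta> \<phi>)" "continuous_on UNIV (momentum_map G A \<eta> \<phi>)"
proof -
  obtain V \<psi> where c: "lie_chart1 G = (V, \<psi>)" by fastforce
  define F where "F = (state_ext A \<phi> \<circ> \<eta>) \<circ> inv_into V \<psi>"
  have ms: "mfd_smooth UNIV (lie_charts G) id_charts (state_ext A \<phi> \<circ> \<eta>)" using \<phi> by (simp add: smooth_states_def)
  note sm = smooth_in_chart1[OF G c ms]
  have c1: "c1_on (\<psi> ` V) F (ddir tv_real F)" unfolding F_def by (rule smooth_to_c1_on[OF sm(1)])
  have m: "momentum_map G A \<eta> \<phi> h = Im (ddir tv_real F (\<psi> \<one>\<^bsub>G\<^esub>) h)" for h
    by (simp add: momentum_map_def diff_one_def c F_def)
  show "linear (momentum_map G A \<eta> \<phi>)"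
    by (rule linearI) (simp_all add: m c1_on_add[OF c1 sm(2)] c1_on_scale[OF c1 sm(2)])
  show "continuous_on UNIV (momentum_map G A \<eta> \<phi>)"
    unfolding continuous_on_def m by (intro ballI tendsto_intros c1_on_tendsto[OF c1 sm(2)])
qed

text \<open>Evaluation at x is continuous for pointwise convergence, so a lower bound valid for all
  momenta of smooth states defines a closed set and persists in the closure.\<close>

lemma momentum_set_props:
  fixes G :: "('g::t2_space, 'e::lcs) lie_group"
  assumes G: "lie_group G"
  shows "f \<in> momentum_set G A \<eta> ==> linear f \<and> continuous_on UNIV f"
    and "(\<And>\<phi>. \<phi> \<in> smooth_states G A \<eta> ==> b \<le> momentum_map G A \<eta> \<phi> x) ==> f \<in> momentum_set G A \<eta> ==> b \<le> f x"
    and "smooth_states G A \<eta> \<noteq> {} ==> momentum_set G A \<eta> \<noteq> {}"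
proof -
  define Z where "Z = {f :: 'e => real. linear f \<and> continuous_on UNIV f}"
  have top: "weak_star_dual = top_of_set Z" by (simp add: weak_star_dual_def Z_def)
  have im: "momentum_map G A \<eta> ` smooth_states G A \<eta> \<subseteq> Z"
    using momentum_map_in_dual[OF G] by (auto simp: Z_def)
  have "momentum_set G A \<eta> \<subseteq> Z" unfolding momentum_set_def top by (metis closure_of_subset_topspace topspace_euclidean_subtopology)
  then show "f \<in> momentum_set G A \<eta> ==> linear f \<and> continuous_on UNIV f" by (auto simp: Z_def)
  show "smooth_states G A \<eta> \<noteq> {} ==> momentum_set G A \<eta> \<noteq> {}"
    unfolding momentum_set_def using closure_of_subset[of "momentum_map G A \<eta> ` smooth_states G A \<eta>" weak_star_dual] im by (auto simp: top)
  assume b: "\<And>\<phi>. \<phi> \<in> smooth_states G A \<eta> ==> b \<le> momentum_map G A \<eta> \<phi> x" and f: "f \<in> momentum_set G A \<eta>"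
  have "closed {f :: 'e => real. b \<le> f x}"
    by (intro closed_Collect_le continuous_on_const continuous_on_product_coordinates)
  then have "closedin (top_of_set Z) (Z \<inter> {f. b \<le> f x})" by (simp add: closedin_closed_Int)
  moreover have "momentum_map G A \<eta> ` smooth_states G A \<eta> \<subseteq> Z \<inter> {f. b \<le> f x}" using im b by auto
  ultimately have "momentum_set G A \<eta> \<subseteq> Z \<inter> {f. b \<le> f x}" unfolding momentum_set_def top by (rule closure_of_minimal[rotated])
  then show "b \<le> f x" using f by blast
qed

subsection \<open>Existence of smooth states\<close>

lemma (in pre_cstar) stateI:
  assumes l: "clin \<psi>" and pos: "\<And>c. c \<in> carrier A ==> \<psi> (star A c \<otimes> c) \<in> \<real>\<^sub>\<ge>\<^sub>0"
    and contr: "\<And>c. c \<in> carrier A ==> cmod (\<psi> c) \<le> nrm A c"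
    and a: "\<And>n. a n \<in> carrier A" "\<And>n. nrm A (a n) \<le> 1" "(\<lambda>n. \<psi> (a n)) \<longlonglongrightarrow> 1"
  shows "state A \<psi>"
proof -
  define X where "X = {cmod (\<psi> c) |c. c \<in> carrier A \<and> nrm A c \<le> 1}"
  have le: "r \<le> 1" if "r \<in> X" for r using that contr by (force simp: X_def)
  have bdd: "bdd_above X" using le by (rule bdd_aboveI)
  have aX: "cmod (\<psi> (a n)) \<in> X" for n using a by (auto simp: X_def)
  have "cmod 1 \<le> Sup X"
    by (rule tendsto_upperbound[OF tendsto_norm[OF a(3)]]) (use aX bdd in \<open>simp_all add: cSup_upper\<close>)
  moreover have "Sup X \<le> 1" using aX le by (intro cSup_least) auto
  ultimately show ?thesis using l pos bdd by (simp add: state_def clin_def X_def)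
qed

text \<open>The notion of a smooth map between manifolds includes continuity. It is recovered here
  from the order-zero derivatives in the charts, which form an open cover.\<close>

lemma smooth_complex_map:
  fixes G :: "('g::t2_space, 'e::lcs) lie_group" and \<Phi> :: "'g => complex"
  assumes G: "lie_group G" and sm: "\<And>V \<psi>. (V, \<psi>) \<in> lie_charts G ==> smooth_to tv_real (\<psi> ` V) (\<Phi> \<circ> inv_into V \<psi>)"
  shows "mfd_smooth UNIV (lie_charts G) id_charts \<Phi>"
proof -
  have at: "\<forall>c\<in>lie_charts G. is_chart c" "\<Union> (fst ` lie_charts G) = UNIV" using G by (auto simp: lie_group_def is_atlas_def)
  have "continuous_on V \<Phi>" if c: "(V, \<psi>) \<in> lie_charts G" for V \<psi>
  proof -
    have ch: "inj_on \<psi> V" "continuous_on V \<psi>" using at(1) c by (auto simp: is_chart_def homeomorphism_def)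
    have "continuous_on (\<psi> ` V \<times> UNIV) (\<lambda>(x, h :: nat => 'e). (\<Phi> \<circ> inv_into V \<psi>) x)"
      using smooth_to_continuous_on[OF sm[OF c], of 0] by simp
    then have "continuous_on (\<psi> ` V) (\<lambda>x. case (x, undefined) of (x, h :: nat => 'e) => (\<Phi> \<circ> inv_into V \<psi>) x)"
      by (rule continuous_on_compose2) (auto intro!: continuous_intros)
    then have "continuous_on V (\<lambda>g. (\<Phi> \<circ> inv_into V \<psi>) (\<psi> g))"
      using ch(2) by (auto intro: continuous_on_compose2)
    then show ?thesis by (rule continuous_on_eq) (simp add: ch)
  qed
  then have "continuous_on (\<Union>c\<in>lie_charts G. fst c) \<Phi>"
    by (intro continuous_on_open_UN) (use at(1) in \<open>auto simp: is_chart_def\<close>)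
  then show ?thesis using sm at(2) by (auto simp: mfd_map_def id_charts_def)
qed

text \<open>Compressing a positive functional by a smooth element \<open>b\<close> turns it into a smooth state.\<close>

lemma smooth_state_exists:
  fixes G :: "('g::t2_space, 'e::lcs) lie_group" and A :: "'a normed_star_algebra" (structure)
  assumes A: "pre_cstar A" and G: "lie_group G" and \<eta>: "\<And>g. \<eta> g \<in> carrier (multiplier_algebra A)"
    and ss: "strictly_smooth G A \<eta>" and a: "a \<in> carrier A" "a \<noteq> \<zero>"
  shows "smooth_states G A \<eta> \<noteq> {}"
proof -
  interpret pre_cstar A by (rule A)
  have "\<exists>\<phi>. clin \<phi> \<and> (\<forall>x\<in>carrier A. cmod (\<phi> x) \<le> nrm A x) \<and>
      (\<forall>x\<in>carrier A. \<phi> (star A x \<otimes> x) \<in> \<real>\<^sub>\<ge>\<^sub>0) \<and> \<phi> (star A a \<otimes> a) \<noteq> 0"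
    by (rule positive_functional[OF a]) (rule exI, intro conjI ballI, assumption, simp_all)
  then obtain \<phi> where "clin \<phi> \<and> (\<forall>x\<in>carrier A. cmod (\<phi> x) \<le> nrm A x) \<and>
      (\<forall>x\<in>carrier A. \<phi> (star A x \<otimes> x) \<in> \<real>\<^sub>\<ge>\<^sub>0) \<and> \<phi> (star A a \<otimes> a) \<noteq> 0" by (rule exE)
  then have \<phi>: "clin \<phi>" "\<And>x. x \<in> carrier A ==> cmod (\<phi> x) \<le> nrm A x"
    "\<And>x. x \<in> carrier A ==> \<phi> (star A x \<otimes> x) \<in> \<real>\<^sub>\<ge>\<^sub>0" "\<phi> (star A a \<otimes> a) \<noteq> 0" by simp_all
  interpret P: positive_functional A \<phi> by unfold_locales (fact \<phi>)+
  have sqa: "P.sq a > 0" using P.sq[OF a(1)] P.sq_nonneg[OF a(1)] \<phi>(4) by (simp add: less_le)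
  \<comment> \<open>The distance of b from a is below the GNS seminorm of a, and the norm dominates
    that seminorm; hence b has nonzero seminorm and can be normalized.\<close>
  obtain b where b [simp]: "b \<in> carrier A" and ab: "nrm A (a \<ominus> b) < sqrt (P.sq a)"
    and sm: "mfd_smooth_to (tv_alg A) (lie_charts G) (\<lambda>g. fst (\<eta> g) b)"
    using ss a(1) sqa unfolding strictly_smooth_def by (meson real_sqrt_gt_zero)
  define k where "k = P.sq b"
  have k: "k > 0"
  proof -
    have "a = (a \<ominus> b) \<oplus> b" using a by (simp add: minus_sm a_assoc sm_collect)
    then have "sqrt (P.sq a) \<le> sqrt (P.sq (a \<ominus> b)) + sqrt k"
      using P.sqrt_sq_add[of "a \<ominus> b" b] a by (simp add: k_def)
    moreover have "sqrt (P.sq (a \<ominus> b)) \<le> nrm A (a \<ominus> b)" using P.sq_le[of "a \<ominus> b"] a by (simp add: real_le_lsqrt nrm_nonneg)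
    ultimately have "sqrt k > 0" using ab by linarith
    then show ?thesis by simp
  qed
  \<comment> \<open>The state will be \<psi> c = \<phi>(b' c b) / \<phi>(b' b) with b' the adjoint
    of b. It is factored as l(cb), so that multipliers act on b alone.\<close>
  define l where "l c = \<phi> (star A b \<otimes> c) / complex_of_real k" for c
  define \<psi> where "\<psi> c = l (c \<otimes> b)" for c
  have l_lin: "clin l" by (simp add: clin_def l_def r_distr smult_r P.\<phi>_lin add_divide_distrib)
  have l_le: "cmod (l c) \<le> nrm A b / k * nrm A c" if c [simp]: "c \<in> carrier A" for c
  proof -
    have "cmod (\<phi> (star A b \<otimes> c)) \<le> nrm A b * nrm A c" using P.contr[of "star A b \<otimes> c"] nrm_mult[of "star A b" c] by simp
    then show ?thesis using k by (simp add: l_def norm_divide divide_right_mono)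
  qed
  have lb: "l b = 1" using k P.sq[OF b] by (simp add: l_def k_def)
  have "\<exists>u. u \<in> carrier A \<and> nrm A u \<le> 1 \<and> nrm A (b \<ominus> u \<otimes> b) < 1 / real (Suc n)" for n
    using approximate_unit[OF b, of "1 / real (Suc n)"] by (metis of_nat_0_less_iff zero_less_Suc zero_less_divide_1_iff)
  then obtain u where u [simp]: "\<And>n. u n \<in> carrier A" and u1: "\<And>n. nrm A (u n) \<le> 1"
    and ub: "\<And>n. nrm A (b \<ominus> u n \<otimes> b) < 1 / real (Suc n)" by metis
  have null: "(\<lambda>n. 1 / real (Suc n)) \<longlonglongrightarrow> 0" using LIMSEQ_inverse_real_of_nat by (simp add: inverse_eq_divide)
  have l_lim: "(\<lambda>n. l (fst m (u n \<otimes> b))) \<longlonglongrightarrow> l (fst m b)" if m: "m \<in> carrier MA" for m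
  proof -
    obtain C where C: "C > 0" "\<And>x. x \<in> carrier A ==> nrm A (fst m x) \<le> C * nrm A x" using multiplier_bound[OF m] by metis
    note ml = multiplier_l[OF m]
    have K: "nrm A b / k \<ge> 0" using k nrm_nonneg[OF b] by simp
    have est: "cmod (l (fst m (u n \<otimes> b)) - l (fst m b)) \<le> nrm A b / k * (C * (1 / real (Suc n)))" for n
    proof -
      have "l (fst m b) - l (fst m (u n \<otimes> b)) = l (fst m (b \<ominus> u n \<otimes> b))"
        by (simp add: minus_sm ml clin_add[OF l_lin] clin_smult[OF l_lin])
      then have "cmod (l (fst m (u n \<otimes> b)) - l (fst m b)) \<le> nrm A b / k * nrm A (fst m (b \<ominus> u n \<otimes> b))"
        using l_le[of "fst m (b \<ominus> u n \<otimes> b)"] ml(1) by (simp add: norm_minus_commute)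
      also have "\<dots> \<le> nrm A b / k * (C * (1 / real (Suc n)))"
        using C(2)[of "b \<ominus> u n \<otimes> b"] mult_left_mono[OF less_imp_le[OF ub[of n]], of C] C(1)
        by (intro mult_left_mono K) (auto intro: order_trans)
      finally show ?thesis .
    qed
    have "(\<lambda>n. nrm A b / k * (C * (1 / real (Suc n)))) \<longlonglongrightarrow> nrm A b / k * (C * 0)"
      by (rule tendsto_mult[OF tendsto_const tendsto_mult[OF tendsto_const null]])
    then have z: "(\<lambda>n. nrm A b / k * (C * (1 / real (Suc n)))) \<longlonglongrightarrow> 0" by (simp only: mult_zero_right)
    have "(\<lambda>n. l (fst m (u n \<otimes> b)) - l (fst m b)) \<longlonglongrightarrow> 0"
      by (rule Lim_null_comparison[OF _ z]) (rule always_eventually, rule allI, rule est)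
    then show ?thesis by (simp add: LIM_zero_iff)
  qed
  have \<psi>_lin: "clin \<psi>" by (simp add: clin_def \<psi>_def l_distr smult_l clin_add[OF l_lin] clin_smult[OF l_lin])
  have \<psi>_pos: "\<psi> (star A c \<otimes> c) \<in> \<real>\<^sub>\<ge>\<^sub>0" if c [simp]: "c \<in> carrier A" for c
  proof -
    have "\<psi> (star A c \<otimes> c) = complex_of_real (P.sq (c \<otimes> b) / k)"
      using P.sq[of "c \<otimes> b"] by (simp add: \<psi>_def l_def star_mult m_assoc)
    then show ?thesis using P.sq_nonneg[of "c \<otimes> b"] k by simp
  qed
  have \<psi>_le: "cmod (\<psi> c) \<le> nrm A c" if c [simp]: "c \<in> carrier A" for c
  proof -
    have "(cmod (\<phi> (star A b \<otimes> (c \<otimes> b))))\<^sup>2 \<le> k * P.sq (c \<otimes> b)" using P.Cauchy_Schwarz[of b "c \<otimes> b"] by (simp add: k_def)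
    also have "\<dots> \<le> k * ((nrm A c)\<^sup>2 * k)" using P.sq_left_mult[of c b] k by (intro mult_left_mono) (simp_all add: k_def)
    also have "\<dots> = (k * nrm A c)\<^sup>2" by (simp add: power2_eq_square)
    finally have "cmod (\<phi> (star A b \<otimes> (c \<otimes> b))) \<le> k * nrm A c" by (rule power2_le_imp_le) (use k nrm_nonneg in simp)
    then show ?thesis using k by (simp add: \<psi>_def l_def norm_divide divide_le_eq mult.commute)
  qed
  have \<psi>u: "(\<lambda>n. \<psi> (u n)) \<longlonglongrightarrow> 1"
  proof -
    have est: "cmod (\<psi> (u n) - 1) \<le> nrm A b / k * (1 / real (Suc n))" for n
    proof -
      have "1 - \<psi> (u n) = l (b \<ominus> u n \<otimes> b)" by (simp add: lb \<psi>_def minus_sm clin_add[OF l_lin] clin_smult[OF l_lin])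
      then have "cmod (\<psi> (u n) - 1) \<le> nrm A b / k * nrm A (b \<ominus> u n \<otimes> b)" using l_le[of "b \<ominus> u n \<otimes> b"] by (simp add: norm_minus_commute)
      also have "\<dots> \<le> nrm A b / k * (1 / real (Suc n))" using less_imp_le[OF ub[of n]] k nrm_nonneg[OF b] by (intro mult_left_mono) auto
      finally show ?thesis .
    qed
    have "(\<lambda>n. nrm A b / k * (1 / real (Suc n))) \<longlonglongrightarrow> nrm A b / k * 0"
      by (rule tendsto_mult[OF tendsto_const null])
    then have z: "(\<lambda>n. nrm A b / k * (1 / real (Suc n))) \<longlonglongrightarrow> 0" by (simp only: mult_zero_right)
    have "(\<lambda>n. \<psi> (u n) - 1) \<longlonglongrightarrow> 0"
      by (rule Lim_null_comparison[OF _ z]) (rule always_eventually, rule allI, rule est)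
    then show ?thesis by (simp add: LIM_zero_iff)
  qed
  interpret Q: state_functional A \<psi> u
    by unfold_locales (fact \<psi>_lin \<psi>_pos \<psi>_le u u1 \<psi>u)+
  \<comment> \<open>The extended state at \<open>\<eta> g\<close> is a bounded functional of
    \<open>\<eta> g\<close> applied to b, and smoothness of the orbit of b is therefore inherited by
    the scalar function.\<close>
  have ext: "state_ext A \<psi> (\<eta> g) = l (fst (\<eta> g) b)" for g
  proof (rule LIMSEQ_unique[OF Q.state_ext_lim[OF \<eta>]])
    have "\<psi> (fst (\<eta> g) (u n)) = l (fst (\<eta> g) (u n \<otimes> b))" for n
      using multiplier_l(6)[OF \<eta>, of "u n" b g] by (simp add: \<psi>_def)
    then show "(\<lambda>n. \<psi> (fst (\<eta> g) (u n))) \<longlonglongrightarrow> l (fst (\<eta> g) b)" using l_lim[OF \<eta>[of g]] by simp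
  qed
  have "mfd_smooth UNIV (lie_charts G) id_charts (state_ext A \<psi> \<circ> \<eta>)"
  proof (rule smooth_complex_map[OF G])
    fix V \<xi> assume "(V, \<xi>) \<in> lie_charts G"
    then have "smooth_to (tv_alg A) (\<xi> ` V) ((\<lambda>g. fst (\<eta> g) b) \<circ> inv_into V \<xi>)" using sm by (auto simp: mfd_smooth_to_def)
    from smooth_to_clin(1)[OF l_lin l_le this]
    show "smooth_to tv_real (\<xi> ` V) ((state_ext A \<psi> \<circ> \<eta>) \<circ> inv_into V \<xi>)" by (simp add: o_def ext)
  qed
  moreover have "state A \<psi>" by (rule stateI[OF \<psi>_lin \<psi>_pos \<psi>_le u u1 \<psi>u])
  ultimately show ?thesis by (auto simp: smooth_states_def)
qed

subsection \<open>The momentum set of a host algebra\<close>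

text \<open>The first two conjuncts make the infimum meaningful: the momentum set is nonempty as
  soon as the algebra is nonzero, and its values at x are bounded below. The zero algebra has no
  states, so its momentum set is empty.\<close>

theorem proposition3p12:
  fixes G :: "('g::t2_space, 'e::lcs) lie_group"
    and ex :: "'e \<Rightarrow> 'g"
    and S :: "('s::t2_space, 'f::complex_lcs) inv_semigroup"
    and \<eta>\<^sub>S :: "'g \<Rightarrow> 's mpair"
    and W :: "'e set"
    and hat :: "'e \<Rightarrow> complex \<Rightarrow> 's mpair"
    and \<alpha> :: "'s \<Rightarrow> real"
    and \<A> :: "(nat \<Rightarrow> (nat \<Rightarrow> 's \<Rightarrow> complex) set) set normed_star_algebra"
    and \<eta> :: "'g \<Rightarrow> ((nat \<Rightarrow> (nat \<Rightarrow> 's \<Rightarrow> complex) set) set \<Rightarrow> (nat \<Rightarrow> (nat \<Rightarrow> 's \<Rightarrow> complex) set) set) \<times>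
      ((nat \<Rightarrow> (nat \<Rightarrow> 's \<Rightarrow> complex) set) set \<Rightarrow> (nat \<Rightarrow> (nat \<Rightarrow> 's \<Rightarrow> complex) set) set)"
  defines "\<A> \<equiv> host_cstar S \<alpha>"
  assumes "lie_group G" and "connected (UNIV :: 'g set)"
    and "exponential_function G ex"
    and "host_semigroup G ex S \<eta>\<^sub>S W hat"
    and "continuous_on W (host_Exp S hat)"
    and "absolute_value S \<alpha>" and "locally_bounded_on UNIV \<alpha>"
    and "\<forall>g s. \<alpha> (fst (\<eta>\<^sub>S g) s) = \<alpha> s"
    and "\<eta> \<in> hom G (alg_unitary_group \<A>)"
    and "\<forall>g s. fst (\<eta> g) (host_eta S \<alpha> s) = host_eta S \<alpha> (fst (\<eta>\<^sub>S g) s)"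
    and "strictly_smooth G \<A> \<eta>"
  shows "(carrier \<A> \<noteq> {\<zero>\<^bsub>\<A>\<^esub>} \<longrightarrow> momentum_set G \<A> \<eta> \<noteq> {}) \<and>
    (\<forall>x\<in>W. bdd_below {f x |f. f \<in> momentum_set G \<A> \<eta>}) \<and>
    locally_bounded_on W (\<lambda>x. - Inf {f x |f. f \<in> momentum_set G \<A> \<eta>})"
proof -
  note G = \<open>lie_group G\<close> and exf = \<open>exponential_function G ex\<close> and host = \<open>host_semigroup G ex S \<eta>\<^sub>S W hat\<close>
  have S: "complex_inv_semigroup S" using host by (simp add: host_semigroup_def)
  interpret bounded_semigroup S \<alpha>
    by unfold_locales (use S assms(7,8) in simp_all)
  have pre: "pre_cstar \<A>" unfolding \<A>_def by (rule host_pre_cstar)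
  interpret A: pre_cstar \<A> by (rule pre)
  have gr: "group G" and car: "carrier G = UNIV" using G by (simp_all add: lie_group_def)
  have \<eta>U: "\<eta> g \<in> carrier (alg_unitary_group \<A>)" for g using assms(10) car by (auto simp: hom_def)
  have \<eta>M: "\<eta> g \<in> carrier (multiplier_algebra \<A>)" for g using \<eta>U[of g] by (simp add: alg_unitary_group_def Let_def)
  define E where "E = host_Exp S hat"
  have one: "\<one>\<^bsub>G\<^esub> \<otimes>\<^bsub>G\<^esub> \<one>\<^bsub>G\<^esub> = \<one>\<^bsub>G\<^esub>" using gr by (simp add: group.is_monoid)
  \<comment> \<open>The image of the unit element is an idempotent and a unitary, hence the
    identity, by cancelling with its adjoint.\<close>
  have \<eta>1: "fst (\<eta> \<one>\<^bsub>G\<^esub>) b = b" if b: "b \<in> carrier \<A>" for b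
  proof -
    let ?u = "\<eta> \<one>\<^bsub>G\<^esub>"
    have comp: "fst (m \<otimes>\<^bsub>multiplier_algebra \<A>\<^esub> m') b = fst m (fst m' b)" if "b \<in> carrier \<A>" for m m' b
      using that by (simp add: multiplier_algebra_def case_prod_unfold compose_def)
    have u: "?u \<otimes>\<^bsub>multiplier_algebra \<A>\<^esub> ?u = ?u"
    proof -
      have "\<eta> (\<one>\<^bsub>G\<^esub> \<otimes>\<^bsub>G\<^esub> \<one>\<^bsub>G\<^esub>) = ?u \<otimes>\<^bsub>multiplier_algebra \<A>\<^esub> ?u"
        using assms(10) car by (simp add: hom_def alg_unitary_group_def Let_def)
      then show ?thesis unfolding one by (rule sym)
    qed
    have v: "star (multiplier_algebra \<A>) ?u \<otimes>\<^bsub>multiplier_algebra \<A>\<^esub> ?u = \<one>\<^bsub>multiplier_algebra \<A>\<^esub>"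
      using \<eta>U[of "\<one>\<^bsub>G\<^esub>"] by (simp add: alg_unitary_group_def Let_def)
    have inv: "fst (star (multiplier_algebra \<A>) ?u) (fst ?u c) = c" if c: "c \<in> carrier \<A>" for c
      using comp[OF c, of "star (multiplier_algebra \<A>) ?u" ?u] c unfolding v by (simp add: multiplier_algebra_def)
    have "fst ?u (fst ?u b) = fst ?u b" using comp[OF b, of ?u ?u] unfolding u by simp
    then show ?thesis using inv[OF b] inv[OF A.multiplier_l(1)[OF \<eta>M b]] by metis
  qed
  have \<eta>S1: "\<eta>\<^sub>S \<one>\<^bsub>G\<^esub> = (id, id)"
  proof -
    let ?u = "\<eta>\<^sub>S \<one>\<^bsub>G\<^esub>"
    have h: "\<eta>\<^sub>S \<in> hom G (sg_unitary_group S)" using host by (simp add: host_semigroup_def)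
    have "\<eta>\<^sub>S (\<one>\<^bsub>G\<^esub> \<otimes>\<^bsub>G\<^esub> \<one>\<^bsub>G\<^esub>) = mpair_mult ?u ?u" using h car by (simp add: hom_def sg_unitary_group_def)
    then have u: "mpair_mult ?u ?u = ?u" unfolding one by (rule sym)
    have v: "mpair_mult ?u (mpair_star S ?u) = (id, id)" using h car by (auto simp: hom_def sg_unitary_group_def)
    have "mpair_mult (mpair_mult ?u ?u) (mpair_star S ?u) = mpair_mult ?u (mpair_mult ?u (mpair_star S ?u))"
      by (simp add: mpair_mult_def comp_assoc)
    then show ?thesis unfolding u v by (simp add: mpair_mult_def)
  qed
  have lower: "- ln (1 + \<alpha> (E x)) \<le> momentum_map G \<A> \<eta> \<phi> x" if x: "x \<in> W" and \<phi>: "\<phi> \<in> smooth_states G \<A> \<eta>" for x \<phi>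
  proof -
    obtain V \<psi> where c: "lie_chart1 G = (V, \<psi>)" by fastforce
    have st: "state \<A> \<phi>" and ms: "mfd_smooth UNIV (lie_charts G) id_charts (state_ext \<A> \<phi> \<circ> \<eta>)"
      using \<phi> by (simp_all add: smooth_states_def)
    note sm = smooth_in_chart1[OF G c ms]
    obtain \<gamma>' w where \<gamma>: "\<forall>\<^sub>F r in nhds 0. ((\<lambda>t. (1 / t) *\<^sub>R (\<psi> (ex ((r + t) *\<^sub>R x)) - \<psi> (ex (r *\<^sub>R x)))) \<longlongrightarrow> \<gamma>' r) (at 0)"
      and V: "\<forall>\<^sub>F r in nhds 0. ex (r *\<^sub>R x) \<in> V" and start: "\<gamma>' 0 = x"
      and \<gamma>'': "((\<lambda>t. (1 / t) *\<^sub>R (\<gamma>' t - \<gamma>' 0)) \<longlongrightarrow> w) (at 0)" and e0: "ex 0 = \<one>\<^bsub>G\<^esub>"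
      using exponential_curve[OF G exf c] .
    interpret upper_curve S \<alpha> "\<lambda>t. \<eta>\<^sub>S (ex (t *\<^sub>R x))" "hat x"
      by unfold_locales (use host x \<eta>S1 e0 in \<open>simp_all add: host_semigroup_def\<close>)
    define F where "F = (state_ext \<A> \<phi> \<circ> \<eta>) \<circ> inv_into V \<psi>"
    obtain g' g'' where g': "\<forall>\<^sub>F r in nhds 0. ((\<lambda>r. F (\<psi> (ex (r *\<^sub>R x)))) has_vector_derivative g' r) (at r)"
      "(g' has_vector_derivative g'') (at 0)" "g' 0 = ddir tv_real F (\<psi> (ex (0 *\<^sub>R x))) (\<gamma>' 0)"
    proof -
      have "\<psi> (ex (0 *\<^sub>R x)) \<in> \<psi> ` V" "\<forall>\<^sub>F r in nhds 0. \<psi> (ex (r *\<^sub>R x)) \<in> \<psi> ` V"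
        using sm(2) e0 by (simp_all add: eventually_mono[OF V])
      from smooth_to_curve[OF sm(1)[folded F_def] this(1) \<gamma> this(2) \<gamma>''] show thesis using that by blast
    qed
    have "- ln (1 + \<alpha> (\<tau> \<i>)) \<le> Im (g' 0)"
    proof (rule momentum_bound[where U = "\<lambda>t. \<eta> (ex (t *\<^sub>R x))", OF _ _ _ _ _ g'(1,2)])
      show "state (host_cstar S \<alpha>) \<phi>" using st by (simp add: \<A>_def)
      show "\<eta> (ex (t *\<^sub>R x)) \<in> carrier (alg_unitary_group (host_cstar S \<alpha>))" for t using \<eta>U by (simp add: \<A>_def)
      show "fst (\<eta> (ex (t *\<^sub>R x))) (host_eta S \<alpha> s) = host_eta S \<alpha> (fst (\<eta>\<^sub>S (ex (t *\<^sub>R x))) s)" for t s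
        using assms(11) by simp
      show "fst (\<eta> (ex (0 *\<^sub>R x))) b = b" if "b \<in> carrier (host_cstar S \<alpha>)" for b
        using \<eta>1[unfolded \<A>_def, OF that] e0 by simp
      show "\<forall>\<^sub>F t in nhds 0. F (\<psi> (ex (t *\<^sub>R x))) = state_ext (host_cstar S \<alpha>) \<phi> (\<eta> (ex (t *\<^sub>R x)))"
        by (rule eventually_mono[OF V]) (simp add: F_def sm(3) \<A>_def)
    qed
    moreover have "momentum_map G \<A> \<eta> \<phi> x = Im (g' 0)"
      using g'(3) start e0 by (simp add: momentum_map_def diff_one_def c F_def)
    ultimately show ?thesis by (simp add: E_def host_Exp_def \<tau>_def)
  qed
  define M where "M = momentum_set G \<A> \<eta>"
  have Mlin: "continuous_on UNIV f" if "f \<in> M" for f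
    by (rule conjunct2[OF momentum_set_props(1)[OF G that[unfolded M_def]]])
  have Mlow: "- ln (1 + \<alpha> (E x)) \<le> f x" if "x \<in> W" "f \<in> M" for x f
    by (rule momentum_set_props(2)[OF G lower[OF that(1)] that(2)[unfolded M_def]])
  have bdd: "bdd_below {f x |f. f \<in> M}" if "x \<in> W" for x
    using Mlow[OF that] by (intro bdd_belowI[of _ "- ln (1 + \<alpha> (E x))"]) auto
  have nonempty: "M \<noteq> {}" if ne: "carrier \<A> \<noteq> {\<zero>\<^bsub>\<A>\<^esub>}"
  proof -
    have "\<exists>a. a \<in> carrier \<A> \<and> a \<noteq> \<zero>\<^bsub>\<A>\<^esub>" using ne A.zero_closed by blast
    then obtain a where "a \<in> carrier \<A>" "a \<noteq> \<zero>\<^bsub>\<A>\<^esub>" by blast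
    then show ?thesis unfolding M_def
      by (intro momentum_set_props(3)[OF G] smooth_state_exists[OF pre G \<eta>M assms(12)])
  qed
  have locally: "locally_bounded_on W (\<lambda>x. - Inf {f x |f. f \<in> M})"
  proof (cases "M = {}")
    \<comment> \<open>The infimum over the empty set is one fixed number, so the function is
      constant.\<close>
    case True
    then show ?thesis by (auto simp: locally_bounded_on_def bounded_iff intro!: exI[of _ UNIV])
  next
    case False
    then obtain f where f: "f \<in> M" by blast
    show ?thesis
      unfolding locally_bounded_on_def
    proof
      fix x0 assume x0: "x0 \<in> W"
      obtain N where N: "open N" "E x0 \<in> N" "bounded (\<alpha> ` N)"
        using assms(8) unfolding locally_bounded_on_def by auto
      then obtain B where B: "\<And>u. u \<in> N \<Longrightarrow> \<bar>\<alpha> u\<bar> \<le> B" unfolding bounded_iff by auto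
      obtain V1 where V1: "open V1" "x0 \<in> V1" "\<And>y. y \<in> W \<Longrightarrow> y \<in> V1 \<Longrightarrow> E y \<in> N"
        using assms(6) x0 N(1,2) unfolding continuous_on_topological E_def by metis
      \<comment> \<open>One fixed f in the momentum set bounds the infimum from above; by continuity
        of f this bound is uniform near x0. The bound from below is uniform on V1 because \<alpha>
        is bounded near \<open>E x0\<close>.\<close>
      obtain V2 where V2: "open V2" "x0 \<in> V2" "\<And>y. y \<in> V2 \<Longrightarrow> f y < f x0 + 1"
        using Mlin[OF f] unfolding continuous_on_topological by (metis (no_types) UNIV_I lessThan_iff less_add_one open_lessThan)
      have "bounded ((\<lambda>x. - Inf {f x |f. f \<in> M}) ` (V1 \<inter> V2 \<inter> W))"
      proof (rule boundedI)
        fix r assume "r \<in> (\<lambda>x. - Inf {f x |f. f \<in> M}) ` (V1 \<inter> V2 \<inter> W)"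
        then obtain y where y: "y \<in> V1" "y \<in> V2" "y \<in> W" and r: "r = - Inf {f y |f. f \<in> M}" by auto
        have "- ln (1 + \<alpha> (E y)) \<le> Inf {f y |f. f \<in> M}" using f Mlow[OF y(3)] by (intro cInf_greatest) auto
        moreover have "ln (1 + \<alpha> (E y)) \<le> ln (1 + B)"
        proof -
          have "\<alpha> (E y) \<le> B" "0 \<le> \<alpha> (E y)" using B[OF V1(3)[OF y(3,1)]] assms(7) by (auto simp: absolute_value_def)
          then have "0 < 1 + \<alpha> (E y)" "0 < 1 + B" "1 + \<alpha> (E y) \<le> 1 + B" by linarith+
          then show ?thesis by (rule iffD2[OF ln_le_cancel_iff])
        qed
        moreover have "Inf {f y |f. f \<in> M} \<le> f y" using f bdd[OF y(3)] by (intro cInf_lower) auto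
        ultimately show "norm r \<le> \<bar>f x0 + 1\<bar> + \<bar>ln (1 + B)\<bar>" using V2(3)[OF y(2)] r by simp
      qed
      then show "\<exists>V. open V \<and> x0 \<in> V \<and> bounded ((\<lambda>x. - Inf {f x |f. f \<in> M}) ` (V \<inter> W))"
        using V1(1,2) V2(1,2) by (intro exI[of _ "V1 \<inter> V2"]) auto
    qed
  qed
  show ?thesis unfolding M_def[symmetric] by (intro conjI impI ballI nonempty bdd locally)
qed

end
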